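(* Assume $\mu(X)=\infty$. The set $\mathrm{Erg}^{\mathrm{III}_1}_2(X,\mathcal{A},\mu):=\{T\in\mathrm{Aut}_2(X,\mathcal{A},\mu):\ T \text{ is ergodic of type } \mathrm{III}_1\}$ is a dense $G_\delta$ subset of $\mathrm{Aut}_2(X,\mathcal{A},\mu)$ endowed with the topology $d_2$.
   Context: $(X,\mathcal{A},\mu)$ is a standard $\sigma$-finite non-atomic measure space. For an invertible nonsingular $T$, $T'=\frac{d\mu\circ T^{-1}}{d\mu}$, $U_Tf=\sqrt{T'}f\circ T^{-1}$. $\mathrm{Aut}_2(X,\mathcal A,\mu)=\{T:\sqrt{T'}-1\in L^2(\mu)\}$ with topology $d_2$: $T_n\to T$ iff $U_{T_n}\to U_T$ weakly and $\|\sqrt{T_n'}-\sqrt{T'}\|_2\to0$. The Maharam extension of $T$ is $\tilde T(x,y)=(Tx,\,y-\log\frac{d\mu\circ T}{d\mu}(x))$ on $X\times\mathbb{R}$, preserving $\tilde\mu(A\times I)=\mu(A)\int_Ie^t\,dt$; $T$ is (ergodic) of type $\mathrm{III}_1$ if its Maharam extension is ergodic. *)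

theory Defs
  imports "HOL-Analysis.Analysis" "HOL-Probability.Probability"
begin

definition non_atomic :: "'a measure \<Rightarrow> bool" where
  "non_atomic M \<longleftrightarrow> (\<forall>A\<in>sets M. 0 < emeasure M A \<longrightarrow>
      (\<exists>B\<in>sets M. B \<subseteq> A \<and> 0 < emeasure M B \<and> emeasure M B < emeasure M A))"

definition nonsingular :: "'a measure \<Rightarrow> ('a \<Rightarrow> 'a) \<Rightarrow> bool" where
  "nonsingular M T \<longleftrightarrow> bij_betw T (space M) (space M) \<and>
      T \<in> measurable M M \<and> the_inv_into (space M) T \<in> measurable M M \<and>
      (\<forall>A\<in>sets M. emeasure M (T -` A \<inter> space M) = 0 \<longleftrightarrow> emeasure M A = 0)"

definition Tinv :: "'a measure \<Rightarrow> ('a \<Rightarrow> 'a) \<Rightarrow> 'a \<Rightarrow> 'a" where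
  "Tinv M T = the_inv_into (space M) T"

definition Tprime :: "'a measure \<Rightarrow> ('a \<Rightarrow> 'a) \<Rightarrow> 'a \<Rightarrow> real" where
  "Tprime M T x = enn2real (RN_deriv M (distr M M T) x)"

definition sqrtTprime :: "'a measure \<Rightarrow> ('a \<Rightarrow> 'a) \<Rightarrow> 'a \<Rightarrow> real" where
  "sqrtTprime M T x = sqrt (Tprime M T x)"

definition L2 :: "'a measure \<Rightarrow> ('a \<Rightarrow> real) \<Rightarrow> bool" where
  "L2 M f \<longleftrightarrow> f \<in> borel_measurable M \<and> integrable M (\<lambda>x. (f x)\<^sup>2)"

definition inner2 :: "'a measure \<Rightarrow> ('a \<Rightarrow> real) \<Rightarrow> ('a \<Rightarrow> real) \<Rightarrow> real" where
  "inner2 M f g = (\<integral>x. f x * g x \<partial>M)"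

definition norm2 :: "'a measure \<Rightarrow> ('a \<Rightarrow> real) \<Rightarrow> real" where
  "norm2 M f = sqrt (\<integral>x. (f x)\<^sup>2 \<partial>M)"

definition UT :: "'a measure \<Rightarrow> ('a \<Rightarrow> 'a) \<Rightarrow> ('a \<Rightarrow> real) \<Rightarrow> 'a \<Rightarrow> real" where
  "UT M T f x = sqrtTprime M T x * f (Tinv M T x)"

definition Aut2 :: "'a measure \<Rightarrow> ('a \<Rightarrow> 'a) set" where
  "Aut2 M = {T. nonsingular M T \<and> L2 M (\<lambda>x. sqrtTprime M T x - 1)}"

text \<open>The topology \<open>d\<^sub>2\<close>: the initial topology on \<open>Aut\<^sub>2\<close> making
  \<open>T \<mapsto> U_T\<close> continuous for the weak operator topology and
  \<open>T \<mapsto> sqrt T'\<close> continuous for the L2 norm.\<close>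
definition d2_open :: "'a measure \<Rightarrow> ('a \<Rightarrow> 'a) set \<Rightarrow> bool" where
  "d2_open M W \<longleftrightarrow> W \<subseteq> Aut2 M \<and>
     (\<forall>S\<in>W. \<exists>F e. finite F \<and> (\<forall>(f,g)\<in>F. L2 M f \<and> L2 M g) \<and> 0 < e \<and>
        {T\<in>Aut2 M. (\<forall>(f,g)\<in>F. \<bar>inner2 M (UT M T f) g - inner2 M (UT M S f) g\<bar> < e) \<and>
                    norm2 M (\<lambda>x. sqrtTprime M T x - sqrtTprime M S x) < e} \<subseteq> W)"

definition d2_topology :: "'a measure \<Rightarrow> ('a \<Rightarrow> 'a) topology" where
  "d2_topology M = topology (d2_open M)"

definition maharam :: "'a measure \<Rightarrow> ('a \<Rightarrow> 'a) \<Rightarrow> 'a \<times> real \<Rightarrow> 'a \<times> real" where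
  "maharam M T = (\<lambda>(x,y). (T x, y - ln (enn2real (RN_deriv M (distr M M (Tinv M T)) x))))"

definition maharam_measure :: "'a measure \<Rightarrow> ('a \<times> real) measure" where
  "maharam_measure M = density (M \<Otimes>\<^sub>M lborel) (\<lambda>(x,y). ennreal (exp y))"

definition ergodic :: "'b measure \<Rightarrow> ('b \<Rightarrow> 'b) \<Rightarrow> bool" where
  "ergodic N S \<longleftrightarrow> (\<forall>A\<in>sets N. S -` A \<inter> space N = A \<longrightarrow>
       emeasure N A = 0 \<or> emeasure N (space N - A) = 0)"

definition ergodic_III1 :: "'a measure \<Rightarrow> ('a \<Rightarrow> 'a) \<Rightarrow> bool" where
  "ergodic_III1 M T \<longleftrightarrow> ergodic M T \<and> ergodic (maharam_measure M) (maharam M T)"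

definition Erg_III1_2 :: "'a measure \<Rightarrow> ('a \<Rightarrow> 'a) set" where
  "Erg_III1_2 M = {T\<in>Aut2 M. ergodic_III1 M T}"

end

theory Submission
  imports Defs
begin

text \<open>
  \<^emph>\<open>The set is a \<open>G\<^sub>\<delta>\<close>.\<close> The Maharam extension \<open>T~\<close> preserves \<open>nu\<close>, and it is ergodic iff every integrable
  function of integral 0 is an \<open>L\<^sup>1\<close>-limit of coboundaries \<open>h - h \<circ> T~\<^sup>-\<^sup>1\<close>. Since \<open>T \<mapsto> h \<circ> T~\<^sup>-\<^sup>1\<close> is continuous from
  \<open>d\<^sub>2\<close> to \<open>L\<^sup>1(nu)\<close>, approximability of one function up to a given error is an open condition, and it is enough to test
  countably many functions. Ergodicity of \<open>T~\<close> implies that of \<open>T\<close>.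

  \<^emph>\<open>The set is dense.\<close> Given \<open>S\<close>, partition most of a set of finite measure into finitely many pieces \<open>R\<^sub>i\<close> on which
  \<open>S'\<close> is almost constant, and put \<open>P\<^sub>i = S\<^sup>-\<^sup>1 R\<^sub>i\<close>. Identify \<open>M\<close> with Lebesgue measure on the half line and build \<open>T\<close> by
  cutting and stacking, starting with columns that map almost all of each \<open>P\<^sub>i\<close> affinely onto almost all of \<open>R\<^sub>i\<close>.
  Interpolating the square roots of the widths linearly along many spacers links columns of different
  widths at arbitrarily small cost \<open>\<integral>(sqrt T' - 1)\<^sup>2\<close>; as the total measure is infinite there is room for the spacers.
  At stage \<open>n\<close> the tower is cut into \<open>L\<close> parts of equal width, and the part of index \<open>l < L\<close> into \<open>a\<^sup>l\<close> columns of equal width.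
  For a set \<open>E\<close> invariant under \<open>T~\<close>, the density of \<open>E\<close> below a height is then an average of \<open>L\<close> such densities at heights
  that form a geometric progression of ratio \<open>a\<close>, so it is invariant under that scaling up to \<open>1/L\<close>.
  Every \<open>a \<ge> 2\<close> occurs infinitely often with \<open>L \<rightarrow> \<infinity>\<close>, so the density is constant and \<open>E\<close> is trivial.
\<close>

section \<open>Nonsingular maps and the Maharam extension\<close>

text \<open>Boxes \<open>A \<times> {..b}\<close> carry both halves. The image of such a box under
  \<open>T~\<close> has fibre mass e^b (U_T 1_A)^2 over each point, so unitarity of
  \<open>U_T\<close> turns weak convergence into convergence in L1(nu). And the box of mass
  \<open>s\<close> above one level of a column is carried onto the box of mass \<open>s\<close>
  above the next level, so that cutting a level acts on the density of an invariant set by rescaling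
  \<open>s\<close>. The obstacle in the density half is that the pieces P_i and R_i may overlap
  arbitrarily: sending P_i straight onto R_i could close orbits into cycles, which do not fit into
  columns. All pieces are therefore cut into N strips, and strip j is sent only to strip j + 1; what
  is lost is the first strips, a fraction 1/N. On these edges the derivative is exactly
  mu(P_i)/mu(R_i), the mean of S' over R_i, so only the cost of linking columns is charged to the
  error.\<close>

instance prod :: (polish_space, polish_space) polish_space ..

section \<open>Square-integrable functions: sums, Cauchy-Schwarz, triangle inequality\<close>

lemma L2_add: assumes "L2 M f" "L2 M g" shows "L2 M (\<lambda>x. f x + g x)"
proof -
  have [measurable]: "f \<in> borel_measurable M" "g \<in> borel_measurable M" using assms by (auto simp: L2_def)
  have "integrable M (\<lambda>x. (f x + g x)\<^sup>2)"
  proof (rule Bochner_Integration.integrable_bound)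
    show "integrable M (\<lambda>x. 2 * (f x)\<^sup>2 + 2 * (g x)\<^sup>2)" using assms by (auto simp: L2_def)
    show "AE x in M. norm ((f x + g x)\<^sup>2) \<le> norm (2 * (f x)\<^sup>2 + 2 * (g x)\<^sup>2)"
    proof (rule AE_I2)
      fix x show "norm ((f x + g x)\<^sup>2) \<le> norm (2 * (f x)\<^sup>2 + 2 * (g x)\<^sup>2)"
        using sum_squares_bound[of "f x" "g x"] by (simp add: abs_of_nonneg) (simp add: power2_sum)
    qed
  qed auto
  then show ?thesis by (auto simp: L2_def)
qed

lemma L2_scale: "L2 M f \<Longrightarrow> L2 M (\<lambda>x. c * f x)"
  by (auto simp: L2_def power_mult_distrib)

lemma L2_diff: assumes "L2 M f" "L2 M g" shows "L2 M (\<lambda>x. f x - g x)"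
  using L2_add[OF assms(1) L2_scale[OF assms(2), of "-1"]] by simp

lemma L2_product:
  assumes "L2 M f" "L2 M g"
  shows L2_integrable_mult: "integrable M (\<lambda>x. f x * g x)"
    and L2_Cauchy_Schwarz: "(\<integral>x. \<bar>f x * g x\<bar> \<partial>M) \<le> norm2 M f * norm2 M g"
proof -
  have [measurable]: "f \<in> borel_measurable M" "g \<in> borel_measurable M"
    and i: "integrable M (\<lambda>x. (f x)\<^sup>2)" "integrable M (\<lambda>x. (g x)\<^sup>2)" using assms by (auto simp: L2_def)
  show 1: "integrable M (\<lambda>x. f x * g x)"
  proof (rule Bochner_Integration.integrable_bound)
    show "integrable M (\<lambda>x. (f x)\<^sup>2 + (g x)\<^sup>2)" using i by auto
    show "AE x in M. norm (f x * g x) \<le> norm ((f x)\<^sup>2 + (g x)\<^sup>2)"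
    proof (rule AE_I2)
      fix x have "0 \<le> \<bar>f x\<bar> * \<bar>g x\<bar>" by simp
      then have "\<bar>f x\<bar> * \<bar>g x\<bar> \<le> (f x)\<^sup>2 + (g x)\<^sup>2"
        using sum_squares_bound[of "\<bar>f x\<bar>" "\<bar>g x\<bar>"] unfolding power2_abs by linarith
      then show "norm (f x * g x) \<le> norm ((f x)\<^sup>2 + (g x)\<^sup>2)" by (simp add: abs_mult)
    qed
  qed auto
  define A B C where "A = (\<integral>x. (f x)\<^sup>2 \<partial>M)" and "B = (\<integral>x. (g x)\<^sup>2 \<partial>M)" and "C = (\<integral>x. \<bar>f x * g x\<bar> \<partial>M)"
  have nn: "0 \<le> A" "0 \<le> B" "0 \<le> C" by (auto simp: A_def B_def C_def)
  have "C \<le> sqrt A * sqrt B"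
  proof (cases "A = 0")
    case True
    then have "AE x in M. (f x)\<^sup>2 = 0" using i(1) by (simp add: A_def integral_nonneg_eq_0_iff_AE)
    then have "AE x in M. \<bar>f x * g x\<bar> = 0" by eventually_elim auto
    then have "C = 0" unfolding C_def by (subst integral_cong_AE[where g="\<lambda>_. 0"]) auto
    then show ?thesis using nn by simp
  next
    case False
    then have A: "A > 0" using nn by simp
    \<comment> \<open>The minimiser of the quadratic \<open>t\<^sup>2 * A - 2 * t * C + B\<close>;
      its nonnegativity there is the claim.\<close>
    define t where "t = C / A"
    have 2: "integrable M (\<lambda>x. \<bar>f x * g x\<bar>)" using 1 by (rule integrable_abs)
    have "0 \<le> (\<integral>x. (t * \<bar>f x\<bar> - \<bar>g x\<bar>)\<^sup>2 \<partial>M)" by simp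
    also have "\<dots> = (\<integral>x. t\<^sup>2 * (f x)\<^sup>2 - 2 * t * \<bar>f x * g x\<bar> + (g x)\<^sup>2 \<partial>M)"
      by (intro Bochner_Integration.integral_cong) (auto simp: power2_eq_square algebra_simps abs_mult)
    also have "\<dots> = t\<^sup>2 * A - 2 * t * C + B" unfolding A_def B_def C_def using i 2 by simp
    also have "\<dots> = B - C\<^sup>2 / A" using A by (simp add: t_def power2_eq_square field_simps)
    finally have "C\<^sup>2 \<le> A * B" using A by (simp add: field_simps)
    then have "sqrt (C\<^sup>2) \<le> sqrt (A * B)" by (rule real_sqrt_le_mono)
    then show ?thesis using nn by (simp add: real_sqrt_mult)
  qed
  then show "(\<integral>x. \<bar>f x * g x\<bar> \<partial>M) \<le> norm2 M f * norm2 M g"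
    by (simp add: A_def B_def C_def norm2_def)
qed

lemma norm2_nonneg [simp]: "0 \<le> norm2 M f"
  by (simp add: norm2_def)

lemma norm2_power2: "(norm2 M f)\<^sup>2 = (\<integral>x. (f x)\<^sup>2 \<partial>M)"
  by (simp add: norm2_def)

lemma norm2_triangle:
  assumes "L2 M f" "L2 M g" shows "norm2 M (\<lambda>x. f x + g x) \<le> norm2 M f + norm2 M g"
proof (rule power2_le_imp_le)
  have i: "integrable M (\<lambda>x. (f x)\<^sup>2)" "integrable M (\<lambda>x. (g x)\<^sup>2)" using assms by (auto simp: L2_def)
  have "(norm2 M (\<lambda>x. f x + g x))\<^sup>2 = (\<integral>x. (f x)\<^sup>2 + 2 * (f x * g x) + (g x)\<^sup>2 \<partial>M)"
    unfolding norm2_power2 by (intro Bochner_Integration.integral_cong) (auto simp: power2_eq_square algebra_simps)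
  also have "\<dots> = (norm2 M f)\<^sup>2 + 2 * (\<integral>x. f x * g x \<partial>M) + (norm2 M g)\<^sup>2"
    unfolding norm2_power2 using i L2_product[OF assms] by simp
  also have "(\<integral>x. f x * g x \<partial>M) \<le> (\<integral>x. \<bar>f x * g x\<bar> \<partial>M)"
    by (intro integral_mono L2_product[OF assms] integrable_abs) auto
  also note L2_product(2)[OF assms]
  finally show "(norm2 M (\<lambda>x. f x + g x))\<^sup>2 \<le> (norm2 M f + norm2 M g)\<^sup>2"
    by (simp add: power2_eq_square algebra_simps)
qed simp

lemma norm2_minus_commute: "norm2 M (\<lambda>x. f x - g x) = norm2 M (\<lambda>x. g x - f x)"
  unfolding norm2_def by (simp add: power2_commute)

lemma norm2_triangle3:
  assumes "L2 M f" "L2 M g" "L2 M h"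
  shows "norm2 M (\<lambda>x. f x - h x) \<le> norm2 M (\<lambda>x. f x - g x) + norm2 M (\<lambda>x. g x - h x)"
  using norm2_triangle[OF L2_diff[OF assms(1,2)] L2_diff[OF assms(2,3)]] by simp

section \<open>Borel measures on a Polish space, nonsingular maps and their derivatives\<close>

locale std_space = sigma_finite_measure M for M :: "'a::polish_space measure" +
  assumes sets_M: "sets M = sets borel"
begin

lemma space_M [simp]: "space M = UNIV"
  using sets_eq_imp_space_eq[OF sets_M] by simp

lemma measurable_M1 [simp]: "measurable M N = measurable borel N"
  by (rule measurable_cong_sets) (auto simp: sets_M)

lemma measurable_M2 [simp]: "measurable N M = measurable N borel"
  by (rule measurable_cong_sets) (auto simp: sets_M)

lemma Tinv_eq: "Tinv M T = inv_into UNIV T" if "bij T"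
  using that by (auto simp: Tinv_def fun_eq_iff bij_is_inj bij_is_surj surj_f_inv_f intro!: the_inv_into_f_eq)

lemma nonsingularD:
  assumes "nonsingular M T"
  shows "bij T" "T \<in> borel_measurable borel" "Tinv M T \<in> borel_measurable borel"
    "Tinv M T (T x) = x" "T (Tinv M T x) = x"
    "A \<in> sets borel \<Longrightarrow> emeasure M (T -` A) = 0 \<longleftrightarrow> emeasure M A = 0"
proof -
  show b: "bij T" using assms by (simp add: nonsingular_def)
  show "T \<in> borel_measurable borel" "Tinv M T \<in> borel_measurable borel"
    using assms by (auto simp: nonsingular_def Tinv_def)
  show "Tinv M T (T x) = x" "T (Tinv M T x) = x"
    using b by (simp_all add: Tinv_eq bij_is_inj bij_is_surj surj_f_inv_f)
  show "A \<in> sets borel \<Longrightarrow> emeasure M (T -` A) = 0 \<longleftrightarrow> emeasure M A = 0"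
    using assms by (auto simp: nonsingular_def sets_M)
qed

lemma nonsingularI:
  assumes [measurable]: "T \<in> borel_measurable borel" "V \<in> borel_measurable borel"
    and i: "\<And>x. V (T x) = x" "\<And>x. T (V x) = x"
    and n: "\<And>A. A \<in> sets borel \<Longrightarrow> emeasure M (T -` A) = 0 \<longleftrightarrow> emeasure M A = 0"
  shows "nonsingular M T" "Tinv M T = V"
proof -
  have b: "bij T" by (rule o_bij[of V]) (auto simp: i)
  show V: "Tinv M T = V"
  proof
    fix x have "T (Tinv M T x) = T (V x)" using b by (simp add: Tinv_eq bij_is_inj bij_is_surj surj_f_inv_f i)
    then show "Tinv M T x = V x" using b by (auto dest: bij_is_inj injD)
  qed
  show "nonsingular M T" using b V n by (auto simp: nonsingular_def Tinv_def sets_M)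
qed

lemma nonsingular_Tinv:
  assumes "nonsingular M T"
  shows "nonsingular M (Tinv M T)" "Tinv M (Tinv M T) = T"
proof -
  note T = nonsingularD[OF assms]
  note [measurable] = T(2,3)
  have "emeasure M (Tinv M T -` A) = 0 \<longleftrightarrow> emeasure M A = 0" if [measurable]: "A \<in> sets borel" for A
  proof -
    have "emeasure M (T -` (Tinv M T -` A)) = 0 \<longleftrightarrow> emeasure M (Tinv M T -` A) = 0"
      by (rule T(6)) (simp add: measurable_sets_borel[OF T(3)])
    moreover have "T -` (Tinv M T -` A) = A" by (auto simp: T(4,5))
    ultimately show ?thesis by simp
  qed
  note N = nonsingularI[OF T(3,2) T(5,4) this]
  show "nonsingular M (Tinv M T)" "Tinv M (Tinv M T) = T" by (rule N, assumption)+
qed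

lemma AE_comp:
  assumes "nonsingular M T" "AE x in M. P x" shows "AE x in M. P (T x)"
proof -
  note T = nonsingularD[OF assms(1)]
  from assms(2) obtain N where N: "{x. \<not> P x} \<subseteq> N" "N \<in> sets borel" "emeasure M N = 0"
    by (elim AE_E) (auto simp: sets_M)
  show ?thesis
  proof (rule AE_I)
    show "{x \<in> space M. \<not> P (T x)} \<subseteq> T -` N" using N by auto
    show "emeasure M (T -` N) = 0" using T(6) N by simp
    show "T -` N \<in> sets M" using measurable_sets_borel[OF T(2) N(2)] by (simp add: sets_M)
  qed
qed

text \<open>The images under \<open>T\<close> of an exhaustion of \<open>M\<close> have finite mass
  for the push-forward; they are written as preimages under the inverse, which is
  measurable.\<close>

lemma sigma_finite_distr: assumes "nonsingular M T" shows "sigma_finite_measure (distr M M T)"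
proof -
  note T = nonsingularD[OF assms]
  obtain A :: "nat \<Rightarrow> 'a set" where A: "range A \<subseteq> sets M" "(\<Union>i. A i) = space M" "\<And>i. emeasure M (A i) \<noteq> \<infinity>"
    using sigma_finite by blast
  have A': "Tinv M T -` A i \<in> sets borel" for i
    using A(1) by (auto intro!: measurable_sets_borel[OF T(3)] simp: sets_M)
  show ?thesis
  proof (unfold_locales, intro exI[of _ "range (\<lambda>i. Tinv M T -` A i)"] conjI)
    show "\<Union> (range (\<lambda>i. Tinv M T -` A i)) = space (distr M M T)" proof -
      have "\<exists>i. Tinv M T x \<in> A i" for x using A(2) by (metis UNIV_I UN_iff space_M)
      then show ?thesis by auto
    qed
    have "T -` (Tinv M T -` A i) = A i" for i by (auto simp: T)
    then show "\<forall>a\<in>range (\<lambda>i. Tinv M T -` A i). emeasure (distr M M T) a \<noteq> \<infinity>"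
      using A' A(3) T(2) by (auto simp: emeasure_distr sets_M)
  qed (use A' in \<open>auto simp: sets_M\<close>)
qed

lemma absolutely_continuous_distr: assumes "nonsingular M T" shows "absolutely_continuous M (distr M M T)"
  using nonsingularD[OF assms] by (auto simp: absolutely_continuous_def null_sets_def emeasure_distr sets_M)

lemma Tprime_measurable [measurable]: "Tprime M T \<in> borel_measurable borel"
proof -
  note [measurable] = borel_measurable_RN_deriv[of M "distr M M T", unfolded measurable_M1]
  show ?thesis unfolding Tprime_def[abs_def] by measurable
qed

lemma sqrtTprime_measurable [measurable]: "sqrtTprime M T \<in> borel_measurable borel"
  unfolding sqrtTprime_def[abs_def] by measurable

lemma Tprime_nonneg [simp]: "0 \<le> Tprime M T x"
  by (simp add: Tprime_def)

lemma density_Tprime: assumes "nonsingular M T"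
  shows "density M (\<lambda>x. ennreal (Tprime M T x)) = distr M M T"
proof -
  have "density M (\<lambda>x. ennreal (Tprime M T x)) = density M (RN_deriv M (distr M M T))"
  proof (rule density_cong)
    show "AE x in M. ennreal (Tprime M T x) = RN_deriv M (distr M M T) x"
      using RN_deriv_finite[OF sigma_finite_distr absolutely_continuous_distr, OF assms assms]
      by (auto simp: Tprime_def less_top)
    show "RN_deriv M (distr M M T) \<in> borel_measurable M" by (rule borel_measurable_RN_deriv)
  qed simp
  also have "\<dots> = distr M M T"
    by (rule density_RN_deriv[OF absolutely_continuous_distr[OF assms]]) simp
  finally show ?thesis .
qed

lemma Tprime_unique:
  assumes "r \<in> borel_measurable borel" "\<And>x. 0 \<le> r x"
    "density M (\<lambda>x. ennreal (r x)) = distr M M T"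
  shows "AE x in M. Tprime M T x = r x"
proof -
  have "AE x in M. ennreal (r x) = RN_deriv M (distr M M T) x"
    by (rule RN_deriv_unique) (use assms in auto)
  then show ?thesis by eventually_elim (metis Tprime_def assms(2) enn2real_ennreal)
qed

lemma nn_integral_T:
  assumes "nonsingular M T" and [measurable]: "f \<in> borel_measurable borel"
  shows "(\<integral>\<^sup>+x. f (T x) \<partial>M) = (\<integral>\<^sup>+x. ennreal (Tprime M T x) * f x \<partial>M)"
proof -
  note T = nonsingularD[OF assms(1)]
  note [measurable] = T(2)
  have "(\<integral>\<^sup>+x. f (T x) \<partial>M) = integral\<^sup>N (distr M M T) f"
    by (subst nn_integral_distr) auto
  also have "\<dots> = (\<integral>\<^sup>+x. ennreal (Tprime M T x) * f x \<partial>M)"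
    unfolding density_Tprime[OF assms(1), symmetric] by (subst nn_integral_density) auto
  finally show ?thesis .
qed

text \<open>The preimage of the zero set of \<open>Tprime\<close> is null, its mass being the
  integral of \<open>Tprime\<close> over that set; the converse direction of nonsingularity makes
  the zero set itself null.\<close>

lemma Tprime_pos: assumes "nonsingular M T" shows "AE x in M. 0 < Tprime M T x"
proof -
  note T = nonsingularD[OF assms]
  let ?Z = "{x. Tprime M T x = 0}"
  have [measurable]: "?Z \<in> sets borel" by measurable
  have "emeasure M (T -` ?Z) = emeasure (distr M M T) ?Z"
    using T(2) by (subst emeasure_distr) (auto simp: sets_M)
  also have "\<dots> = (\<integral>\<^sup>+x. ennreal (Tprime M T x) * indicator ?Z x \<partial>M)"
    unfolding density_Tprime[OF assms, symmetric] by (rule emeasure_density) (auto simp: sets_M)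
  also have "\<dots> = (\<integral>\<^sup>+x. 0 \<partial>M)" by (intro nn_integral_cong) (auto split: split_indicator)
  finally have "emeasure M ?Z = 0" using T(6)[of ?Z] by simp
  then have "AE x in M. x \<notin> ?Z" by (intro AE_not_in) (auto simp: null_sets_def sets_M)
  then show ?thesis by eventually_elim (simp add: less_le)
qed

text \<open>The candidate density is tested against \<open>distr M M (Tinv M T)\<close>: written as
  a function of \<open>T x\<close>, it is transformed by \<open>nn_integral_T\<close>, and the two
  Jacobians cancel.\<close>

lemma Tprime_Tinv: assumes "nonsingular M T"
  shows "AE x in M. Tprime M (Tinv M T) x = 1 / Tprime M T (T x)"
proof (rule Tprime_unique)
  note T = nonsingularD[OF assms]
  note [measurable] = T(2,3)
  show "(\<lambda>x. 1 / Tprime M T (T x)) \<in> borel_measurable borel" by measurable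
  show "density M (\<lambda>x. ennreal (1 / Tprime M T (T x))) = distr M M (Tinv M T)"
  proof (rule measure_eqI)
    fix A assume "A \<in> sets (density M (\<lambda>x. ennreal (1 / Tprime M T (T x))))"
    then have A[measurable]: "A \<in> sets borel" by (simp add: sets_M)
    have B[measurable]: "Tinv M T -` A \<in> sets borel" by (rule measurable_sets_borel[OF T(3) A])
    have "emeasure (density M (\<lambda>x. ennreal (1 / Tprime M T (T x)))) A
        = (\<integral>\<^sup>+x. ennreal (1 / Tprime M T (T x)) * indicator A x \<partial>M)"
      by (rule emeasure_density) (auto simp: sets_M)
    also have "\<dots> = (\<integral>\<^sup>+x. (\<lambda>z. ennreal (1 / Tprime M T z) * indicator (Tinv M T -` A) z) (T x) \<partial>M)"
      by (intro nn_integral_cong) (auto simp: T split: split_indicator)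
    also have "\<dots> = (\<integral>\<^sup>+x. ennreal (Tprime M T x) * (ennreal (1 / Tprime M T x) * indicator (Tinv M T -` A) x) \<partial>M)"
      by (rule nn_integral_T[OF assms]) measurable
    also have "\<dots> = (\<integral>\<^sup>+x. indicator (Tinv M T -` A) x \<partial>M)"
      using Tprime_pos[OF assms]
      by (intro nn_integral_cong_AE, eventually_elim)
         (auto simp: ennreal_mult[symmetric] split: split_indicator)
    also have "\<dots> = emeasure (distr M M (Tinv M T)) A"
      by (subst emeasure_distr) (auto simp: sets_M)
    finally show "emeasure (density M (\<lambda>x. ennreal (1 / Tprime M T (T x)))) A = emeasure (distr M M (Tinv M T)) A" .
  qed simp
qed simp

lemma Tprime_Tinv': assumes "nonsingular M T"
  shows "AE x in M. Tprime M (Tinv M T) (Tinv M T x) = 1 / Tprime M T x"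
  using AE_comp[OF nonsingular_Tinv(1)[OF assms] Tprime_Tinv[OF assms]] nonsingularD(5)[OF assms] by simp

section \<open>The operators \<open>U_T\<close> are isometries of L2\<close>

lemma UT_measurable: assumes "nonsingular M T" "f \<in> borel_measurable M"
  shows "UT M T f \<in> borel_measurable M"
proof -
  have [measurable]: "Tinv M T \<in> borel_measurable borel" "f \<in> borel_measurable borel"
    using nonsingularD[OF assms(1)] assms(2) by auto
  show ?thesis unfolding UT_def[abs_def] by simp
qed

lemma nn_integral_UT:
  assumes "nonsingular M T" and f: "f \<in> borel_measurable M"
  shows "(\<integral>\<^sup>+x. ennreal ((UT M T f x)\<^sup>2) \<partial>M) = (\<integral>\<^sup>+x. ennreal ((f x)\<^sup>2) \<partial>M)"
proof -
  note T = nonsingularD[OF assms(1)]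
  have [measurable]: "f \<in> borel_measurable borel" "Tinv M T \<in> borel_measurable borel" using f T by auto
  have "(\<integral>\<^sup>+x. ennreal ((f x)\<^sup>2) \<partial>M) = (\<integral>\<^sup>+x. (\<lambda>z. ennreal ((f (Tinv M T z))\<^sup>2)) (T x) \<partial>M)"
    by (simp add: T)
  also have "\<dots> = (\<integral>\<^sup>+x. ennreal (Tprime M T x) * ennreal ((f (Tinv M T x))\<^sup>2) \<partial>M)"
    by (rule nn_integral_T[OF assms(1)]) measurable
  also have "\<dots> = (\<integral>\<^sup>+x. ennreal ((UT M T f x)\<^sup>2) \<partial>M)"
    by (intro nn_integral_cong) (simp add: UT_def sqrtTprime_def power_mult_distrib ennreal_mult)
  finally show ?thesis by simp
qed

lemma
  assumes "nonsingular M T" and f: "L2 M f"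
  shows L2_UT: "L2 M (UT M T f)" and norm2_UT: "norm2 M (UT M T f) = norm2 M f"
proof -
  have fm: "f \<in> borel_measurable M" and fi: "integrable M (\<lambda>x. (f x)\<^sup>2)" using f by (auto simp: L2_def)
  have m: "UT M T f \<in> borel_measurable M" by (rule UT_measurable[OF assms(1) fm])
  have eq: "(\<integral>\<^sup>+x. ennreal ((UT M T f x)\<^sup>2) \<partial>M) = (\<integral>\<^sup>+x. ennreal ((f x)\<^sup>2) \<partial>M)"
    by (rule nn_integral_UT[OF assms(1) fm])
  show "L2 M (UT M T f)" unfolding L2_def
  proof (intro conjI m integrableI_bounded)
    show "(\<lambda>x. (UT M T f x)\<^sup>2) \<in> borel_measurable M" using m by measurable
    show "(\<integral>\<^sup>+ x. ennreal (norm ((UT M T f x)\<^sup>2)) \<partial>M) < \<infinity>" using fi eq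
      by (simp add: integrable_iff_bounded)
  qed
  have 1: "(\<lambda>x. (UT M T f x)\<^sup>2) \<in> borel_measurable M" using m by measurable
  have 2: "(\<lambda>x. (f x)\<^sup>2) \<in> borel_measurable M" using fm by measurable
  show "norm2 M (UT M T f) = norm2 M f"
    unfolding norm2_def using eq integral_eq_nn_integral[OF 1] integral_eq_nn_integral[OF 2] by simp
qed

lemma UT_diff: "UT M T (\<lambda>x. f x - g x) = (\<lambda>x. UT M T f x - UT M T g x)"
  by (auto simp: UT_def algebra_simps)

section \<open>The Maharam measure and its invariance\<close>

abbreviation nu where "nu \<equiv> maharam_measure M"

lemma sets_nu: "sets nu = sets borel"
  unfolding maharam_measure_def sets_density
  using sets_pair_measure_cong[OF sets_M sets_lborel] by (simp only: borel_prod)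

lemma space_nu [simp]: "space nu = UNIV"
  using sets_eq_imp_space_eq[OF sets_nu] by simp

lemma measurable_nu1 [simp]: "measurable nu N = measurable borel N"
  by (rule measurable_cong_sets) (auto simp: sets_nu)

lemma measurable_nu2 [simp]: "measurable N nu = measurable N borel"
  by (rule measurable_cong_sets) (auto simp: sets_nu)

lemma measurable_pair_M [simp]: "measurable (M \<Otimes>\<^sub>M lborel) N = measurable (borel :: ('a \<times> real) measure) N"
  by (rule measurable_cong_sets) (use sets_pair_measure_cong[OF sets_M sets_lborel] in \<open>auto simp only: borel_prod\<close>)

lemma nn_integral_nu:
  assumes [measurable]: "h \<in> borel_measurable borel"
  shows "integral\<^sup>N nu h = (\<integral>\<^sup>+x. \<integral>\<^sup>+y. ennreal (exp y) * h (x, y) \<partial>lborel \<partial>M)"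
proof -
  have e[measurable]: "(\<lambda>p::'a \<times> real. ennreal (exp (snd p))) \<in> borel_measurable borel" 
    by (rule measurable_compose[OF _ measurable_ennreal], rule borel_measurable_continuous_onI) (intro continuous_intros)
  have e': "(\<lambda>(x::'a, y::real). ennreal (exp y)) = (\<lambda>p. ennreal (exp (snd p)))" by auto
  have m: "(\<lambda>p. ennreal (exp (snd p)) * h p) \<in> borel_measurable (M \<Otimes>\<^sub>M lborel)"
    unfolding measurable_pair_M by measurable
  have "integral\<^sup>N nu h = (\<integral>\<^sup>+p. ennreal (exp (snd p)) * h p \<partial>(M \<Otimes>\<^sub>M lborel))"
    unfolding maharam_measure_def e' by (rule nn_integral_density) (simp_all only: measurable_pair_M e assms)
  also have "\<dots> = (\<integral>\<^sup>+x. \<integral>\<^sup>+y. ennreal (exp y) * h (x, y) \<partial>lborel \<partial>M)"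
    using lborel.nn_integral_fst[OF m] by simp
  finally show ?thesis .
qed

text \<open>The cocycle is the derivative of the measure composed with \<open>T\<close>, that is,
  the push-forward density under the inverse map; hence \<open>Tprime\<close> of
  \<open>Tinv\<close>.\<close>

lemma maharam_eq: "maharam M T = (\<lambda>(x,y). (T x, y - ln (Tprime M (Tinv M T) x)))"
  by (simp add: maharam_def Tprime_def)

definition mahinv :: "('a \<Rightarrow> 'a) \<Rightarrow> 'a \<times> real \<Rightarrow> 'a \<times> real" where
  "mahinv T = (\<lambda>(x,y). (Tinv M T x, y + ln (Tprime M (Tinv M T) (Tinv M T x))))"

lemma maharam_measurable: assumes "nonsingular M T"
  shows "maharam M T \<in> borel_measurable borel" "mahinv T \<in> borel_measurable borel"
proof -
  note T = nonsingularD[OF assms]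
  have [measurable]: "T \<in> borel_measurable borel" "Tinv M T \<in> borel_measurable borel" using T by auto
  have eq: "maharam M T = (\<lambda>p. (T (fst p), snd p - ln (Tprime M (Tinv M T) (fst p))))"
    "mahinv T = (\<lambda>p. (Tinv M T (fst p), snd p + ln (Tprime M (Tinv M T) (Tinv M T (fst p)))))"
    by (auto simp: maharam_eq mahinv_def)
  show "maharam M T \<in> borel_measurable borel" "mahinv T \<in> borel_measurable borel"
    unfolding eq borel_prod[symmetric] by measurable
qed

lemma maharam_inverse: assumes "nonsingular M T"
  shows "mahinv T (maharam M T p) = p" "maharam M T (mahinv T p) = p"
  using nonsingularD(4,5)[OF assms] by (auto simp: maharam_eq mahinv_def split: prod.split)

lemma AE_pos_Tinv: assumes "nonsingular M T" shows "AE x in M. 0 < Tprime M (Tinv M T) x"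
  by (rule Tprime_pos[OF nonsingular_Tinv(1)[OF assms]])

text \<open>Translating the fibre by \<open>ln (J x)\<close> multiplies the weight
  \<open>exp y\<close> by \<open>J x\<close>. Almost everywhere
  \<open>J x = 1 / Tprime M T (T x)\<close>, which cancels the Jacobian of the substitution by
  \<open>T\<close>.\<close>

lemma nn_integral_maharam: assumes "nonsingular M T" and [measurable]: "h \<in> borel_measurable borel"
  shows "(\<integral>\<^sup>+p. h (maharam M T p) \<partial>nu) = integral\<^sup>N nu h"
proof -
  note T = nonsingularD[OF assms(1)]
  have [measurable]: "T \<in> borel_measurable borel" "Tinv M T \<in> borel_measurable borel" using T by auto
  define J where "J = Tprime M (Tinv M T)"
  have [measurable]: "J \<in> borel_measurable borel" by (simp add: J_def)
  have hm[measurable]: "(\<lambda>p. h (maharam M T p)) \<in> borel_measurable borel"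
    using maharam_measurable(1)[OF assms(1)] by measurable
  define H where "H x = (\<integral>\<^sup>+y. ennreal (exp y) * h (x, y) \<partial>lborel)" for x
  have e[measurable]: "(\<lambda>p::'a \<times> real. ennreal (exp (snd p))) \<in> borel_measurable borel"
    by (rule measurable_compose[OF _ measurable_ennreal], rule borel_measurable_continuous_onI) (intro continuous_intros)
  have h2: "(\<lambda>p. ennreal (exp (snd p)) * h p) \<in> borel_measurable (M \<Otimes>\<^sub>M lborel)" by simp
  have H[measurable]: "H \<in> borel_measurable borel"
    using lborel.borel_measurable_nn_integral_fst[OF h2] by (simp add: H_def[abs_def])
  have "(\<integral>\<^sup>+p. h (maharam M T p) \<partial>nu) = (\<integral>\<^sup>+x. \<integral>\<^sup>+y. ennreal (exp y) * h (T x, y - ln (J x)) \<partial>lborel \<partial>M)"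
    unfolding nn_integral_nu[OF hm] by (simp add: maharam_eq J_def)
  also have "\<dots> = (\<integral>\<^sup>+x. ennreal (J x) * H (T x) \<partial>M)"
    using AE_pos_Tinv[OF assms(1)]
  proof (intro nn_integral_cong_AE, eventually_elim)
    fix x assume "0 < Tprime M (Tinv M T) x" then have J: "0 < J x" by (simp add: J_def)
    have "(\<integral>\<^sup>+y. ennreal (exp y) * h (T x, y - ln (J x)) \<partial>lborel)
      = (\<integral>\<^sup>+y. ennreal (exp (ln (J x) + 1 * y)) * h (T x, (ln (J x) + 1 * y) - ln (J x)) \<partial>lborel)"
      using nn_integral_real_affine[of "\<lambda>y. ennreal (exp y) * h (T x, y - ln (J x))" 1 "ln (J x)"] by simp
    also have "\<dots> = (\<integral>\<^sup>+y. ennreal (J x) * (ennreal (exp y) * h (T x, y)) \<partial>lborel)"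
      using J by (intro nn_integral_cong) (simp add: exp_add ennreal_mult mult.assoc)
    also have "\<dots> = ennreal (J x) * H (T x)" unfolding H_def by (rule nn_integral_cmult) measurable
    finally show "(\<integral>\<^sup>+y. ennreal (exp y) * h (T x, y - ln (J x)) \<partial>lborel) = ennreal (J x) * H (T x)" .
  qed
  also have "\<dots> = (\<integral>\<^sup>+x. (\<lambda>z. ennreal (1 / Tprime M T z) * H z) (T x) \<partial>M)"
    using Tprime_Tinv[OF assms(1)] by (intro nn_integral_cong_AE, eventually_elim) (simp add: J_def)
  also have "\<dots> = (\<integral>\<^sup>+x. ennreal (Tprime M T x) * (ennreal (1 / Tprime M T x) * H x) \<partial>M)"
    by (rule nn_integral_T[OF assms(1)]) measurable
  also have "\<dots> = (\<integral>\<^sup>+x. H x \<partial>M)"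
    using Tprime_pos[OF assms(1)]
    by (intro nn_integral_cong_AE, eventually_elim)
       (auto simp: mult.assoc[symmetric] ennreal_mult[symmetric])
  also have "\<dots> = integral\<^sup>N nu h" unfolding H_def by (simp add: nn_integral_nu)
  finally show ?thesis .
qed

lemma distr_maharam: assumes "nonsingular M T" shows "distr nu nu (maharam M T) = nu"
proof (rule measure_eqI)
  fix A assume "A \<in> sets (distr nu nu (maharam M T))"
  then have [measurable]: "A \<in> sets borel" by (simp add: sets_nu)
  note m[measurable] = maharam_measurable[OF assms]
  have "emeasure (distr nu nu (maharam M T)) A = (\<integral>\<^sup>+p. indicator A (maharam M T p) \<partial>nu)"
  proof -
    have "emeasure (distr nu nu (maharam M T)) A = integral\<^sup>N (distr nu nu (maharam M T)) (indicator A)"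
      by (subst nn_integral_indicator) (auto simp: sets_nu)
    also have "\<dots> = (\<integral>\<^sup>+p. indicator A (maharam M T p) \<partial>nu)"
      by (rule nn_integral_distr) auto
    finally show ?thesis .
  qed
  also have "\<dots> = emeasure nu A" 
    by (subst nn_integral_maharam[OF assms]) (auto simp: sets_nu)
  finally show "emeasure (distr nu nu (maharam M T)) A = emeasure nu A" .
qed simp

lemma distr_mahinv: assumes "nonsingular M T" shows "distr nu nu (mahinv T) = nu"
proof -
  note m = maharam_measurable[OF assms]
  have "distr nu nu (mahinv T) = distr (distr nu nu (maharam M T)) nu (mahinv T)"
    by (simp add: distr_maharam[OF assms])
  also have "\<dots> = distr nu nu (mahinv T \<circ> maharam M T)"
    by (rule distr_distr) (use m in auto)
  also have "mahinv T \<circ> maharam M T = id" by (auto simp: maharam_inverse[OF assms])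
  finally show ?thesis using distr_id[of nu] by (simp add: id_def)
qed

end

section \<open>The topology d_2 and its basic neighbourhoods\<close>

lemma d2_istopology: "istopology (d2_open M)"
  unfolding istopology_def
proof (intro conjI allI impI)
  fix S T assume S: "d2_open M S" and T: "d2_open M T"
  show "d2_open M (S \<inter> T)" unfolding d2_open_def
  proof (intro conjI ballI)
    show "S \<inter> T \<subseteq> Aut2 M" using S by (auto simp: d2_open_def)
    fix R assume R: "R \<in> S \<inter> T"
    obtain F e where F: "finite F" "\<forall>(f,g)\<in>F. L2 M f \<and> L2 M g" "0 < e"
      "{T\<in>Aut2 M. (\<forall>(f,g)\<in>F. \<bar>inner2 M (UT M T f) g - inner2 M (UT M R f) g\<bar> < e) \<and>
                    norm2 M (\<lambda>x. sqrtTprime M T x - sqrtTprime M R x) < e} \<subseteq> S"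
      using S R unfolding d2_open_def by (meson IntD1)
    obtain F' e' where F': "finite F'" "\<forall>(f,g)\<in>F'. L2 M f \<and> L2 M g" "0 < e'"
      "{T\<in>Aut2 M. (\<forall>(f,g)\<in>F'. \<bar>inner2 M (UT M T f) g - inner2 M (UT M R f) g\<bar> < e') \<and>
                    norm2 M (\<lambda>x. sqrtTprime M T x - sqrtTprime M R x) < e'} \<subseteq> T"
      using T R unfolding d2_open_def by (meson IntD2)
    show "\<exists>F e. finite F \<and> (\<forall>(f,g)\<in>F. L2 M f \<and> L2 M g) \<and> 0 < e \<and>
        {T\<in>Aut2 M. (\<forall>(f,g)\<in>F. \<bar>inner2 M (UT M T f) g - inner2 M (UT M R f) g\<bar> < e) \<and>
                    norm2 M (\<lambda>x. sqrtTprime M T x - sqrtTprime M R x) < e} \<subseteq> S \<inter> T"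
      by (rule exI[of _ "F \<union> F'"], rule exI[of _ "min e e'"]) (use F F' in \<open>fastforce\<close>)
  qed
next
  fix K assume K: "\<forall>S\<in>K. d2_open M S"
  show "d2_open M (\<Union>K)" unfolding d2_open_def
  proof (intro conjI ballI)
    show "\<Union>K \<subseteq> Aut2 M" using K by (auto simp: d2_open_def)
    fix R assume "R \<in> \<Union>K"
    then obtain S where "S \<in> K" "R \<in> S" by auto
    then show "\<exists>F e. finite F \<and> (\<forall>(f,g)\<in>F. L2 M f \<and> L2 M g) \<and> 0 < e \<and>
        {T\<in>Aut2 M. (\<forall>(f,g)\<in>F. \<bar>inner2 M (UT M T f) g - inner2 M (UT M R f) g\<bar> < e) \<and>
                    norm2 M (\<lambda>x. sqrtTprime M T x - sqrtTprime M R x) < e} \<subseteq> \<Union>K"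
      using K unfolding d2_open_def by (meson Union_upper subset_trans)
  qed
qed

lemma openin_d2 [simp]: "openin (d2_topology M) = d2_open M"
  unfolding d2_topology_def by (rule topology_inverse'[OF d2_istopology])

lemma topspace_d2 [simp]: "topspace (d2_topology M) = Aut2 M"
proof -
  have "d2_open M (Aut2 M)" unfolding d2_open_def
    by (auto intro!: exI[of _ "{}"] exI[of _ "1::real"])
  then show ?thesis
    unfolding topspace_def openin_d2 using d2_open_def by blast
qed

section \<open>Continuity of the Maharam extension\<close>

text \<open>A property that holds on some basic neighbourhood of \<open>S\<close>. The laws
  \<open>d2_nhd_mono\<close> and \<open>d2_nhd_conj\<close> make it behave like a filter, so
  continuity can be argued without sequences.\<close>

definition d2_nhd :: "'a measure \<Rightarrow> ('a \<Rightarrow> 'a) \<Rightarrow> (('a \<Rightarrow> 'a) \<Rightarrow> bool) \<Rightarrow> bool" where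
  "d2_nhd M S P \<longleftrightarrow> (\<exists>F e. finite F \<and> (\<forall>(f,g)\<in>F. L2 M f \<and> L2 M g) \<and> 0 < e \<and>
     (\<forall>T\<in>Aut2 M. (\<forall>(f,g)\<in>F. \<bar>inner2 M (UT M T f) g - inner2 M (UT M S f) g\<bar> < e) \<longrightarrow>
                    norm2 M (\<lambda>x. sqrtTprime M T x - sqrtTprime M S x) < e \<longrightarrow> P T))"

lemma d2_open_iff: "d2_open M W \<longleftrightarrow> W \<subseteq> Aut2 M \<and> (\<forall>S\<in>W. d2_nhd M S (\<lambda>T. T \<in> W))"
  unfolding d2_open_def d2_nhd_def by (intro conj_cong ball_cong ex_cong1) auto

lemma d2_nhd_mono: "d2_nhd M S P \<Longrightarrow> (\<And>T. T \<in> Aut2 M \<Longrightarrow> P T \<Longrightarrow> Q T) \<Longrightarrow> d2_nhd M S Q"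
  unfolding d2_nhd_def by meson

lemma d2_nhd_conj:
  assumes "d2_nhd M S P" "d2_nhd M S Q" shows "d2_nhd M S (\<lambda>T. P T \<and> Q T)"
proof -
  obtain F e where F: "finite F" "\<forall>(f,g)\<in>F. L2 M f \<and> L2 M g" "0 < e"
    and P: "\<And>T. T\<in>Aut2 M \<Longrightarrow> (\<forall>(f,g)\<in>F. \<bar>inner2 M (UT M T f) g - inner2 M (UT M S f) g\<bar> < e) \<Longrightarrow>
                    norm2 M (\<lambda>x. sqrtTprime M T x - sqrtTprime M S x) < e \<Longrightarrow> P T"
    using assms(1) unfolding d2_nhd_def by blast
  obtain F' e' where F': "finite F'" "\<forall>(f,g)\<in>F'. L2 M f \<and> L2 M g" "0 < e'"
    and Q: "\<And>T. T\<in>Aut2 M \<Longrightarrow> (\<forall>(f,g)\<in>F'. \<bar>inner2 M (UT M T f) g - inner2 M (UT M S f) g\<bar> < e') \<Longrightarrow>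
                    norm2 M (\<lambda>x. sqrtTprime M T x - sqrtTprime M S x) < e' \<Longrightarrow> Q T"
    using assms(2) unfolding d2_nhd_def by blast
  show ?thesis unfolding d2_nhd_def
  proof (rule exI[of _ "F \<union> F'"], rule exI[of _ "min e e'"], intro conjI ballI impI)
    fix T assume T: "T \<in> Aut2 M"
      "\<forall>(f, g)\<in>F \<union> F'. \<bar>inner2 M (UT M T f) g - inner2 M (UT M S f) g\<bar> < min e e'"
      "norm2 M (\<lambda>x. sqrtTprime M T x - sqrtTprime M S x) < min e e'"
    show "P T" by (rule P) (use T in auto)
    show "Q T" by (rule Q) (use T in auto)
  qed (use F F' in auto)
qed

lemma nn_integral_exp_atMost:
  "(\<integral>\<^sup>+y. ennreal (exp y) * indicator {..s} y \<partial>lborel) = ennreal (exp s)"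
proof -
  have "(\<integral>\<^sup>+y. ennreal (exp y) * indicator {..s} y \<partial>lborel)
      = (\<integral>\<^sup>+y. ennreal (exp (0 + (-1) * y)) * indicator {..s} (0 + (-1) * y) \<partial>lborel)"
    using nn_integral_real_affine[of "\<lambda>y. ennreal (exp y) * indicator {..s} y" "-1" 0] by simp
  also have "\<dots> = (\<integral>\<^sup>+y. ennreal (exp (- y)) * indicator {-s..} y \<partial>lborel)"
    by (intro nn_integral_cong) (auto split: split_indicator)
  also have "\<dots> = ennreal (0 - (- exp (- (- s))))"
  proof (rule nn_integral_FTC_atLeast)
    show "DERIV (\<lambda>x. - exp (- x)) x :> exp (- x)" for x :: real by (auto intro!: derivative_eq_intros)
    have "((\<lambda>x::real. - exp (- x)) \<longlongrightarrow> - 0) at_top"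
      by (intro tendsto_minus filterlim_compose[OF exp_at_bot filterlim_uminus_at_bot_at_top])
    then show "((\<lambda>x::real. - exp (- x)) \<longlongrightarrow> 0) at_top" by simp
  qed auto
  finally show ?thesis by simp
qed

lemma nn_integral_exp_diff_le:
  assumes "s \<le> s'"
  shows "(\<integral>\<^sup>+y. ennreal (exp y) * ennreal \<bar>indicator {..s} y - indicator {..s'} y\<bar> \<partial>lborel)
     = ennreal \<bar>exp s - exp s'\<bar>"
proof -
  have "(\<integral>\<^sup>+y. ennreal (exp y) * ennreal \<bar>indicator {..s} y - indicator {..s'} y\<bar> \<partial>lborel)
    = (\<integral>\<^sup>+y. ennreal (exp y) * indicator {..s'} y - ennreal (exp y) * indicator {..s} y \<partial>lborel)"
    using assms by (intro nn_integral_cong) (auto split: split_indicator)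
  also have "\<dots> = (\<integral>\<^sup>+y. ennreal (exp y) * indicator {..s'} y \<partial>lborel) - (\<integral>\<^sup>+y. ennreal (exp y) * indicator {..s} y \<partial>lborel)"
    using assms by (intro nn_integral_diff) (auto simp: nn_integral_exp_atMost split: split_indicator intro!: AE_I2)
  also have "\<dots> = ennreal \<bar>exp s - exp s'\<bar>"
    using assms by (simp add: nn_integral_exp_atMost ennreal_minus abs_of_nonpos)
  finally show ?thesis .
qed

lemma nn_integral_exp_diff:
  "(\<integral>\<^sup>+y. ennreal (exp y) * ennreal \<bar>indicator {..s} y - indicator {..s'} y\<bar> \<partial>lborel)
     = ennreal \<bar>exp s - exp s'\<bar>"
proof (cases "s \<le> s'")
  case False
  then show ?thesis using nn_integral_exp_diff_le[of s' s] by (simp add: abs_minus_commute)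
qed (rule nn_integral_exp_diff_le)

context std_space begin

text \<open>For isometries with equal norms, the squared distance of \<open>U_T f\<close> and
  \<open>U_S f\<close> is twice the inner product of \<open>U_S f - U_T f\<close> with
  \<open>U_S f\<close>. The single test pair \<open>(f, UT M S f)\<close> with radius
  \<open>e\<^sup>2 / 2\<close> therefore suffices: weak closeness is strong closeness.\<close>

lemma UT_strong:
  assumes S: "S \<in> Aut2 M" and f: "L2 M f" and e: "0 < e"
  shows "d2_nhd M S (\<lambda>T. norm2 M (\<lambda>x. UT M T f x - UT M S f x) < e)"
proof -
  have nS: "nonsingular M S" using S by (auto simp: Aut2_def)
  define d where "d = e\<^sup>2 / 2"
  show ?thesis unfolding d2_nhd_def
  proof (rule exI[of _ "{(f, UT M S f)}"], rule exI[of _ d], intro conjI ballI impI)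
    show "0 < d" using e by (simp add: d_def)
    show "case x of (f, g) \<Rightarrow> L2 M f \<and> L2 M g" if "x \<in> {(f, UT M S f)}" for x
      using that f L2_UT[OF nS f] by simp
    fix T assume T: "T \<in> Aut2 M"
      and "\<forall>(f, g)\<in>{(f, UT M S f)}. \<bar>inner2 M (UT M T f) g - inner2 M (UT M S f) g\<bar> < d"
    then have c: "\<bar>inner2 M (UT M T f) (UT M S f) - inner2 M (UT M S f) (UT M S f)\<bar> < d" by simp
    have nT: "nonsingular M T" using T by (auto simp: Aut2_def)
    let ?u = "UT M T f" and ?v = "UT M S f"
    note L = L2_UT[OF nT f] L2_UT[OF nS f]
    have i: "integrable M (\<lambda>x. (?u x)\<^sup>2)" "integrable M (\<lambda>x. (?v x)\<^sup>2)" using L by (auto simp: L2_def)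
    have "(norm2 M (\<lambda>x. ?u x - ?v x))\<^sup>2 = (\<integral>x. (?u x)\<^sup>2 - 2 * (?u x * ?v x) + (?v x)\<^sup>2 \<partial>M)"
      unfolding norm2_power2 by (intro Bochner_Integration.integral_cong) (auto simp: power2_eq_square algebra_simps)
    also have "\<dots> = (norm2 M ?u)\<^sup>2 - 2 * inner2 M ?u ?v + (norm2 M ?v)\<^sup>2"
      unfolding norm2_power2 inner2_def using i L2_product(1)[OF L] by simp
    also have "\<dots> = 2 * (inner2 M ?v ?v - inner2 M ?u ?v)"
      unfolding norm2_UT[OF nT f] norm2_UT[OF nS f, symmetric] norm2_power2
      by (simp add: inner2_def power2_eq_square)
    also have "\<dots> < e\<^sup>2" using c[THEN abs_le_D2[OF less_imp_le]] abs_less_iff[THEN iffD1, OF c] unfolding d_def by argo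
    finally show "norm2 M (\<lambda>x. ?u x - ?v x) < e" using e by (simp add: power_less_imp_less_base)
  qed simp
qed

definition dK :: "('a \<times> real \<Rightarrow> real) \<Rightarrow> ('a \<Rightarrow> 'a) \<Rightarrow> ('a \<Rightarrow> 'a) \<Rightarrow> ennreal" where
  "dK h T S = (\<integral>\<^sup>+p. ennreal \<bar>h (mahinv T p) - h (mahinv S p)\<bar> \<partial>nu)"

text \<open>Continuity of \<open>T \<mapsto> h \<circ> T~^-1\<close> into L1(nu). The closure
  properties below extend it from boxes to every integrable \<open>h\<close>.\<close>

definition L1cont :: "('a \<times> real \<Rightarrow> real) \<Rightarrow> bool" where
  "L1cont h \<longleftrightarrow> h \<in> borel_measurable borel \<and>
     (\<forall>S\<in>Aut2 M. \<forall>e>0. d2_nhd M S (\<lambda>T. dK h T S < ennreal e))"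

lemma Aut2_measurable:
  assumes "T \<in> Aut2 M" shows "mahinv T \<in> borel_measurable borel" "maharam M T \<in> borel_measurable borel"
  using maharam_measurable[of T] assms by (auto simp: Aut2_def)

lemma nn_integral_mahinv: assumes "nonsingular M T" "h \<in> borel_measurable borel"
  shows "(\<integral>\<^sup>+p. h (mahinv T p) \<partial>nu) = integral\<^sup>N nu h"
  using nn_integral_distr[of "mahinv T" nu nu h] distr_mahinv[OF assms(1)] assms(2)
    maharam_measurable(2)[OF assms(1)] by simp

lemma dK_triangle:
  assumes [measurable]: "h \<in> borel_measurable borel" "k \<in> borel_measurable borel" "l \<in> borel_measurable borel"
    and T: "T \<in> Aut2 M" "S \<in> Aut2 M"
    and le: "\<And>p q. \<bar>l p - l q\<bar> \<le> \<bar>h p - h q\<bar> + \<bar>k p - k q\<bar>"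
  shows "dK l T S \<le> dK h T S + dK k T S"
proof -
  note [measurable] = Aut2_measurable(1)[OF T(1)] Aut2_measurable(1)[OF T(2)]
  have "dK l T S \<le> (\<integral>\<^sup>+p. ennreal \<bar>h (mahinv T p) - h (mahinv S p)\<bar> + ennreal \<bar>k (mahinv T p) - k (mahinv S p)\<bar> \<partial>nu)"
    unfolding dK_def using le by (intro nn_integral_mono) (simp add: ennreal_plus[symmetric] del: ennreal_plus)
  also have "\<dots> = dK h T S + dK k T S" unfolding dK_def by (rule nn_integral_add) auto
  finally show ?thesis .
qed

text \<open>Stated through increments so that sums and differences are covered at once.\<close>

lemma L1cont_comb:
  assumes h: "L1cont h" and k: "L1cont k" and l: "l \<in> borel_measurable borel"
    and le: "\<And>p q. \<bar>l p - l q\<bar> \<le> \<bar>h p - h q\<bar> + \<bar>k p - k q\<bar>"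
  shows "L1cont l"
  unfolding L1cont_def
proof (intro conjI l ballI allI impI)
  fix S and e :: real assume S: "S \<in> Aut2 M" and e: "0 < e"
  have "d2_nhd M S (\<lambda>T. dK h T S < ennreal (e/2) \<and> dK k T S < ennreal (e/2))"
    using h k S e by (intro d2_nhd_conj) (auto simp: L1cont_def)
  then show "d2_nhd M S (\<lambda>T. dK l T S < ennreal e)"
  proof (rule d2_nhd_mono)
    fix T assume T: "T \<in> Aut2 M" and lt: "dK h T S < ennreal (e/2) \<and> dK k T S < ennreal (e/2)"
    have "dK l T S \<le> dK h T S + dK k T S"
      using h k by (intro dK_triangle l T S le) (auto simp: L1cont_def)
    also have "\<dots> < ennreal (e/2) + ennreal (e/2)" using lt by (intro add_strict_mono) auto
    also have "\<dots> = ennreal e" using e by (simp flip: ennreal_plus)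
    finally show "dK l T S < ennreal e" .
  qed
qed

lemma L1cont_add: "L1cont h \<Longrightarrow> L1cont k \<Longrightarrow> L1cont (\<lambda>p. h p + k p)"
  by (rule L1cont_comb[of h k]) (auto simp: L1cont_def)

lemma L1cont_diff: "L1cont h \<Longrightarrow> L1cont k \<Longrightarrow> L1cont (\<lambda>p. h p - k p)"
  by (rule L1cont_comb[of h k]) (auto simp: L1cont_def)

lemma L1cont_zero: "L1cont (\<lambda>p. 0)"
proof -
  have "d2_nhd M S (\<lambda>T. True)" for S unfolding d2_nhd_def by (auto intro!: exI[of _ "{}"] exI[of _ "1::real"])
  then show ?thesis by (auto simp: L1cont_def dK_def elim: d2_nhd_mono)
qed

lemma L1cont_scale: assumes "L1cont h" shows "L1cont (\<lambda>p. c * h p)"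
  unfolding L1cont_def
proof (intro conjI ballI allI impI)
  have [measurable]: "h \<in> borel_measurable borel" using assms by (auto simp: L1cont_def)
  show "(\<lambda>p. c * h p) \<in> borel_measurable borel" by measurable
  fix S and e :: real assume S: "S \<in> Aut2 M" and e: "0 < e"
  have "0 < e / (\<bar>c\<bar> + 1)" using e by (simp add: field_simps)
  then have "d2_nhd M S (\<lambda>T. dK h T S < ennreal (e / (\<bar>c\<bar> + 1)))" using assms S by (auto simp: L1cont_def)
  then show "d2_nhd M S (\<lambda>T. dK (\<lambda>p. c * h p) T S < ennreal e)"
  proof (rule d2_nhd_mono)
    fix T assume T: "T \<in> Aut2 M" and lt: "dK h T S < ennreal (e / (\<bar>c\<bar> + 1))"
    note [measurable] = Aut2_measurable(1)[OF T] Aut2_measurable(1)[OF S]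
    have "dK (\<lambda>p. c * h p) T S = (\<integral>\<^sup>+p. ennreal \<bar>c\<bar> * ennreal \<bar>h (mahinv T p) - h (mahinv S p)\<bar> \<partial>nu)"
      unfolding dK_def by (intro nn_integral_cong) (simp add: ennreal_mult[symmetric] abs_mult[symmetric] right_diff_distrib)
    also have "\<dots> = ennreal \<bar>c\<bar> * dK h T S" unfolding dK_def by (rule nn_integral_cmult) auto
    also have "\<dots> \<le> ennreal \<bar>c\<bar> * ennreal (e / (\<bar>c\<bar> + 1))" using lt by (intro mult_left_mono) auto
    also have "\<dots> = ennreal (\<bar>c\<bar> * (e / (\<bar>c\<bar> + 1)))" by (rule ennreal_mult'[symmetric]) simp
    also have "\<dots> < ennreal e" using e by (intro ennreal_lessI) (auto simp: field_simps)
    finally show "dK (\<lambda>p. c * h p) T S < ennreal e" .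
  qed
qed

text \<open>An \<open>e / 3\<close> argument that is uniform in \<open>T\<close>: composing with
  \<open>mahinv T\<close> does not change the L1 distance of \<open>h\<close> and \<open>k\<close>,
  because \<open>nu\<close> is preserved.\<close>

lemma L1cont_limit:
  assumes h[measurable]: "h \<in> borel_measurable borel"
    and a: "\<And>e. 0 < e \<Longrightarrow> \<exists>k. L1cont k \<and> (\<integral>\<^sup>+p. ennreal \<bar>h p - k p\<bar> \<partial>nu) < ennreal e"
  shows "L1cont h"
  unfolding L1cont_def
proof (intro conjI h ballI allI impI)
  fix S and e :: real assume S: "S \<in> Aut2 M" and e: "0 < e"
  from a[of "e/3"] e obtain k where k: "L1cont k" and lt: "(\<integral>\<^sup>+p. ennreal \<bar>h p - k p\<bar> \<partial>nu) < ennreal (e/3)" by auto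
  have [measurable]: "k \<in> borel_measurable borel" using k by (auto simp: L1cont_def)
  have "d2_nhd M S (\<lambda>T. dK k T S < ennreal (e/3))" using k S e by (auto simp: L1cont_def)
  then show "d2_nhd M S (\<lambda>T. dK h T S < ennreal e)"
  proof (rule d2_nhd_mono)
    fix T assume T: "T \<in> Aut2 M" and d: "dK k T S < ennreal (e/3)"
    note [measurable] = Aut2_measurable(1)[OF T] Aut2_measurable(1)[OF S]
    have n: "nonsingular M T" "nonsingular M S" using T S by (auto simp: Aut2_def)
    have "dK h T S \<le> (\<integral>\<^sup>+p. (ennreal \<bar>h (mahinv T p) - k (mahinv T p)\<bar> + ennreal \<bar>h (mahinv S p) - k (mahinv S p)\<bar>)
       + ennreal \<bar>k (mahinv T p) - k (mahinv S p)\<bar> \<partial>nu)"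
      unfolding dK_def by (intro nn_integral_mono) (simp add: ennreal_plus[symmetric] del: ennreal_plus)
    also have "\<dots> = ((\<integral>\<^sup>+p. ennreal \<bar>h (mahinv T p) - k (mahinv T p)\<bar> \<partial>nu) + (\<integral>\<^sup>+p. ennreal \<bar>h (mahinv S p) - k (mahinv S p)\<bar> \<partial>nu)) + dK k T S"
      unfolding dK_def by (simp add: nn_integral_add)
    also have "(\<integral>\<^sup>+p. ennreal \<bar>h (mahinv T p) - k (mahinv T p)\<bar> \<partial>nu) = (\<integral>\<^sup>+p. ennreal \<bar>h p - k p\<bar> \<partial>nu)"
      using nn_integral_mahinv[OF n(1), of "\<lambda>p. ennreal \<bar>h p - k p\<bar>"] by simp
    also have "(\<integral>\<^sup>+p. ennreal \<bar>h (mahinv S p) - k (mahinv S p)\<bar> \<partial>nu) = (\<integral>\<^sup>+p. ennreal \<bar>h p - k p\<bar> \<partial>nu)"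
      using nn_integral_mahinv[OF n(2), of "\<lambda>p. ennreal \<bar>h p - k p\<bar>"] by simp
    also have "(\<integral>\<^sup>+p. ennreal \<bar>h p - k p\<bar> \<partial>nu) + (\<integral>\<^sup>+p. ennreal \<bar>h p - k p\<bar> \<partial>nu) + dK k T S
       < (ennreal (e/3) + ennreal (e/3)) + ennreal (e/3)" using lt d by (intro add_strict_mono) auto
    also have "\<dots> = ennreal e" using e by (simp flip: ennreal_plus)
    finally show "dK h T S < ennreal e" .
  qed
qed

text \<open>Over \<open>x\<close> the image of the box is empty or the half line below
  \<open>b + ln (Tprime M T x)\<close>, of mass \<open>exp b * Tprime M T x\<close>, according to
  whether \<open>Tinv M T x\<close> lies in \<open>A\<close>. This mass is \<open>exp b\<close>
  times the square of \<open>UT M T (indicator A) x\<close>, and two such half lines differ by the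
  difference of their masses.\<close>

lemma dK_box:
  assumes T: "T \<in> Aut2 M" and S: "S \<in> Aut2 M" and A[measurable]: "A \<in> sets borel"
  shows "dK (indicator (A \<times> {..b})) T S
    = ennreal (exp b) * (\<integral>\<^sup>+x. ennreal \<bar>(UT M T (indicator A) x)\<^sup>2 - (UT M S (indicator A) x)\<^sup>2\<bar> \<partial>M)"
proof -
  have n: "nonsingular M T" "nonsingular M S" using T S by (auto simp: Aut2_def)
  note [measurable] = Aut2_measurable(1)[OF T] Aut2_measurable(1)[OF S] nonsingularD(3)[OF n(1)] nonsingularD(3)[OF n(2)]
  have [measurable]: "A \<times> {..b} \<in> sets borel" unfolding borel_prod[symmetric] by simp
  have "dK (indicator (A \<times> {..b})) T S
     = (\<integral>\<^sup>+x. \<integral>\<^sup>+y. ennreal (exp y) * ennreal \<bar>indicator (A \<times> {..b}) (mahinv T (x,y)) - indicator (A \<times> {..b}) (mahinv S (x,y))\<bar> \<partial>lborel \<partial>M)"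
    unfolding dK_def by (subst nn_integral_nu) auto
  also have "\<dots> = (\<integral>\<^sup>+x. ennreal (exp b) * ennreal \<bar>(UT M T (indicator A) x)\<^sup>2 - (UT M S (indicator A) x)\<^sup>2\<bar> \<partial>M)"
  proof (rule nn_integral_cong_AE)
    show "AE x in M. (\<integral>\<^sup>+y. ennreal (exp y) * ennreal \<bar>indicator (A \<times> {..b}) (mahinv T (x,y)) - indicator (A \<times> {..b}) (mahinv S (x,y))\<bar> \<partial>lborel)
       = ennreal (exp b) * ennreal \<bar>(UT M T (indicator A) x)\<^sup>2 - (UT M S (indicator A) x)\<^sup>2\<bar>"
      using Tprime_pos[OF n(1)] Tprime_pos[OF n(2)] Tprime_Tinv'[OF n(1)] Tprime_Tinv'[OF n(2)]
    proof eventually_elim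
      fix x assume p: "0 < Tprime M T x" "0 < Tprime M S x"
        and j: "Tprime M (Tinv M T) (Tinv M T x) = 1 / Tprime M T x" "Tprime M (Tinv M S) (Tinv M S x) = 1 / Tprime M S x"
      define s s' where "s = b + ln (Tprime M T x)" and "s' = b + ln (Tprime M S x)"
      have es: "exp s = exp b * Tprime M T x" "exp s' = exp b * Tprime M S x"
        using p by (auto simp: s_def s'_def exp_add)
      have 1: "indicator (A \<times> {..b}) (mahinv T (x,y)) = (indicator A (Tinv M T x) * indicator {..s} y :: real)"
        "indicator (A \<times> {..b}) (mahinv S (x,y)) = (indicator A (Tinv M S x) * indicator {..s'} y :: real)" for y
        using p by (auto simp: mahinv_def j s_def s'_def ln_div split: split_indicator)
      have 2: "(UT M T (indicator A) x)\<^sup>2 = indicator A (Tinv M T x) * Tprime M T x"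
        "(UT M S (indicator A) x)\<^sup>2 = indicator A (Tinv M S x) * Tprime M S x"
        using p by (auto simp: UT_def sqrtTprime_def power_mult_distrib split: split_indicator)
      have eb: "ennreal (exp b) * ennreal (Tprime M T x) = ennreal (exp s)" "ennreal (exp b) * ennreal (Tprime M S x) = ennreal (exp s')"
        "ennreal (exp b) * ennreal \<bar>Tprime M T x - Tprime M S x\<bar> = ennreal \<bar>exp s - exp s'\<bar>"
        using p unfolding es by (auto simp: ennreal_mult'[symmetric] abs_mult right_diff_distrib[symmetric])
      consider "Tinv M T x \<in> A" "Tinv M S x \<in> A" | "Tinv M T x \<in> A" "Tinv M S x \<notin> A" |
        "Tinv M T x \<notin> A" "Tinv M S x \<in> A" | "Tinv M T x \<notin> A" "Tinv M S x \<notin> A" by blast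
      then show "(\<integral>\<^sup>+y. ennreal (exp y) * ennreal \<bar>indicator (A \<times> {..b}) (mahinv T (x,y)) - indicator (A \<times> {..b}) (mahinv S (x,y))\<bar> \<partial>lborel)
       = ennreal (exp b) * ennreal \<bar>(UT M T (indicator A) x)\<^sup>2 - (UT M S (indicator A) x)\<^sup>2\<bar>"
        unfolding 1 2 using p
        by cases (simp_all add: eb nn_integral_exp_diff nn_integral_exp_atMost ennreal_indicator)
    qed
  qed
  also have "\<dots> = ennreal (exp b) * (\<integral>\<^sup>+x. ennreal \<bar>(UT M T (indicator A) x)\<^sup>2 - (UT M S (indicator A) x)\<^sup>2\<bar> \<partial>M)"
    by (rule nn_integral_cmult) (auto simp: UT_def[abs_def])
  finally show ?thesis .
qed

lemma L2_indicator: assumes "A \<in> sets borel" "emeasure M A < \<infinity>"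
  shows "L2 M (indicator A)" "norm2 M (indicator A) = sqrt (measure M A)"
proof -
  have sq: "(\<lambda>x. (indicator A x :: real)\<^sup>2) = indicator A" by (auto split: split_indicator)
  show "L2 M (indicator A)" unfolding L2_def sq using assms by (auto simp: sets_M)
  show "norm2 M (indicator A) = sqrt (measure M A)" unfolding norm2_def sq using assms by (simp add: sets_M)
qed

text \<open>Factor the difference of squares and apply Cauchy-Schwarz.\<close>

lemma nn_integral_sq_diff:
  assumes "L2 M u" "L2 M v"
  shows "(\<integral>\<^sup>+x. ennreal \<bar>(u x)\<^sup>2 - (v x)\<^sup>2\<bar> \<partial>M) \<le> ennreal (norm2 M (\<lambda>x. u x - v x) * (norm2 M u + norm2 M v))"
proof -
  note d = L2_diff[OF assms] and s = L2_add[OF assms]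
  have eq: "\<bar>(u x)\<^sup>2 - (v x)\<^sup>2\<bar> = \<bar>(u x - v x) * (u x + v x)\<bar>" for x by (simp add: power2_eq_square algebra_simps)
  have "(\<integral>\<^sup>+x. ennreal \<bar>(u x)\<^sup>2 - (v x)\<^sup>2\<bar> \<partial>M) = ennreal (\<integral>x. \<bar>(u x - v x) * (u x + v x)\<bar> \<partial>M)"
    unfolding eq using L2_product(1)[OF d s] by (intro nn_integral_eq_integral integrable_abs) auto
  also have "\<dots> \<le> ennreal (norm2 M (\<lambda>x. u x - v x) * (norm2 M u + norm2 M v))"
    using L2_product(2)[OF d s] norm2_triangle[OF assms]
    by (intro ennreal_leI) (meson mult_left_mono norm2_nonneg order_trans)
  finally show ?thesis .
qed

lemma L1cont_box:
  assumes A: "A \<in> sets borel" "emeasure M A < \<infinity>"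
  shows "L1cont (indicator (A \<times> {..b}))"
  unfolding L1cont_def
proof (intro conjI ballI allI impI)
  have [measurable]: "A \<times> {..b} \<in> sets borel" unfolding borel_prod[symmetric] using A by simp
  show "indicator (A \<times> {..b}) \<in> borel_measurable borel" by measurable
  fix S and e :: real assume S: "S \<in> Aut2 M" and e: "0 < e"
  \<comment> \<open>\<open>exp b\<close> times the sum of the norms of the two images of
    \<open>indicator A\<close>, both equal to \<open>sqrt (measure M A)\<close>. Dividing by
    \<open>c + 1\<close> also covers \<open>c = 0\<close>.\<close>
  define c where "c = exp b * (2 * sqrt (measure M A))"
  have c: "0 \<le> c" by (simp add: c_def)
  note I = L2_indicator[OF A]
  have "d2_nhd M S (\<lambda>T. norm2 M (\<lambda>x. UT M T (indicator A) x - UT M S (indicator A) x) < e / (c + 1))"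
    using e c by (intro UT_strong S I) auto
  then show "d2_nhd M S (\<lambda>T. dK (indicator (A \<times> {..b})) T S < ennreal e)"
  proof (rule d2_nhd_mono)
    fix T assume T: "T \<in> Aut2 M" and lt: "norm2 M (\<lambda>x. UT M T (indicator A) x - UT M S (indicator A) x) < e / (c + 1)"
    have n: "nonsingular M T" "nonsingular M S" using T S by (auto simp: Aut2_def)
    have "dK (indicator (A \<times> {..b})) T S \<le> ennreal (exp b) * ennreal (norm2 M (\<lambda>x. UT M T (indicator A) x - UT M S (indicator A) x)
        * (norm2 M (UT M T (indicator A)) + norm2 M (UT M S (indicator A))))"
      unfolding dK_box[OF T S A(1)] by (intro mult_left_mono nn_integral_sq_diff L2_UT n I) auto
    also have "\<dots> = ennreal (c * norm2 M (\<lambda>x. UT M T (indicator A) x - UT M S (indicator A) x))"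
      unfolding norm2_UT[OF n(1) I(1)] norm2_UT[OF n(2) I(1)] I(2) c_def
      by (simp add: ennreal_mult'[symmetric] ac_simps)
    also have "\<dots> < ennreal e"
    proof (rule ennreal_lessI)
      have "c * norm2 M (\<lambda>x. UT M T (indicator A) x - UT M S (indicator A) x) \<le> c * (e / (c + 1))"
        using lt c by (intro mult_left_mono) auto
      also have "\<dots> < e" using c e by (simp add: field_simps)
      finally show "c * norm2 M (\<lambda>x. UT M T (indicator A) x - UT M S (indicator A) x) < e" .
    qed (rule e)
    finally show "dK (indicator (A \<times> {..b})) T S < ennreal e" .
  qed
qed

end

section \<open>Ergodicity and coboundaries\<close>

text \<open>The factor 2 is the bound that \<open>integrable_induct\<close> supplies; dominated
  convergence then applies with \<open>3 * \<bar>f x\<bar>\<close>.\<close>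

lemma nn_integral_abs_tendsto_0:
  fixes f :: "'b \<Rightarrow> real"
  assumes "\<And>i. integrable N (s i)" "integrable N f"
    "\<And>x. x \<in> space N \<Longrightarrow> (\<lambda>i. s i x) \<longlonglongrightarrow> f x" "\<And>i x. x \<in> space N \<Longrightarrow> norm (s i x) \<le> 2 * norm (f x)"
  shows "(\<lambda>i. \<integral>\<^sup>+x. ennreal \<bar>f x - s i x\<bar> \<partial>N) \<longlonglongrightarrow> 0"
proof -
  have [measurable]: "\<And>i. s i \<in> borel_measurable N" "f \<in> borel_measurable N" using assms(1,2) by auto
  have "(\<lambda>i. \<integral>x. \<bar>f x - s i x\<bar> \<partial>N) \<longlonglongrightarrow> (\<integral>x. 0 \<partial>N)"
  proof (rule integral_dominated_convergence[where w="\<lambda>x. 3 * \<bar>f x\<bar>"])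
    show "AE x in N. (\<lambda>i. \<bar>f x - s i x\<bar>) \<longlonglongrightarrow> 0"
      using assms(3) by (intro AE_I2) (auto intro!: tendsto_eq_intros)
    show "AE x in N. norm \<bar>f x - s i x\<bar> \<le> 3 * \<bar>f x\<bar>" for i
    proof (rule AE_I2)
      fix x assume "x \<in> space N"
      then have "\<bar>s i x\<bar> \<le> 2 * \<bar>f x\<bar>" using assms(4) by auto
      then show "norm \<bar>f x - s i x\<bar> \<le> 3 * \<bar>f x\<bar>" by simp
    qed
  qed (use assms in auto)
  moreover have "(\<integral>\<^sup>+x. ennreal \<bar>f x - s i x\<bar> \<partial>N) = ennreal (\<integral>x. \<bar>f x - s i x\<bar> \<partial>N)" for i
    using assms by (intro nn_integral_eq_integral) auto
  ultimately show ?thesis using tendsto_ennrealI by fastforce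
qed

lemma small_ennreal:
  assumes "s \<longlonglongrightarrow> (0::ennreal)" "0 < e" shows "\<exists>n. s n < ennreal e"
  using order_tendstoD(2)[OF assms(1), of "ennreal e"] assms(2) by (auto simp: eventually_sequentially)

text \<open>Positive mass of \<open>f\<close> is moved greedily along the orbit onto its negative part. What can never be
  moved lives on two sets whose saturations are disjoint, so ergodicity makes it vanish.\<close>

lemma ergodic_coboundary_dense:
  fixes N :: "'b measure" and S V :: "'b \<Rightarrow> 'b" and f :: "'b \<Rightarrow> real"
  assumes [simp]: "space N = UNIV"
    and m[measurable]: "S \<in> measurable N N" "V \<in> measurable N N"
    and inv: "\<And>z. V (S z) = z" "\<And>z. S (V z) = z"
    and pres: "distr N N S = N" "distr N N V = N"
    and erg: "ergodic N S" and f: "integrable N f" "integral\<^sup>L N f = 0" and e: "0 < (e::real)"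
  shows "\<exists>h. integrable N h \<and> (\<integral>\<^sup>+z. ennreal \<bar>f z - h z + h (V z)\<bar> \<partial>N) < ennreal e"
proof -
  have iS: "integrable N (\<lambda>z. g (S z))" "integral\<^sup>L N (\<lambda>z. g (S z)) = integral\<^sup>L N g" if "integrable N g" for g :: "'b \<Rightarrow> real"
    using that integrable_distr_eq[OF m(1), of g] integral_distr[OF m(1), of g] pres by auto
  have iV: "integrable N (\<lambda>z. g (V z))" "integral\<^sup>L N (\<lambda>z. g (V z)) = integral\<^sup>L N g" if "integrable N g" for g :: "'b \<Rightarrow> real"
    using that integrable_distr_eq[OF m(2), of g] integral_distr[OF m(2), of g] pres by auto
  have iSk: "integrable N (\<lambda>z. g ((S ^^ k) z)) \<and> integral\<^sup>L N (\<lambda>z. g ((S ^^ k) z)) = integral\<^sup>L N g"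
    if "integrable N g" for g :: "'b \<Rightarrow> real" and k using that
  proof (induction k arbitrary: g)
    case (Suc k)
    show ?case using Suc.IH[OF iS(1)[OF Suc.prems]] iS[OF Suc.prems] by (simp)
  qed simp
  have iVk: "integrable N (\<lambda>z. g ((V ^^ k) z)) \<and> integral\<^sup>L N (\<lambda>z. g ((V ^^ k) z)) = integral\<^sup>L N g"
    if "integrable N g" for g :: "'b \<Rightarrow> real" and k using that
  proof (induction k arbitrary: g)
    case (Suc k)
    show ?case using Suc.IH[OF iV(1)[OF Suc.prems]] iV[OF Suc.prems] by (simp)
  qed simp
  define cob where "cob c \<longleftrightarrow> (\<exists>h. integrable N h \<and> c = (\<lambda>z. h z - h (V z)))" for c :: "'b \<Rightarrow> real"
  have cob_add: "cob (\<lambda>z. a z + b z)" if "cob a" "cob b" for a b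
  proof -
    obtain h k where "integrable N h" "integrable N k" "a = (\<lambda>z. h z - h (V z))" "b = (\<lambda>z. k z - k (V z))"
      using \<open>cob a\<close> \<open>cob b\<close> unfolding cob_def by blast
    then show ?thesis unfolding cob_def by (intro exI[of _ "\<lambda>z. h z + k z"]) (auto simp: algebra_simps)
  qed
  have cob0: "cob (\<lambda>z. 0)" unfolding cob_def by (rule exI[of _ "\<lambda>z. 0"]) auto
  have VS: "(S ^^ Suc k) (V z) = (S ^^ k) z" "(V ^^ Suc k) (S z) = (V ^^ k) z" for k z
    by (simp_all only: funpow_Suc_right o_apply inv)
  have cobS: "cob (\<lambda>z. g ((S ^^ k) z) - g z)" if g: "integrable N g" for g k
  proof (induction k)
    case 0 then show ?case using cob0 by simp
  next
    case (Suc k)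
    have "cob (\<lambda>z. g ((S ^^ Suc k) z) - g ((S ^^ k) z))"
      unfolding cob_def using iSk[OF g, of "Suc k"]
      by (intro exI[of _ "\<lambda>z. g ((S ^^ Suc k) z)"] conjI) (simp_all only: VS)
    from cob_add[OF this Suc] show ?case by simp
  qed
  have cobV: "cob (\<lambda>z. g ((V ^^ k) z) - g z)" if g: "integrable N g" for g k
  proof (induction k)
    case 0 then show ?case using cob0 by simp
  next
    case (Suc k)
    have "cob (\<lambda>z. g ((V ^^ Suc k) z) - g ((V ^^ k) z))"
      unfolding cob_def using iVk[OF g, of k]
      by (intro exI[of _ "\<lambda>z. - g ((V ^^ k) z)"] conjI) (simp_all add: funpow_swap1)
    from cob_add[OF this Suc] show ?case by simp
  qed
  \<comment> \<open>\<open>W\<close> runs through all powers of \<open>S\<close>, nonnegative ones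
    at even and nonpositive ones at odd indices, with inverse \<open>W'\<close>; any two points of
    one orbit are compared at some index.\<close>
  define W W' where "W n = (if even n then S ^^ (n div 2) else V ^^ (n div 2))"
    and "W' n = (if even n then V ^^ (n div 2) else S ^^ (n div 2))" for n :: nat
  have pw_aux: "(V ^^ Suc k) ((S ^^ Suc k) z) = (V ^^ k) ((S ^^ k) z)" "(S ^^ Suc k) ((V ^^ Suc k) z) = (S ^^ k) ((V ^^ k) z)" for k z
    using VS(1)[of k "(V ^^ k) z"] VS(2)[of k "(S ^^ k) z"] by (simp_all only: funpow.simps(2) o_apply)
  have pw: "(V ^^ k) ((S ^^ k) z) = z" "(S ^^ k) ((V ^^ k) z) = z" for k z
    by (induction k) (simp_all only: pw_aux funpow_0)
  have WW: "W' n (W n z) = z" "W n (W' n z) = z" for n z by (auto simp: W_def W'_def pw)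
  have iW: "integrable N (\<lambda>z. g (W n z))" "integral\<^sup>L N (\<lambda>z. g (W n z)) = integral\<^sup>L N g"
    "integrable N (\<lambda>z. g (W' n z))" "cob (\<lambda>z. g (W n z) - g z)"
    if "integrable N g" for g :: "'b \<Rightarrow> real" and n
    using iSk[OF that] iVk[OF that] cobS[OF that] cobV[OF that] by (auto simp: W_def W'_def)
  \<comment> \<open>\<open>p\<close> and \<open>q\<close> are the remaining positive and negative
    masses. At index \<open>n\<close> the amount \<open>min (p z) (q (W n z))\<close> is cancelled
    in \<open>p\<close> at \<open>z\<close> and in \<open>q\<close> at \<open>W n z\<close>; up to
    sign, \<open>p - q\<close> changes by \<open>g \<circ> W n - g\<close>, a coboundary.\<close>
  define pq where "pq = rec_nat ((\<lambda>z. max (f z) 0), (\<lambda>z. max (- f z) 0))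
     (\<lambda>n (p,q). ((\<lambda>z. p z - min (p z) (q (W n z))), (\<lambda>z. q z - min (p (W' n z)) (q z))))"
  define p q where "p n = fst (pq n)" and "q n = snd (pq n)" for n
  have p0: "p 0 = (\<lambda>z. max (f z) 0)" "q 0 = (\<lambda>z. max (- f z) 0)" by (auto simp: p_def q_def pq_def)
  have pS: "p (Suc n) = (\<lambda>z. p n z - min (p n z) (q n (W n z)))"
    "q (Suc n) = (\<lambda>z. q n z - min (p n (W' n z)) (q n z))" for n
    by (auto simp: p_def q_def pq_def split: prod.split)
  have *: "integrable N (p n) \<and> integrable N (q n) \<and> (\<forall>z. 0 \<le> p n z) \<and> (\<forall>z. 0 \<le> q n z) \<and>
     integral\<^sup>L N (p n) = integral\<^sup>L N (q n) \<and> cob (\<lambda>z. f z - (p n z - q n z))" for n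
  proof (induction n)
    case 0
    have i: "integrable N (p 0)" "integrable N (q 0)" using f by (auto simp: p0)
    have eq: "f z = p 0 z - q 0 z" for z by (simp add: p0)
    have "integral\<^sup>L N f = integral\<^sup>L N (p 0) - integral\<^sup>L N (q 0)"
      unfolding Bochner_Integration.integral_diff[OF i, symmetric] by (simp only: eq[symmetric])
    then have "integral\<^sup>L N (p 0) = integral\<^sup>L N (q 0)" using f by simp
    moreover have "cob (\<lambda>z. f z - (p 0 z - q 0 z))" unfolding eq[symmetric] using cob0 by simp
    moreover have "0 \<le> p 0 z" "0 \<le> q 0 z" for z by (simp_all add: p0)
    ultimately show ?case using i by blast
  next
    case (Suc n)
    define g where "g z = min (p n (W' n z)) (q n z)" for z
    have ip: "integrable N (\<lambda>z. p n (W' n z))" by (rule iW(3)) (use Suc in auto)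
    have ig: "integrable N g" unfolding g_def[abs_def] using ip Suc by (intro integrable_min) auto
    have pS': "p (Suc n) = (\<lambda>z. p n z - g (W n z))" "q (Suc n) = (\<lambda>z. q n z - g z)"
      by (auto simp: pS g_def WW)
    have c: "cob (\<lambda>z. (f z - (p n z - q n z)) + (g (W n z) - g z))"
      using Suc by (intro cob_add iW(4) ig) auto
    show ?case
    proof (intro conjI)
      show "integrable N (p (Suc n))" "integrable N (q (Suc n))" using Suc ig iW(1)[OF ig] by (auto simp: pS')
      show "\<forall>z. 0 \<le> p (Suc n) z" "\<forall>z. 0 \<le> q (Suc n) z" by (auto simp: pS)
      show "integral\<^sup>L N (p (Suc n)) = integral\<^sup>L N (q (Suc n))" using Suc ig iW(1,2)[OF ig] by (simp add: pS')
      show "cob (\<lambda>z. f z - (p (Suc n) z - q (Suc n) z))" using c by (simp add: pS' algebra_simps)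
    qed
  qed
  have [measurable]: "p n \<in> borel_measurable N" "q n \<in> borel_measurable N" for n using * by auto
  have decp: "decseq (\<lambda>n. p n z)" and decq: "decseq (\<lambda>n. q n z)" for z
    using * by (auto intro!: decseq_SucI simp: pS)
  define P Q where "P z = lim (\<lambda>n. p n z)" and "Q z = lim (\<lambda>n. q n z)" for z
  have limP: "(\<lambda>n. p n z) \<longlonglongrightarrow> P z" for z unfolding P_def
    using decseq_convergent[OF decp[of z], of 0] * by (metis limI)
  have limQ: "(\<lambda>n. q n z) \<longlonglongrightarrow> Q z" for z unfolding Q_def
    using decseq_convergent[OF decq[of z], of 0] * by (metis limI)
  have Ple: "P z \<le> p n z" "Q z \<le> q n z" for n z
    using decseq_ge[OF decp limP] decseq_ge[OF decq limQ] by auto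
  have P0: "0 \<le> P z" "0 \<le> Q z" for z
    using LIMSEQ_le_const[OF limP] LIMSEQ_le_const[OF limQ] * by auto
  have [measurable]: "P \<in> borel_measurable N" "Q \<in> borel_measurable N"
    by (rule borel_measurable_LIMSEQ_real[of N p], simp add: limP, simp) (rule borel_measurable_LIMSEQ_real[of N q], simp add: limQ, simp)
  have bd: "\<bar>p n z\<bar> \<le> p 0 z" "\<bar>q n z\<bar> \<le> q 0 z" for n z
    using decseqD[OF decp, of 0 n] decseqD[OF decq, of 0 n] * by auto
  have cP: "(\<lambda>n. integral\<^sup>L N (p n)) \<longlonglongrightarrow> integral\<^sup>L N P"
    by (rule integral_dominated_convergence[where w="p 0"]) (use * limP bd in auto)
  have cQ: "(\<lambda>n. integral\<^sup>L N (q n)) \<longlonglongrightarrow> integral\<^sup>L N Q"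
    by (rule integral_dominated_convergence[where w="q 0"]) (use * limQ bd in auto)
  have PQ: "integral\<^sup>L N P = integral\<^sup>L N Q"
  proof -
    have "(\<lambda>n. integral\<^sup>L N (p n)) = (\<lambda>n. integral\<^sup>L N (q n))" using * by auto
    then show ?thesis using LIMSEQ_unique[OF cP] cQ by simp
  qed
  \<comment> \<open>The saturation of the set where some positive mass is never cancelled.\<close>
  define E where "E = {z. (\<exists>k. 0 < P ((S ^^ k) z)) \<or> (\<exists>k. 0 < P ((V ^^ k) z))}"
  have [measurable]: "(S ^^ k) \<in> measurable N N" "(V ^^ k) \<in> measurable N N" for k
    by (auto intro: measurable_compose_n)
  have Em: "E \<in> sets N"
  proof -
    have "{z \<in> space N. (\<exists>k. 0 < P ((S ^^ k) z)) \<or> (\<exists>k. 0 < P ((V ^^ k) z))} \<in> sets N" by measurable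
    then show ?thesis by (simp add: E_def)
  qed
  \<comment> \<open>If mass survives at \<open>W' n z\<close>, it was not exhausted at index
    \<open>n\<close>, so the minimum was \<open>q n z\<close> and nothing of \<open>q\<close> is
    left at \<open>z\<close>.\<close>
  have Q0: "Q z = 0" if "z \<in> E" for z
  proof -
    obtain n where "0 < P (W' n z)"
    proof -
      from \<open>z \<in> E\<close> consider k where "0 < P ((S ^^ k) z)" | k where "0 < P ((V ^^ k) z)" unfolding E_def by blast
      then show thesis
      proof cases
        case 1 show ?thesis by (rule that[of "Suc (2 * k)"]) (use 1 in \<open>simp add: W'_def\<close>)
      next
        case 2 show ?thesis by (rule that[of "2 * k"]) (use 2 in \<open>simp add: W'_def\<close>)
      qed
    qed
    then have "0 < p (Suc n) (W' n z)" using Ple(1) less_le_trans by blast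
    then have "q n z < p n (W' n z)" by (auto simp: pS WW split: if_splits simp: min_def)
    then have "q (Suc n) z = 0" by (simp add: pS)
    then show "Q z = 0" using Ple(2)[of z "Suc n"] P0(2)[of z] by simp
  qed
  have inE: "S z \<in> E \<longleftrightarrow> z \<in> E" for z
  proof
    assume "S z \<in> E"
    then consider k where "0 < P ((S ^^ k) (S z))" | k where "0 < P ((V ^^ k) (S z))" unfolding E_def by blast
    then show "z \<in> E"
    proof cases
      case 1 then have "0 < P ((S ^^ Suc k) z)" by (simp add: funpow_swap1)
      then show ?thesis unfolding E_def by blast
    next
      case 2 then show ?thesis
      proof (cases k)
        case 0 then have "0 < P ((S ^^ 1) z)" using 2 by simp
        then show ?thesis unfolding E_def by blast
      next
        case (Suc j) then have "0 < P ((V ^^ j) z)" using 2 by (simp only: VS)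
        then show ?thesis unfolding E_def by blast
      qed
    qed
  next
    assume "z \<in> E"
    then consider k where "0 < P ((S ^^ k) z)" | k where "0 < P ((V ^^ k) z)" unfolding E_def by blast
    then show "S z \<in> E"
    proof cases
      case 2 then have "0 < P ((V ^^ Suc k) (S z))" by (simp only: VS)
      then show ?thesis unfolding E_def by blast
    next
      case 1 then show ?thesis
      proof (cases k)
        case 0 then have "0 < P ((V ^^ Suc 0) (S z))" using 1 by (simp only: VS funpow_0)
        then show ?thesis unfolding E_def by blast
      next
        case (Suc j) then have "0 < P ((S ^^ j) (S z))" using 1 by (simp add: funpow_swap1)
        then show ?thesis unfolding E_def by blast
      qed
    qed
  qed
  have "S -` E \<inter> space N = E" using inE by auto
  then have "emeasure N E = 0 \<or> emeasure N (space N - E) = 0"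
    using erg Em unfolding ergodic_def by blast
  \<comment> \<open>A null saturation gives \<open>P = 0\<close> almost everywhere, a conull one
    gives \<open>Q = 0\<close>; the two integrals agree, so both vanish.\<close>
  then have int0: "integral\<^sup>L N P = 0"
  proof
    assume "emeasure N E = 0"
    then have "AE z in N. z \<notin> E" using Em by (intro AE_not_in) auto
    moreover have "0 < P z \<Longrightarrow> z \<in> E" for z unfolding E_def by (auto intro: exI[of _ 0])
    ultimately have "AE z in N. P z = 0" using P0(1) by (auto elim!: eventually_mono simp: order.order_iff_strict)
    then show ?thesis by (rule integral_eq_zero_AE)
  next
    assume "emeasure N (space N - E) = 0"
    then have "AE z in N. z \<notin> space N - E" using sets.compl_sets[OF Em] by (intro AE_not_in) (auto simp: null_sets_def)
    then have "AE z in N. Q z = 0" using Q0 by (auto elim!: eventually_mono)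
    then show ?thesis unfolding PQ by (rule integral_eq_zero_AE)
  qed
  have "(\<lambda>n. integral\<^sup>L N (p n) + integral\<^sup>L N (q n)) \<longlonglongrightarrow> 0"
    using tendsto_add[OF cP cQ] int0 PQ by simp
  from order_tendstoD(2)[OF this e] obtain n where n: "integral\<^sup>L N (p n) + integral\<^sup>L N (q n) < e"
    by (auto simp: eventually_sequentially)
  from *[of n] obtain h where h: "integrable N h" "(\<lambda>z. f z - (p n z - q n z)) = (\<lambda>z. h z - h (V z))"
    unfolding cob_def by blast
  have "(\<integral>\<^sup>+z. ennreal \<bar>f z - h z + h (V z)\<bar> \<partial>N) \<le> (\<integral>\<^sup>+z. ennreal (p n z + q n z) \<partial>N)"
  proof (intro nn_integral_mono ennreal_leI)
    fix z
    have "f z - h z + h (V z) = p n z - q n z" using fun_cong[OF h(2), of z] by simp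
    moreover have "0 \<le> p n z" "0 \<le> q n z" using * by auto
    ultimately show "\<bar>f z - h z + h (V z)\<bar> \<le> p n z + q n z" by simp
  qed
  also have "\<dots> = ennreal (integral\<^sup>L N (p n) + integral\<^sup>L N (q n))"
    using * by (subst nn_integral_eq_integral) auto
  also have "\<dots> < ennreal e" using n e by (rule ennreal_lessI[rotated])
  finally show ?thesis using h(1) by blast
qed

section \<open>The \<open>G\<^sub>\<delta>\<close> property\<close>

context std_space begin

lemma exhaustion:
  obtains X :: "nat \<Rightarrow> 'a set" where "incseq X" "\<And>n. X n \<in> sets borel" "\<And>n. emeasure M (X n) < \<infinity>" "(\<Union>n. X n) = UNIV"
proof -
  obtain X :: "nat \<Rightarrow> 'a set" where X: "range X \<subseteq> sets M" "(\<Union>n. X n) = space M" "\<And>n. emeasure M (X n) \<noteq> \<infinity>" "incseq X"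
    by (rule sigma_finite_incseq) blast
  show thesis by (rule that[of X]) (use X in \<open>auto simp: sets_M less_top\<close>)
qed

lemma emeasure_nu_box: assumes [measurable]: "A \<in> sets borel"
  shows "emeasure nu (A \<times> {..b}) = ennreal (exp b) * emeasure M A"
proof -
  have [measurable]: "A \<times> {..b} \<in> sets borel" unfolding borel_prod[symmetric] by simp
  have "emeasure nu (A \<times> {..b}) = integral\<^sup>N nu (indicator (A \<times> {..b}))" by (simp add: sets_nu)
  also have "\<dots> = (\<integral>\<^sup>+x. \<integral>\<^sup>+y. indicator A x * (ennreal (exp y) * indicator {..b} y) \<partial>lborel \<partial>M)"
    by (subst nn_integral_nu) (auto intro!: nn_integral_cong split: split_indicator)
  also have "\<dots> = (\<integral>\<^sup>+x. indicator A x * ennreal (exp b) \<partial>M)"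
    by (subst nn_integral_cmult) (auto simp: nn_integral_exp_atMost)
  also have "\<dots> = ennreal (exp b) * emeasure M A"
    by (subst nn_integral_multc) (auto simp: mult.commute sets_M)
  finally show ?thesis .
qed

lemma boxes_measurable: "A \<in> sets borel \<Longrightarrow> B \<in> sets borel \<Longrightarrow> A \<times> (B :: real set) \<in> sets (borel :: ('a \<times> real) measure)"
  unfolding borel_prod[symmetric] by simp

section \<open>From boxes to all integrable functions\<close>

lemma L1cont_incseq:
  assumes D: "incseq D" "\<And>n. D n \<in> sets borel" "\<And>n. L1cont (indicator (D n))" "emeasure nu (\<Union>n. D n) < \<infinity>"
  shows "L1cont (indicator (\<Union>n. D n))"
proof (rule L1cont_limit)
  let ?U = "\<Union>n. D n"
  have U[measurable]: "?U \<in> sets borel" and [measurable]: "\<And>n. D n \<in> sets borel" using D(2) by auto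
  show "indicator ?U \<in> borel_measurable borel" by measurable
  fix e :: real assume e: "0 < e"
  have "(\<lambda>n. \<integral>\<^sup>+p. ennreal \<bar>indicator ?U p - indicator (D n) p\<bar> \<partial>nu) \<longlonglongrightarrow> 0"
  proof (rule nn_integral_abs_tendsto_0)
    have "emeasure nu (D n) < \<infinity>" for n
      using D(4) U by (intro le_less_trans[OF emeasure_mono D(4)]) (auto simp: sets_nu)
    then show "integrable nu (indicator (D n) :: _ \<Rightarrow> real)" for n by (auto simp: sets_nu)
    show "integrable nu (indicator ?U :: _ \<Rightarrow> real)" using D(4) by (auto simp: sets_nu)
    show "(\<lambda>i. indicator (D i) x :: real) \<longlonglongrightarrow> indicator ?U x" for x
      by (rule LIMSEQ_indicator_incseq[OF D(1)])
  qed (auto split: split_indicator)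
  from small_ennreal[OF this e]
  show "\<exists>k. L1cont k \<and> (\<integral>\<^sup>+p. ennreal \<bar>indicator ?U p - k p\<bar> \<partial>nu) < ennreal e" using D(3) by blast
qed

lemma L1cont_disjoint_union:
  assumes D: "disjoint_family D" "\<And>n. D n \<in> sets borel" "\<And>n. L1cont (indicator (D n))" "emeasure nu (\<Union>n. D n) < \<infinity>"
  shows "L1cont (indicator (\<Union>n::nat. D n))"
proof -
  have "L1cont (indicator (\<Union>i<n. D i))" for n
  proof (induction n)
    case (Suc n)
    have "indicator (\<Union>i<Suc n. D i) = (\<lambda>p. indicator (\<Union>i<n. D i) p + indicator (D n) p :: real)"
    proof
      fix p
      have "D i \<inter> D n = {}" if "i < n" for i
        using D(1)[unfolded disjoint_family_on_def, rule_format, of i n] that by simp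
      then have "(\<Union>i<n. D i) \<inter> D n = {}" by blast
      then show "indicator (\<Union>i<Suc n. D i) p = (indicator (\<Union>i<n. D i) p + indicator (D n) p :: real)"
        by (auto simp: lessThan_Suc split: split_indicator)
    qed
    then show ?case using L1cont_add[OF Suc D(3)[of n]] by simp
  qed (use L1cont_zero in simp)
  moreover have U: "(\<Union>n. \<Union>i<n. D i) = (\<Union>n. D n)" by auto
  ultimately show ?thesis
    using L1cont_incseq[of "\<lambda>n. \<Union>i<n. D i", unfolded U] D(2,4) by (fastforce simp: incseq_def)
qed

lemma L1cont_subtract:
  assumes "L1cont (indicator A)" "L1cont (indicator B)" "B \<subseteq> A" shows "L1cont (indicator (A - B))"
proof -
  have "indicator (A - B) = (\<lambda>p. indicator A p - indicator B p :: real)" using assms(3) by (auto simp: fun_eq_iff split: split_indicator)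
  then show ?thesis using L1cont_diff[OF assms(1,2)] by simp
qed

text \<open>Dynkin's theorem in the fibre coordinate, starting from half lines. Intersecting with a
  box of finite measure makes complements differences inside that box.\<close>

lemma L1cont_rect:
  assumes A: "A \<in> sets borel" and X: "X \<in> sets borel" "emeasure M X < \<infinity>" and B: "B \<in> sets borel"
  shows "L1cont (indicator ((A \<times> B) \<inter> (X \<times> {..b})))"
proof -
  have fin: "emeasure nu (X \<times> {..b}) < \<infinity>" using X by (simp add: emeasure_nu_box ennreal_mult_less_top)
  have AX: "A \<inter> X \<in> sets borel" "emeasure M (A \<inter> X) < \<infinity>"
    using A X by (auto intro!: le_less_trans[OF emeasure_mono[of "A \<inter> X" X M]] simp: sets_M)
  have sb: "sigma_sets UNIV (range atMost) = sets (borel :: real measure)" by (simp add: borel_eq_atMost)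
  have "Int_stable (range (atMost :: real \<Rightarrow> _))" "range (atMost :: real \<Rightarrow> _) \<subseteq> Pow UNIV" "B \<in> sigma_sets UNIV (range atMost)"
    using B sb by (auto simp: Int_stable_def)
  then show ?thesis
  proof (induction rule: sigma_sets_induct_disjoint)
    case (basic B)
    then obtain a where a: "B = {..a}" by auto
    have "(A \<times> B) \<inter> (X \<times> {..b}) = (A \<inter> X) \<times> {..min a b}" by (auto simp: a)
    then show ?case using L1cont_box[OF AX] by simp
  next
    case empty show ?case using L1cont_zero by simp
  next
    case (compl B)
    have eq: "(A \<times> (UNIV - B)) \<inter> (X \<times> {..b}) = (A \<inter> X) \<times> {..b} - (A \<times> B) \<inter> (X \<times> {..b})" by auto
    show ?case unfolding eq by (rule L1cont_subtract[OF L1cont_box[OF AX] compl(2)]) auto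
  next
    case (union D)
    have eq: "(A \<times> (\<Union>i. D i)) \<inter> (X \<times> {..b}) = (\<Union>i. (A \<times> D i) \<inter> (X \<times> {..b}))" by auto
    show ?case unfolding eq
    proof (rule L1cont_disjoint_union)
      show "disjoint_family (\<lambda>i. (A \<times> D i) \<inter> (X \<times> {..b}))" using union(1) by (auto simp: disjoint_family_on_def)
      show m: "(A \<times> D n) \<inter> (X \<times> {..b}) \<in> sets borel" for n
        using union(2) A X sb by (intro sets.Int boxes_measurable) auto
      show "emeasure nu (\<Union>n. (A \<times> D n) \<inter> (X \<times> {..b})) < \<infinity>"
        by (rule le_less_trans[OF emeasure_mono fin]) (auto simp: sets_nu intro!: boxes_measurable X)
      show "L1cont (indicator ((A \<times> D n) \<inter> (X \<times> {..b})))" for n using union(3) .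
    qed
  qed
qed

text \<open>The same argument over the rectangles, which generate the Borel sets of the
  product.\<close>

lemma L1cont_inter:
  assumes D: "D \<in> sets borel" and X: "X \<in> sets borel" "emeasure M X < \<infinity>"
  shows "L1cont (indicator (D \<inter> (X \<times> {..b})))"
proof -
  have fin: "emeasure nu (X \<times> {..b}) < \<infinity>" using X by (simp add: emeasure_nu_box ennreal_mult_less_top)
  let ?G = "{a \<times> b | a b. a \<in> sets (borel :: 'a measure) \<and> b \<in> sets (borel :: real measure)}"
  have sb: "sigma_sets UNIV ?G = sets borel" 
    unfolding borel_prod[symmetric] using sets_pair_measure[of "borel :: 'a measure" "borel :: real measure"] by simp
  have "Int_stable ?G" "?G \<subseteq> Pow UNIV" "D \<in> sigma_sets UNIV ?G"
    using D sb Int_stable_pair_measure_generator[of "borel :: 'a measure" "borel :: real measure"] by auto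
  then show ?thesis
  proof (induction rule: sigma_sets_induct_disjoint)
    case (basic D)
    then show ?case using L1cont_rect X by auto
  next
    case empty show ?case using L1cont_zero by simp
  next
    case (compl D)
    have eq: "(UNIV - D) \<inter> (X \<times> {..b}) = X \<times> {..b} - D \<inter> (X \<times> {..b})" by auto
    show ?case unfolding eq by (rule L1cont_subtract[OF L1cont_box[OF X] compl(2)]) auto
  next
    case (union D)
    have eq: "(\<Union>i. D i) \<inter> (X \<times> {..b}) = (\<Union>i. D i \<inter> (X \<times> {..b}))" by auto
    show ?case unfolding eq
    proof (rule L1cont_disjoint_union)
      show "disjoint_family (\<lambda>i. D i \<inter> (X \<times> {..b}))" using union(1) by (auto simp: disjoint_family_on_def)
      show m: "D n \<inter> (X \<times> {..b}) \<in> sets borel" for n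
        using union(2) X sb by (intro sets.Int boxes_measurable) auto
      show "emeasure nu (\<Union>n. D n \<inter> (X \<times> {..b})) < \<infinity>"
        by (rule le_less_trans[OF emeasure_mono fin]) (auto simp: sets_nu intro!: boxes_measurable X)
      show "L1cont (indicator (D n \<inter> (X \<times> {..b})))" for n using union(3) .
    qed
  qed
qed

lemma L1cont_indicator:
  assumes D: "D \<in> sets borel" "emeasure nu D < \<infinity>" shows "L1cont (indicator D)"
proof -
  obtain X where X: "incseq X" "\<And>n. X n \<in> sets borel" "\<And>n. emeasure M (X n) < \<infinity>" "(\<Union>n. X n) = (UNIV :: 'a set)"
    by (rule exhaustion) blast
  have U: "(\<Union>n. D \<inter> (X n \<times> {..real n})) = D"
  proof (intro equalityI subsetI)
    fix p assume p: "p \<in> D"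
    obtain x y where xy: "p = (x,y)" by fastforce
    obtain n where "x \<in> X n" using X(4) by blast
    moreover obtain m where "y \<le> real m" using real_arch_simple by blast
    ultimately have "x \<in> X (max n m)" "y \<le> real (max n m)" using X(1) by (auto simp: incseq_def max_def)
    then show "p \<in> (\<Union>n. D \<inter> (X n \<times> {..real n}))" using p xy by blast
  qed auto
  have "L1cont (indicator (\<Union>n. D \<inter> (X n \<times> {..real n})))"
  proof (rule L1cont_incseq)
    show "incseq (\<lambda>n. D \<inter> (X n \<times> {..real n}))" using X(1) by (fastforce simp: incseq_def)
    show "D \<inter> (X n \<times> {..real n}) \<in> sets borel" for n using X D by (intro sets.Int boxes_measurable) auto
    show "L1cont (indicator (D \<inter> (X n \<times> {..real n})))" for n by (rule L1cont_inter) (use D X in auto)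
    show "emeasure nu (\<Union>n. D \<inter> (X n \<times> {..real n})) < \<infinity>" unfolding U by (rule D)
  qed
  then show ?thesis unfolding U .
qed

lemma L1cont_integrable: assumes "integrable nu h" shows "L1cont h"
  using assms
proof (induction rule: integrable_induct)
  case (base A c)
  have "L1cont (\<lambda>p. c * indicator A p)" using base by (intro L1cont_scale L1cont_indicator) (auto simp: sets_nu)
  then show ?case by (simp add: mult.commute)
next
  case (add f g) then show ?case by (intro L1cont_add)
next
  case (lim f s)
  show ?case
  proof (rule L1cont_limit)
    show "f \<in> borel_measurable borel" using borel_measurable_integrable[OF lim(4)] by simp
    fix e :: real assume e: "0 < e"
    from small_ennreal[OF nn_integral_abs_tendsto_0[OF lim(1,4,2,3)] e] lim(5)
    show "\<exists>k. L1cont k \<and> (\<integral>\<^sup>+p. ennreal \<bar>f p - k p\<bar> \<partial>nu) < ennreal e" by blast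
  qed
qed

section \<open>Open conditions: approximability by coboundaries\<close>

definition cob_near :: "('a \<times> real \<Rightarrow> real) \<Rightarrow> real \<Rightarrow> ('a \<Rightarrow> 'a) set" where
  "cob_near f e = {T \<in> Aut2 M. \<exists>h. integrable nu h \<and>
      (\<integral>\<^sup>+p. ennreal \<bar>f p - h p + h (mahinv T p)\<bar> \<partial>nu) < ennreal e}"

text \<open>The \<open>h\<close> that works for \<open>S\<close> works for all nearby
  \<open>T\<close>: only the term \<open>h \<circ> mahinv T\<close> moves, and the slack
  \<open>e - a\<close> absorbs it.\<close>

lemma cob_near_open:
  assumes f: "integrable nu f" shows "d2_open M (cob_near f e)"
  unfolding d2_open_iff
proof (intro conjI ballI)
  show "cob_near f e \<subseteq> Aut2 M" by (auto simp: cob_near_def)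
  fix S assume "S \<in> cob_near f e"
  then obtain h where S: "S \<in> Aut2 M" and h: "integrable nu h"
    and lt: "(\<integral>\<^sup>+p. ennreal \<bar>f p - h p + h (mahinv S p)\<bar> \<partial>nu) < ennreal e" by (auto simp: cob_near_def)
  obtain a where a: "(\<integral>\<^sup>+p. ennreal \<bar>f p - h p + h (mahinv S p)\<bar> \<partial>nu) = ennreal a" "0 \<le> a" "a < e"
    using lt by (cases "\<integral>\<^sup>+p. ennreal \<bar>f p - h p + h (mahinv S p)\<bar> \<partial>nu") (auto simp: ennreal_less_iff)
  have [measurable]: "f \<in> borel_measurable borel" "h \<in> borel_measurable borel"
    using borel_measurable_integrable[OF f] borel_measurable_integrable[OF h] by auto
  have "d2_nhd M S (\<lambda>T. dK h T S < ennreal (e - a))"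
    using L1cont_integrable[OF h] S a(3) unfolding L1cont_def by auto
  then show "d2_nhd M S (\<lambda>T. T \<in> cob_near f e)"
  proof (rule d2_nhd_mono)
    fix T assume T: "T \<in> Aut2 M" and d: "dK h T S < ennreal (e - a)"
    note [measurable] = Aut2_measurable(1)[OF T] Aut2_measurable(1)[OF S]
    have "(\<integral>\<^sup>+p. ennreal \<bar>f p - h p + h (mahinv T p)\<bar> \<partial>nu)
      \<le> (\<integral>\<^sup>+p. ennreal \<bar>f p - h p + h (mahinv S p)\<bar> + ennreal \<bar>h (mahinv T p) - h (mahinv S p)\<bar> \<partial>nu)"
      by (intro nn_integral_mono) (simp add: ennreal_plus[symmetric] del: ennreal_plus)
    also have "\<dots> = ennreal a + dK h T S" unfolding dK_def a(1)[symmetric] by (rule nn_integral_add) auto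
    also have "\<dots> < ennreal a + ennreal (e - a)" using d by (simp add: ennreal_add_left_cancel_less)
    also have "\<dots> = ennreal e" using a by (simp flip: ennreal_plus)
    finally show "T \<in> cob_near f e" using T h by (auto simp: cob_near_def)
  qed
qed

lemma maharam_ergodic_cob:
  assumes T: "T \<in> Aut2 M" "ergodic nu (maharam M T)" and f: "integrable nu f" "integral\<^sup>L nu f = 0" "0 < e"
  shows "T \<in> cob_near f e"
proof -
  have n: "nonsingular M T" using T by (auto simp: Aut2_def)
  have "\<exists>h. integrable nu h \<and> (\<integral>\<^sup>+z. ennreal \<bar>f z - h z + h (mahinv T z)\<bar> \<partial>nu) < ennreal e"
    by (rule ergodic_coboundary_dense[of nu "maharam M T"])
      (use T f maharam_measurable[OF n] maharam_inverse[OF n] distr_maharam[OF n] distr_mahinv[OF n] in auto)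
  then show ?thesis using T by (auto simp: cob_near_def)
qed

text \<open>An invariant set lifts to an invariant cylinder, and a null cylinder has a null
  base.\<close>

lemma maharam_ergodic_imp_ergodic:
  assumes "nonsingular M T" "ergodic nu (maharam M T)" shows "ergodic M T"
  unfolding ergodic_def
proof (intro ballI impI)
  fix A assume A: "A \<in> sets M" "T -` A \<inter> space M = A"
  have z: "emeasure M B = 0" if "B \<in> sets borel" "emeasure nu (B \<times> UNIV) = 0" for B
  proof -
    have "emeasure nu (B \<times> {..0}) \<le> emeasure nu (B \<times> UNIV)"
      by (rule emeasure_mono) (auto simp: sets_nu intro!: boxes_measurable that)
    then show ?thesis using that by (simp add: emeasure_nu_box)
  qed
  have AU: "A \<times> UNIV \<in> sets nu" using A by (auto simp: sets_nu sets_M intro!: boxes_measurable)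
  have "maharam M T -` (A \<times> UNIV) \<inter> space nu = A \<times> UNIV" using A(2) by (auto simp: maharam_eq)
  then have "emeasure nu (A \<times> UNIV) = 0 \<or> emeasure nu (space nu - A \<times> UNIV) = 0"
    using assms(2) AU unfolding ergodic_def by blast
  moreover have "space nu - A \<times> UNIV = (space M - A) \<times> UNIV" by auto
  ultimately show "emeasure M A = 0 \<or> emeasure M (space M - A) = 0"
    using z[of A] z[of "space M - A"] A(1) by (auto simp: sets_M)
qed

text \<open>Pick a box \<open>E k\<close> in which \<open>A\<close> has mass \<open>a > 0\<close>.
  Outer regularity on the Polish space \<open>'a \<times> real\<close> gives an open
  \<open>U\<close> that contains \<open>A\<close> with excess below \<open>a / 8\<close> inside the
  box, and a finite union of base sets inside \<open>U\<close> has mass above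
  \<open>7 * a / 8\<close> there. Its part outside \<open>A\<close> is below \<open>a / 8\<close>,
  less than a quarter.\<close>

lemma countable_density_sets:
  obtains B :: "nat \<Rightarrow> ('a \<times> real) set" where "\<And>n. B n \<in> sets borel" "\<And>n. emeasure nu (B n) < \<infinity>"
    "\<And>A. A \<in> sets borel \<Longrightarrow> emeasure nu A > 0 \<Longrightarrow> \<exists>n. 0 < measure nu (B n) \<and> 4 * measure nu (B n - A) < measure nu (B n)"
proof -
  obtain X where X: "incseq X" "\<And>n. X n \<in> sets borel" "\<And>n. emeasure M (X n) < \<infinity>" "(\<Union>n. X n) = (UNIV :: 'a set)"
    by (rule exhaustion) blast
  define E where "E n = X n \<times> {..real n}" for n
  have Em[measurable]: "E n \<in> sets borel" for n unfolding E_def by (intro boxes_measurable X) auto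
  have Ef: "emeasure nu (E n) < \<infinity>" for n using X by (simp add: E_def emeasure_nu_box ennreal_mult_less_top)
  have EU: "\<exists>n. p \<in> E n" for p
  proof -
    obtain x y where xy: "p = (x,y)" by fastforce
    obtain n where "x \<in> X n" using X(4) by blast
    moreover obtain m where "y \<le> real m" using real_arch_simple by blast
    ultimately have "x \<in> X (max n m)" "y \<le> real (max n m)" using X(1) by (auto simp: incseq_def max_def)
    then show ?thesis using xy unfolding E_def by blast
  qed
  obtain \<B> :: "('a \<times> real) set set" where \<B>: "countable \<B>" "topological_basis \<B>" using ex_countable_basis by blast
  define \<F> where "\<F> = {F. finite F \<and> F \<subseteq> \<B>}"
  have cF: "countable \<F>" unfolding \<F>_def using \<B>(1) by (rule countable_Collect_finite_subset)
  have neF: "\<F> \<noteq> {}" by (auto simp: \<F>_def)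
  \<comment> \<open>Enumerates the intersections of finite unions of base sets with the boxes
    \<open>E k\<close>, by coding the pair in one index.\<close>
  define C where "C n = \<Union> (from_nat_into \<F> (fst (prod_decode n))) \<inter> E (snd (prod_decode n))" for n
  have opF: "open (\<Union>F)" if "F \<in> \<F>" for F using that topological_basis_open[OF \<B>(2)] by (intro open_Union) (auto simp: \<F>_def)
  have Cm: "C n \<in> sets borel" for n
    unfolding C_def using opF[OF from_nat_into[OF neF]] by (intro sets.Int) auto
  have Cf: "emeasure nu (C n) < \<infinity>" for n
    by (rule le_less_trans[OF emeasure_mono Ef[of "snd (prod_decode n)"]]) (auto simp: C_def sets_nu)
  have CE: "\<exists>n. C n = \<Union>F \<inter> E k" if "F \<in> \<F>" for F k
    by (rule exI[of _ "prod_encode (to_nat_on \<F> F, k)"]) (simp add: C_def from_nat_into_to_nat_on[OF cF that])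
  have "\<exists>n. 0 < measure nu (C n) \<and> 4 * measure nu (C n - A) < measure nu (C n)"
    if A[measurable]: "A \<in> sets borel" and pos: "emeasure nu A > 0" for A
  proof -
    obtain k where k: "emeasure nu (A \<inter> E k) > 0"
    proof (rule ccontr)
      assume "\<not> thesis"
      then have "emeasure nu (A \<inter> E k) = 0" for k using that by (auto simp: zero_less_iff_neq_zero)
      then have "emeasure nu (\<Union>k. A \<inter> E k) = 0" by (intro emeasure_UN_eq_0) (auto simp: sets_nu)
      moreover have "(\<Union>k. A \<inter> E k) = A" using EU by auto
      ultimately show False using pos by simp
    qed
    define \<kappa> where "\<kappa> = density nu (indicator (E k))"
    have s\<kappa>: "sets \<kappa> = sets borel" by (simp add: \<kappa>_def sets_nu)
    have e\<kappa>: "emeasure \<kappa> D = emeasure nu (D \<inter> E k)" if "D \<in> sets borel" for D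
    proof -
      have "emeasure \<kappa> D = (\<integral>\<^sup>+p. indicator (E k) p * indicator D p \<partial>nu)"
        unfolding \<kappa>_def using that by (intro emeasure_density) (auto simp: sets_nu)
      also have "\<dots> = (\<integral>\<^sup>+p. indicator (D \<inter> E k) p \<partial>nu)" by (intro nn_integral_cong) (auto split: split_indicator)
      finally show ?thesis using that by (simp add: sets_nu)
    qed
    have sp: "space \<kappa> = UNIV" using sets_eq_imp_space_eq[OF s\<kappa>] by simp
    interpret K: finite_measure \<kappa> by standard (use Ef[of k] in \<open>auto simp: sp e\<kappa>\<close>)
    have m\<kappa>: "measure \<kappa> D = measure nu (D \<inter> E k)" if "D \<in> sets borel" for D
      using e\<kappa>[OF that] by (simp add: measure_def)
    define a where "a = measure \<kappa> A"
    have a: "emeasure \<kappa> A = ennreal a" "0 < a"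
      using k unfolding e\<kappa>[OF A, symmetric] by (auto simp: a_def K.emeasure_eq_measure)
    have "emeasure \<kappa> A = (INF U \<in> {U. A \<subseteq> U \<and> open U}. emeasure \<kappa> U)"
      by (rule outer_regular[OF s\<kappa>]) auto
    moreover have "emeasure \<kappa> A < ennreal (a * 9 / 8)" using a by (simp add: ennreal_less_iff)
    ultimately obtain U where U: "A \<subseteq> U" "open U" "emeasure \<kappa> U < ennreal (a * 9 / 8)"
      by (auto simp: INF_less_iff)
    obtain \<B>' where \<B>': "\<B>' \<subseteq> \<B>" "\<Union>\<B>' = U" using \<B>(2) U(2) by (auto simp: topological_basis_def)
    have ne: "\<B>' \<noteq> {}"
    proof
      assume "\<B>' = {}" then have "A = {}" using \<B>' U by auto
      then show False using a by simp
    qed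
    have c': "countable \<B>'" using \<B>' \<B>(1) countable_subset by blast
    define D where "D n = (\<Union>i\<le>n. from_nat_into \<B>' i)" for n
    have op: "open (from_nat_into \<B>' i)" for i
      using from_nat_into[OF ne, of i] \<B>' \<B>(2) by (auto simp: topological_basis_open)
    have Dm: "D n \<in> sets borel" for n unfolding D_def using op by auto
    have DU: "(\<Union>n. D n) = U"
    proof -
      have "(\<Union>n. D n) = \<Union> (range (from_nat_into \<B>'))" by (auto simp: D_def)
      then show ?thesis using range_from_nat_into[OF ne c'] \<B>' by simp
    qed
    have "(\<lambda>n. measure \<kappa> (D n)) \<longlonglongrightarrow> measure \<kappa> (\<Union>n. D n)"
    proof (rule K.finite_Lim_measure_incseq)
      show "range D \<subseteq> sets \<kappa>" using Dm by (auto simp: s\<kappa>)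
      show "incseq D" unfolding incseq_def D_def by (auto intro: order_trans)
    qed
    moreover have "measure \<kappa> A \<le> measure \<kappa> U" using U by (intro K.finite_measure_mono) (auto simp: s\<kappa>)
    ultimately have "\<forall>\<^sub>F n in sequentially. measure \<kappa> (D n) > a * 7 / 8"
      using a by (intro order_tendstoD(1)) (auto simp: DU a_def)
    then obtain n where n: "measure \<kappa> (D n) > a * 7 / 8" by (auto simp: eventually_sequentially)
    define V where "V = D n"
    have Vm[measurable]: "V \<in> sets borel" and VU: "V \<subseteq> U" and V7: "measure \<kappa> V > a * 7/8" using Dm DU n by (auto simp: V_def)
    have "from_nat_into \<B>' ` {..n} \<in> \<F>" using from_nat_into[OF ne] \<B>'(1) by (auto simp: \<F>_def)
    from CE[OF this, of k] obtain j where j: "C j = V \<inter> E k" by (auto simp: V_def D_def)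
    have Um: "U \<in> sets borel" using U(2) by auto
    have "measure \<kappa> (V - A) \<le> measure \<kappa> (U - A)" using VU Um by (intro K.finite_measure_mono) (auto simp: s\<kappa>)
    also have "\<dots> = measure \<kappa> U - a" unfolding a_def using U Um by (intro K.finite_measure_Diff) (auto simp: s\<kappa>)
    also have "\<dots> < a / 8" using U(3) a(2) by (simp add: K.emeasure_eq_measure ennreal_less_iff)
    finally have "4 * measure \<kappa> (V - A) < measure \<kappa> V" using V7 a by simp
    moreover have "(V - A) \<inter> E k = C j - A" "V \<inter> E k = C j" by (auto simp: j)
    ultimately have "4 * measure nu (C j - A) < measure nu (C j)" using m\<kappa>[of "V - A"] m\<kappa>[of V] by simp
    moreover have "0 < measure nu (C j)" using V7 a m\<kappa>[of V] by (simp add: j)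
    ultimately show ?thesis by blast
  qed
  then show thesis using that Cm Cf by blast
qed

text \<open>If both \<open>A\<close> and its complement had positive mass, some \<open>B i\<close>
  would lie mostly in \<open>A\<close> and some \<open>B j\<close> mostly outside. Integration over
  the invariant \<open>A\<close> annihilates coboundaries, but the integral of the test function
  over \<open>A\<close> exceeds \<open>3/4 - 1/4\<close> of \<open>b * c\<close>, which is the
  tolerance.\<close>

lemma cob_near_imp_ergodic:
  assumes B: "\<And>n. B n \<in> sets borel" "\<And>n. emeasure nu (B n) < \<infinity>"
    "\<And>A. A \<in> sets borel \<Longrightarrow> emeasure nu A > 0 \<Longrightarrow> \<exists>n. 0 < measure nu (B n) \<and> 4 * measure nu (B n - A) < measure nu (B n)"
    and c: "\<And>i j. T \<in> cob_near (\<lambda>p. measure nu (B j) * indicator (B i) p - measure nu (B i) * indicator (B j) p)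
        (measure nu (B i) * measure nu (B j) / 2) \<or> measure nu (B i) = 0 \<or> measure nu (B j) = 0"
    and n: "nonsingular M T"
  shows "ergodic nu (maharam M T)"
  unfolding ergodic_def
proof (intro ballI impI)
  fix A assume "A \<in> sets nu" and inv: "maharam M T -` A \<inter> space nu = A"
  then have A[measurable]: "A \<in> sets borel" by (simp add: sets_nu)
  show "emeasure nu A = 0 \<or> emeasure nu (space nu - A) = 0"
  proof (rule ccontr)
    assume "\<not> ?thesis"
    then have "emeasure nu A > 0" "emeasure nu (- A) > 0" by (auto simp: zero_less_iff_neq_zero Compl_eq_Diff_UNIV)
    then obtain i j where i: "0 < measure nu (B i)" "4 * measure nu (B i - A) < measure nu (B i)"
      and j: "0 < measure nu (B j)" "4 * measure nu (B j - (- A)) < measure nu (B j)"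
      using B(3)[of A] B(3)[of "- A"] by auto
    define b c where "b = measure nu (B i)" and "c = measure nu (B j)"
    define f where "f p = c * indicator (B i) p - b * indicator (B j) p" for p
    obtain h where h: "integrable nu h" and lt: "(\<integral>\<^sup>+p. ennreal \<bar>f p - h p + h (mahinv T p)\<bar> \<partial>nu) < ennreal (b * c / 2)"
      using c[where i=i and j=j] i j by (auto simp: cob_near_def f_def b_def c_def)
    note [measurable] = B(1) maharam_measurable[OF n]
    have hm[measurable]: "h \<in> borel_measurable borel" using borel_measurable_integrable[OF h] by auto
    have AT: "maharam M T p \<in> A \<longleftrightarrow> p \<in> A" for p using inv by auto
    have AV: "mahinv T p \<in> A \<longleftrightarrow> p \<in> A" for p using AT[of "mahinv T p"] maharam_inverse[OF n] by simp
    have iB: "integrable nu (indicator (B k) :: _ \<Rightarrow> real)" for k using B by (auto simp: sets_nu)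
    have mi: "integrable nu (\<lambda>p. indicator A p * g p)" if "integrable nu g" for g :: "_ \<Rightarrow> real"
      using integrable_mult_indicator[OF _ that, of A] by (simp add: sets_nu)
    have hA: "integrable nu (\<lambda>p. indicator A p * h p)" by (rule mi[OF h])
    have hV: "integrable nu (\<lambda>p. h (mahinv T p))" and hAV: "integrable nu (\<lambda>p. indicator A p * h (mahinv T p))"
      and eq: "(\<integral>p. indicator A p * h (mahinv T p) \<partial>nu) = (\<integral>p. indicator A p * h p \<partial>nu)"
    proof -
      show "integrable nu (\<lambda>p. h (mahinv T p))"
        using h integrable_distr_eq[of "mahinv T" nu nu h] distr_mahinv[OF n] by simp
      then show "integrable nu (\<lambda>p. indicator A p * h (mahinv T p))" by (rule mi)
      have "(\<integral>p. indicator A p * h p \<partial>nu) = (\<integral>p. (\<lambda>q. indicator A q * h q) (mahinv T p) \<partial>nu)"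
        using integral_distr[of "mahinv T" nu nu "\<lambda>q. indicator A q * h q"] distr_mahinv[OF n] by simp
      then show "(\<integral>p. indicator A p * h (mahinv T p) \<partial>nu) = (\<integral>p. indicator A p * h p \<partial>nu)"
        by (simp add: AV indicator_def)
    qed
    have fi: "integrable nu f" unfolding f_def using iB by auto
    have fA: "integrable nu (\<lambda>p. indicator A p * f p)" by (rule mi[OF fi])
    have gi: "integrable nu (\<lambda>p. f p - h p + h (mahinv T p))" using fi h hV by auto
    have Bd: "measure nu (B k) = measure nu (B k \<inter> A) + measure nu (B k - A)" for k
    proof -
      have "emeasure nu (B k \<inter> A) \<noteq> \<infinity>" "emeasure nu (B k - A) \<noteq> \<infinity>"
        using B(2)[of k] emeasure_mono[of "B k \<inter> A" "B k" nu] emeasure_mono[of "B k - A" "B k" nu] B(1)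
        by (auto simp: sets_nu less_top[symmetric] top_unique)
      from measure_Union[OF this] show ?thesis by (simp add: sets_nu Int_Diff_Un) (metis Diff_disjoint Int_Diff Int_Diff_Un inf_bot_right inf_commute)
    qed
    have "(\<integral>p. indicator A p * f p \<partial>nu) = (\<integral>p. c * indicator (B i \<inter> A) p - b * indicator (B j \<inter> A) p \<partial>nu)"
      by (intro Bochner_Integration.integral_cong) (auto simp: f_def split: split_indicator)
    also have "\<dots> = c * measure nu (B i \<inter> A) - b * measure nu (B j \<inter> A)"
    proof -
      have "emeasure nu (B k \<inter> A) < \<infinity>" for k
        by (rule le_less_trans[OF emeasure_mono B(2)[of k]]) (auto simp: sets_nu)
      then have "integrable nu (indicator (B k \<inter> A) :: _ \<Rightarrow> real)" for k by (auto simp: sets_nu)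
      then show ?thesis by (simp add: sets_nu)
    qed
    finally have 1: "(\<integral>p. indicator A p * f p \<partial>nu) = c * measure nu (B i \<inter> A) - b * measure nu (B j \<inter> A)" .
    have "c * (3/4 * b) < c * measure nu (B i \<inter> A)" using i j Bd[of i] by (intro mult_strict_left_mono) (auto simp: b_def c_def)
    moreover have "b * measure nu (B j \<inter> A) < b * (1/4 * c)"
      using i j by (intro mult_strict_left_mono) (auto simp: b_def c_def Diff_eq)
    ultimately have "b * c / 2 < (\<integral>p. indicator A p * f p \<partial>nu)" unfolding 1 by (simp add: algebra_simps)
    also have "\<dots> = (\<integral>p. indicator A p * f p - indicator A p * h p + indicator A p * h (mahinv T p) \<partial>nu)"
      using fA hA hAV eq by simp
    also have "\<dots> \<le> (\<integral>p. \<bar>f p - h p + h (mahinv T p)\<bar> \<partial>nu)"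
      using fA hA hAV gi by (intro integral_mono) (auto split: split_indicator)
    finally have "b * c / 2 < (\<integral>p. \<bar>f p - h p + h (mahinv T p)\<bar> \<partial>nu)" .
    moreover have "(\<integral>\<^sup>+p. ennreal \<bar>f p - h p + h (mahinv T p)\<bar> \<partial>nu) = ennreal (\<integral>p. \<bar>f p - h p + h (mahinv T p)\<bar> \<partial>nu)"
      using gi by (intro nn_integral_eq_integral) auto
    ultimately show False using lt i j by (auto simp: ennreal_less_iff b_def c_def)
  qed
qed

theorem gdelta_Erg: "gdelta_in (d2_topology M) (Erg_III1_2 M)"
proof -
  obtain B :: "nat \<Rightarrow> ('a \<times> real) set" where B: "\<And>n. B n \<in> sets borel" "\<And>n. emeasure nu (B n) < \<infinity>"
    "\<And>A. A \<in> sets borel \<Longrightarrow> emeasure nu A > 0 \<Longrightarrow> \<exists>n. 0 < measure nu (B n) \<and> 4 * measure nu (B n - A) < measure nu (B n)"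
    using countable_density_sets by blast
  \<comment> \<open>If one of the sets is null the tolerance is 0 and the strict inequality is
    impossible, so the condition is replaced by the trivial one.\<close>
  define O' where "O' i j = (if measure nu (B i) = 0 \<or> measure nu (B j) = 0 then Aut2 M else
    cob_near (\<lambda>p. measure nu (B j) * indicator (B i) p - measure nu (B i) * indicator (B j) p)
        (measure nu (B i) * measure nu (B j) / 2))" for i j
  have iB: "integrable nu (indicator (B k) :: _ \<Rightarrow> real)" for k using B by (auto simp: sets_nu)
  have op: "openin (d2_topology M) (O' i j)" for i j
    using iB cob_near_open openin_topspace[of "d2_topology M"] by (auto simp: O'_def)
  have eq: "Erg_III1_2 M = topspace (d2_topology M) \<inter> \<Inter> (range (\<lambda>(i,j). O' i j))"
  proof (intro equalityI subsetI)
    fix T assume T: "T \<in> Erg_III1_2 M"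
    then have "T \<in> Aut2 M" "ergodic nu (maharam M T)" by (auto simp: Erg_III1_2_def ergodic_III1_def)
    then have "T \<in> O' i j" for i j
      using iB B unfolding O'_def by (auto intro!: maharam_ergodic_cob simp: sets_nu zero_less_mult_iff less_le)
    then show "T \<in> topspace (d2_topology M) \<inter> \<Inter> (range (\<lambda>(i,j). O' i j))" using \<open>T \<in> Aut2 M\<close> by auto
  next
    fix T assume "T \<in> topspace (d2_topology M) \<inter> \<Inter> (range (\<lambda>(i,j). O' i j))"
    then have T: "T \<in> Aut2 M" "T \<in> O' i j" for i j by auto
    then have n: "nonsingular M T" by (auto simp: Aut2_def)
    have "T \<in> cob_near (\<lambda>p. measure nu (B j) * indicator (B i) p - measure nu (B i) * indicator (B j) p)
        (measure nu (B i) * measure nu (B j) / 2) \<or> measure nu (B i) = 0 \<or> measure nu (B j) = 0" for i j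
      using T(2)[of i j] by (auto simp: O'_def split: if_splits)
    from cob_near_imp_ergodic[OF B this n] have "ergodic nu (maharam M T)" .
    then show "T \<in> Erg_III1_2 M" using T maharam_ergodic_imp_ergodic[OF n] by (auto simp: Erg_III1_2_def ergodic_III1_def)
  qed
  have "(countable intersection_of openin (d2_topology M)) (\<Inter> (range (\<lambda>(i,j). O' i j)))"
    unfolding intersection_of_def using op by (intro exI[of _ "range (\<lambda>(i,j). O' i j)"]) auto
  then show ?thesis unfolding gdelta_in_def relative_to_def eq by blast
qed

end

section \<open>Isomorphism with the half line\<close>

text \<open>A countable separating family of Borel sets is read off from the base 3 digits of one real function.\<close>

lemma real_code:
  fixes B :: "nat \<Rightarrow> 'b set"
  assumes B: "\<And>i. B i \<in> sets N" "space N = UNIV"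
  obtains \<theta> :: "'b \<Rightarrow> real" and C :: "nat \<Rightarrow> real set"
  where "\<theta> \<in> borel_measurable N" "\<And>x. 0 \<le> \<theta> x" "\<And>x. \<theta> x \<le> 1/2" "\<And>i. C i \<in> sets borel" "\<And>i. B i = \<theta> -` C i"
proof -
  define t where "t i x = (1/3::real) ^ Suc i * indicator (B i) x" for i x
  have g: "(\<lambda>i. (1/3::real) ^ Suc i) sums (1/2)"
    using geometric_sums[of "1/3::real"] sums_mult[of "\<lambda>n. (1/3::real)^n" _ "1/3"] by fastforce
  have gt: "(\<lambda>j. (1/3::real) ^ Suc (j + k)) sums ((1/3)^k * (1/2))" for k
    using sums_mult[OF g, of "(1/3)^k"] by (simp add: power_add mult.commute)
  have t0: "0 \<le> t i x" "t i x \<le> (1/3) ^ Suc i" for i x by (auto simp: t_def split: split_indicator)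
  have st: "summable (\<lambda>i. t i x)" for x
    by (rule summable_comparison_test'[OF sums_summable[OF g], of 0]) (use t0 in auto)
  define \<theta> where "\<theta> x = (\<Sum>i. t i x)" for x
  have \<theta>m: "\<theta> \<in> borel_measurable N" unfolding \<theta>_def[abs_def] t_def using B by measurable
  have \<theta>0: "0 \<le> \<theta> x" for x unfolding \<theta>_def by (rule suminf_nonneg[OF st]) (use t0 in auto)
  have \<theta>1: "\<theta> x \<le> 1/2" for x
    unfolding \<theta>_def sums_unique[OF g] by (rule suminf_le[OF t0(2) st sums_summable[OF g]])
  \<comment> \<open>Once the earlier digits are subtracted, the terms after digit \<open>i\<close>
    add up to at most half of \<open>(1/3) ^ Suc i\<close>; comparison with this number decides the
    digit.\<close>
  have key: "x \<in> B i \<longleftrightarrow> (1/3)^Suc i \<le> \<theta> x - (\<Sum>j<i. t j x)" for x i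
  proof -
    have "\<theta> x - (\<Sum>j<i. t j x) = (\<Sum>j. t (j + i) x)"
      unfolding \<theta>_def by (subst suminf_split_initial_segment[OF st, of _ i]) simp
    also have "\<dots> = t i x + (\<Sum>j. t (j + Suc i) x)"
      using suminf_split_initial_segment[of "\<lambda>j. t (j + i) x" 1] summable_ignore_initial_segment[OF st[of x], of i] by simp
    finally have e: "\<theta> x - (\<Sum>j<i. t j x) = t i x + (\<Sum>j. t (j + Suc i) x)" .
    have s2: "summable (\<lambda>j. t (j + Suc i) x)" by (rule summable_ignore_initial_segment[OF st])
    have r0: "0 \<le> (\<Sum>j. t (j + Suc i) x)" by (rule suminf_nonneg[OF s2]) (use t0 in auto)
    have "(\<Sum>j. t (j + Suc i) x) \<le> (\<Sum>j. (1/3::real) ^ Suc (j + Suc i))"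
      by (rule suminf_le[OF t0(2) s2 sums_summable[OF gt]])
    also have "\<dots> = (1/3)^Suc i * (1/2)" by (rule sums_unique[OF gt, symmetric])
    also have "\<dots> < (1/3)^Suc i" by simp
    finally have r1: "(\<Sum>j. t (j + Suc i) x) < (1/3)^Suc i" .
    show ?thesis unfolding e using r0 r1 by (simp add: t_def split: split_indicator)
  qed
  \<comment> \<open>By induction the earlier digits are Borel functions of
    \<open>\<theta> x\<close>, hence the threshold test is a Borel condition on
    \<open>\<theta> x\<close>.\<close>
  have ex: "\<exists>C. C \<in> sets borel \<and> B i = \<theta> -` C" for i
  proof (induction i rule: less_induct)
    case (less i)
    then obtain C where C: "\<And>j. j < i \<Longrightarrow> C j \<in> sets borel \<and> B j = \<theta> -` C j" by metis
    define D where "D = {s. (1/3)^Suc i \<le> s - (\<Sum>j<i. (1/3::real) ^ Suc j * indicator (C j) s)}"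
    have "D \<in> sets borel"
    proof -
      have "(\<lambda>s. \<Sum>j<i. (1/3::real) ^ Suc j * indicator (C j) s) \<in> borel_measurable borel"
        using C by (intro borel_measurable_sum borel_measurable_times borel_measurable_indicator) auto
      then show ?thesis unfolding D_def by measurable
    qed
    moreover have "B i = \<theta> -` D"
    proof (rule set_eqI)
      fix x
      have "(\<Sum>j<i. t j x) = (\<Sum>j<i. (1/3::real) ^ Suc j * indicator (C j) (\<theta> x))"
        using C by (intro sum.cong) (auto simp: t_def split: split_indicator)
      then show "x \<in> B i \<longleftrightarrow> x \<in> \<theta> -` D" unfolding key by (simp add: D_def)
    qed
    ultimately show ?case by blast
  qed
  then obtain C where "\<And>i. C i \<in> sets borel \<and> B i = \<theta> -` C i" by metis
  then show thesis using that \<theta>m \<theta>0 \<theta>1 by blast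
qed

context std_space begin

text \<open>The integer part of \<open>\<psi>\<close> lists the classes below \<open>n\<close> in
  order and then the shells of an exhaustion of class \<open>n\<close>; the fractional part codes
  the point. Sublevel sets therefore have finite measure, and the classes below \<open>k\<close> are
  cut off by \<open>\<psi> x < real k\<close>.\<close>

lemma separating_function:
  fixes \<kappa> :: "'a \<Rightarrow> nat"
  assumes \<kappa>: "\<And>i. {x. \<kappa> x = i} \<in> sets borel" "\<And>k. k < n \<Longrightarrow> emeasure M {x. \<kappa> x = k} < \<infinity>" "\<And>x. \<kappa> x \<le> n"
  obtains \<psi> :: "'a \<Rightarrow> real" and \<B> :: "nat \<Rightarrow> 'a set" and C where "\<psi> \<in> borel_measurable borel" "\<And>x. 0 \<le> \<psi> x"
    "\<And>t. emeasure M {x. \<psi> x \<le> t} < \<infinity>"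
    "\<And>k x. k \<le> n \<Longrightarrow> \<kappa> x < k \<longleftrightarrow> \<psi> x < real k"
    "topological_basis (range \<B>)" "\<And>i. C i \<in> sets borel" "\<And>i. \<B> i = \<psi> -` C i"
proof -
  obtain X where X: "incseq X" "\<And>n. X n \<in> sets borel" "\<And>n. emeasure M (X n) < \<infinity>" "(\<Union>n. X n) = (UNIV :: 'a set)"
    by (rule exhaustion) blast
  define \<iota> where "\<iota> x = (if \<kappa> x < n then \<kappa> x else n + (LEAST i. x \<in> X i))" for x
  have \<iota>le: "{x. \<iota> x \<le> k} = {x. \<kappa> x \<le> k \<and> \<kappa> x < n} \<union> (if n \<le> k then {x. \<kappa> x = n} \<inter> X (k - n) else {})" for k
  proof (rule set_eqI)
    fix x
    have ex: "\<exists>i. x \<in> X i" using X(4) by auto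
    have 1: "(LEAST i. x \<in> X i) \<le> j \<longleftrightarrow> x \<in> X j" for j
      using LeastI_ex[OF ex] X(1) Least_le[of "\<lambda>i. x \<in> X i" j] by (auto simp: incseq_def)
    show "x \<in> {x. \<iota> x \<le> k} \<longleftrightarrow> x \<in> {x. \<kappa> x \<le> k \<and> \<kappa> x < n} \<union> (if n \<le> k then {x. \<kappa> x = n} \<inter> X (k - n) else {})"
      using \<kappa>(3)[of x] 1[of "k - n"] by (auto simp: \<iota>_def)
  qed
  have eqU: "{x. \<kappa> x \<le> k \<and> \<kappa> x < n} = (\<Union>i\<in>{i. i \<le> k \<and> i < n}. {x. \<kappa> x = i})" for k by auto
  have \<iota>m: "{x. \<iota> x \<le> k} \<in> sets borel" for k unfolding \<iota>le eqU using \<kappa>(1) X(2) by auto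
  have \<iota>f: "emeasure M {x. \<iota> x \<le> k} < \<infinity>" for k
  proof -
    have "emeasure M {x. \<kappa> x \<le> k \<and> \<kappa> x < n} < \<infinity>" unfolding eqU
      using \<kappa>(1,2) by (intro le_less_trans[OF emeasure_subadditive_finite]) (auto simp: sets_M)
    moreover have "emeasure M (if n \<le> k then {x. \<kappa> x = n} \<inter> X (k - n) else {}) < \<infinity>"
    proof (cases "n \<le> k")
      case True
      have "emeasure M ({x. \<kappa> x = n} \<inter> X (k - n)) \<le> emeasure M (X (k - n))" using X(2) by (intro emeasure_mono) (auto simp: sets_M)
      then show ?thesis using True X(3)[of "k - n"] by (simp add: le_less_trans)
    qed simp
    moreover have "{x. \<kappa> x \<le> k \<and> \<kappa> x < n} \<in> sets M" "(if n \<le> k then {x. \<kappa> x = n} \<inter> X (k - n) else {}) \<in> sets M"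
      unfolding eqU using \<kappa>(1) X(2) by (auto simp: sets_M)
    ultimately show ?thesis unfolding \<iota>le
      by (intro le_less_trans[OF emeasure_subadditive]) (auto simp: ennreal_add_less_top)
  qed
  obtain \<B>' :: "'a set set" where \<B>': "countable \<B>'" "topological_basis \<B>'" using ex_countable_basis by blast
  have ne: "\<B>' \<noteq> {}"
  proof
    assume "\<B>' = {}"
    moreover obtain F where "F \<subseteq> \<B>'" "\<Union>F = (UNIV :: 'a set)" using \<B>'(2) open_UNIV unfolding topological_basis_def by blast
    ultimately show False by auto
  qed
  define \<B> where "\<B> = from_nat_into \<B>'"
  have r: "range \<B> = \<B>'" unfolding \<B>_def by (rule range_from_nat_into[OF ne \<B>'(1)])
  have b: "topological_basis (range \<B>)" using \<B>'(2) r by simp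
  have Bm: "\<B> i \<in> sets borel" for i using topological_basis_open[OF b] by auto
  obtain \<theta> :: "'a \<Rightarrow> real" and C :: "nat \<Rightarrow> real set" where \<theta>: "\<theta> \<in> borel_measurable borel" "\<And>x. 0 \<le> \<theta> x" "\<And>x. \<theta> x \<le> 1/2"
    and C: "\<And>i. C i \<in> sets borel" "\<And>i. \<B> i = \<theta> -` C i"
    using real_code[of \<B> borel] Bm by auto
  define \<psi> where "\<psi> x = real (\<iota> x) + \<theta> x" for x
  \<comment> \<open>The code stays in \<open>[0, 1/2]\<close>, so floor and fractional part separate
    the two ingredients.\<close>
  have fl: "\<lfloor>\<psi> x\<rfloor> = int (\<iota> x)" for x using \<theta>(2,3)[of x] by (auto simp: \<psi>_def floor_eq_iff)
  have fr: "frac (\<psi> x) = \<theta> x" for x unfolding frac_def fl by (simp add: \<psi>_def)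
  have \<iota>m': "(\<lambda>x. real (\<iota> x)) \<in> borel_measurable borel"
  proof (rule borel_measurableI_le)
    fix y :: real
    have "{x \<in> space borel. real (\<iota> x) \<le> y} = (if y < 0 then {} else {x. \<iota> x \<le> nat \<lfloor>y\<rfloor>})" by (auto simp: le_nat_floor) linarith+
    then show "{x \<in> space borel. real (\<iota> x) \<le> y} \<in> sets borel" using \<iota>m by simp
  qed
  show thesis
  proof (rule that[of \<psi> \<B> "\<lambda>i. frac -` C i"])
    show "\<psi> \<in> borel_measurable borel" unfolding \<psi>_def[abs_def] using \<iota>m' \<theta>(1) by measurable
    then have [measurable]: "\<psi> \<in> borel_measurable borel" .
    show "0 \<le> \<psi> x" for x using \<theta>(2) by (simp add: \<psi>_def)
    show "emeasure M {x. \<psi> x \<le> t} < \<infinity>" for t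
    proof -
      have "emeasure M {x. \<psi> x \<le> t} \<le> emeasure M {x. \<iota> x \<le> nat \<lfloor>t\<rfloor>}"
      proof (rule emeasure_mono)
        show "{x. \<psi> x \<le> t} \<subseteq> {x. \<iota> x \<le> nat \<lfloor>t\<rfloor>}"
        proof
          fix x assume "x \<in> {x. \<psi> x \<le> t}"
          then have "real (\<iota> x) \<le> t" using \<theta>(2)[of x] by (auto simp: \<psi>_def)
          then show "x \<in> {x. \<iota> x \<le> nat \<lfloor>t\<rfloor>}" by (simp add: le_nat_floor)
        qed
      qed (use \<iota>m in \<open>simp add: sets_M\<close>)
      then show ?thesis using \<iota>f le_less_trans by blast
    qed
    show "\<kappa> x < k \<longleftrightarrow> \<psi> x < real k" if "k \<le> n" for k x
      using \<kappa>(3)[of x] that \<theta>(2,3)[of x] unfolding \<psi>_def \<iota>_def by (auto, linarith?)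
    show "topological_basis (range \<B>)" by (rule b)
    have "(frac :: real \<Rightarrow> real) \<in> borel_measurable borel" unfolding frac_def[abs_def] by measurable
    then show "frac -` C i \<in> sets borel" for i by (rule measurable_sets_borel) (rule C)
    show "\<B> i = \<psi> -` (frac -` C i)" for i unfolding C(2) by (auto simp: fr)
  qed
qed

text \<open>\<open>G = m \<circ> \<psi>\<close> with \<open>m\<close> the distribution function of
  \<open>\<psi>\<close>; without atoms its distribution is Lebesgue measure. The inverse is rebuilt
  from a dense sequence, because open sets are, up to null sets, preimages under \<open>G\<close>.
  Monotonicity of \<open>m\<close> turns the classes into consecutive intervals.\<close>

lemma iso_exists:
  fixes \<kappa> :: "'a \<Rightarrow> nat"
  assumes na: "non_atomic M" and inf: "emeasure M UNIV = \<infinity>"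
    and \<kappa>: "\<And>i. {x. \<kappa> x = i} \<in> sets borel" "\<And>k. k < n \<Longrightarrow> emeasure M {x. \<kappa> x = k} < \<infinity>" "\<And>x. \<kappa> x \<le> n"
  obtains G :: "'a \<Rightarrow> real" and \<Gamma> :: "real \<Rightarrow> 'a" where
    "G \<in> borel_measurable borel" "\<Gamma> \<in> borel_measurable borel"
    "distr M borel G = density lborel (indicator {0..})"
    "AE x in M. \<Gamma> (G x) = x"
    "\<And>k. k \<le> n \<Longrightarrow> AE x in M. \<kappa> x < k \<longleftrightarrow> G x < (\<Sum>j<k. measure M {x. \<kappa> x = j})"
proof -
  obtain \<psi> :: "'a \<Rightarrow> real" and \<B> :: "nat \<Rightarrow> 'a set" and C where \<psi>[measurable]: "\<psi> \<in> borel_measurable borel" and \<psi>0: "\<And>x. 0 \<le> \<psi> x"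
    and \<psi>f: "\<And>t. emeasure M {x. \<psi> x \<le> t} < \<infinity>"
    and \<psi>\<kappa>: "\<And>k x. k \<le> n \<Longrightarrow> \<kappa> x < k \<longleftrightarrow> \<psi> x < real k"
    and \<B>: "topological_basis (range \<B>)" and C: "\<And>i. C i \<in> sets borel" "\<And>i. \<B> i = \<psi> -` C i"
    using separating_function[of \<kappa> n] \<kappa> by metis
  have inj: "x = y" if "\<psi> x = \<psi> y" for x y
  proof (rule ccontr)
    assume "x \<noteq> y"
    then obtain U where U: "open U" "x \<in> U" "y \<notin> U" using t1_space by blast
    then obtain D where "D \<in> range \<B>" "x \<in> D" "D \<subseteq> U" using topological_basisE[OF \<B>] by metis
    then obtain i where "x \<in> \<B> i" "y \<notin> \<B> i" using U by auto
    then show False using that C(2)[of i] by auto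
  qed
  have sM: "A \<in> sets borel \<Longrightarrow> A \<in> sets M" for A by (simp add: sets_M)
  \<comment> \<open>A level set of the injective \<open>\<psi>\<close> has at most one point, so it
    has no nonempty proper subset of smaller positive measure.\<close>
  have atom: "emeasure M {x. \<psi> x = t} = 0" for t
  proof (rule ccontr)
    assume "emeasure M {x. \<psi> x = t} \<noteq> 0"
    then have "0 < emeasure M {x. \<psi> x = t}" by (simp add: zero_less_iff_neq_zero)
    moreover have "{x. \<psi> x = t} \<in> sets M" by (rule sM) measurable
    ultimately obtain B where B: "B \<subseteq> {x. \<psi> x = t}" "0 < emeasure M B" "emeasure M B < emeasure M {x. \<psi> x = t}"
      using na unfolding non_atomic_def by blast
    then obtain z where z: "z \<in> B" by (cases "B = {}") auto
    then have "{x. \<psi> x = t} \<subseteq> B" using B(1) inj by fastforce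
    then have "{x. \<psi> x = t} = B" using B(1) by auto
    then show False using B(3) by simp
  qed
  have atom': "emeasure M {x. \<psi> x < t} = emeasure M {x. \<psi> x \<le> t}" for t
  proof -
    have "emeasure M {x. \<psi> x \<le> t} = emeasure M ({x. \<psi> x < t} \<union> {x. \<psi> x = t})" by (rule arg_cong[where f="emeasure M"]) auto
    also have "\<dots> = emeasure M {x. \<psi> x < t} + emeasure M {x. \<psi> x = t}"
      by (rule plus_emeasure[symmetric]) (auto intro!: sM)
    finally show ?thesis using atom by simp
  qed
  define m where "m t = measure M {x. \<psi> x \<le> t}" for t
  have em: "emeasure M {x. \<psi> x \<le> t} = ennreal (m t)" for t
    unfolding m_def using \<psi>f[of t] by (intro emeasure_eq_ennreal_measure) auto
  have m0: "0 \<le> m t" for t by (simp add: m_def)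
  have mm: "m s \<le> m t" if "s \<le> t" for s t
  proof -
    have "emeasure M {x. \<psi> x \<le> s} \<le> emeasure M {x. \<psi> x \<le> t}" using that by (intro emeasure_mono) (auto intro!: sM)
    then show ?thesis by (simp add: em m0)
  qed
  have mbor[measurable]: "m \<in> borel_measurable borel" by (rule borel_measurable_mono) (auto simp: mono_def mm)
  have mneg: "m t = 0" if "t < 0" for t
  proof -
    have "{x. \<psi> x \<le> t} = {}" using \<psi>0 that by (auto simp: not_le intro: less_le_trans)
    then show ?thesis by (simp add: m_def)
  qed
  have minf: "\<exists>k::nat. s < m (real k)" for s
  proof (rule ccontr)
    assume "\<not> ?thesis"
    then have le: "emeasure M {x. \<psi> x \<le> real k} \<le> ennreal s" for k unfolding em by (auto simp: not_less intro: ennreal_leI)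
    have "(SUP k. emeasure M {x. \<psi> x \<le> real k}) = emeasure M (\<Union>k. {x. \<psi> x \<le> real k})"
      by (rule SUP_emeasure_incseq) (auto simp: incseq_def intro!: sM)
    also have "(\<Union>k. {x. \<psi> x \<le> real k}) = UNIV" using real_arch_simple by auto
    finally have "emeasure M UNIV \<le> ennreal s" using le by (metis SUP_least)
    then show False using inf by (simp add: top_unique)
  qed
  define G where "G x = m (\<psi> x)" for x
  have Gm[measurable]: "G \<in> borel_measurable borel" unfolding G_def[abs_def] by measurable
  have cdf: "emeasure M {x. G x \<le> s} = ennreal s" if s: "0 \<le> s" for s
  proof -
    define T where "T = {t. m t \<le> s}"
    obtain k :: nat where k: "s < m (real k)" using minf by blast
    have bdd: "bdd_above T" 
    proof (rule bdd_aboveI[of _ "real k"])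
      fix t assume "t \<in> T"
      then have "m t < m (real k)" using k by (simp add: T_def)
      then show "t \<le> real k" using mm[of "real k" t] by linarith
    qed
    have neT: "-1 \<in> T" using s mneg[of "-1"] by (simp add: T_def)
    \<comment> \<open>\<open>m\<close> exceeds \<open>s\<close> to the right of \<open>u\<close> and
      is at most \<open>s\<close> to the left; continuity of measure and the absence of atoms give
      \<open>m u = s\<close>.\<close>
    define u where "u = Sup T"
    have lt: "m t \<le> s" if "t < u" for t
    proof -
      have "T \<noteq> {}" using neT by auto
      from less_cSupD[OF this that[unfolded u_def]] obtain t' where "t' \<in> T" "t < t'" by blast
      then show ?thesis using mm[of t t'] by (simp add: T_def)
    qed
    have gt: "s < m t" if "u < t" for t
    proof (rule ccontr)
      assume "\<not> s < m t"
      then have "t \<in> T" by (simp add: T_def)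
      then show False using that cSup_upper[OF _ bdd, of t] by (simp add: u_def)
    qed
    have up: "s \<le> m u"
    proof -
      have d: "(\<lambda>j. emeasure M {x. \<psi> x \<le> u + 1 / real (Suc j)}) \<longlonglongrightarrow> emeasure M (\<Inter>j. {x. \<psi> x \<le> u + 1 / real (Suc j)})"
      proof (rule Lim_emeasure_decseq)
        show "range (\<lambda>j. {x. \<psi> x \<le> u + 1 / real (Suc j)}) \<subseteq> sets M" by (auto intro!: sM)
        show "decseq (\<lambda>j. {x. \<psi> x \<le> u + 1 / real (Suc j)})"
          unfolding decseq_def by (auto intro: order_trans simp: frac_le)
        show "emeasure M {x. \<psi> x \<le> u + 1 / real (Suc j)} \<noteq> \<infinity>" for j using \<psi>f by (simp add: less_top)
      qed
      have "(\<Inter>j. {x. \<psi> x \<le> u + 1 / real (Suc j)}) = {x. \<psi> x \<le> u}"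
      proof (intro equalityI subsetI)
        fix x assume "x \<in> (\<Inter>j. {x. \<psi> x \<le> u + 1 / real (Suc j)})"
        then have x: "\<psi> x \<le> u + 1 / real (Suc j)" for j by auto
        have l: "(\<lambda>j. u + 1 / real (Suc j)) \<longlonglongrightarrow> u + 0" by (intro tendsto_add tendsto_const LIMSEQ_Suc[OF lim_1_over_n])
        have "\<psi> x \<le> u + 0" by (rule LIMSEQ_le_const[OF l]) (use x in auto)
        then show "x \<in> {x. \<psi> x \<le> u}" by simp
      next
        fix x assume "x \<in> {x. \<psi> x \<le> u}"
        then have "\<psi> x \<le> u + 1 / real (Suc j)" for j by (simp add: add_increasing2)
        then show "x \<in> (\<Inter>j. {x. \<psi> x \<le> u + 1 / real (Suc j)})" by auto
      qed
      with d have d': "(\<lambda>j. ennreal (m (u + 1 / real (Suc j)))) \<longlonglongrightarrow> ennreal (m u)" by (simp add: em)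
      have "ennreal s \<le> ennreal (m (u + 1 / real (Suc j)))" for j
        using gt[of "u + 1 / real (Suc j)"] by (intro ennreal_leI) simp
      then have "ennreal s \<le> ennreal (m u)" by (intro LIMSEQ_le_const[OF d']) blast
      then show ?thesis using m0 by simp
    qed
    have dn: "emeasure M {x. \<psi> x < u} \<le> ennreal s"
    proof -
      have "(SUP j. emeasure M {x. \<psi> x \<le> u - 1 / real (Suc j)}) = emeasure M (\<Union>j. {x. \<psi> x \<le> u - 1 / real (Suc j)})"
      proof (rule SUP_emeasure_incseq)
        show "range (\<lambda>j. {x. \<psi> x \<le> u - 1 / real (Suc j)}) \<subseteq> sets M" by (auto intro!: sM)
        show "incseq (\<lambda>j. {x. \<psi> x \<le> u - 1 / real (Suc j)})"
          unfolding incseq_def by (auto intro: order_trans simp: frac_le)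
      qed
      moreover have "{x. \<psi> x < u} \<subseteq> (\<Union>j. {x. \<psi> x \<le> u - 1 / real (Suc j)})"
      proof
        fix x assume "x \<in> {x. \<psi> x < u}"
        then have "0 < u - \<psi> x" by simp
        from reals_Archimedean[OF this] obtain j where "inverse (real (Suc j)) < u - \<psi> x" by blast
        then have "\<psi> x \<le> u - 1 / real (Suc j)" by (simp add: inverse_eq_divide)
        then show "x \<in> (\<Union>j. {x. \<psi> x \<le> u - 1 / real (Suc j)})" by blast
      qed
      then have "emeasure M {x. \<psi> x < u} \<le> emeasure M (\<Union>j. {x. \<psi> x \<le> u - 1 / real (Suc j)})"
        by (rule emeasure_mono) (auto intro!: sM)
      moreover have "(SUP j. emeasure M {x. \<psi> x \<le> u - 1 / real (Suc j)}) \<le> ennreal s"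
        by (rule SUP_least) (auto simp: em intro!: ennreal_leI lt)
      ultimately show ?thesis by simp
    qed
    have mu: "m u = s" using dn up by (simp add: atom' em s)
    have "emeasure M {x. G x \<le> s} \<le> emeasure M {x. \<psi> x \<le> u}"
    proof (rule emeasure_mono)
      show "{x. G x \<le> s} \<subseteq> {x. \<psi> x \<le> u}" 
      proof
        fix x assume "x \<in> {x. G x \<le> s}"
        then show "x \<in> {x. \<psi> x \<le> u}" using gt[of "\<psi> x"] by (simp add: G_def) (rule leI, blast)
      qed
    qed (auto intro!: sM)
    moreover have "emeasure M {x. \<psi> x < u} \<le> emeasure M {x. G x \<le> s}"
      by (rule emeasure_mono) (auto simp: G_def intro!: sM lt)
    ultimately show ?thesis by (simp add: atom' em mu)
  qed
  have dG: "distr M borel G = density lborel (indicator {0..})"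
  proof (rule measure_eqI_generator_eq[where E="range (\<lambda>a::real. {..a})" and \<Omega>=UNIV and A="\<lambda>i. {..real i}"])
    show "Int_stable (range (\<lambda>a::real. {..a}))" by (auto simp: Int_stable_def)
    have 1: "emeasure (distr M borel G) {..s} = ennreal s" for s
    proof -
      have "emeasure (distr M borel G) {..s} = emeasure M {x. G x \<le> s}"
        by (subst emeasure_distr) (auto simp: vimage_def)
      also have "\<dots> = ennreal s"
      proof (cases "0 \<le> s")
        case False
        then have "{x. G x \<le> s} = {}" using m0 by (auto simp: G_def not_le intro: less_le_trans)
        then show ?thesis using False by (simp add: ennreal_neg)
      qed (rule cdf)
      finally show ?thesis .
    qed
    have 2: "emeasure (density lborel (indicator {0..})) {..s} = ennreal s" for s :: real
    proof -
      have "emeasure (density lborel (indicator {0..})) {..s} = (\<integral>\<^sup>+x. indicator {0..} x * indicator {..s} x \<partial>lborel)"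
        by (rule emeasure_density) auto
      also have "\<dots> = (\<integral>\<^sup>+x. indicator {0..s} x \<partial>lborel)"
        by (intro nn_integral_cong) (auto split: split_indicator)
      also have "\<dots> = ennreal s" by (cases "0 \<le> s") (auto simp: ennreal_neg)
      finally show ?thesis .
    qed
    show "emeasure (distr M borel G) X = emeasure (density lborel (indicator {0..})) X" if "X \<in> range (\<lambda>a. {..a})" for X
      using that 1 2 by auto
    show "sets (distr M borel G) = sigma_sets UNIV (range (\<lambda>a::real. {..a}))" by (simp add: borel_eq_atMost)
    show "sets (density lborel (indicator {0..})) = sigma_sets UNIV (range (\<lambda>a::real. {..a}))" by (simp add: borel_eq_atMost)
    show "(\<Union>i. {..real i}) = UNIV" using real_arch_simple by auto
    show "emeasure (distr M borel G) {..real i} \<noteq> \<infinity>" for i by (simp add: 1)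
  qed auto
  \<comment> \<open>For a half line, \<open>\<psi> x \<le> t\<close> implies
    \<open>G x \<le> m t\<close>, and both sets have measure \<open>m t\<close>, so they agree up to
    a null set. The remaining cases propagate this through the generated sigma-algebra.\<close>
  have tr: "\<exists>C'\<in>sets borel. AE x in M. \<psi> x \<in> D \<longleftrightarrow> G x \<in> C'" if "D \<in> sets borel" for D
  proof -
    have "D \<in> sigma_sets UNIV (range (\<lambda>a::real. {..a}))" using that by (simp add: borel_eq_atMost)
    then show ?thesis
    proof induction
      case (Basic a)
      then obtain t where a: "a = {..t}" by auto
      have "AE x in M. \<psi> x \<le> t \<longleftrightarrow> G x \<le> m t"
      proof (rule AE_I)
        show "{x \<in> space M. \<not> (\<psi> x \<le> t \<longleftrightarrow> G x \<le> m t)} \<subseteq> {x. G x \<le> m t} - {x. \<psi> x \<le> t}"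
          using mm by (auto simp: G_def)
        have "emeasure M ({x. G x \<le> m t} - {x. \<psi> x \<le> t}) = emeasure M {x. G x \<le> m t} - emeasure M {x. \<psi> x \<le> t}"
          using mm by (intro emeasure_Diff) (auto simp: em G_def intro!: sM)
        also have "\<dots> = 0" using cdf[OF m0] by (simp add: em)
        finally show "emeasure M ({x. G x \<le> m t} - {x. \<psi> x \<le> t}) = 0" .
      qed (auto intro!: sM)
      then show ?case by (intro bexI[of _ "{..m t}"]) (auto simp: a)
    next
      case Empty then show ?case by (intro bexI[of _ "{}"]) auto
    next
      case (Compl a)
      then obtain C' where "C' \<in> sets borel" "AE x in M. \<psi> x \<in> a \<longleftrightarrow> G x \<in> C'" by blast
      then show ?case by (intro bexI[of _ "- C'"]) auto
    next
      case (Union a)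
      then obtain C' where C': "\<And>i. C' i \<in> sets borel" "\<And>i. AE x in M. \<psi> x \<in> a i \<longleftrightarrow> G x \<in> C' i" by metis
      have "AE x in M. \<forall>i. \<psi> x \<in> a i \<longleftrightarrow> G x \<in> C' i" using C'(2) by (simp add: AE_all_countable)
      then show ?case using C'(1) by (intro bexI[of _ "\<Union>i. C' i"]) (auto elim!: eventually_mono)
    qed
  qed
  have trB: "\<exists>C'\<in>sets borel. AE x in M. x \<in> U \<longleftrightarrow> G x \<in> C'" if "open U" for U :: "'a set"
  proof -
    have "\<forall>i. \<exists>C'\<in>sets borel. AE x in M. x \<in> \<B> i \<longleftrightarrow> G x \<in> C'" using tr[OF C(1)] C(2) by simp
    then obtain C' where C': "\<And>i. C' i \<in> sets borel" "\<And>i. AE x in M. x \<in> \<B> i \<longleftrightarrow> G x \<in> C' i" by metis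
    have "\<exists>F\<subseteq>range \<B>. \<Union>F = U" using \<B> that by (simp add: topological_basis_def)
    then obtain F where F: "F \<subseteq> range \<B>" "\<Union>F = U" by auto
    define J where "J = {i. \<B> i \<in> F}"
    have U: "U = (\<Union>i\<in>J. \<B> i)" using F by (auto simp: J_def)
    have "AE x in M. \<forall>i. x \<in> \<B> i \<longleftrightarrow> G x \<in> C' i" using C'(2) by (simp add: AE_all_countable)
    then show ?thesis using C'(1) unfolding U by (intro bexI[of _ "\<Union>i\<in>J. C' i"]) (auto elim!: eventually_mono)
  qed
  obtain \<D> :: "'a set" where \<D>: "countable \<D>" "\<And>X. open X \<Longrightarrow> X \<noteq> {} \<Longrightarrow> \<exists>d\<in>\<D>. d \<in> X"
    by (rule countable_dense_setE) blast
  have neD: "\<D> \<noteq> {}" using \<D>(2)[of UNIV] by auto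
  define d where "d = from_nat_into \<D>"
  have dd: "\<exists>j. dist (d j) x < e" if "0 < e" for x e
  proof -
    have "\<exists>y\<in>\<D>. y \<in> ball x e" using \<D>(2)[of "ball x e"] that by simp
    then obtain y where "y \<in> \<D>" "y \<in> ball x e" by blast
    then show ?thesis using from_nat_into_surj[OF \<D>(1), of y] by (auto simp: d_def dist_commute)
  qed
  have "\<forall>i j. \<exists>C'\<in>sets borel. AE x in M. x \<in> ball (d j) ((1/2)^i) \<longleftrightarrow> G x \<in> C'" using trB by blast
  then obtain D where D[measurable]: "\<And>i j. D i j \<in> sets borel" and DA: "\<And>i j. AE x in M. x \<in> ball (d j) ((1/2)^i) \<longleftrightarrow> G x \<in> D i j"
    by metis
  \<comment> \<open>At \<open>t = G x\<close> this is the first dense point whose ball of radius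
    \<open>(1/2)^i\<close> contains \<open>x\<close>, expressed through \<open>t\<close>
    alone.\<close>
  define \<gamma> where "\<gamma> i t = d (LEAST j. t \<in> D i j)" for i t
  have \<gamma>m[measurable]: "\<gamma> i \<in> borel_measurable borel" for i
    unfolding \<gamma>_def[abs_def] by measurable
  \<comment> \<open>The constant default makes the sequence converge at every \<open>t\<close>, so
    that the limit is measurable everywhere.\<close>
  define \<gamma>' where "\<gamma>' i t = (if Cauchy (\<lambda>i. \<gamma> i t) then \<gamma> i t else d 0)" for i t
  have \<gamma>'m: "\<gamma>' i \<in> borel_measurable borel" for i
    unfolding \<gamma>'_def[abs_def] by measurable
  define \<Gamma> where "\<Gamma> t = lim (\<lambda>i. \<gamma>' i t)" for t
  have \<Gamma>l: "(\<lambda>i. \<gamma>' i t) \<longlonglongrightarrow> \<Gamma> t" for t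
  proof -
    have "Cauchy (\<lambda>i. \<gamma>' i t)" by (cases "Cauchy (\<lambda>i. \<gamma> i t)") (auto simp: \<gamma>'_def intro: convergent_Cauchy convergent_const)
    then show ?thesis unfolding \<Gamma>_def by (meson Cauchy_convergent convergent_LIMSEQ_iff)
  qed
  have \<Gamma>m: "\<Gamma> \<in> borel_measurable borel" by (rule borel_measurable_LIMSEQ_metric[OF \<gamma>'m \<Gamma>l])
  have "AE x in M. \<forall>i j. x \<in> ball (d j) ((1/2)^i) \<longleftrightarrow> G x \<in> D i j" using DA by (simp add: AE_all_countable)
  then have \<Gamma>G: "AE x in M. \<Gamma> (G x) = x"
  proof eventually_elim
    fix x assume x: "\<forall>i j. x \<in> ball (d j) ((1/2)^i) \<longleftrightarrow> G x \<in> D i j"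
    have b: "dist (\<gamma> i (G x)) x < (1/2)^i" for i
    proof -
      obtain j where "dist (d j) x < (1/2)^i" using dd[of "(1/2)^i" x] by auto
      then have "G x \<in> D i j" using x by (metis mem_ball)
      then have "G x \<in> D i (LEAST j. G x \<in> D i j)" by (rule LeastI)
      then have "x \<in> ball (\<gamma> i (G x)) ((1/2)^i)" using x unfolding \<gamma>_def by blast
      then show ?thesis by simp
    qed
    have "(\<lambda>i. dist (\<gamma> i (G x)) x) \<longlonglongrightarrow> 0"
    proof (rule tendsto_sandwich[OF _ _ tendsto_const])
      show "(\<lambda>i. (1/2::real)^i) \<longlonglongrightarrow> 0" by (rule LIMSEQ_realpow_zero) auto
    qed (use b in \<open>auto intro!: always_eventually less_imp_le\<close>)
    then have l: "(\<lambda>i. \<gamma> i (G x)) \<longlonglongrightarrow> x" by (rule iffD2[OF tendsto_dist_iff])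
    then have "\<gamma>' i (G x) = \<gamma> i (G x)" for i by (simp add: \<gamma>'_def LIMSEQ_imp_Cauchy)
    then show "\<Gamma> (G x) = x" using \<Gamma>l[of "G x"] l LIMSEQ_unique by auto
  qed
  show thesis
  proof (rule that[OF Gm \<Gamma>m dG \<Gamma>G])
    fix k assume k: "k \<le> n"
    have "emeasure M {x. \<psi> x < real k} = ennreal (\<Sum>j<k. measure M {x. \<kappa> x = j})"
    proof -
      have "{x. \<psi> x < real k} = (\<Union>j<k. {x. \<kappa> x = j})" using \<psi>\<kappa>[OF k] by auto
      also have "emeasure M \<dots> = (\<Sum>j<k. emeasure M {x. \<kappa> x = j})"
        using \<kappa>(1) by (intro sum_emeasure[symmetric]) (auto simp: disjoint_family_on_def intro!: sM)
      also have "\<dots> = (\<Sum>j<k. ennreal (measure M {x. \<kappa> x = j}))"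
        using \<kappa>(2) k by (intro sum.cong emeasure_eq_ennreal_measure) (auto simp: less_top)
      finally show ?thesis by (simp add: sum_ennreal)
    qed
    then have eq: "m (real k) = (\<Sum>j<k. measure M {x. \<kappa> x = j})" unfolding atom' em using m0 by (simp add: sum_nonneg)
    \<comment> \<open>\<open>\<psi> x < real k\<close> and \<open>G x < m (real k)\<close> can
      disagree only where \<open>G x\<close> takes this one value.\<close>
    have z: "AE x in M. G x \<noteq> m (real k)"
    proof -
      have "emeasure M {x. G x = m (real k)} = emeasure (distr M borel G) {m (real k)}"
        by (subst emeasure_distr) (auto simp: vimage_def)
      also have "\<dots> = (\<integral>\<^sup>+t. indicator {0..} t * indicator {m (real k)} t \<partial>lborel)" unfolding dG by (rule emeasure_density) auto
      also have "\<dots> \<le> (\<integral>\<^sup>+t. indicator {m (real k)} t \<partial>lborel)" by (intro nn_integral_mono) (auto split: split_indicator)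
      also have "\<dots> = 0" by simp
      finally have "{x. G x = m (real k)} \<in> null_sets M" by (auto simp: null_sets_def intro!: sM)
      from AE_not_in[OF this] show ?thesis by auto
    qed
    show "AE x in M. \<kappa> x < k \<longleftrightarrow> G x < (\<Sum>j<k. measure M {x. \<kappa> x = j})"
      using z
    proof eventually_elim
      fix x assume "G x \<noteq> m (real k)"
      then show "\<kappa> x < k \<longleftrightarrow> G x < (\<Sum>j<k. measure M {x. \<kappa> x = j})"
        unfolding \<psi>\<kappa>[OF k] eq[symmetric] G_def using mm[of "\<psi> x" "real k"] mm[of "real k" "\<psi> x"]
        by (cases "\<psi> x < real k") auto
    qed
  qed
qed

end

section \<open>Columns and spacers\<close>

text \<open>A level is an interval given by its left end point and its width; a column is a list of levels, each
  mapped affinely onto the next one.\<close>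

type_synonym lev = "real \<times> real"

definition ivl :: "lev \<Rightarrow> real set" where "ivl p = {fst p ..< fst p + snd p}"

definition sublev :: "real \<Rightarrow> real \<Rightarrow> lev \<Rightarrow> lev" where
  "sublev s t p = (fst p + snd p * s, snd p * (t - s))"

definition edges :: "lev list \<Rightarrow> (lev \<times> lev) list" where "edges c = zip c (tl c)"

text \<open>The multiplicity with which the levels cover \<open>x\<close>. An equation
  \<open>cnt c x = indicator {0..<K} x\<close> says both that the levels are disjoint and that they
  fill the interval.\<close>

definition cnt :: "lev list \<Rightarrow> real \<Rightarrow> real" where "cnt c x = (\<Sum>p\<leftarrow>c. indicator (ivl p) x)"

text \<open>All levels share the relative position \<open>u\<close>, so cutting a column is a
  reparametrisation of \<open>u\<close>.\<close>

definition gr_at :: "lev list \<Rightarrow> real \<Rightarrow> (real \<times> real \<times> real) set" where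
  "gr_at c u = (\<lambda>(p, q). (fst p + snd p * u, fst q + snd q * u, snd p / snd q)) ` set (edges c)"

text \<open>The graph of the map along a column, together with its inverse Jacobian.\<close>

definition gr :: "lev list \<Rightarrow> (real \<times> real \<times> real) set" where "gr c = (\<Union>u\<in>{0..<1}. gr_at c u)"

text \<open>The squared norm of \<open>sqrt T' - 1\<close> over the levels reached along a column.\<close>

definition cost :: "lev list \<Rightarrow> real" where
  "cost c = (\<Sum>(p, q)\<leftarrow>edges c. (sqrt (snd p) - sqrt (snd q))\<^sup>2)"

definition posc :: "lev list \<Rightarrow> bool" where "posc c \<longleftrightarrow> c \<noteq> [] \<and> (\<forall>p\<in>set c. 0 < snd p)"

abbreviation cutc :: "real \<Rightarrow> real \<Rightarrow> lev list \<Rightarrow> lev list" where "cutc s t \<equiv> map (sublev s t)"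

lemma edges_Nil [simp]: "edges [] = []" and edges_single [simp]: "edges [p] = []"
  and edges_Cons [simp]: "edges (p # q # c) = (p, q) # edges (q # c)"
  by (auto simp: edges_def)

lemma edges_append: "c \<noteq> [] \<Longrightarrow> d \<noteq> [] \<Longrightarrow> edges (c @ d) = edges c @ (last c, hd d) # edges d"
proof (induction c)
  case (Cons p c)
  show ?case
  proof (cases c)
    case Nil
    then show ?thesis using Cons.prems by (cases d) auto
  next
    case (Cons q c')
    then show ?thesis using Cons.IH Cons.prems by auto
  qed
qed simp

lemma edges_map: "edges (map f c) = map (map_prod f f) (edges c)"
  by (simp add: edges_def map_tl[symmetric] zip_map_map map_prod_def)

lemma edges_set: "(p, q) \<in> set (edges c) \<Longrightarrow> p \<in> set c \<and> q \<in> set c"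
  unfolding edges_def by (cases c) (auto dest: set_zip_leftD set_zip_rightD)

lemma cnt_append [simp]: "cnt (c @ d) x = cnt c x + cnt d x"
  by (simp add: cnt_def)

lemma posc_append: "posc c \<Longrightarrow> posc d \<Longrightarrow> posc (c @ d)"
  by (auto simp: posc_def)

lemma gr_append:
  assumes "c \<noteq> []" "d \<noteq> []"
  shows "gr (c @ d) = gr c \<union> gr d \<union> gr [last c, hd d]"
  using assms by (auto simp: gr_def gr_at_def edges_append)

lemma cost_append:
  assumes "c \<noteq> []" "d \<noteq> []"
  shows "cost (c @ d) = cost c + (sqrt (snd (last c)) - sqrt (snd (hd d)))\<^sup>2 + cost d"
  using assms by (simp add: cost_def edges_append)

lemma sublev_01 [simp]: "sublev 0 1 p = p"
  by (simp add: sublev_def)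

lemma cutc_01 [simp]: "cutc 0 1 c = c"
  by (simp add: map_idI)

lemma ivl_sublev: "0 \<le> s \<Longrightarrow> s \<le> t \<Longrightarrow> t \<le> 1 \<Longrightarrow> 0 < snd p \<Longrightarrow> ivl (sublev s t p) \<subseteq> ivl p"
proof -
  assume a: "0 \<le> s" "s \<le> t" "t \<le> 1" "0 < snd p"
  then have "snd p * t \<le> snd p * 1" "0 \<le> snd p * s" by (auto intro: mult_left_mono)
  then show ?thesis by (auto simp: ivl_def sublev_def algebra_simps)
qed

lemma ivl_split: "ivl p \<subseteq> ivl (sublev 0 s p) \<union> ivl (sublev s 1 p)"
  by (auto simp: ivl_def sublev_def algebra_simps)

lemma posc_cut: "posc c \<Longrightarrow> s < t \<Longrightarrow> posc (cutc s t c)"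
  by (auto simp: posc_def sublev_def)

text \<open>The count of a cut column is the increment of this function between the two cuts, so
  counts telescope over a partition of \<open>[0, 1]\<close>.\<close>

definition cdf :: "lev list \<Rightarrow> real \<Rightarrow> real \<Rightarrow> real" where
  "cdf c x t = (\<Sum>p\<leftarrow>c. if x < fst p + snd p * t then 1 else 0)"

lemma cnt_cut: "posc c \<Longrightarrow> s \<le> t \<Longrightarrow> cnt (cutc s t c) x = cdf c x t - cdf c x s"
proof -
  assume c: "posc c" and st: "s \<le> t"
  have "indicator (ivl (sublev s t p)) x = (if x < fst p + snd p * t then 1 else 0) - (if x < fst p + snd p * s then 1 else (0::real))"
    if "p \<in> set c" for p
  proof -
    have "snd p * s \<le> snd p * t" using c st that by (auto simp: posc_def intro!: mult_left_mono)
    then show ?thesis by (auto simp: ivl_def sublev_def algebra_simps split: split_indicator)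
  qed
  then show ?thesis unfolding cnt_def cdf_def sum_list_subtractf[symmetric] by (simp add: o_def cong: map_cong)
qed

lemma gr_at_cut: "s < t \<Longrightarrow> gr_at (cutc s t c) u = gr_at c (s + (t - s) * u)"
  unfolding gr_at_def edges_map set_map image_image
  by (rule image_cong[OF refl]) (auto simp: sublev_def distrib_left mult.assoc add.assoc)

lemma gr_cut: assumes "0 \<le> s" "s < t" "t \<le> 1" shows "gr (cutc s t c) \<subseteq> gr c"
proof -
  have "s + (t - s) * u \<in> {0..<1}" if "u \<in> {0..<1}" for u
  proof -
    have "(t - s) * u < (t - s) * 1" using assms that by (intro mult_strict_left_mono) auto
    then have "s + (t - s) * u < s + (t - s) * 1" by (rule add_strict_left_mono)
    also have "\<dots> \<le> 1" using assms by simp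
    finally have "s + (t - s) * u < 1" .
    moreover have "0 \<le> s + (t - s) * u" using assms that by simp
    ultimately show ?thesis by simp
  qed
  then show ?thesis unfolding gr_def gr_at_cut[OF assms(2)] by blast
qed

lemma gr_at_cut': assumes "s \<le> u" "u < t" shows "gr_at c u \<subseteq> gr (cutc s t c)"
proof -
  have "s + (t - s) * ((u - s) / (t - s)) = u" using assms by simp
  then have "gr_at c u = gr_at (cutc s t c) ((u - s) / (t - s))" using assms by (subst gr_at_cut) auto
  moreover have "(u - s) / (t - s) \<in> {0..<1}" using assms by (simp add: field_simps)
  ultimately show ?thesis unfolding gr_def by blast
qed

lemma gr_split: "gr c \<subseteq> gr (cutc 0 s c) \<union> gr (cutc s 1 c)"
proof -
  have "gr_at c u \<subseteq> gr (cutc 0 s c) \<union> gr (cutc s 1 c)" if "u \<in> {0..<1}" for u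
    using gr_at_cut'[of 0 u s c] gr_at_cut'[of s u 1 c] that by (cases "u < s") auto
  then show ?thesis unfolding gr_def[of c] by blast
qed

text \<open>Cutting multiplies all widths by \<open>t - s\<close>, and the cost is a quadratic form
  in the square roots of the widths.\<close>

lemma cost_cut: assumes "posc c" "s \<le> t" shows "cost (cutc s t c) = (t - s) * cost c"
proof -
  have "(sqrt (snd p * (t - s)) - sqrt (snd q * (t - s)))\<^sup>2 = (t - s) * (sqrt (snd p) - sqrt (snd q))\<^sup>2" for p q :: lev
  proof -
    have "(sqrt (snd p * (t - s)) - sqrt (snd q * (t - s)))\<^sup>2 = (sqrt (t - s) * (sqrt (snd p) - sqrt (snd q)))\<^sup>2"
      by (simp only: real_sqrt_mult) (simp add: algebra_simps)
    also have "\<dots> = (t - s) * (sqrt (snd p) - sqrt (snd q))\<^sup>2" using assms by (simp add: power_mult_distrib)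
    finally show ?thesis .
  qed
  then show ?thesis unfolding cost_def edges_map sum_list_const_mult[symmetric]
    by (simp add: o_def split_beta' sublev_def)
qed

text \<open>Applied to indicators: a point of multiplicity at most one lies on one edge
  only.\<close>

lemma sum_list_two:
  fixes f :: "'b \<Rightarrow> real"
  assumes "e \<in> set xs" "e' \<in> set xs" "e \<noteq> e'" "\<And>z. 0 \<le> f z"
  shows "f e + f e' \<le> sum_list (map f xs)"
  using assms(1,2,3)
proof (induction xs)
  case (Cons a xs)
  have 1: "f z \<le> sum_list (map f xs)" if "z \<in> set xs" for z
    using that assms(4) by (intro member_le_sum_list) auto
  show ?case using Cons 1[of e] 1[of e'] assms(4)[of a] by (auto simp: add_increasing)
qed simp

lemma edges_cnt:
  "(\<Sum>e\<leftarrow>edges c. indicator (ivl (fst e)) x) \<le> cnt c x" "(\<Sum>e\<leftarrow>edges c. indicator (ivl (snd e)) x) \<le> cnt c x"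
proof -
  \<comment> \<open>The position at the head of the list has no edge into it; its indicator is added
    to make the second bound inductive.\<close>
  have "(\<Sum>e\<leftarrow>edges c. indicator (ivl (fst e)) x) \<le> cnt c x \<and> (\<Sum>e\<leftarrow>edges c. indicator (ivl (snd e)) x) + (if c = [] then 0 else indicator (ivl (hd c)) x) \<le> cnt c x"
  proof (induction c)
    case (Cons p c)
    then show ?case by (cases c) (auto simp: cnt_def)
  qed (simp add: cnt_def)
  then show "(\<Sum>e\<leftarrow>edges c. indicator (ivl (fst e)) x) \<le> cnt c x" "(\<Sum>e\<leftarrow>edges c. indicator (ivl (snd e)) x) \<le> cnt c x"
    by (auto split: if_splits simp: add_nonneg_eq_0_iff intro: order_trans[rotated])
qed

lemma edge_unique:
  assumes "cnt c x \<le> 1" "e \<in> set (edges c)" "e' \<in> set (edges c)"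
  shows "x \<in> ivl (fst e) \<Longrightarrow> x \<in> ivl (fst e') \<Longrightarrow> e = e'" "x \<in> ivl (snd e) \<Longrightarrow> x \<in> ivl (snd e') \<Longrightarrow> e = e'"
proof -
  show "e = e'" if "x \<in> ivl (fst e)" "x \<in> ivl (fst e')"
  proof (rule ccontr)
    assume "e \<noteq> e'"
    from sum_list_two[OF assms(2,3) this, of "\<lambda>e. indicator (ivl (fst e)) x"] edges_cnt(1)[of x c] assms that show False
      by simp
  qed
  show "e = e'" if "x \<in> ivl (snd e)" "x \<in> ivl (snd e')"
  proof (rule ccontr)
    assume "e \<noteq> e'"
    from sum_list_two[OF assms(2,3) this, of "\<lambda>e. indicator (ivl (snd e)) x"] edges_cnt(2)[of x c] assms that show False
      by simp
  qed
qed

lemma grE: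
  assumes "(x, y, r) \<in> gr c" "posc c"
  obtains p q u where "(p, q) \<in> set (edges c)" "0 \<le> u" "u < 1" "x = fst p + snd p * u" "y = fst q + snd q * u"
    "r = snd p / snd q" "x \<in> ivl p" "y \<in> ivl q" "0 < snd p" "0 < snd q"
proof -
  from assms(1) obtain p q u where e: "(p, q) \<in> set (edges c)" "0 \<le> u" "u < 1" "x = fst p + snd p * u"
    "y = fst q + snd q * u" "r = snd p / snd q" unfolding gr_def gr_at_def by auto
  have pq: "0 < snd p" "0 < snd q" using edges_set[OF e(1)] assms(2) by (auto simp: posc_def)
  have "x \<in> ivl p" "y \<in> ivl q" using e pq by (auto simp: ivl_def)
  then show thesis using that e pq by blast
qed

lemma grI:
  assumes "(p, q) \<in> set (edges c)" "0 \<le> u" "u < 1"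
  shows "(fst p + snd p * u, fst q + snd q * u, snd p / snd q) \<in> gr c"
  using assms unfolding gr_def gr_at_def by force

lemma gr_fun:
  assumes "\<And>x. cnt c x \<le> 1" "posc c" "(x, y, r) \<in> gr c" "(x, y', r') \<in> gr c" shows "y = y' \<and> r = r'"
proof -
  from assms(3,2) obtain p q u where e: "(p, q) \<in> set (edges c)" "x = fst p + snd p * u" "y = fst q + snd q * u"
    "r = snd p / snd q" "x \<in> ivl p" "0 < snd p" by (rule grE)
  from assms(4,2) obtain p' q' u' where e': "(p', q') \<in> set (edges c)" "x = fst p' + snd p' * u'" "y' = fst q' + snd q' * u'"
    "r' = snd p' / snd q'" "x \<in> ivl p'" "0 < snd p'" by (rule grE)
  have "(p, q) = (p', q')" by (rule edge_unique(1)[OF assms(1)[of x] e(1) e'(1)]) (use e e' in auto)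
  then show ?thesis using e e' by auto
qed

lemma gr_inj:
  assumes "\<And>x. cnt c x \<le> 1" "posc c" "(x, y, r) \<in> gr c" "(x', y, r') \<in> gr c" shows "x = x' \<and> r = r'"
proof -
  from assms(3,2) obtain p q u where e: "(p, q) \<in> set (edges c)" "x = fst p + snd p * u" "y = fst q + snd q * u"
    "r = snd p / snd q" "y \<in> ivl q" "0 < snd q" by (rule grE)
  from assms(4,2) obtain p' q' u' where e': "(p', q') \<in> set (edges c)" "x' = fst p' + snd p' * u'" "y = fst q' + snd q' * u'"
    "r' = snd p' / snd q'" "y \<in> ivl q'" "0 < snd q'" by (rule grE)
  have "(p, q) = (p', q')" by (rule edge_unique(2)[OF assms(1)[of y] e(1) e'(1)]) (use e e' in auto)
  then show ?thesis using e e' by auto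
qed

section \<open>Families of columns, spacers and linking\<close>

definition CNT :: "lev list list \<Rightarrow> real \<Rightarrow> real" where "CNT css x = (\<Sum>c\<leftarrow>css. cnt c x)"
definition GR :: "lev list list \<Rightarrow> (real \<times> real \<times> real) set" where "GR css = (\<Union>c\<in>set css. gr c)"

lemma CNT_simps [simp]: "CNT [] x = 0" "CNT (c # css) x = cnt c x + CNT css x" "CNT (css @ css') x = CNT css x + CNT css' x"
  by (auto simp: CNT_def)

lemma GR_simps [simp]: "GR [] = {}" "GR (c # css) = gr c \<union> GR css" "GR (css @ css') = GR css \<union> GR css'"
  by (auto simp: GR_def)

fun place :: "real \<Rightarrow> real list \<Rightarrow> lev list" where
  "place K [] = []"
| "place K (w # ws) = (K, w) # place (K + w) ws"

lemma place_snd [simp]: "map snd (place K ws) = ws"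
  by (induction ws arbitrary: K) auto

lemma place_cnt: "(\<forall>w\<in>set ws. 0 < w) \<Longrightarrow> cnt (place K ws) x = indicator {K ..< K + sum_list ws} x"
proof (induction ws arbitrary: K)
  case (Cons w ws)
  have "0 \<le> sum_list ws" using Cons.prems by (intro sum_list_nonneg) auto
  moreover have "0 < w" using Cons.prems by simp
  moreover have "cnt (place K (w # ws)) x = indicator {K ..< K + w} x + cnt (place (K + w) ws) x"
    by (simp add: cnt_def ivl_def)
  ultimately show ?case using Cons by (auto split: split_indicator)
qed (simp add: cnt_def)

lemma cost_widths: "cost c = (\<Sum>(a, b)\<leftarrow>zip (map snd c) (tl (map snd c)). (sqrt a - sqrt b)\<^sup>2)"
  by (simp add: cost_def edges_def zip_map_map map_tl[symmetric] o_def split_beta')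

lemma sum_list_zip_upt:
  "(\<Sum>(a, b)\<leftarrow>zip (map f [0..<Suc n]) (tl (map f [0..<Suc n])). h a b) = (\<Sum>i<n. (h (f i) (f (Suc i)) :: real))"
proof -
  have "zip (map f [0..<Suc n]) (tl (map f [0..<Suc n])) = map (\<lambda>i. (f i, f (Suc i))) [0..<n]"
    by (rule nth_equalityI) (auto simp: nth_tl nth_append simp del: upt_Suc)
  then show ?thesis by (simp only: map_map o_def split_conv interv_sum_list_conv_sum_set_nat set_upt lessThan_atLeast0)
qed

text \<open>Interpolating square roots of widths linearly between \<open>v\<close> and \<open>v'\<close> makes the cost as small as we like.\<close>

lemma spacer:
  assumes v: "0 < v" "0 < v'" and d: "0 < (\<delta>::real)"
  shows "\<exists>sp K'. posc sp \<and> (\<forall>x. cnt sp x = indicator {K..<K'} x) \<and> K + 1 \<le> K' \<and>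
    (sqrt v - sqrt (snd (hd sp)))\<^sup>2 + cost sp + (sqrt (snd (last sp)) - sqrt v')\<^sup>2 \<le> \<delta> \<and>
    (\<forall>p\<in>set sp. snd p \<le> max v v')"
proof -
  define A where "A = (sqrt v' - sqrt v)\<^sup>2"
  \<comment> \<open>\<open>m0\<close> makes the cost \<open>A / (m + 1)\<close> at most
    \<open>\<delta>\<close>; \<open>m1\<close> makes the \<open>m\<close> spacers, each at least
    \<open>min v v'\<close> wide, longer than 1 in total.\<close>
  obtain m0 :: nat where m0: "A / \<delta> < real m0" using reals_Archimedean2 by blast
  obtain m1 :: nat where m1: "1 / min v v' < real m1" using reals_Archimedean2 by blast
  define m where "m = Suc (max m0 m1)"
  have m: "A / \<delta> < real m" "1 / min v v' < real m" "0 < m" using m0 m1 by (auto simp: m_def)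
  \<comment> \<open>Indices 0 and \<open>Suc m\<close> stand for the given widths \<open>v\<close>
    and \<open>v'\<close>; the spacers are the indices from 1 to \<open>m\<close>.\<close>
  define r where "r i = sqrt v + (sqrt v' - sqrt v) * (real i / real (Suc m))" for i
  define f where "f i = (r i)\<^sup>2" for i
  have rb: "min (sqrt v) (sqrt v') \<le> r i \<and> r i \<le> max (sqrt v) (sqrt v')" if "i \<le> Suc m" for i
  proof -
    define t where "t = real i / real (Suc m)"
    have t: "0 \<le> t" "t \<le> 1" using that by (auto simp: t_def)
    have ri: "r i = (1 - t) * sqrt v + t * sqrt v'" unfolding r_def t_def[symmetric] by (simp add: algebra_simps)
    have "(1 - t) * min (sqrt v) (sqrt v') + t * min (sqrt v) (sqrt v') \<le> r i"
      unfolding ri using t by (intro add_mono mult_left_mono) auto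
    moreover have "r i \<le> (1 - t) * max (sqrt v) (sqrt v') + t * max (sqrt v) (sqrt v')"
      unfolding ri using t by (intro add_mono mult_left_mono) auto
    ultimately show ?thesis by (simp add: algebra_simps)
  qed
  have mn: "0 < min (sqrt v) (sqrt v')" using v by simp
  have r0: "0 < r i" if "i \<le> Suc m" for i using rb[OF that] mn by linarith
  have sf: "sqrt (f i) = r i" if "i \<le> Suc m" for i using r0[OF that] by (simp add: f_def)
  have fb: "min v v' \<le> f i \<and> f i \<le> max v v'" if "i \<le> Suc m" for i
  proof -
    have "(min (sqrt v) (sqrt v'))\<^sup>2 \<le> f i" unfolding f_def using rb[OF that] mn by (intro power_mono) auto
    moreover have "f i \<le> (max (sqrt v) (sqrt v'))\<^sup>2" unfolding f_def using rb[OF that] r0[OF that] by (intro power_mono) auto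
    moreover have "(min (sqrt v) (sqrt v'))\<^sup>2 = min v v'" "(max (sqrt v) (sqrt v'))\<^sup>2 = max v v'"
      using v by (auto simp: min_def max_def)
    ultimately show ?thesis by simp
  qed
  have f0: "0 < f i" if "i \<le> Suc m" for i using fb[OF that] v by linarith
  have ends: "f 0 = v" "f (Suc m) = v'" using v by (auto simp: f_def r_def)
  define ws where "ws = map f [1..<Suc m]"
  define sp where "sp = place K ws"
  have wsne: "ws \<noteq> []" using m by (simp add: ws_def)
  have ws0: "\<forall>w\<in>set ws. 0 < w" using f0 by (auto simp: ws_def)
  have spw: "map snd sp = ws" by (simp add: sp_def)
  have spne: "sp \<noteq> []" using wsne spw by auto
  have "posc sp" unfolding posc_def
  proof (intro conjI ballI spne)
    fix p assume "p \<in> set sp"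
    then have "snd p \<in> set ws" unfolding spw[symmetric] by auto
    then show "0 < snd p" using ws0 by blast
  qed
  moreover have "\<forall>x. cnt sp x = indicator {K..<K + sum_list ws} x" unfolding sp_def using place_cnt[OF ws0] by blast
  moreover have "K + 1 \<le> K + sum_list ws"
  proof -
    have "1 \<le> real m * min v v'" using m(2) v by (simp add: field_simps)
    also have "\<dots> = (\<Sum>i=1..m. min v v')" by simp
    also have "\<dots> \<le> (\<Sum>i=1..m. f i)" using fb by (intro sum_mono) auto
    also have "\<dots> = sum_list ws" unfolding ws_def interv_sum_list_conv_sum_set_nat by (rule sum.cong) auto
    finally show ?thesis by simp
  qed
  moreover have "(sqrt v - sqrt (snd (hd sp)))\<^sup>2 + cost sp + (sqrt (snd (last sp)) - sqrt v')\<^sup>2 \<le> \<delta>"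
  proof -
    \<comment> \<open>The two outer jumps become edges of a list flanked by levels of widths
      \<open>v\<close> and \<open>v'\<close>. Their left end points are arbitrary, since the cost
      sees only widths.\<close>
    have "(sqrt v - sqrt (snd (hd sp)))\<^sup>2 + cost sp + (sqrt (snd (last sp)) - sqrt v')\<^sup>2 = cost ([(0, v)] @ sp @ [(0, v')])"
      using spne by (simp add: cost_append cost_def[of "[_]"] del: append_Cons append_Nil)
    also have "\<dots> = (\<Sum>i<Suc m. (sqrt (f i) - sqrt (f (Suc i)))\<^sup>2)"
    proof -
      have "map snd ([(0, v)] @ sp @ [(0, v')]) = map f [0..<Suc (Suc m)]"
      proof -
        have "[0..<Suc (Suc m)] = [0] @ [1..<Suc m] @ [Suc m]"
          using upt_Suc_append[of 0 "Suc m"] upt_conv_Cons[of 0 "Suc m"] by simp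
        then show ?thesis using ends by (simp only: map_append list.map spw ws_def snd_conv)
      qed
      then show ?thesis unfolding cost_widths by (simp only: sum_list_zip_upt)
    qed
    also have "\<dots> = (\<Sum>i<Suc m. ((sqrt v' - sqrt v) / real (Suc m))\<^sup>2)"
    proof (rule sum.cong[OF refl])
      fix i assume "i \<in> {..<Suc m}"
      then have i: "i \<le> Suc m" "Suc i \<le> Suc m" by auto
      have "sqrt (f i) - sqrt (f (Suc i)) = - ((sqrt v' - sqrt v) / real (Suc m))"
      proof -
        have "real i / real (Suc m) - real (Suc i) / real (Suc m) = - (1 / real (Suc m))"
          by (simp add: diff_divide_distrib[symmetric])
        moreover have "r i - r (Suc i) = (sqrt v' - sqrt v) * (real i / real (Suc m) - real (Suc i) / real (Suc m))"
          by (simp add: r_def right_diff_distrib)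
        ultimately show ?thesis unfolding sf[OF i(1)] sf[OF i(2)] by simp
      qed
      then show "(sqrt (f i) - sqrt (f (Suc i)))\<^sup>2 = ((sqrt v' - sqrt v) / real (Suc m))\<^sup>2" by simp
    qed
    also have "\<dots> = A / real (Suc m)" by (simp add: A_def power_divide power2_eq_square)
    also have "\<dots> \<le> \<delta>"
    proof -
      have "A < real m * \<delta>" using m(1) d by (simp add: field_simps)
      also have "\<dots> \<le> real (Suc m) * \<delta>" using d by (intro mult_right_mono) auto
      finally show ?thesis by (simp add: field_simps)
    qed
    finally show ?thesis .
  qed
  moreover have "\<forall>p\<in>set sp. snd p \<le> max v v'"
  proof
    fix p assume "p \<in> set sp"
    then have "snd p \<in> set ws" unfolding spw[symmetric] by auto
    then obtain i where "i \<in> set [1..<Suc m]" "snd p = f i" unfolding ws_def set_map by blast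
    then show "snd p \<le> max v v'" using fb[of i] by auto
  qed
  ultimately show ?thesis by blast
qed

text \<open>The tail is linked with spacers from \<open>{K..<K0}\<close>, and the new junction uses
  \<open>{K0..<K'}\<close>. It receives half of the budget and the tail the other half. Every
  junction adds length at least 1, which later makes the columns exhaust the half line.\<close>

lemma link:
  assumes "css \<noteq> []" "\<forall>c\<in>set css. posc c" "0 < (\<delta>::real)"
  shows "\<exists>d K'. posc d \<and> hd d = hd (hd css) \<and> last d = last (last css) \<and>
    (\<forall>x. cnt d x = CNT css x + indicator {K..<K'} x) \<and> K \<le> K' \<and> (2 \<le> length css \<longrightarrow> K + 1 \<le> K') \<and>
    (\<forall>c\<in>set css. set c \<subseteq> set d) \<and> GR css \<subseteq> gr d \<and> cost d \<le> sum_list (map cost css) + \<delta> \<and>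
    (\<forall>W. (\<forall>c\<in>set css. \<forall>p\<in>set c. snd p \<le> W) \<longrightarrow> (\<forall>p\<in>set d. snd p \<le> W))"
  using assms
proof (induction css arbitrary: \<delta>)
  case (Cons c css)
  show ?case
  proof (cases "css = []")
    case True
    then show ?thesis using Cons.prems by (intro exI[of _ c] exI[of _ K]) auto
  next
    case False
    have pc: "posc c" using Cons.prems by simp
    obtain d K0 where d: "posc d" "hd d = hd (hd css)" "last d = last (last css)"
      "\<And>x. cnt d x = CNT css x + indicator {K..<K0} x" "K \<le> K0" "\<forall>c\<in>set css. set c \<subseteq> set d" "GR css \<subseteq> gr d"
      "cost d \<le> sum_list (map cost css) + \<delta> / 2"
      "\<And>W. (\<forall>c\<in>set css. \<forall>p\<in>set c. snd p \<le> W) \<Longrightarrow> (\<forall>p\<in>set d. snd p \<le> W)"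
    proof -
      have "\<forall>c\<in>set css. posc c" "0 < \<delta> / 2" using Cons.prems by auto
      from Cons.IH[OF False this] show thesis using that by blast
    qed
    have "0 < snd (last c)" "0 < snd (hd d)" using pc d(1) by (auto simp: posc_def)
    moreover have "0 < \<delta> / 2" using Cons.prems by simp
    ultimately obtain sp K' where sp: "posc sp" "\<And>x. cnt sp x = indicator {K0..<K'} x"
      "K0 + 1 \<le> K'" "(sqrt (snd (last c)) - sqrt (snd (hd sp)))\<^sup>2 + cost sp + (sqrt (snd (last sp)) - sqrt (snd (hd d)))\<^sup>2 \<le> \<delta> / 2"
      "\<forall>p\<in>set sp. snd p \<le> max (snd (last c)) (snd (hd d))"
      using spacer[of "snd (last c)" "snd (hd d)" "\<delta> / 2" K0] by blast
    have ne: "c \<noteq> []" "sp \<noteq> []" "d \<noteq> []" using pc sp d by (auto simp: posc_def)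
    let ?d = "c @ sp @ d"
    show ?thesis
    proof (intro exI[of _ ?d] exI[of _ K'] conjI allI impI)
      show "posc ?d" using pc sp d by (intro posc_append)
      show "hd ?d = hd (hd (c # css))" "last ?d = last (last (c # css))" using ne d False by auto
      show "cnt ?d x = CNT (c # css) x + indicator {K..<K'} x" for x
        using d(5) sp(3) by (auto simp: sp(2) d(4) split: split_indicator)
      show "K \<le> K'" "K + 1 \<le> K'" using d(5) sp(3) by auto
      show "\<forall>c'\<in>set (c # css). set c' \<subseteq> set ?d" using d(6) by auto
      show "GR (c # css) \<subseteq> gr ?d" using d(7) ne by (auto simp: gr_append)
      show "cost ?d \<le> sum_list (map cost (c # css)) + \<delta>" using sp(4) d(8) ne by (simp add: cost_append)
      fix W assume W: "\<forall>c'\<in>set (c # css). \<forall>p\<in>set c'. snd p \<le> W"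
      then have "\<forall>p\<in>set d. snd p \<le> W" using d(9) by auto
      moreover have "snd (last c) \<le> W" using W ne by auto
      moreover have "snd (hd d) \<le> W" using calculation ne by simp
      ultimately show "\<forall>p\<in>set ?d. snd p \<le> W" using W sp(5) by (auto intro: order_trans)
    qed
  qed
qed simp

section \<open>One stage of cutting and stacking\<close>

definition fracs :: "nat \<Rightarrow> nat \<Rightarrow> (real \<times> real) list" where
  "fracs a L = concat (map (\<lambda>l. map (\<lambda>i. ((real l + real i / real (a ^ l)) / real L, (real l + real (Suc i) / real (a ^ l)) / real L))
     [0..<a ^ l]) [0..<L])"

lemma sum_list_map_concat: "sum_list (map f (concat (map g xs))) = (\<Sum>x\<leftarrow>xs. sum_list (map f (g x)))"
  by (induction xs) auto

lemma sum_list_fracs: "(\<Sum>z\<leftarrow>fracs a L. f z) = (\<Sum>l<L. \<Sum>i<a ^ l.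
   (f ((real l + real i / real (a ^ l)) / real L, (real l + real (Suc i) / real (a ^ l)) / real L) :: real))"
  by (simp add: fracs_def sum_list_map_concat o_def interv_sum_list_conv_sum_set_nat lessThan_atLeast0)

text \<open>Consecutive end points agree inside a part and from one part to the next. Counts, costs
  and covering statements for the pieces all come from this identity.\<close>

lemma fracs_telescope:
  assumes "0 < a" "0 < L" shows "(\<Sum>(s, t)\<leftarrow>fracs a L. h t - h s) = h 1 - (h 0 :: real)"
proof -
  have "(\<Sum>i<a ^ l. h ((real l + real (Suc i) / real (a ^ l)) / real L) - h ((real l + real i / real (a ^ l)) / real L))
     = h (real (Suc l) / real L) - h (real l / real L)" for l
    unfolding sum_lessThan_telescope[of "\<lambda>i. h ((real l + real i / real (a ^ l)) / real L)"] using assms by (simp add: add.commute)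
  then have "(\<Sum>(s, t)\<leftarrow>fracs a L. h t - h s) = (\<Sum>l<L. h (real (Suc l) / real L) - h (real l / real L))"
    unfolding sum_list_fracs by simp
  also have "\<dots> = h 1 - h 0" unfolding sum_lessThan_telescope[of "\<lambda>l. h (real l / real L)"] using assms by simp
  finally show ?thesis .
qed

lemma fracs_sum_diff:
  assumes "0 < a" "0 < L" shows "(\<Sum>(s, t)\<leftarrow>fracs a L. f (t - s)) = (\<Sum>l<L. real (a ^ l) * (f (1 / (real L * real (a ^ l))) :: real))"
proof -
  have "(real l + real (Suc i) / real (a ^ l)) / real L - (real l + real i / real (a ^ l)) / real L = 1 / (real L * real (a ^ l))" for l i
    using assms by (simp add: field_simps)
  then show ?thesis unfolding sum_list_fracs by simp
qed

lemma fracs_mem: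
  assumes "(s, t) \<in> set (fracs a L)" "0 < a"
  shows "0 \<le> s" "s < t" "t \<le> 1" "t - s \<le> 1 / real L"
proof -
  from assms obtain l i where l: "l < L" "i < a ^ l"
    and s: "s = (real l + real i / real (a ^ l)) / real L" and t: "t = (real l + real (Suc i) / real (a ^ l)) / real L"
    by (auto simp: fracs_def)
  have p: "0 < real (a ^ l)" "1 \<le> real (a ^ l)" "0 < real L" using assms l by auto
  show "0 \<le> s" by (simp add: s)
  show "s < t" unfolding s t using p by (intro divide_strict_right_mono add_strict_left_mono) auto
  have "real (Suc i) \<le> real (a ^ l)" using l(2) by (simp only: of_nat_le_iff Suc_le_eq)
  then have "real (Suc i) / real (a ^ l) \<le> 1" using p by (simp only: divide_le_eq_1) simp
  moreover have "real l + 1 \<le> real L" using l by simp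
  ultimately have "real l + real (Suc i) / real (a ^ l) \<le> real L" by linarith
  then show "t \<le> 1" unfolding t using p(3) by (simp only: divide_le_eq_1 simp_thms)
  have "t - s = (1 / real (a ^ l)) / real L" unfolding s t by (simp add: diff_divide_distrib[symmetric] add_divide_distrib)
  also have "\<dots> \<le> 1 / real L" using p by (intro divide_right_mono) (auto simp: divide_le_eq_1)
  finally show "t - s \<le> 1 / real L" .
qed

text \<open>The indicator of \<open>u < t\<close> climbs from 0 at \<open>t = 0\<close> to 1 at
  \<open>t = 1\<close>, so it jumps across some piece.\<close>

lemma fracs_cover:
  assumes "0 < a" "0 < L" "0 \<le> u" "u < 1" shows "\<exists>(s,t)\<in>set (fracs a L). s \<le> u \<and> u < t"
proof (rule ccontr)
  define h where "h t = (if u < t then 1 else (0::real))" for t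
  assume n: "\<not> ?thesis"
  have "h t - h s \<le> 0" if "(s, t) \<in> set (fracs a L)" for s t
    using n that by (auto simp: h_def)
  then have "(\<Sum>(s, t)\<leftarrow>fracs a L. h t - h s) \<le> 0" by (intro sum_list_nonpos) auto
  then show False using assms by (simp add: fracs_telescope h_def)
qed

lemma cut_all:
  assumes c: "posc c" and aL: "0 < a" "0 < L"
  defines "css \<equiv> map (\<lambda>(s,t). cutc s t c) (fracs a L)"
  shows "\<forall>d\<in>set css. posc d" "CNT css x = cnt c x" "gr c \<subseteq> GR css" "sum_list (map cost css) = cost c"
proof -
  show "\<forall>d\<in>set css. posc d" using c fracs_mem(2)[OF _ aL(1)] by (auto simp: css_def intro!: posc_cut)
  have "CNT css x = (\<Sum>(s,t)\<leftarrow>fracs a L. cdf c x t - cdf c x s)"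
    unfolding CNT_def css_def map_map using fracs_mem(2)[OF _ aL(1)] c
    by (intro arg_cong[where f=sum_list] map_cong) (auto simp: cnt_cut less_imp_le)
  also have "\<dots> = cdf c x 1 - cdf c x 0" by (rule fracs_telescope[OF aL])
  also have "\<dots> = cnt c x" using cnt_cut[OF c, of 0 1 x] by simp
  finally show "CNT css x = cnt c x" .
  show "gr c \<subseteq> GR css"
  proof
    fix z assume "z \<in> gr c"
    then obtain u where u: "0 \<le> u" "u < 1" "z \<in> gr_at c u" by (auto simp: gr_def)
    with fracs_cover[OF aL u(1,2)] obtain s t where st: "(s,t) \<in> set (fracs a L)" "s \<le> u" "u < t" by auto
    then have "z \<in> gr (cutc s t c)" using gr_at_cut'[OF st(2,3)] u by blast
    moreover have "cutc s t c \<in> set css" using st(1) by (force simp: css_def)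
    ultimately show "z \<in> GR css" by (auto simp: GR_def)
  qed
  have "sum_list (map cost css) = (\<Sum>(s,t)\<leftarrow>fracs a L. t * cost c - s * cost c)"
    unfolding css_def map_map using fracs_mem(2)[OF _ aL(1)] c
    by (intro arg_cong[where f=sum_list] map_cong) (auto simp: cost_cut less_imp_le left_diff_distrib)
  also have "\<dots> = cost c" using fracs_telescope[OF aL, of "\<lambda>t. t * cost c"] by simp
  finally show "sum_list (map cost css) = cost c" .
qed

lemma length_fracs: assumes "0 < a" "2 \<le> L" shows "2 \<le> length (fracs a L)"
proof -
  have "length (fracs a L) = (\<Sum>l<L. a ^ l)"
    by (simp add: fracs_def length_concat o_def interv_sum_list_conv_sum_set_nat lessThan_atLeast0)
  moreover have "(\<Sum>l<L. 1) \<le> (\<Sum>l<L. a ^ l)" using assms by (intro sum_mono) auto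
  ultimately show ?thesis using assms by simp
qed

text \<open>\<open>fracs\<close> cuts and \<open>link\<close> restacks. As \<open>2 \<le> L\<close>,
  widths at least halve and at least one spacer is added, whence \<open>K + 1 \<le> K'\<close>. The
  pieces of the bottom level remain levels of the new column; the recursion for densities is read
  off from them.\<close>

lemma stage:
  assumes c: "posc c" "\<And>x. cnt c x = indicator {0..<K} x" "0 \<le> K" and aL: "0 < a" "2 \<le> L" and d: "0 < (\<delta>::real)"
  shows "\<exists>d K'. posc d \<and> (\<forall>x. cnt d x = indicator {0..<K'} x) \<and> K + 1 \<le> K' \<and> gr c \<subseteq> gr d \<and> cost d \<le> cost c + \<delta> \<and>
     (\<forall>W. (\<forall>p\<in>set c. snd p \<le> W) \<longrightarrow> (\<forall>p\<in>set d. snd p \<le> W / 2)) \<and> ivl (hd d) \<subseteq> ivl (hd c) \<and> ivl (last d) \<subseteq> ivl (last c) \<and>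
     (\<forall>(s,t)\<in>set (fracs a L). sublev s t (hd c) \<in> set d)"
proof -
  define css where "css = map (\<lambda>(s,t). cutc s t c) (fracs a L)"
  have L: "0 < L" using aL by simp
  note C = cut_all[OF c(1) aL(1) L, folded css_def]
  have len: "2 \<le> length css" using length_fracs[OF aL] by (simp add: css_def)
  then have ne: "css \<noteq> []" "fracs a L \<noteq> []" by (auto simp: css_def)
  have cne: "c \<noteq> []" using c by (simp add: posc_def)
  from link[OF ne(1) C(1) d, of K] obtain d K' where D: "posc d" "hd d = hd (hd css)" "last d = last (last css)"
    "\<And>x. cnt d x = CNT css x + indicator {K..<K'} x" "2 \<le> length css \<longrightarrow> K + 1 \<le> K'"
    "\<forall>c\<in>set css. set c \<subseteq> set d" "GR css \<subseteq> gr d" "cost d \<le> sum_list (map cost css) + \<delta>"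
    "\<And>W. (\<forall>c\<in>set css. \<forall>p\<in>set c. snd p \<le> W) \<Longrightarrow> (\<forall>p\<in>set d. snd p \<le> W)" by blast
  show ?thesis
  proof (intro exI[of _ d] exI[of _ K'] conjI allI impI)
    show "posc d" by (rule D(1))
    show KK: "K + 1 \<le> K'" using D(5) len by simp
    show "cnt d x = indicator {0..<K'} x" for x
      unfolding D(4) C(2) c(2) using KK c(3) by (auto split: split_indicator)
    show "gr c \<subseteq> gr d" using C(3) D(7) by simp
    show "cost d \<le> cost c + \<delta>" using D(8) C(4) by simp
    show "\<forall>p\<in>set d. snd p \<le> W / 2" if W: "\<forall>p\<in>set c. snd p \<le> W" for W
    proof (rule D(9), intro ballI)
      fix e p assume "e \<in> set css" "p \<in> set e"
      then obtain s t q where st: "(s,t) \<in> set (fracs a L)" "q \<in> set c" "p = sublev s t q" by (auto simp: css_def)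
      have "t - s \<le> 1 / real L" by (rule fracs_mem(4)[OF st(1) aL(1)])
      also have "\<dots> \<le> 1 / 2" using aL by (intro divide_left_mono) auto
      finally have "t - s \<le> 1 / 2" .
      moreover have q: "0 < snd q" "snd q \<le> W" using W st c by (auto simp: posc_def)
      ultimately have "snd q * (t - s) \<le> W * (1/2)"
        using fracs_mem(2)[OF st(1) aL(1)] by (intro mult_mono) auto
      then show "snd p \<le> W / 2" by (simp add: st sublev_def)
    qed
    have sub: "ivl (sublev s t p) \<subseteq> ivl p" if "(s,t) \<in> set (fracs a L)" "p \<in> set c" for s t p
      using fracs_mem[OF that(1) aL(1)] that(2) c by (intro ivl_sublev) (auto simp: posc_def)
    have "hd d = sublev (fst (hd (fracs a L))) (snd (hd (fracs a L))) (hd c)"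
      unfolding D(2) css_def using ne cne by (simp add: hd_map split_beta')
    then show "ivl (hd d) \<subseteq> ivl (hd c)" using sub[of "fst (hd (fracs a L))" "snd (hd (fracs a L))" "hd c"] ne cne by simp
    have "last d = sublev (fst (last (fracs a L))) (snd (last (fracs a L))) (last c)"
      unfolding D(3) css_def using ne cne by (simp add: last_map split_beta')
    then show "ivl (last d) \<subseteq> ivl (last c)" using sub[of "fst (last (fracs a L))" "snd (last (fracs a L))" "last c"] ne cne by simp
    show "\<forall>(s,t)\<in>set (fracs a L). sublev s t (hd c) \<in> set d"
      using D(6) cne by (fastforce simp: css_def)
  qed
qed

section \<open>Matching columns\<close>

text \<open>A label records the atom that contains the top of a column; this is the total width of
  the tops with label \<open>k\<close>.\<close>

definition toplab :: "nat \<Rightarrow> (nat \<times> lev list) list \<Rightarrow> real" where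
  "toplab k ws = (\<Sum>(l, w)\<leftarrow>ws. if l = k then snd (last w) else 0)"

lemma toplab_simps [simp]: "toplab k [] = 0" "toplab k ((l, w) # ws) = (if l = k then snd (last w) else 0) + toplab k ws"
  "toplab k (ws @ ws') = toplab k ws + toplab k ws'"
  by (auto simp: toplab_def)

text \<open>\<open>ws\<close> arises from cutting the columns \<open>us\<close> and \<open>vs\<close> and putting pieces of \<open>vs\<close> on top of pieces of \<open>us\<close>
  so that all new edges have width ratio \<open>\<rho>\<close>. The labels of \<open>vs\<close> are inherited.\<close>

definition matched :: "real \<Rightarrow> lev list list \<Rightarrow> (nat \<times> lev list) list \<Rightarrow> (nat \<times> lev list) list \<Rightarrow> bool" where
  "matched \<rho> us vs ws \<longleftrightarrow> (\<forall>(l, w)\<in>set ws. posc w) \<and>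
    (\<forall>x. CNT (map snd ws) x = CNT us x + CNT (map snd vs) x) \<and>
    GR us \<union> GR (map snd vs) \<subseteq> GR (map snd ws) \<and>
    (\<forall>k. toplab k ws = toplab k vs) \<and>
    (\<forall>(l, w)\<in>set ws. \<exists>(l', v)\<in>set vs. l' = l \<and> ivl (last w) \<subseteq> ivl (last v)) \<and>
    (\<forall>(x, y, r)\<in>GR (map snd ws). (x, y, r) \<in> GR us \<union> GR (map snd vs) \<or>
        (r = \<rho> \<and> (\<exists>u\<in>set us. x \<in> ivl (last u)) \<and> (\<exists>(l, v)\<in>set vs. y \<in> ivl (hd v)))) \<and>
    (\<forall>(l, v)\<in>set vs. \<forall>y\<in>ivl (hd v). \<exists>x r. (x, y, r) \<in> GR (map snd ws))"

lemma gr_pair: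
  assumes "0 < snd p" "0 < snd q"
  shows "(x, y, r) \<in> gr [p, q] \<Longrightarrow> x \<in> ivl p \<and> y \<in> ivl q \<and> r = snd p / snd q"
    "y \<in> ivl q \<Longrightarrow> \<exists>x r. (x, y, r) \<in> gr [p, q]"
proof -
  show "x \<in> ivl p \<and> y \<in> ivl q \<and> r = snd p / snd q" if "(x, y, r) \<in> gr [p, q]"
    using that assms by (auto simp: gr_def gr_at_def ivl_def)
  assume y: "y \<in> ivl q"
  define u where "u = (y - fst q) / snd q"
  have u: "0 \<le> u" "u < 1" "y = fst q + snd q * u" using y assms by (auto simp: u_def ivl_def field_simps)
  have "(fst p + snd p * u, fst q + snd q * u, snd p / snd q) \<in> gr [p, q]" by (rule grI) (use u in auto)
  then show "\<exists>x r. (x, y, r) \<in> gr [p, q]" using u(3) by auto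
qed

text \<open>Places \<open>v1\<close> on \<open>u1\<close> in front of a matching of the remaining
  columns. As \<open>u1\<close> or \<open>v1\<close> may be a piece of a cut column, the remainders
  are tied to \<open>us\<close> and \<open>vs\<close> only through counts, graphs, end levels and
  labels.\<close>

lemma matched_step:
  assumes m: "matched \<rho> us' vs' ws'"
    and u1: "posc u1" and v1: "posc v1" and eq: "snd (last u1) = \<rho> * snd (hd v1)"
    and cu: "\<And>x. cnt u1 x + CNT us' x = CNT us x"
    and cv: "\<And>x. cnt v1 x + CNT (map snd vs') x = CNT (map snd vs) x"
    and gu: "GR us = gr u1 \<union> GR us'" and gv: "GR (map snd vs) = gr v1 \<union> GR (map snd vs')"
    and tu: "\<And>u. u \<in> set (u1 # us') \<Longrightarrow> \<exists>u0\<in>set us. ivl (last u) \<subseteq> ivl (last u0)"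
    and tv: "\<And>l' v'. (l', v') \<in> set ((l, v1) # vs') \<Longrightarrow> \<exists>v0. (l', v0) \<in> set vs \<and> ivl (last v') \<subseteq> ivl (last v0) \<and> ivl (hd v') \<subseteq> ivl (hd v0)"
    and hv: "\<And>l0 v0. (l0, v0) \<in> set vs \<Longrightarrow> ivl (hd v0) \<subseteq> ivl (hd v1) \<union> (\<Union>(l', v')\<in>set vs'. ivl (hd v'))"
    and tl: "\<And>k. toplab k ((l, v1) # vs') = toplab k vs"
  shows "matched \<rho> us vs ((l, u1 @ v1) # ws')"
proof -
  have ne: "u1 \<noteq> []" "v1 \<noteq> []" and pos: "0 < snd (last u1)" "0 < snd (hd v1)" using u1 v1 by (auto simp: posc_def)
  have rho: "snd (last u1) / snd (hd v1) = \<rho>" using eq pos by simp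
  have g: "gr (u1 @ v1) = gr u1 \<union> gr v1 \<union> gr [last u1, hd v1]" by (rule gr_append[OF ne])
  note mm = m[unfolded matched_def]
  have mt: "toplab k ws' = toplab k vs'" for k using mm by blast
  show ?thesis unfolding matched_def
  proof (intro conjI allI)
    show "\<forall>(l, w)\<in>set ((l, u1 @ v1) # ws'). posc w" using mm posc_append[OF u1 v1] by auto
    show "CNT (map snd ((l, u1 @ v1) # ws')) x = CNT us x + CNT (map snd vs) x" for x
      using mm cu[of x] cv[of x] by simp
    show "GR us \<union> GR (map snd vs) \<subseteq> GR (map snd ((l, u1 @ v1) # ws'))" using mm g gu gv by auto
    show "toplab k ((l, u1 @ v1) # ws') = toplab k vs" for k using ne by (simp add: tl[of k, symmetric] mt)
    show "\<forall>(l', w)\<in>set ((l, u1 @ v1) # ws'). \<exists>(l'', v)\<in>set vs. l'' = l' \<and> ivl (last w) \<subseteq> ivl (last v)"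
    proof (intro ballI, clarify)
      fix l' w assume "(l', w) \<in> set ((l, u1 @ v1) # ws')"
      then consider "l' = l" "w = u1 @ v1" | "(l', w) \<in> set ws'" by auto
      then show "\<exists>(l'', v)\<in>set vs. l'' = l' \<and> ivl (last w) \<subseteq> ivl (last v)"
      proof cases
        case 1 then show ?thesis using tv[of l v1] ne by auto
      next
        case 2
        then obtain v where "(l', v) \<in> set vs'" "ivl (last w) \<subseteq> ivl (last v)" using mm by blast
        then show ?thesis using tv[of l' v] by auto
      qed
    qed
    show "\<forall>(x, y, r)\<in>GR (map snd ((l, u1 @ v1) # ws')). (x, y, r) \<in> GR us \<union> GR (map snd vs) \<or>
        (r = \<rho> \<and> (\<exists>u\<in>set us. x \<in> ivl (last u)) \<and> (\<exists>(l, v)\<in>set vs. y \<in> ivl (hd v)))"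
    proof (intro ballI, clarify)
      fix x y r assume no: "\<not> (r = \<rho> \<and> (\<exists>u\<in>set us. x \<in> ivl (last u)) \<and> (\<exists>(l, v)\<in>set vs. y \<in> ivl (hd v)))"
        "(x, y, r) \<notin> GR (map snd vs)"
        and "(x, y, r) \<in> GR (map snd ((l, u1 @ v1) # ws'))"
      then consider "(x, y, r) \<in> gr u1 \<union> gr v1" | "(x, y, r) \<in> gr [last u1, hd v1]" | "(x, y, r) \<in> GR (map snd ws')"
        using g by auto
      then show "(x, y, r) \<in> GR us"
      proof cases
        case 1 then show ?thesis using gu gv no by auto
      next
        case 2
        then have "x \<in> ivl (last u1)" "y \<in> ivl (hd v1)" "r = \<rho>" using gr_pair(1)[OF pos] rho by auto
        then show ?thesis using no(1) tu[of u1] tv[of l v1] by fastforce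
      next
        case 3
        then consider "(x, y, r) \<in> GR us' \<union> GR (map snd vs')" | u l' v' where "r = \<rho>" "u \<in> set us'" "x \<in> ivl (last u)" "(l', v') \<in> set vs'" "y \<in> ivl (hd v')"
          using mm by fast
        then show ?thesis
        proof cases
          case 1 then show ?thesis using gu gv no by auto
        next
          case 2
          then show ?thesis using no(1) tu[of u] tv[of l' v'] by fastforce
        qed
      qed
    qed
    show "\<forall>(l', v)\<in>set vs. \<forall>y\<in>ivl (hd v). \<exists>x r. (x, y, r) \<in> GR (map snd ((l, u1 @ v1) # ws'))"
    proof (intro ballI, clarify)
      fix l0 v0 y assume "(l0, v0) \<in> set vs" "y \<in> ivl (hd v0)"
      then consider "y \<in> ivl (hd v1)" | l' v' where "(l', v') \<in> set vs'" "y \<in> ivl (hd v')" using hv by fastforce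
      then show "\<exists>x r. (x, y, r) \<in> GR (map snd ((l, u1 @ v1) # ws'))"
      proof cases
        case 1
        then obtain x r where "(x, y, r) \<in> gr [last u1, hd v1]" using gr_pair(2)[OF pos] by blast
        then have "(x, y, r) \<in> GR (map snd ((l, u1 @ v1) # ws'))" using g by simp
        then show ?thesis by blast
      next
        case 2
        then obtain x r where "(x, y, r) \<in> GR (map snd ws')" using mm by fast
        then have "(x, y, r) \<in> GR (map snd ((l, u1 @ v1) # ws'))" by simp
        then show ?thesis by blast
      qed
    qed
  qed
qed

lemma cut_two:
  assumes c: "posc c" and s: "0 < s" "s < 1"
  shows "posc (cutc 0 s c)" "posc (cutc s 1 c)" "cnt (cutc 0 s c) x + cnt (cutc s 1 c) x = cnt c x"
    "gr c = gr (cutc 0 s c) \<union> gr (cutc s 1 c)"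
    "ivl (hd (cutc 0 s c)) \<subseteq> ivl (hd c)" "ivl (hd (cutc s 1 c)) \<subseteq> ivl (hd c)"
    "ivl (hd c) \<subseteq> ivl (hd (cutc 0 s c)) \<union> ivl (hd (cutc s 1 c))"
    "ivl (last (cutc 0 s c)) \<subseteq> ivl (last c)" "ivl (last (cutc s 1 c)) \<subseteq> ivl (last c)"
    "snd (hd (cutc 0 s c)) = snd (hd c) * s" "snd (hd (cutc s 1 c)) = snd (hd c) * (1 - s)"
    "snd (last (cutc 0 s c)) = snd (last c) * s" "snd (last (cutc s 1 c)) = snd (last c) * (1 - s)"
proof -
  have ne: "c \<noteq> []" and p: "0 < snd (hd c)" "0 < snd (last c)" using c by (auto simp: posc_def)
  show "posc (cutc 0 s c)" "posc (cutc s 1 c)" using c s by (auto intro: posc_cut)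
  show "cnt (cutc 0 s c) x + cnt (cutc s 1 c) x = cnt c x"
    using cnt_cut[OF c, of 0 s x] cnt_cut[OF c, of s 1 x] cnt_cut[OF c, of 0 1 x] s by simp
  show "gr c = gr (cutc 0 s c) \<union> gr (cutc s 1 c)" using gr_split[of c s] gr_cut[of 0 s c] gr_cut[of s 1 c] s by auto
  show "ivl (hd (cutc 0 s c)) \<subseteq> ivl (hd c)" "ivl (hd (cutc s 1 c)) \<subseteq> ivl (hd c)"
    "ivl (last (cutc 0 s c)) \<subseteq> ivl (last c)" "ivl (last (cutc s 1 c)) \<subseteq> ivl (last c)"
    using ne p s by (simp_all add: hd_map last_map ivl_sublev less_imp_le)
  show "ivl (hd c) \<subseteq> ivl (hd (cutc 0 s c)) \<union> ivl (hd (cutc s 1 c))" using ivl_split ne by (simp add: hd_map)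
  show "snd (hd (cutc 0 s c)) = snd (hd c) * s" "snd (hd (cutc s 1 c)) = snd (hd c) * (1 - s)"
    "snd (last (cutc 0 s c)) = snd (last c) * s" "snd (last (cutc s 1 c)) = snd (last c) * (1 - s)"
    using ne by (auto simp: hd_map last_map sublev_def)
qed

text \<open>Place the first \<open>v\<close> on the first \<open>u\<close>; if
  \<open>snd (last u)\<close> and \<open>\<rho> * snd (hd v)\<close> differ, cut the column that is
  too wide and return the remainder to its list. Every round uses up a column, and equal totals make
  both lists end together.\<close>

lemma greedy:
  assumes "0 < \<rho>" "\<forall>u\<in>set us. posc u" "\<forall>(l, v)\<in>set vs. posc v"
    "(\<Sum>u\<leftarrow>us. snd (last u)) = \<rho> * (\<Sum>(l, v)\<leftarrow>vs. snd (hd v))"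
  shows "\<exists>ws. matched \<rho> us vs ws"
  using assms(2-)
proof (induction "length us + length vs" arbitrary: us vs rule: less_induct)
  case less
  have lp: "0 < snd (last u)" if "u \<in> set us" for u using less.prems(1) that by (auto simp: posc_def)
  have hp: "0 < snd (hd v)" if "(l, v) \<in> set vs" for l v using less.prems(2) that by (auto simp: posc_def)
  show ?case
  proof (cases us)
    case Nil
    have "vs = []"
    proof (cases vs)
      case (Cons z vs')
      obtain l v where z: "z = (l, v)" by fastforce
      have "0 \<le> (\<Sum>(l, v)\<leftarrow>vs'. snd (hd v))" using hp Cons by (intro sum_list_nonneg) (force intro: less_imp_le)
      moreover have "0 < snd (hd v)" using hp Cons z by auto
      ultimately have "0 < \<rho> * (\<Sum>(l, v)\<leftarrow>vs. snd (hd v))" using assms(1) Cons z by simp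
      then show ?thesis using less.prems(3) unfolding Nil list.map sum_list.Nil by linarith
    qed simp
    then show ?thesis using Nil by (intro exI[of _ "[]"]) (simp add: matched_def)
  next
    case (Cons u us')
    note us = Cons
    have u: "posc u" using less.prems(1) us by simp
    have a: "0 < snd (last u)" using lp us by simp
    show ?thesis
    proof (cases vs)
      case Nil
      have "0 \<le> (\<Sum>u\<leftarrow>us'. snd (last u))" using lp us by (intro sum_list_nonneg) (force intro: less_imp_le)
      then show ?thesis using less.prems(3) Nil us a by simp
    next
      case (Cons z vs')
      obtain l v where z: "z = (l, v)" by fastforce
      note vs = Cons[unfolded z]
      have v: "posc v" using less.prems(2) vs by simp
      have b: "0 < \<rho> * snd (hd v)" using hp[of l v] vs assms(1) by simp
      have tot: "snd (last u) + (\<Sum>u\<leftarrow>us'. snd (last u)) = \<rho> * snd (hd v) + \<rho> * (\<Sum>(l, v)\<leftarrow>vs'. snd (hd v))"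
        using less.prems(3) us vs by (simp add: distrib_left)
      consider "snd (last u) = \<rho> * snd (hd v)" | "snd (last u) < \<rho> * snd (hd v)" | "\<rho> * snd (hd v) < snd (last u)" by linarith
      then show ?thesis
      proof cases
        case 1
        have "\<exists>ws. matched \<rho> us' vs' ws"
          by (rule less.hyps) (use less.prems us vs tot 1 in auto)
        then obtain ws where "matched \<rho> us' vs' ws" ..
        then have "matched \<rho> us vs ((l, u @ v) # ws)"
        proof (rule matched_step[OF _ u v 1])
          show "\<exists>v0. (l', v0) \<in> set vs \<and> ivl (last v') \<subseteq> ivl (last v0) \<and> ivl (hd v') \<subseteq> ivl (hd v0)"
            if "(l', v') \<in> set ((l, v) # vs')" for l' v'
            using that vs by (intro exI[of _ v']) auto
        qed (use us vs in auto)
        then show ?thesis by blast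
      next
        case 2
        \<comment> \<open>The fraction of \<open>v\<close> whose bottom width fits on
          \<open>u\<close>.\<close>
        define s where "s = snd (last u) / (\<rho> * snd (hd v))"
        have s: "0 < s" "s < 1" using a b 2 by (auto simp: s_def)
        have se: "snd (last u) = \<rho> * (snd (hd v) * s)" using b by (auto simp: s_def)
        note c = cut_two[OF v s]
        have "\<exists>ws. matched \<rho> us' ((l, cutc s 1 v) # vs') ws"
        proof (rule less.hyps)
          show "length us' + length ((l, cutc s 1 v) # vs') < length us + length vs" using us vs by simp
          show "\<forall>u\<in>set us'. posc u" using less.prems us by simp
          show "\<forall>(l, v)\<in>set ((l, cutc s 1 v) # vs'). posc v" using less.prems vs c(2) by simp
          show "(\<Sum>u\<leftarrow>us'. snd (last u)) = \<rho> * (\<Sum>(l, v)\<leftarrow>(l, cutc s 1 v) # vs'. snd (hd v))"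
            using tot se by (simp add: c(11) algebra_simps)
        qed
        then obtain ws where "matched \<rho> us' ((l, cutc s 1 v) # vs') ws" ..
        then have "matched \<rho> us vs ((l, u @ cutc 0 s v) # ws)"
        proof (rule matched_step[OF _ u c(1)])
          show "snd (last u) = \<rho> * snd (hd (cutc 0 s v))" using se by (simp add: c(10))
          show "cnt (cutc 0 s v) x + CNT (map snd ((l, cutc s 1 v) # vs')) x = CNT (map snd vs) x" for x
            using c(3)[of x] vs by simp
          show "GR (map snd vs) = gr (cutc 0 s v) \<union> GR (map snd ((l, cutc s 1 v) # vs'))" using c(4) vs by auto
          show "\<exists>v0. (l', v0) \<in> set vs \<and> ivl (last v') \<subseteq> ivl (last v0) \<and> ivl (hd v') \<subseteq> ivl (hd v0)"
            if "(l', v') \<in> set ((l, cutc 0 s v) # (l, cutc s 1 v) # vs')" for l' v'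
          proof -
            from that consider "l' = l" "v' = cutc 0 s v" | "l' = l" "v' = cutc s 1 v" | "(l', v') \<in> set vs'" by auto
            then show ?thesis
            proof cases
              case 1 show ?thesis unfolding 1 by (intro exI[of _ v] conjI c) (simp add: vs)
            next
              case 2 show ?thesis unfolding 2 by (intro exI[of _ v] conjI c) (simp add: vs)
            next
              case 3 then show ?thesis by (intro exI[of _ v']) (simp add: vs)
            qed
          qed
          show "ivl (hd v0) \<subseteq> ivl (hd (cutc 0 s v)) \<union> (\<Union>(l', v')\<in>set ((l, cutc s 1 v) # vs'). ivl (hd v'))"
            if "(l0, v0) \<in> set vs" for l0 v0 using that vs c(7) by auto
          show "toplab k ((l, cutc 0 s v) # (l, cutc s 1 v) # vs') = toplab k vs" for k
            using vs by (simp add: c(12,13) algebra_simps)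
        qed (use us in auto)
        then show ?thesis by blast
      next
        case 3
        \<comment> \<open>The fraction of \<open>u\<close> that carries all of
          \<open>v\<close>.\<close>
        define s where "s = \<rho> * snd (hd v) / snd (last u)"
        have s: "0 < s" "s < 1" using a b 3 by (auto simp: s_def)
        have se: "snd (last u) * s = \<rho> * snd (hd v)" using a by (simp add: s_def)
        note c = cut_two[OF u s]
        have "\<exists>ws. matched \<rho> (cutc s 1 u # us') vs' ws"
        proof (rule less.hyps)
          show "length (cutc s 1 u # us') + length vs' < length us + length vs" using us vs by simp
          show "\<forall>u\<in>set (cutc s 1 u # us'). posc u" using less.prems us c(2) by simp
          show "\<forall>(l, v)\<in>set vs'. posc v" using less.prems vs by simp
          show "(\<Sum>u\<leftarrow>cutc s 1 u # us'. snd (last u)) = \<rho> * (\<Sum>(l, v)\<leftarrow>vs'. snd (hd v))"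
            using tot se by (simp add: c(13) algebra_simps)
        qed
        then obtain ws where "matched \<rho> (cutc s 1 u # us') vs' ws" ..
        then have "matched \<rho> us vs ((l, cutc 0 s u @ v) # ws)"
        proof (rule matched_step[OF _ c(1) v])
          show "snd (last (cutc 0 s u)) = \<rho> * snd (hd v)" using se by (simp add: c(12))
          show "cnt (cutc 0 s u) x + CNT (cutc s 1 u # us') x = CNT us x" for x using c(3)[of x] us by simp
          show "GR us = gr (cutc 0 s u) \<union> GR (cutc s 1 u # us')" using c(4) us by auto
          show "\<exists>u0\<in>set us. ivl (last u') \<subseteq> ivl (last u0)" if "u' \<in> set (cutc 0 s u # cutc s 1 u # us')" for u'
            using that us c(8,9) by auto
          show "\<exists>v0. (l', v0) \<in> set vs \<and> ivl (last v') \<subseteq> ivl (last v0) \<and> ivl (hd v') \<subseteq> ivl (hd v0)"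
            if "(l', v') \<in> set ((l, v) # vs')" for l' v'
            using that vs by (intro exI[of _ v']) auto
        qed (use vs in auto)
        then show ?thesis by blast
      qed
    qed
  qed
qed

section \<open>Initial columns from labelled atoms\<close>

lemma sum_list_partition:
  assumes "\<And>x. x \<in> set xs \<Longrightarrow> g x \<le> (m::nat)"
  shows "sum_list (map f xs) = (\<Sum>i\<le>m. sum_list (map f (filter (\<lambda>x. g x = i) xs)) :: real)"
  using assms
proof (induction xs)
  case (Cons x xs)
  have "(\<Sum>i\<le>m. sum_list (map f (filter (\<lambda>x. g x = i) (x # xs))))
      = (\<Sum>i\<le>m. (if g x = i then f x else 0) + sum_list (map f (filter (\<lambda>x. g x = i) xs)))"
    by (rule sum.cong) auto
  also have "\<dots> = f x + sum_list (map f xs)" using Cons by (simp add: sum.distrib)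
  finally show ?case by simp
qed simp

lemma sum_list_toplab:
  assumes "finite S" "\<And>k c. (k, c) \<in> set xs \<Longrightarrow> k \<in> S"
  shows "(\<Sum>(k, c)\<leftarrow>xs. snd (last c)) = (\<Sum>k\<in>S. toplab k xs)"
  using assms(2)
proof (induction xs)
  case (Cons z xs)
  obtain l c where z: "z = (l, c)" by fastforce
  have "l \<in> S" using Cons.prems z by auto
  moreover have "(\<Sum>(k, c)\<leftarrow>xs. snd (last c)) = (\<Sum>k\<in>S. toplab k xs)"
    by (rule Cons.IH) (use Cons.prems in auto)
  ultimately show ?case using assms(1) by (simp add: z sum.distrib)
qed simp

lemma toplab_filter: "P k \<Longrightarrow> toplab k (filter (\<lambda>z. P (fst z)) xs) = toplab k xs"
  by (induction xs) auto

lemma toplab_strips: "distinct ks \<Longrightarrow> toplab k (map (\<lambda>k. (k, [f k])) ks) = (if k \<in> set ks then snd (f k) else 0)"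
  by (induction ks) auto

lemma CNT_sum_list: "CNT css x = sum_list (map (\<lambda>c. cnt c x) css)"
  by (simp add: CNT_def)

lemma CNT_concat: "CNT (concat xss) x = (\<Sum>xs\<leftarrow>xss. CNT xs x)"
  by (induction xss) auto

lemma toplab_concat: "toplab k (concat xss) = (\<Sum>xs\<leftarrow>xss. toplab k xs)"
  by (induction xss) auto

lemma GR_mono: "set xs \<subseteq> set ys \<Longrightarrow> GR xs \<subseteq> GR ys"
  by (auto simp: GR_def)

text \<open>Atoms with \<open>p k = i\<close> form P_i, those with \<open>q k = i\<close> form R_i,
  and an atom may serve both; label 0 means no piece. With every atom cut into \<open>N\<close>
  strips, the tops in one strip of P_i are matched with the next strip of R_i, and the growing strip
  index excludes cycles. Only the first strips of the R_i remain unreached.\<close>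

lemma initial_columns:
  fixes n m N :: nat and w :: "nat \<Rightarrow> real" and p q :: "nat \<Rightarrow> nat"
  assumes w: "\<And>k. k < n \<Longrightarrow> 0 \<le> w k" and pq: "\<And>k. k < n \<Longrightarrow> p k \<le> m \<and> q k \<le> m" and N: "0 < N"
    and PW: "\<And>i. i \<in> {1..m} \<Longrightarrow> 0 < (\<Sum>k | k < n \<and> p k = i. w k)"
    and RW: "\<And>i. i \<in> {1..m} \<Longrightarrow> 0 < (\<Sum>k | k < n \<and> q k = i. w k)"
  defines "atom \<equiv> \<lambda>k. ((\<Sum>j<k. w j), w k)"
  shows "\<exists>css. (\<forall>c\<in>set css. posc c) \<and> (\<forall>x. CNT css x = indicator {0..<\<Sum>k<n. w k} x) \<and>
    (\<forall>(x, y, r)\<in>GR css. \<exists>i\<in>{1..m}. (\<exists>k<n. p k = i \<and> x \<in> ivl (atom k)) \<and> (\<exists>k<n. q k = i \<and> y \<in> ivl (atom k)) \<and>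
        r = (\<Sum>k | k < n \<and> p k = i. w k) / (\<Sum>k | k < n \<and> q k = i. w k)) \<and>
    (\<forall>k<n. q k \<in> {1..m} \<longrightarrow> (\<forall>y\<in>ivl (atom k). y \<in> ivl (sublev 0 (1 / real N) (atom k)) \<or> (\<exists>x r. (x, y, r) \<in> GR css)))"
proof -
  \<comment> \<open>Atoms of width 0 are dropped, since levels of a column must have positive
    width.\<close>
  define ks where "ks = filter (\<lambda>k. 0 < w k) [0..<n]"
  have dks: "distinct ks" by (simp add: ks_def)
  have ksm: "k \<in> set ks \<longleftrightarrow> k < n \<and> 0 < w k" for k by (auto simp: ks_def)
  define strip where "strip k j = sublev (real j / real N) (real (Suc j) / real N) (atom k)" for k j
  define \<rho> where "\<rho> i = (\<Sum>k | k < n \<and> p k = i. w k) / (\<Sum>k | k < n \<and> q k = i. w k)" for i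
  have atm: "snd (atom k) = w k" for k by (simp add: atom_def)
  have sw: "snd (strip k j) = w k / real N" for k j
    by (simp add: strip_def sublev_def atm diff_divide_distrib[symmetric])
  have ssub: "ivl (strip k j) \<subseteq> ivl (atom k)" if "k \<in> set ks" "j < N" for k j
    unfolding strip_def using that N by (intro ivl_sublev) (auto simp: atm ksm divide_right_mono)
  have sp: "posc [strip k j]" if "k \<in> set ks" for k j using that N by (simp add: posc_def sw ksm)
  define okg where "okg G \<longleftrightarrow> (\<forall>(x, y, r)\<in>G. \<exists>i\<in>{1..m}. (\<exists>k<n. p k = i \<and> x \<in> ivl (atom k)) \<and> (\<exists>k<n. q k = i \<and> y \<in> ivl (atom k)) \<and> r = \<rho> i)"
    for G :: "(real \<times> real \<times> real) set"
  \<comment> \<open>After \<open>j\<close> strips: \<open>D\<close> holds finished columns,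
    \<open>A\<close> the active ones, labelled by the atom of their top. The tops with label
    \<open>k\<close> have total width \<open>w k / N\<close>, that of a strip, and all columns
    together fill the first \<open>j\<close> strips of every atom.\<close>
  define Inv where "Inv j D A \<longleftrightarrow> (\<forall>c\<in>set D. posc c) \<and> (\<forall>(k, c)\<in>set A. posc c \<and> k \<in> set ks \<and> ivl (last c) \<subseteq> ivl (atom k)) \<and>
     (\<forall>x. CNT D x + CNT (map snd A) x = (\<Sum>k\<leftarrow>ks. indicator (ivl (sublev 0 (real j / real N) (atom k))) x)) \<and>
     (\<forall>k\<in>set ks. toplab k A = w k / real N) \<and> okg (GR D \<union> GR (map snd A)) \<and>
     (\<forall>k\<in>set ks. q k \<in> {1..m} \<longrightarrow> (\<forall>y\<in>ivl (sublev 0 (real j / real N) (atom k)).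
        y \<in> ivl (sublev 0 (1 / real N) (atom k)) \<or> (\<exists>x r. (x, y, r) \<in> GR D \<union> GR (map snd A))))"
    for j D and A :: "(nat \<times> lev list) list"
  have ind_step: "indicator (ivl (sublev 0 (real (Suc j) / real N) (atom k))) x
     = indicator (ivl (sublev 0 (real j / real N) (atom k))) x + (indicator (ivl (strip k j)) x :: real)"
    if "k \<in> set ks" for k j x
  proof -
    have c: "posc [atom k]" using that by (simp add: posc_def atm ksm)
    have le: "real j / real N \<le> real (Suc j) / real N" by (rule divide_right_mono) auto
    show ?thesis using cnt_cut[OF c, of 0 "real (Suc j) / real N" x] cnt_cut[OF c, of 0 "real j / real N" x]
      cnt_cut[OF c le, of x] unfolding strip_def by (simp add: cnt_def)
  qed
  have gr1: "gr [z] = {}" for z by (simp add: gr_def gr_at_def)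
  have GR1: "GR (map snd (map (\<lambda>k. (k, [f k])) ls)) = {}" for f :: "nat \<Rightarrow> lev" and ls by (auto simp: GR_def gr1)
  have ex: "\<exists>D A. Inv (Suc j) D A" if "Suc j \<le> N" for j using that
  proof (induction j)
    case 0
    let ?A = "map (\<lambda>k. (k, [strip k 0])) ks"
    have "Inv (Suc 0) [] ?A" unfolding Inv_def
    proof (intro conjI allI ballI impI)
      show "case z of (k, c) \<Rightarrow> posc c \<and> k \<in> set ks \<and> ivl (last c) \<subseteq> ivl (atom k)" if "z \<in> set ?A" for z
      proof -
        from that obtain k where k: "z = (k, [strip k 0])" "k \<in> set ks" by auto
        show ?thesis using k sp[OF k(2)] ssub[OF k(2) N] by simp
      qed
      show "CNT [] x + CNT (map snd ?A) x = (\<Sum>k\<leftarrow>ks. indicator (ivl (sublev 0 (real (Suc 0) / real N) (atom k))) x)" for x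
        by (simp add: CNT_def o_def cnt_def strip_def)
      show "toplab k ?A = w k / real N" if "k \<in> set ks" for k using that by (simp add: toplab_strips[OF dks] sw)
      show "okg (GR [] \<union> GR (map snd ?A))" unfolding GR1 by (simp add: okg_def)
    qed auto
    then show ?case by blast
  next
    case (Suc j)
    then obtain D A where I: "Inv (Suc j) D A" by auto
    note I' = I[unfolded Inv_def]
    have Aok: "posc c" "k \<in> set ks" "ivl (last c) \<subseteq> ivl (atom k)" if "(k, c) \<in> set A" for k c using I' that by auto
    \<comment> \<open>\<open>us i\<close> are the active columns with top in P_i;
      \<open>vs i\<close> below are the next strips of R_i. Their total widths are those of P_i and
      R_i divided by \<open>N\<close>, hence in ratio \<open>\<rho> i\<close>.\<close>
    define us where "us i = map snd (filter (\<lambda>z. p (fst z) = i) A)" for i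
    define V where "V = map (\<lambda>k. (k, [strip k (Suc j)])) ks"
    define vs where "vs i = filter (\<lambda>z. q (fst z) = i) V" for i
    have Vmem: "(k, v) \<in> set V \<longleftrightarrow> k \<in> set ks \<and> v = [strip k (Suc j)]" for k v by (auto simp: V_def)
    have "\<exists>ws. matched (\<rho> i) (us i) (vs i) ws" if i: "i \<in> {1..m}" for i
    proof (rule greedy)
      show "0 < \<rho> i" using PW[OF i] RW[OF i] by (simp add: \<rho>_def)
      show "\<forall>u\<in>set (us i). posc u" using Aok by (auto simp: us_def)
      show "\<forall>(l, v)\<in>set (vs i). posc v" using sp by (auto simp: vs_def Vmem)
      have drop0: "(\<Sum>k | k \<in> set ks \<and> P k. w k) = (\<Sum>k | k < n \<and> P k. w k)" for P
        using w by (intro sum.mono_neutral_left) (auto simp: ksm less_le)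
      have "(\<Sum>u\<leftarrow>us i. snd (last u)) = (\<Sum>(k, c)\<leftarrow>filter (\<lambda>z. p (fst z) = i) A. snd (last c))"
        by (simp add: us_def o_def split_beta')
      also have "\<dots> = (\<Sum>k\<in>{k \<in> set ks. p k = i}. toplab k (filter (\<lambda>z. p (fst z) = i) A))"
        by (rule sum_list_toplab) (use Aok(2) in auto)
      also have "\<dots> = (\<Sum>k\<in>{k \<in> set ks. p k = i}. w k / real N)"
        using I' toplab_filter[of "\<lambda>k. p k = i"] by (intro sum.cong) auto
      also have "\<dots> = (\<Sum>k | k < n \<and> p k = i. w k) / real N" unfolding drop0[symmetric] by (simp add: sum_divide_distrib)
      finally have 1: "(\<Sum>u\<leftarrow>us i. snd (last u)) = (\<Sum>k | k < n \<and> p k = i. w k) / real N" .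
      have "(\<Sum>(l, v)\<leftarrow>vs i. snd (hd v)) = (\<Sum>(l, v)\<leftarrow>vs i. snd (last v))"
        by (intro arg_cong[where f=sum_list] map_cong) (auto simp: vs_def Vmem)
      also have "\<dots> = (\<Sum>k\<in>{k \<in> set ks. q k = i}. toplab k (vs i))"
        by (rule sum_list_toplab) (auto simp: vs_def Vmem)
      also have "\<dots> = (\<Sum>k\<in>{k \<in> set ks. q k = i}. w k / real N)"
        unfolding vs_def V_def using toplab_filter[of "\<lambda>k. q k = i"] by (intro sum.cong) (auto simp: toplab_strips[OF dks] sw)
      also have "\<dots> = (\<Sum>k | k < n \<and> q k = i. w k) / real N" unfolding drop0[symmetric] by (simp add: sum_divide_distrib)
      finally have 2: "(\<Sum>(l, v)\<leftarrow>vs i. snd (hd v)) = (\<Sum>k | k < n \<and> q k = i. w k) / real N" .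
      show "(\<Sum>u\<leftarrow>us i. snd (last u)) = \<rho> i * (\<Sum>(l, v)\<leftarrow>vs i. snd (hd v))"
        unfolding 1 2 \<rho>_def using RW[OF i] by simp
    qed
    then obtain W0 where W0: "\<And>i. i \<in> {1..m} \<Longrightarrow> matched (\<rho> i) (us i) (vs i) (W0 i)" by metis
    \<comment> \<open>Label 0 is not matched: the columns \<open>us 0\<close> retire into
      \<open>D'\<close>, and the strips \<open>vs 0\<close> start new columns of one level.\<close>
    define W where "W i = (if i = 0 then vs 0 else W0 i)" for i
    define A' where "A' = concat (map W [0..<Suc m])"
    define D' where "D' = D @ us 0"
    have Wm: "matched (\<rho> i) (us i) (vs i) (W i)" if "i \<in> {1..m}" for i using W0[OF that] that by (simp add: W_def)
    have Amem: "z \<in> set A' \<longleftrightarrow> (\<exists>i\<le>m. z \<in> set (W i))" for z by (auto simp: A'_def less_Suc_eq_le simp del: upt_Suc)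
    have Wcnt: "CNT (map snd (W i)) x = (if i = 0 then 0 else CNT (us i) x) + CNT (map snd (vs i)) x" if "i \<le> m" for i x
      using Wm[of i] that by (cases "i = 0") (auto simp: W_def matched_def)
    have Wtop: "toplab k (W i) = toplab k (vs i)" if "i \<le> m" for i k
      using Wm[of i] that by (cases "i = 0") (auto simp: W_def matched_def)
    have Wlab: "\<exists>v. (k, v) \<in> set (vs i) \<and> ivl (last c) \<subseteq> ivl (last v) \<and> posc c" if "i \<le> m" "(k, c) \<in> set (W i)" for i k c
    proof (cases "i = 0")
      case True
      then show ?thesis using that sp by (auto simp: W_def vs_def Vmem)
    next
      case False
      then have "matched (\<rho> i) (us i) (vs i) (W i)" using Wm that by auto
      then show ?thesis using that(2) unfolding matched_def by fast
    qed
    have pA: "p (fst z) \<le> m" if "z \<in> set A" for z using Aok(2)[of "fst z" "snd z"] that pq ksm by simp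
    have qV: "q (fst z) \<le> m" if "z \<in> set V" for z using Vmem[of "fst z" "snd z"] that pq ksm by simp
    have GV: "GR (map snd (vs i)) = {}" for i by (auto simp: vs_def V_def GR_def gr1)
    have GRA: "GR (map snd A) \<subseteq> GR D' \<union> GR (map snd A')"
    proof
      fix g assume "g \<in> GR (map snd A)"
      then obtain k c where kc: "(k, c) \<in> set A" "g \<in> gr c" by (auto simp: GR_def)
      then have "c \<in> set (us (p k))" by (force simp: us_def)
      then have g: "g \<in> GR (us (p k))" using kc by (auto simp: GR_def)
      show "g \<in> GR D' \<union> GR (map snd A')"
      proof (cases "p k = 0")
        case True then show ?thesis using g by (simp add: D'_def)
      next
        case False
        then have pk: "p k \<in> {1..m}" using pA[OF kc(1)] by auto
        then have "g \<in> GR (map snd (W (p k)))" using Wm[OF pk] g unfolding matched_def by blast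
        moreover have "set (map snd (W (p k))) \<subseteq> set (map snd A')" using pk Amem by (auto simp: image_iff)
        ultimately show ?thesis using GR_mono by blast
      qed
    qed
    have GRD: "GR D \<subseteq> GR D'" by (simp add: D'_def)
    have usA: "(\<exists>k. (k, u) \<in> set A \<and> p k = i)" if "u \<in> set (us i)" for u i using that by (auto simp: us_def)
    have "Inv (Suc (Suc j)) D' A'" unfolding Inv_def
    proof (intro conjI allI)
      have "\<forall>c\<in>set (us 0). posc c" using Aok(1) usA by blast
      then show "\<forall>c\<in>set D'. posc c" using I' by (auto simp: D'_def)
      show "\<forall>(k, c)\<in>set A'. posc c \<and> k \<in> set ks \<and> ivl (last c) \<subseteq> ivl (atom k)"
      proof (intro ballI, clarify)
        fix k c assume "(k, c) \<in> set A'"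
        then obtain i where "i \<le> m" "(k, c) \<in> set (W i)" using Amem by blast
        from Wlab[OF this] obtain v where "(k, v) \<in> set (vs i)" "ivl (last c) \<subseteq> ivl (last v)" "posc c" by blast
        moreover then have "k \<in> set ks" "v = [strip k (Suc j)]" by (auto simp: vs_def Vmem)
        ultimately show "posc c \<and> k \<in> set ks \<and> ivl (last c) \<subseteq> ivl (atom k)"
          using ssub[of k "Suc j"] Suc.prems by auto
      qed
      show "CNT D' x + CNT (map snd A') x = (\<Sum>k\<leftarrow>ks. indicator (ivl (sublev 0 (real (Suc (Suc j)) / real N) (atom k))) x)" for x
      proof -
        have "CNT (map snd A') x = (\<Sum>i\<le>m. CNT (map snd (W i)) x)"
          by (simp add: A'_def map_concat CNT_concat o_def interv_sum_list_conv_sum_set_nat atLeast0LessThan lessThan_Suc_atMost del: upt_Suc)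
        also have "\<dots> = (\<Sum>i\<le>m. (if i = 0 then 0 else CNT (us i) x) + CNT (map snd (vs i)) x)"
          by (intro sum.cong) (auto simp: Wcnt)
        also have "\<dots> = (\<Sum>i\<le>m. if i = 0 then 0 else CNT (us i) x) + (\<Sum>i\<le>m. CNT (map snd (vs i)) x)"
          by (rule sum.distrib)
        also have "(\<Sum>i\<le>m. CNT (map snd (vs i)) x) = CNT (map snd V) x"
          unfolding CNT_sum_list vs_def map_map by (rule sum_list_partition[symmetric]) (rule qV)
        finally have 1: "CNT (map snd A') x = (\<Sum>i\<le>m. if i = 0 then 0 else CNT (us i) x) + CNT (map snd V) x" .
        have "CNT (map snd A) x = (\<Sum>i\<le>m. CNT (us i) x)"
          unfolding CNT_sum_list us_def map_map by (rule sum_list_partition) (rule pA)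
        also have "\<dots> = CNT (us 0) x + (\<Sum>i\<le>m. if i = 0 then 0 else CNT (us i) x)"
        proof -
          have "(\<Sum>i\<le>m. CNT (us i) x) = (\<Sum>i\<le>m. (if i = 0 then CNT (us 0) x else 0) + (if i = 0 then 0 else CNT (us i) x))"
            by (rule sum.cong) auto
          then show ?thesis by (simp add: sum.distrib)
        qed
        finally have 2: "CNT (map snd A) x = CNT (us 0) x + (\<Sum>i\<le>m. if i = 0 then 0 else CNT (us i) x)" .
        have 3: "CNT (map snd V) x = (\<Sum>k\<leftarrow>ks. indicator (ivl (strip k (Suc j))) x)"
          by (simp add: V_def CNT_def o_def cnt_def)
        have "CNT D' x + CNT (map snd A') x = (CNT D x + CNT (map snd A) x) + CNT (map snd V) x"
          unfolding 1 2 D'_def by simp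
        also have "\<dots> = (\<Sum>k\<leftarrow>ks. indicator (ivl (sublev 0 (real (Suc j) / real N) (atom k))) x + indicator (ivl (strip k (Suc j))) x)"
          using I' unfolding 3 sum_list_addf by simp
        also have "\<dots> = (\<Sum>k\<leftarrow>ks. indicator (ivl (sublev 0 (real (Suc (Suc j)) / real N) (atom k))) x)"
          by (intro arg_cong[where f=sum_list] map_cong refl ind_step[symmetric])
        finally show ?thesis .
      qed
      show "\<forall>k\<in>set ks. toplab k A' = w k / real N"
      proof
        fix k assume k: "k \<in> set ks"
        have "toplab k A' = (\<Sum>i\<le>m. toplab k (W i))"
          by (simp add: A'_def toplab_concat o_def interv_sum_list_conv_sum_set_nat atLeast0LessThan lessThan_Suc_atMost del: upt_Suc)
        also have "\<dots> = (\<Sum>i\<le>m. toplab k (vs i))" by (intro sum.cong) (auto simp: Wtop)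
        also have "\<dots> = toplab k V" unfolding toplab_def vs_def by (rule sum_list_partition[symmetric]) (rule qV)
        also have "\<dots> = w k / real N" using k by (simp add: V_def toplab_strips[OF dks] sw)
        finally show "toplab k A' = w k / real N" .
      qed
      show "okg (GR D' \<union> GR (map snd A'))" unfolding okg_def
      proof (rule ballI)
        fix z assume gz: "z \<in> GR D' \<union> GR (map snd A')"
        obtain x y r where z: "z = (x, y, r)" by (cases z) auto
        note g = gz[unfolded z]
        have okI: "okg (GR D \<union> GR (map snd A))" using I' by blast
        have old: "\<exists>i\<in>{1..m}. (\<exists>k<n. p k = i \<and> x \<in> ivl (atom k)) \<and> (\<exists>k<n. q k = i \<and> y \<in> ivl (atom k)) \<and> r = \<rho> i"
          if "(x, y, r) \<in> GR D \<union> GR (map snd A)"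
          using bspec[OF okI[unfolded okg_def] that] by simp
        have usG: "GR (us i) \<subseteq> GR (map snd A)" for i by (rule GR_mono) (auto simp: us_def)
        have "\<exists>i\<in>{1..m}. (\<exists>k<n. p k = i \<and> x \<in> ivl (atom k)) \<and> (\<exists>k<n. q k = i \<and> y \<in> ivl (atom k)) \<and> r = \<rho> i"
        proof (cases "(x, y, r) \<in> GR D'")
          case True
          then show ?thesis using usG[of 0] by (intro old) (auto simp: D'_def)
        next
          case False
          then have "(x, y, r) \<in> GR (map snd A')" using g by blast
          then obtain k c where "(k, c) \<in> set A'" "(x, y, r) \<in> gr c" by (auto simp: GR_def)
          then obtain i where i: "i \<le> m" "(k, c) \<in> set (W i)" using Amem by blast
          have gW: "(x, y, r) \<in> GR (map snd (W i))" using i \<open>(x, y, r) \<in> gr c\<close> by (force simp: GR_def)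
          have i1: "i \<in> {1..m}"
          proof (rule ccontr)
            assume "i \<notin> {1..m}" then have "i = 0" using i by auto
            then show False using gW GV[of 0] by (simp add: W_def)
          qed
          from Wm[OF i1] gW consider "(x, y, r) \<in> GR (us i) \<union> GR (map snd (vs i))"
            | u l v where "r = \<rho> i" "u \<in> set (us i)" "x \<in> ivl (last u)" "(l, v) \<in> set (vs i)" "y \<in> ivl (hd v)"
            unfolding matched_def by fast
          then show ?thesis
          proof cases
            case 1 then show ?thesis using GV usG by (intro old) blast
          next
            case 2
            obtain k' where k': "(k', u) \<in> set A" "p k' = i" using usA[OF 2(2)] by blast
            have "x \<in> ivl (atom k')" "k' < n" using Aok[OF k'(1)] 2(3) ksm by auto
            moreover have "l \<in> set ks" "v = [strip l (Suc j)]" "q l = i" using 2(4) by (auto simp: vs_def Vmem)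
            moreover then have "y \<in> ivl (atom l)" "l < n" using 2(5) ssub[of l "Suc j"] Suc.prems ksm by auto
            ultimately show ?thesis using i1 2(1) k'(2) by blast
          qed
        qed
        then show "case z of (x, y, r) \<Rightarrow> \<exists>i\<in>{1..m}. (\<exists>k<n. p k = i \<and> x \<in> ivl (atom k)) \<and>
            (\<exists>k<n. q k = i \<and> y \<in> ivl (atom k)) \<and> r = \<rho> i" by (simp add: z)
      qed
      show "\<forall>k\<in>set ks. q k \<in> {1..m} \<longrightarrow> (\<forall>y\<in>ivl (sublev 0 (real (Suc (Suc j)) / real N) (atom k)).
        y \<in> ivl (sublev 0 (1 / real N) (atom k)) \<or> (\<exists>x r. (x, y, r) \<in> GR D' \<union> GR (map snd A')))"
      proof (intro ballI impI)
        fix k y assume k: "k \<in> set ks" "q k \<in> {1..m}" and y: "y \<in> ivl (sublev 0 (real (Suc (Suc j)) / real N) (atom k))"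
        from ind_step[OF k(1), of "Suc j" y] y consider "y \<in> ivl (sublev 0 (real (Suc j) / real N) (atom k))" | "y \<in> ivl (strip k (Suc j))"
          by (auto split: split_indicator_asm)
        then show "y \<in> ivl (sublev 0 (1 / real N) (atom k)) \<or> (\<exists>x r. (x, y, r) \<in> GR D' \<union> GR (map snd A'))"
        proof cases
          case 1
          then show ?thesis using I' k GRA GRD by blast
        next
          case 2
          have "(k, [strip k (Suc j)]) \<in> set (vs (q k))" using k by (simp add: vs_def Vmem)
          then obtain x r where "(x, y, r) \<in> GR (map snd (W (q k)))"
            using Wm[OF k(2)] 2 unfolding matched_def by fastforce
          moreover have "set (map snd (W (q k))) \<subseteq> set (map snd A')" using k(2) Amem by (auto simp: image_iff)
          ultimately show ?thesis using GR_mono by blast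
        qed
      qed
    qed
    then show ?case by blast
  qed
  from ex[of "N - 1"] N obtain D A where I: "Inv N D A" by auto
  note I' = I[unfolded Inv_def]
  have NN: "real N / real N = 1" using N by simp
  have tel: "(\<Sum>k<j. indicator (ivl (atom k)) x) = (indicator {0..<\<Sum>k<j. w k} x :: real)" if "j \<le> n" for j x
    using that
  proof (induction j)
    case (Suc j)
    have "0 \<le> (\<Sum>k<j. w k)" using w Suc.prems by (intro sum_nonneg) auto
    moreover have "0 \<le> w j" using w Suc.prems by auto
    ultimately show ?case using Suc by (auto simp: atom_def ivl_def split: split_indicator)
  qed simp
  show ?thesis
  proof (intro exI[of _ "D @ map snd A"] conjI allI)
    show "\<forall>c\<in>set (D @ map snd A). posc c" using I' by auto
    show "CNT (D @ map snd A) x = indicator {0..<\<Sum>k<n. w k} x" for x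
    proof -
      have "CNT (D @ map snd A) x = (\<Sum>k\<leftarrow>ks. indicator (ivl (atom k)) x)" using I' NN by simp
      also have "\<dots> = (\<Sum>k\<in>set ks. indicator (ivl (atom k)) x)" using dks by (simp add: sum_list_distinct_conv_sum_set)
      also have "\<dots> = (\<Sum>k<n. indicator (ivl (atom k)) x)"
        using w by (intro sum.mono_neutral_left) (auto simp: ksm atom_def ivl_def not_less split: split_indicator)
      finally show ?thesis using tel[of n] by simp
    qed
    show "\<forall>(x, y, r)\<in>GR (D @ map snd A). \<exists>i\<in>{1..m}. (\<exists>k<n. p k = i \<and> x \<in> ivl (atom k)) \<and> (\<exists>k<n. q k = i \<and> y \<in> ivl (atom k)) \<and>
        r = (\<Sum>k | k < n \<and> p k = i. w k) / (\<Sum>k | k < n \<and> q k = i. w k)"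
      using I' unfolding okg_def \<rho>_def by simp
    fix k
    show "k < n \<longrightarrow> q k \<in> {1..m} \<longrightarrow> (\<forall>y\<in>ivl (atom k). y \<in> ivl (sublev 0 (1 / real N) (atom k)) \<or> (\<exists>x r. (x, y, r) \<in> GR (D @ map snd A)))"
    proof (intro impI ballI)
      fix y assume k: "k < n" "q k \<in> {1..m}" and y: "y \<in> ivl (atom k)"
      then have "k \<in> set ks" by (auto simp: ksm ivl_def atom_def)
      then show "y \<in> ivl (sublev 0 (1 / real N) (atom k)) \<or> (\<exists>x r. (x, y, r) \<in> GR (D @ map snd A))"
        using I' k y NN by simp
    qed
  qed
qed

section \<open>Towers\<close>

lemma member_le_sum_map: "p \<in> set c \<Longrightarrow> (\<And>z. 0 \<le> f z) \<Longrightarrow> f p \<le> (\<Sum>z\<leftarrow>c. f z :: real)"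
  by (rule member_le_sum_list) auto

text \<open>The initial linking spends \<open>\<delta> / 2\<close> and stage \<open>n\<close> spends
  \<open>\<delta> / 4 * (1/2) ^ n\<close>, so the cost never exceeds that of \<open>css\<close> by
  more than \<open>\<delta>\<close>. The cutting parameters \<open>a\<close> and \<open>L\<close>
  stay free.\<close>

lemma tower_sequence:
  assumes css: "css \<noteq> []" "\<forall>c\<in>set css. posc c" "\<And>x. CNT css x = indicator {0..<K0} x" "0 \<le> K0" and \<delta>: "0 < (\<delta>::real)"
    and aL: "\<And>n. 0 < a n" "\<And>n. 2 \<le> L n"
  obtains c K W where "\<And>n. posc (c n)" "\<And>n x. cnt (c n) x = indicator {0..<K n} x" "\<And>n. K n + 1 \<le> K (Suc n)" "0 \<le> K 0"
    "\<And>n. gr (c n) \<subseteq> gr (c (Suc n))" "\<And>n p. p \<in> set (c n) \<Longrightarrow> snd p \<le> W / 2 ^ n"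
    "\<And>n. ivl (hd (c (Suc n))) \<subseteq> ivl (hd (c n))" "\<And>n. ivl (last (c (Suc n))) \<subseteq> ivl (last (c n))"
    "\<And>n s t. (s, t) \<in> set (fracs (a n) (L n)) \<Longrightarrow> sublev s t (hd (c n)) \<in> set (c (Suc n))"
    "GR css \<subseteq> gr (c 0)" "\<And>n. cost (c n) \<le> sum_list (map cost css) + \<delta>"
proof -
  from link[OF css(1,2), of "\<delta>/2" K0] \<delta> obtain c0 K1 where c0: "posc c0" "\<And>x. cnt c0 x = CNT css x + indicator {K0..<K1} x" "K0 \<le> K1"
    "GR css \<subseteq> gr c0" "cost c0 \<le> sum_list (map cost css) + \<delta> / 2" by auto
  have c0': "cnt c0 x = indicator {0..<K1} x" for x
    using c0(3) css(4) by (auto simp: c0(2) css(3) split: split_indicator)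
  define P where "P n z \<longleftrightarrow> posc (fst z) \<and> (\<forall>x. cnt (fst z) x = indicator {0..<snd z} x) \<and> 0 \<le> snd z \<and> (n = 0 \<longrightarrow> z = (c0, K1))"
    for n :: nat and z :: "lev list \<times> real"
  define Q where "Q n z z' \<longleftrightarrow> snd z + 1 \<le> snd z' \<and> gr (fst z) \<subseteq> gr (fst z') \<and> cost (fst z') \<le> cost (fst z) + \<delta> / 4 * (1/2) ^ n \<and>
     (\<forall>W. (\<forall>p\<in>set (fst z). snd p \<le> W) \<longrightarrow> (\<forall>p\<in>set (fst z'). snd p \<le> W / 2)) \<and> ivl (hd (fst z')) \<subseteq> ivl (hd (fst z)) \<and>
     ivl (last (fst z')) \<subseteq> ivl (last (fst z)) \<and> (\<forall>(s,t)\<in>set (fracs (a n) (L n)). sublev s t (hd (fst z)) \<in> set (fst z'))"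
    for n :: nat and z z' :: "lev list \<times> real"
  have "\<exists>f. \<forall>n. P n (f n) \<and> Q n (f n) (f (Suc n))"
  proof (rule dependent_nat_choice)
    show "\<exists>z. P 0 z" using c0(1) c0' c0(3) css(4) by (intro exI[of _ "(c0, K1)"]) (simp add: P_def)
    fix z n assume z: "P n z"
    have "0 < \<delta> / 4 * (1/2)^n" using \<delta> by simp
    from stage[of "fst z" "snd z" "a n" "L n", OF _ _ _ aL this] z
    obtain d K' where "posc d" "\<forall>x. cnt d x = indicator {0..<K'} x" "snd z + 1 \<le> K'" "gr (fst z) \<subseteq> gr d" "cost d \<le> cost (fst z) + \<delta> / 4 * (1/2)^n"
      "\<forall>W. (\<forall>p\<in>set (fst z). snd p \<le> W) \<longrightarrow> (\<forall>p\<in>set d. snd p \<le> W / 2)" "ivl (hd d) \<subseteq> ivl (hd (fst z))" "ivl (last d) \<subseteq> ivl (last (fst z))"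
      "\<forall>(s,t)\<in>set (fracs (a n) (L n)). sublev s t (hd (fst z)) \<in> set d"
      unfolding P_def by blast
    then have "P (Suc n) (d, K')" "Q n z (d, K')" using z unfolding P_def Q_def by auto
    then show "\<exists>z'. P (Suc n) z' \<and> Q n z z'" by blast
  qed
  then obtain f where f: "\<And>n. P n (f n)" "\<And>n. Q n (f n) (f (Suc n))" by blast
  define c where "c n = fst (f n)" for n
  define K where "K n = snd (f n)" for n
  note fP = f(1)[unfolded P_def, folded c_def K_def]
  note fQ = f(2)[unfolded Q_def, folded c_def K_def]
  define W where "W = Max (snd ` set (c 0))"
  have wid: "\<forall>p\<in>set (c n). snd p \<le> W / 2 ^ n" for n
  proof (induction n)
    case 0 show ?case by (auto simp: W_def)
  next
    case (Suc n)
    then have "\<forall>p\<in>set (c (Suc n)). snd p \<le> (W / 2 ^ n) / 2" using fQ[of n] by blast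
    then show ?case by (simp add: mult.commute)
  qed
  have c00: "c 0 = c0" using fP[of 0] by (simp add: c_def)
  have cst: "cost (c n) \<le> sum_list (map cost css) + \<delta> / 2 + \<delta> / 2 * (1 - (1/2)^n)" for n
  proof (induction n)
    case 0 then show ?case using c0(5) c00 by simp
  next
    case (Suc n)
    have "cost (c (Suc n)) \<le> cost (c n) + \<delta> / 4 * (1/2)^n" using fQ[of n] by blast
    also have "\<dots> \<le> sum_list (map cost css) + \<delta> / 2 + \<delta> / 2 * (1 - (1/2)^Suc n)" using Suc by (simp add: algebra_simps)
    finally show ?case .
  qed
  have cst': "cost (c n) \<le> sum_list (map cost css) + \<delta>" for n
  proof -
    have "\<delta> / 2 * (1 - (1/2)^n) \<le> \<delta> / 2 * 1" using \<delta> by (intro mult_left_mono) auto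
    then show ?thesis using cst[of n] by linarith
  qed
  show thesis
  proof (rule that[of c K W])
    show "sublev s t (hd (c n)) \<in> set (c (Suc n))" if "(s, t) \<in> set (fracs (a n) (L n))" for n s t
      using fQ[of n] that by blast
    show "GR css \<subseteq> gr (c 0)" using c0(4) c00 by simp
    show "snd p \<le> W / 2 ^ n" if "p \<in> set (c n)" for n p using wid that by blast
  qed (use fP fQ cst' in auto)
qed

text \<open>What the limit map needs from the sequence of columns: \<open>KS\<close> makes them
  exhaust the half line, and \<open>wid\<close> with the nesting in \<open>hdS\<close> and
  \<open>lastS\<close> makes the exceptional sets null.\<close>

locale towers =
  fixes c :: "nat \<Rightarrow> lev list" and K :: "nat \<Rightarrow> real" and W :: real
  assumes pos: "posc (c n)" and cn: "cnt (c n) x = indicator {0..<K n} x" and KS: "K n + 1 \<le> K (Suc n)" and K0: "0 \<le> K 0"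
    and grS: "gr (c n) \<subseteq> gr (c (Suc n))" and wid: "p \<in> set (c n) \<Longrightarrow> snd p \<le> W / 2 ^ n"
    and hdS: "ivl (hd (c (Suc n))) \<subseteq> ivl (hd (c n))" and lastS: "ivl (last (c (Suc n))) \<subseteq> ivl (last (c n))"
begin

lemma cn_le: "cnt (c n) x \<le> 1"
  by (simp add: cn split: split_indicator)

lemma gr_mono: "m \<le> n \<Longrightarrow> gr (c m) \<subseteq> gr (c n)"
  by (rule lift_Suc_mono_le[of "\<lambda>n. gr (c n)"]) (use grS in auto)

lemma K_ge: "real n \<le> K n"
proof (induction n)
  case (Suc n) then show ?case using KS[of n] by simp
qed (use K0 in simp)

section \<open>The limit map, its inverse and its derivative\<close>

definition G :: "(real \<times> real \<times> real) set" where "G = (\<Union>n. gr (c n))"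

lemma G_fun: "(x, y, r) \<in> G \<Longrightarrow> (x, y', r') \<in> G \<Longrightarrow> y = y' \<and> r = r'"
proof -
  assume "(x, y, r) \<in> G" "(x, y', r') \<in> G"
  then obtain m n where "(x, y, r) \<in> gr (c m)" "(x, y', r') \<in> gr (c n)" by (auto simp: G_def)
  then have "(x, y, r) \<in> gr (c (max m n))" "(x, y', r') \<in> gr (c (max m n))" using gr_mono[of m "max m n"] gr_mono[of n "max m n"] by auto
  then show ?thesis using gr_fun[OF cn_le pos] by blast
qed

lemma G_inj: "(x, y, r) \<in> G \<Longrightarrow> (x', y, r') \<in> G \<Longrightarrow> x = x' \<and> r = r'"
proof -
  assume "(x, y, r) \<in> G" "(x', y, r') \<in> G"
  then obtain m n where "(x, y, r) \<in> gr (c m)" "(x', y, r') \<in> gr (c n)" by (auto simp: G_def)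
  then have "(x, y, r) \<in> gr (c (max m n))" "(x', y, r') \<in> gr (c (max m n))" using gr_mono[of m "max m n"] gr_mono[of n "max m n"] by auto
  then show ?thesis using gr_inj[OF cn_le pos] by blast
qed

text \<open>The identity and the value 1 are defaults off the graph. Like \<open>Tprime\<close>,
  \<open>\<rho>\<close> is a function of the target point: source width over target width.\<close>

definition \<tau> where "\<tau> x = (if \<exists>y r. (x, y, r) \<in> G then THE y. \<exists>r. (x, y, r) \<in> G else x)"
definition \<sigma> where "\<sigma> y = (if \<exists>x r. (x, y, r) \<in> G then THE x. \<exists>r. (x, y, r) \<in> G else y)"
definition \<rho> where "\<rho> y = (if \<exists>x r. (x, y, r) \<in> G then THE r. \<exists>x. (x, y, r) \<in> G else 1)"
definition D where "D = {x. \<exists>y r. (x, y, r) \<in> G}"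
definition R where "R = {y. \<exists>x r. (x, y, r) \<in> G}"

lemma G_eq: "(x, y, r) \<in> G \<Longrightarrow> \<tau> x = y \<and> \<sigma> y = x \<and> \<rho> y = r"
  unfolding \<tau>_def \<sigma>_def \<rho>_def using G_fun G_inj by (auto intro!: the_equality)

lemma \<sigma>_\<tau>: assumes "x \<in> D" shows "\<sigma> (\<tau> x) = x" "\<tau> x \<in> R"
proof -
  from assms obtain y r where g: "(x, y, r) \<in> G" by (auto simp: D_def)
  show "\<sigma> (\<tau> x) = x" "\<tau> x \<in> R" using G_eq[OF g] g by (auto simp: R_def)
qed

lemma \<tau>_\<sigma>: assumes "y \<in> R" shows "\<tau> (\<sigma> y) = y" "\<sigma> y \<in> D"
proof -
  from assms obtain x r where g: "(x, y, r) \<in> G" by (auto simp: R_def)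
  show "\<tau> (\<sigma> y) = y" "\<sigma> y \<in> D" using G_eq[OF g] g by (auto simp: D_def)
qed

definition EE where "EE = (\<Union>n. set (edges (c n)))"

lemma countable_EE: "countable EE"
  unfolding EE_def by (intro countable_UN) (auto intro: countable_finite)

lemma EE_pos: "(p, q) \<in> EE \<Longrightarrow> 0 < snd p \<and> 0 < snd q"
  using pos edges_set by (fastforce simp: EE_def posc_def)

lemma lev_sub: "p \<in> set (c n) \<Longrightarrow> ivl p \<subseteq> {0..<K n}"
proof
  fix x assume p: "p \<in> set (c n)" "x \<in> ivl p"
  have "indicator (ivl p) x \<le> cnt (c n) x" unfolding cnt_def by (rule member_le_sum_map[OF p(1)]) simp
  then show "x \<in> {0..<K n}" using p unfolding cn by (auto split: split_indicator_asm)
qed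

lemma EE_sub: "(p, q) \<in> EE \<Longrightarrow> ivl p \<subseteq> {0..} \<and> ivl q \<subseteq> {0..}"
proof -
  assume "(p, q) \<in> EE"
  then obtain n where "(p, q) \<in> set (edges (c n))" by (auto simp: EE_def)
  then have "ivl p \<subseteq> {0..<K n}" "ivl q \<subseteq> {0..<K n}" using edges_set lev_sub by blast+
  then show ?thesis by force
qed

definition aff :: "lev \<times> lev \<Rightarrow> real \<Rightarrow> real" where
  "aff e x = fst (snd e) + snd (snd e) * ((x - fst (fst e)) / snd (fst e))"

lemma edge_gr: assumes "(p, q) \<in> set (edges d)" "posc d" "x \<in> ivl p" shows "(x, aff (p, q) x, snd p / snd q) \<in> gr d"
proof -
  have p: "0 < snd p" using edges_set[OF assms(1)] assms(2) by (auto simp: posc_def)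
  define u where "u = (x - fst p) / snd p"
  have u: "0 \<le> u" "u < 1" "x = fst p + snd p * u" using assms(3) p by (auto simp: u_def ivl_def field_simps)
  have "aff (p, q) x = fst q + snd q * u" by (simp add: aff_def u_def)
  then show ?thesis using grI[OF assms(1) u(1,2)] by (simp only: u(3)[symmetric])
qed

lemma EE_G: "(p, q) \<in> EE \<Longrightarrow> x \<in> ivl p \<Longrightarrow> (x, aff (p, q) x, snd p / snd q) \<in> G"
proof -
  assume "(p, q) \<in> EE" and x: "x \<in> ivl p"
  then obtain n where "(p, q) \<in> set (edges (c n))" by (auto simp: EE_def)
  from edge_gr[OF this pos x] show ?thesis unfolding G_def by blast
qed

lemma aff_inv: "0 < snd p \<Longrightarrow> 0 < snd q \<Longrightarrow> y \<in> ivl q \<Longrightarrow> aff (q, p) y \<in> ivl p \<and> aff (p, q) (aff (q, p) y) = y"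
proof -
  assume a: "0 < snd p" "0 < snd q" "y \<in> ivl q"
  define u where "u = (y - fst q) / snd q"
  have u: "0 \<le> u" "u < 1" "y = fst q + snd q * u" using a by (auto simp: u_def ivl_def field_simps)
  have 1: "aff (q, p) y = fst p + snd p * u" by (simp add: aff_def u_def)
  have "aff (p, q) (fst p + snd p * u) = y" using a u by (simp add: aff_def)
  moreover have "fst p + snd p * u \<in> ivl p" using a u by (auto simp: ivl_def)
  ultimately show ?thesis unfolding 1 by simp
qed

lemma EE_G': assumes "(p, q) \<in> EE" "y \<in> ivl q" shows "(aff (q, p) y, y, snd p / snd q) \<in> G"
  using EE_G[OF assms(1)] aff_inv[of p q y] EE_pos[OF assms(1)] assms(2) by metis

lemma D_eq: "D = (\<Union>(p, q)\<in>EE. ivl p)" and R_eq: "R = (\<Union>(p, q)\<in>EE. ivl q)"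
proof -
  have *: "\<exists>(p, q)\<in>EE. x \<in> ivl p \<and> y \<in> ivl q" if "(x, y, r) \<in> G" for x y r
  proof -
    from that obtain n where "(x, y, r) \<in> gr (c n)" by (auto simp: G_def)
    then obtain p q where "(p, q) \<in> set (edges (c n))" "x \<in> ivl p" "y \<in> ivl q" using grE[OF _ pos] by metis
    then show ?thesis by (auto simp: EE_def)
  qed
  show "D = (\<Union>(p, q)\<in>EE. ivl p)"
  proof (intro equalityI subsetI)
    fix x assume "x \<in> D" then show "x \<in> (\<Union>(p, q)\<in>EE. ivl p)" using * unfolding D_def by blast
  next
    fix x assume "x \<in> (\<Union>(p, q)\<in>EE. ivl p)"
    then obtain p q where "(p, q) \<in> EE" "x \<in> ivl p" by auto
    from EE_G[OF this] show "x \<in> D" unfolding D_def by blast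
  qed
  show "R = (\<Union>(p, q)\<in>EE. ivl q)"
  proof (intro equalityI subsetI)
    fix y assume "y \<in> R" then show "y \<in> (\<Union>(p, q)\<in>EE. ivl q)" using * unfolding R_def by blast
  next
    fix y assume "y \<in> (\<Union>(p, q)\<in>EE. ivl q)"
    then obtain p q where "(p, q) \<in> EE" "y \<in> ivl q" by auto
    from EE_G'[OF this] show "y \<in> R" unfolding R_def by blast
  qed
qed

lemma ivl_borel [measurable]: "ivl p \<in> sets borel"
  by (simp add: ivl_def)

lemma D_borel [measurable]: "D \<in> sets borel" and R_borel [measurable]: "R \<in> sets borel"
  unfolding D_eq R_eq by (auto intro!: sets.countable_UN'' countable_EE)

text \<open>Countably many edges suffice; \<open>b\<close> selects whether the pieces are sources or
  targets.\<close>

lemma piecewise_measurable: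
  fixes f :: "real \<Rightarrow> real"
  assumes "\<And>p q. (p, q) \<in> EE \<Longrightarrow> \<exists>h\<in>borel_measurable borel. \<forall>x\<in>ivl (if b then p else q). f x = h x"
    and "\<exists>h\<in>borel_measurable borel. \<forall>x. x \<notin> (if b then D else R) \<longrightarrow> f x = h x"
  shows "f \<in> borel_measurable borel"
proof -
  define \<A> where "\<A> = insert (- (if b then D else R)) ((\<lambda>(p, q). ivl (if b then p else q)) ` EE)"
  have ct: "countable \<A>" unfolding \<A>_def using countable_EE by auto
  show ?thesis
  proof (rule measurable_piecewise_restrict[OF ct])
    show "space borel \<subseteq> \<Union>\<A>" by (auto simp: \<A>_def D_eq R_eq)
    show "\<Omega> \<inter> space borel \<in> sets borel" if "\<Omega> \<in> \<A>" for \<Omega> using that by (auto simp: \<A>_def)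
    show "f \<in> borel_measurable (restrict_space borel \<Omega>)" if "\<Omega> \<in> \<A>" for \<Omega>
    proof -
      have "\<exists>h\<in>borel_measurable borel. \<forall>x\<in>\<Omega>. f x = h x"
      proof (cases "\<Omega> = - (if b then D else R)")
        case True
        then show ?thesis using assms(2) by (auto split: if_splits)
      next
        case False
        then have "\<Omega> \<in> (\<lambda>(p, q). ivl (if b then p else q)) ` EE" using that by (simp add: \<A>_def)
        then obtain p q where "(p, q) \<in> EE" "\<Omega> = ivl (if b then p else q)" by force
        then show ?thesis using assms(1) by simp
      qed
      then obtain h where h: "h \<in> borel_measurable borel" "\<forall>x\<in>\<Omega>. f x = h x" by blast
      show ?thesis
        by (subst measurable_cong[where g=h]) (use h in \<open>auto simp: space_restrict_space intro: measurable_restrict_space1\<close>)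
    qed
  qed
qed

lemma aff_borel [measurable]: "aff e \<in> borel_measurable borel"
  unfolding aff_def[abs_def] by measurable

lemma \<tau>_borel [measurable]: "\<tau> \<in> borel_measurable borel"
proof (rule piecewise_measurable[where b=True])
  show "\<exists>h\<in>borel_measurable borel. \<forall>x\<in>ivl (if True then p else q). \<tau> x = h x" if "(p, q) \<in> EE" for p q
  proof (rule bexI[of _ "aff (p, q)"])
    show "\<forall>x\<in>ivl (if True then p else q). \<tau> x = aff (p, q) x" using EE_G[OF that, THEN G_eq] by simp
  qed measurable
  show "\<exists>h\<in>borel_measurable borel. \<forall>x. x \<notin> (if True then D else R) \<longrightarrow> \<tau> x = h x"
    by (rule bexI[of _ "\<lambda>x. x"]) (auto simp: \<tau>_def D_def)
qed

lemma \<sigma>_borel [measurable]: "\<sigma> \<in> borel_measurable borel"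
proof (rule piecewise_measurable[where b=False])
  show "\<exists>h\<in>borel_measurable borel. \<forall>x\<in>ivl (if False then p else q). \<sigma> x = h x" if "(p, q) \<in> EE" for p q
  proof (rule bexI[of _ "aff (q, p)"])
    show "\<forall>x\<in>ivl (if False then p else q). \<sigma> x = aff (q, p) x" using EE_G'[OF that, THEN G_eq] by simp
  qed measurable
  show "\<exists>h\<in>borel_measurable borel. \<forall>x. x \<notin> (if False then D else R) \<longrightarrow> \<sigma> x = h x"
    by (rule bexI[of _ "\<lambda>x. x"]) (auto simp: \<sigma>_def R_def)
qed

lemma \<rho>_borel [measurable]: "\<rho> \<in> borel_measurable borel"
proof (rule piecewise_measurable[where b=False])
  show "\<exists>h\<in>borel_measurable borel. \<forall>x\<in>ivl (if False then p else q). \<rho> x = h x" if "(p, q) \<in> EE" for p q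
  proof (rule bexI[of _ "\<lambda>x. snd p / snd q"])
    show "\<forall>x\<in>ivl (if False then p else q). \<rho> x = snd p / snd q" using EE_G'[OF that, THEN G_eq] by simp
  qed measurable
  show "\<exists>h\<in>borel_measurable borel. \<forall>x. x \<notin> (if False then D else R) \<longrightarrow> \<rho> x = h x"
    by (rule bexI[of _ "\<lambda>x. 1"]) (auto simp: \<rho>_def R_def)
qed

lemma \<rho>_pos: "0 < \<rho> y"
proof (cases "y \<in> R")
  case True
  then obtain p q where "(p, q) \<in> EE" "y \<in> ivl q" by (auto simp: R_eq)
  then show ?thesis using EE_G'[of p q y, THEN G_eq] EE_pos[of p q] by simp
qed (simp add: \<rho>_def R_def)

section \<open>Nonsingularity of the limit map for Lebesgue measure on the half line\<close>

abbreviation lam :: "real measure" where "lam \<equiv> density lborel (indicator {0..})"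

lemma emeasure_lam: "A \<in> sets borel \<Longrightarrow> emeasure lam A = emeasure lborel (A \<inter> {0..})"
proof -
  assume A: "A \<in> sets borel"
  have "emeasure lam A = (\<integral>\<^sup>+x. indicator {0..} x * indicator A x \<partial>lborel)" using A by (intro emeasure_density) auto
  also have "\<dots> = (\<integral>\<^sup>+x. indicator (A \<inter> {0..}) x \<partial>lborel)" by (intro nn_integral_cong) (auto split: split_indicator)
  also have "\<dots> = emeasure lborel (A \<inter> {0..})" using A by simp
  finally show ?thesis .
qed

lemma level_in:
  assumes "0 \<le> x" shows "\<exists>n0. \<forall>n\<ge>n0. \<exists>p\<in>set (c n). x \<in> ivl p"
proof -
  obtain n0 :: nat where n0: "x < real n0" using reals_Archimedean2 by blast
  have "\<exists>p\<in>set (c n). x \<in> ivl p" if "n0 \<le> n" for n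
  proof (rule ccontr)
    assume "\<not> ?thesis"
    then have z: "\<forall>p\<in>set (c n). indicator (ivl p) x = (0::real)" by auto
    have "cnt (c n) x = (\<Sum>p\<leftarrow>c n. 0)" unfolding cnt_def by (rule arg_cong[where f=sum_list], rule map_cong) (use z in auto)
    then have "cnt (c n) x = 0" by simp
    moreover have "x < K n" using K_ge[of n] n0 that by (meson less_le_trans of_nat_mono order_trans)
    ultimately show False using assms by (simp add: cn)
  qed
  then show ?thesis by blast
qed

lemma edge_from: "p \<in> set d \<Longrightarrow> p = last d \<or> (\<exists>q. (p, q) \<in> set (edges d))"
proof (induction d)
  case (Cons z d) then show ?case by (cases d) auto
qed simp

lemma edge_to: "p \<in> set d \<Longrightarrow> p = hd d \<or> (\<exists>q. (q, p) \<in> set (edges d))"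
proof (induction d)
  case (Cons z d)
  show ?case
  proof (cases "p \<in> set d")
    case True
    then obtain w d' where d: "d = w # d'" by (cases d) auto
    from Cons.IH[OF True] consider "p = w" | q where "(q, p) \<in> set (edges d)" by (auto simp: d)
    then show ?thesis
    proof cases
      case 1 then have "(z, p) \<in> set (edges (z # d))" by (simp add: d)
      then show ?thesis by blast
    next
      case 2 then have "(q, p) \<in> set (edges (z # d))" by (simp add: d)
      then show ?thesis by blast
    qed
  qed (use Cons.prems in simp)
qed simp

lemma null_nested:
  assumes "\<And>n. A \<subseteq> ivl (l n)" "\<And>n. l n \<in> set (c n)" and A: "A \<in> sets borel"
  shows "emeasure lborel A = 0"
proof -
  have "emeasure lborel A \<le> ennreal (W / 2 ^ n)" for n
  proof -
    have "0 < snd (l n)" using pos assms(2) by (auto simp: posc_def)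
    have "emeasure lborel A \<le> emeasure lborel (ivl (l n))" using assms(1) by (intro emeasure_mono) auto
    also have "\<dots> = ennreal (snd (l n))" using \<open>0 < snd (l n)\<close> by (simp add: ivl_def)
    also have "\<dots> \<le> ennreal (W / 2 ^ n)" using wid[OF assms(2)] by (rule ennreal_leI)
    finally show ?thesis .
  qed
  moreover have "(\<lambda>n. ennreal (W / 2 ^ n)) \<longlonglongrightarrow> ennreal 0"
    by (intro tendsto_ennrealI) (auto intro!: LIMSEQ_divide_realpow_zero)
  ultimately have "emeasure lborel A \<le> ennreal 0" by (intro LIMSEQ_le_const) auto
  then show ?thesis by simp
qed

lemma last_anti: "m \<le> n \<Longrightarrow> ivl (last (c n)) \<subseteq> ivl (last (c m))" and hd_anti: "m \<le> n \<Longrightarrow> ivl (hd (c n)) \<subseteq> ivl (hd (c m))"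
  using lift_Suc_antimono_le[of "\<lambda>n. ivl (last (c n))"] lift_Suc_antimono_le[of "\<lambda>n. ivl (hd (c n))"] lastS hdS by auto

text \<open>A point without image lies in the last level of every late column, and these levels are
  nested with widths tending to 0.\<close>

lemma conull_D: "emeasure lam (- D) = 0"
proof -
  have "x \<in> ivl (last (c n))" if "x \<notin> D" "0 \<le> x" for x n
  proof -
    have "\<exists>n0. \<forall>n\<ge>n0. \<exists>p\<in>set (c n). x \<in> ivl p" by (rule level_in[OF that(2)])
    then obtain n0 where n0: "\<And>n. n0 \<le> n \<Longrightarrow> \<exists>p\<in>set (c n). x \<in> ivl p" by blast
    then obtain p where p: "p \<in> set (c (max n n0))" "x \<in> ivl p" by (metis max.cobounded2)
    have "p = last (c (max n n0))"
      using edge_from[OF p(1)] that(1) p(2) by (auto simp: D_eq EE_def)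
    then show ?thesis using p(2) last_anti[of n "max n n0"] by auto
  qed
  then have "emeasure lborel (- D \<inter> {0..}) = 0"
    by (intro null_nested[of _ "\<lambda>n. last (c n)"]) (use pos in \<open>auto simp: posc_def\<close>)
  then show ?thesis by (simp add: emeasure_lam)
qed

lemma conull_R: "emeasure lam (- R) = 0"
proof -
  have "x \<in> ivl (hd (c n))" if "x \<notin> R" "0 \<le> x" for x n
  proof -
    have "\<exists>n0. \<forall>n\<ge>n0. \<exists>p\<in>set (c n). x \<in> ivl p" by (rule level_in[OF that(2)])
    then obtain n0 where n0: "\<And>n. n0 \<le> n \<Longrightarrow> \<exists>p\<in>set (c n). x \<in> ivl p" by blast
    then obtain p where p: "p \<in> set (c (max n n0))" "x \<in> ivl p" by (metis max.cobounded2)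
    have "p = hd (c (max n n0))"
      using edge_to[OF p(1)] that(1) p(2) by (auto simp: R_eq EE_def)
    then show ?thesis using p(2) hd_anti[of n "max n n0"] by auto
  qed
  then have "emeasure lborel (- R \<inter> {0..}) = 0"
    by (intro null_nested[of _ "\<lambda>n. hd (c n)"]) (use pos in \<open>auto simp: posc_def\<close>)
  then show ?thesis by (simp add: emeasure_lam)
qed

lemma aff_measure:
  assumes pq: "(p, q) \<in> EE" and B[measurable]: "B \<in> sets borel" "B \<subseteq> ivl q"
  shows "emeasure lborel (ivl p \<inter> aff (p, q) -` B) = ennreal (snd p / snd q) * emeasure lborel B"
proof -
  have ps: "0 < snd p" "0 < snd q" using EE_pos[OF pq] by auto
  define t where "t = fst q - snd q * fst p / snd p"
  define k where "k = snd q / snd p"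
  have k: "0 < k" using ps by (simp add: k_def)
  have af: "aff (p, q) x = t + k * x" for x using ps by (simp add: aff_def t_def k_def field_simps)
  have sub: "aff (p, q) -` B \<subseteq> ivl p"
  proof
    fix x assume "x \<in> aff (p, q) -` B"
    then have y: "aff (p, q) x \<in> ivl q" using B(2) by auto
    define u where "u = (x - fst p) / snd p"
    have "aff (p, q) x = fst q + snd q * u" by (simp add: aff_def u_def)
    then have "0 \<le> snd q * u" "snd q * u < snd q * 1" using y by (auto simp: ivl_def)
    then have "0 \<le> u" "u < 1" using ps by (auto simp: zero_le_mult_iff mult_less_cancel_left)
    moreover have "x = fst p + snd p * u" using ps by (simp add: u_def)
    ultimately show "x \<in> ivl p" using ps by (auto simp: ivl_def)
  qed
  have m: "aff (p, q) -` B \<in> sets borel" by (rule measurable_sets_borel[OF aff_borel B(1)])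
  have "emeasure lborel B = (\<integral>\<^sup>+x. indicator B x \<partial>lborel)" by simp
  also have "\<dots> = ennreal \<bar>k\<bar> * (\<integral>\<^sup>+x. indicator B (t + k * x) \<partial>lborel)"
    using k by (intro nn_integral_real_affine) auto
  also have "(\<integral>\<^sup>+x. indicator B (t + k * x) \<partial>lborel) = (\<integral>\<^sup>+x. indicator (aff (p, q) -` B) x \<partial>lborel)"
    by (intro nn_integral_cong) (auto simp: af split: split_indicator)
  also have "\<dots> = emeasure lborel (aff (p, q) -` B)" using m by simp
  finally have "ennreal (1 / k) * emeasure lborel B = (ennreal (1 / k) * ennreal k) * emeasure lborel (aff (p, q) -` B)"
    using k by (simp add: mult.assoc)
  also have "ennreal (1 / k) * ennreal k = 1" using k by (simp flip: ennreal_mult')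
  finally show ?thesis using sub by (simp add: k_def Int_absorb1)
qed

lemma \<tau>_vimage: assumes "(p, q) \<in> EE" "B \<subseteq> ivl q" shows "\<tau> -` B \<inter> D = ivl p \<inter> aff (p, q) -` B"
proof (intro equalityI subsetI)
  fix x assume x: "x \<in> \<tau> -` B \<inter> D"
  then obtain y r where g: "(x, y, r) \<in> G" by (auto simp: D_def)
  then have y: "\<tau> x = y" using G_eq by blast
  then have "y \<in> ivl q" using x assms(2) by auto
  from EE_G'[OF assms(1) this] g have "x = aff (q, p) y" using G_inj by blast
  then show "x \<in> ivl p \<inter> aff (p, q) -` B" using aff_inv[of p q y] EE_pos[OF assms(1)] \<open>y \<in> ivl q\<close> x y by auto
next
  fix x assume x: "x \<in> ivl p \<inter> aff (p, q) -` B"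
  then have "(x, aff (p, q) x, snd p / snd q) \<in> G" using EE_G[OF assms(1)] by blast
  then show "x \<in> \<tau> -` B \<inter> D" using G_eq x by (auto simp: D_def)
qed

lemma \<tau>_measure_edge:
  assumes pq: "(p, q) \<in> EE" and B[measurable]: "B \<in> sets borel" "B \<subseteq> ivl q"
  shows "emeasure lam (\<tau> -` B) = (\<integral>\<^sup>+y. ennreal (\<rho> y) * indicator B y \<partial>lam)"
proof -
  have m[measurable]: "\<tau> -` B \<in> sets borel" by (rule measurable_sets_borel[OF \<tau>_borel B(1)])
  have "emeasure lam (\<tau> -` B) = emeasure lam (\<tau> -` B \<inter> D)"
  proof (rule emeasure_eq_AE)
    have "AE x in lam. x \<notin> - D" using conull_D by (intro AE_not_in) (auto simp: null_sets_def)
    then show "AE x in lam. x \<in> \<tau> -` B \<longleftrightarrow> x \<in> \<tau> -` B \<inter> D" by eventually_elim auto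
  qed auto
  also have "\<dots> = emeasure lborel ((\<tau> -` B \<inter> D) \<inter> {0..})" by (rule emeasure_lam) auto
  also have "(\<tau> -` B \<inter> D) \<inter> {0..} = ivl p \<inter> aff (p, q) -` B" using \<tau>_vimage[OF pq B(2)] EE_sub[OF pq] by auto
  also have "emeasure lborel \<dots> = ennreal (snd p / snd q) * emeasure lborel B" by (rule aff_measure[OF pq B])
  also have "\<dots> = (\<integral>\<^sup>+y. ennreal (snd p / snd q) * indicator B y \<partial>lborel)" by (subst nn_integral_cmult) auto
  also have "\<dots> = (\<integral>\<^sup>+y. indicator {0..} y * (ennreal (\<rho> y) * indicator B y) \<partial>lborel)"
  proof (rule nn_integral_cong)
    fix y
    show "ennreal (snd p / snd q) * indicator B y = indicator {0..} y * (ennreal (\<rho> y) * indicator B y)"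
    proof (cases "y \<in> B")
      case True
      then have "y \<in> ivl q" using B(2) by auto
      then have "\<rho> y = snd p / snd q" "0 \<le> y" using EE_G'[OF pq, THEN G_eq] EE_sub[OF pq] by auto
      then show ?thesis by simp
    qed simp
  qed
  also have "\<dots> = (\<integral>\<^sup>+y. ennreal (\<rho> y) * indicator B y \<partial>lam)" by (subst nn_integral_density) auto
  finally show ?thesis .
qed

text \<open>Edges of different stages overlap, since later columns refine earlier ones. The
  \<open>disjointed\<close> targets split \<open>R\<close> into countably many sets, each inside the
  target of one edge, where \<open>\<tau>\<close> is affine.\<close>

lemma distr_\<tau>: "distr lam borel \<tau> = density lam (\<lambda>y. ennreal (\<rho> y))"
proof (rule measure_eqI)
  show "sets (distr lam borel \<tau>) = sets (density lam (\<lambda>y. ennreal (\<rho> y)))" by simp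
  fix B assume "B \<in> sets (distr lam borel \<tau>)"
  then have B[measurable]: "B \<in> sets borel" by simp
  have neE: "EE \<noteq> {}"
  proof
    assume "EE = {}"
    then have "D = {}" by (simp add: D_eq)
    then have "emeasure lborel {0::real..} = 0" using conull_D by (simp add: emeasure_lam)
    moreover have "emeasure lborel {0::real..1} \<le> emeasure lborel {0::real..}" by (rule emeasure_mono) auto
    ultimately show False by simp
  qed
  define e where "e = from_nat_into EE"
  have e: "e i \<in> EE" for i unfolding e_def by (rule from_nat_into[OF neE])
  have re: "range e = EE" unfolding e_def by (rule range_from_nat_into[OF neE countable_EE])
  define S where "S = disjointed (\<lambda>i. ivl (snd (e i)))"
  have Sm[measurable]: "S i \<in> sets borel" for i
  proof -
    have "range (\<lambda>i. ivl (snd (e i))) \<subseteq> sets borel" by auto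
    from sets.range_disjointed_sets[OF this] show ?thesis unfolding S_def by auto
  qed
  have dS: "disjoint_family S" unfolding S_def by (rule disjoint_family_disjointed)
  have US: "(\<Union>i. S i) = R" unfolding S_def UN_disjointed_eq R_eq re[symmetric] by (auto simp: split_beta')
  have SB: "emeasure lam (\<tau> -` (B \<inter> S i)) = (\<integral>\<^sup>+y. ennreal (\<rho> y) * indicator (B \<inter> S i) y \<partial>lam)" for i
  proof -
    obtain p q where pq: "e i = (p, q)" by (metis surj_pair)
    have "B \<inter> S i \<subseteq> ivl q" using disjointed_subset[of "\<lambda>i. ivl (snd (e i))" i] by (auto simp: S_def pq)
    then show ?thesis using \<tau>_measure_edge[of p q "B \<inter> S i"] e[of i] pq by auto
  qed
  have AR: "AE y in lam. y \<in> R" and AD: "AE x in lam. x \<in> D"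
    using AE_not_in[of "- R" lam] AE_not_in[of "- D" lam] conull_R conull_D by (auto simp: null_sets_def)
  have vm[measurable]: "\<tau> -` (B \<inter> S i) \<in> sets borel" "\<tau> -` B \<in> sets borel" for i
    by (rule measurable_sets_borel[OF \<tau>_borel], simp)+
  have "emeasure (distr lam borel \<tau>) B = emeasure lam (\<tau> -` B)" by (subst emeasure_distr) auto
  also have "\<dots> = emeasure lam (\<Union>i. \<tau> -` (B \<inter> S i))"
  proof (rule emeasure_eq_AE)
    show "AE x in lam. x \<in> \<tau> -` B \<longleftrightarrow> x \<in> (\<Union>i. \<tau> -` (B \<inter> S i))"
      using AD
    proof eventually_elim
      fix x assume "x \<in> D"
      then have "\<tau> x \<in> (\<Union>i. S i)" using \<sigma>_\<tau>(2) US by auto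
      then show "x \<in> \<tau> -` B \<longleftrightarrow> x \<in> (\<Union>i. \<tau> -` (B \<inter> S i))" by auto
    qed
  qed auto
  also have "\<dots> = (\<Sum>i. emeasure lam (\<tau> -` (B \<inter> S i)))"
    by (rule suminf_emeasure[symmetric]) (use dS in \<open>auto simp: disjoint_family_on_def\<close>)
  also have "\<dots> = (\<Sum>i. \<integral>\<^sup>+y. ennreal (\<rho> y) * indicator (B \<inter> S i) y \<partial>lam)" by (simp only: SB)
  also have "\<dots> = (\<Sum>i. emeasure (density lam (\<lambda>y. ennreal (\<rho> y))) (B \<inter> S i))"
    by (intro suminf_cong) (subst emeasure_density[where M=lam]; simp)
  also have "\<dots> = emeasure (density lam (\<lambda>y. ennreal (\<rho> y))) (\<Union>i. B \<inter> S i)"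
    by (rule suminf_emeasure) (use dS in \<open>auto simp: disjoint_family_on_def\<close>)
  also have "\<dots> = emeasure (density lam (\<lambda>y. ennreal (\<rho> y))) B"
  proof (rule emeasure_eq_AE)
    have "AE y in density lam (\<lambda>y. ennreal (\<rho> y)). y \<in> R" using AR by (subst AE_density) auto
    then show "AE y in density lam (\<lambda>y. ennreal (\<rho> y)). y \<in> (\<Union>i. B \<inter> S i) \<longleftrightarrow> y \<in> B"
      by eventually_elim (use US in auto)
  qed auto
  finally show "emeasure (distr lam borel \<tau>) B = emeasure (density lam (\<lambda>y. ennreal (\<rho> y))) B" .
qed

lemma \<tau>_null: assumes "A \<in> sets borel" "emeasure lam A = 0" shows "emeasure lam (\<tau> -` A) = 0"
proof -
  have "emeasure lam (\<tau> -` A) = emeasure (distr lam borel \<tau>) A" using assms(1) by (subst emeasure_distr) auto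
  also have "\<dots> = (\<integral>\<^sup>+y. ennreal (\<rho> y) * indicator A y \<partial>lam)" unfolding distr_\<tau> using assms(1) by (intro emeasure_density) auto
  also have "\<dots> = (\<integral>\<^sup>+y. 0 \<partial>lam)"
  proof (rule nn_integral_cong_AE)
    have "AE y in lam. y \<notin> A" using assms by (intro AE_not_in) (auto simp: null_sets_def)
    then show "AE y in lam. ennreal (\<rho> y) * indicator A y = 0" by eventually_elim simp
  qed
  finally show ?thesis by simp
qed

text \<open>The integral of \<open>\<rho>\<close> over the preimage of \<open>A\<close> is the mass
  of \<open>A\<close>, by invertibility on \<open>D\<close>; it vanishes, and \<open>\<rho>\<close>
  is positive.\<close>

lemma \<sigma>_null: assumes A[measurable]: "A \<in> sets borel" and "emeasure lam A = 0" shows "emeasure lam (\<sigma> -` A) = 0"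
proof -
  have m[measurable]: "\<sigma> -` A \<in> sets borel" by (rule measurable_sets_borel[OF \<sigma>_borel A])
  have "(\<integral>\<^sup>+y. ennreal (\<rho> y) * indicator (\<sigma> -` A) y \<partial>lam) = emeasure (distr lam borel \<tau>) (\<sigma> -` A)"
    unfolding distr_\<tau> by (rule emeasure_density[symmetric]) auto
  also have "\<dots> = emeasure lam (\<tau> -` (\<sigma> -` A))" by (subst emeasure_distr) auto
  also have "\<dots> = emeasure lam A"
  proof (rule emeasure_eq_AE)
    have "AE x in lam. x \<in> D" using AE_not_in[of "- D" lam] conull_D by (auto simp: null_sets_def)
    then show "AE x in lam. x \<in> \<tau> -` (\<sigma> -` A) \<longleftrightarrow> x \<in> A" by eventually_elim (simp add: \<sigma>_\<tau>)
  qed (auto intro: measurable_sets_borel[OF \<tau>_borel m])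
  finally have "(\<integral>\<^sup>+y. ennreal (\<rho> y) * indicator (\<sigma> -` A) y \<partial>lam) = 0" using assms(2) by simp
  then have "AE y in lam. ennreal (\<rho> y) * indicator (\<sigma> -` A) y = 0" by (subst (asm) nn_integral_0_iff_AE) auto
  then have "AE y in lam. y \<notin> \<sigma> -` A"
    using \<rho>_pos by (auto elim!: eventually_mono split: split_indicator_asm simp: ennreal_eq_0_iff not_le[symmetric])
  then show ?thesis by (subst (asm) AE_iff_measurable[of "\<sigma> -` A"]) auto
qed

section \<open>The cost as an integral\<close>

definition gain :: "real \<Rightarrow> real" where "gain y = (sqrt (\<rho> y) - 1)\<^sup>2"

lemma gain_borel [measurable]: "gain \<in> borel_measurable borel"
  unfolding gain_def[abs_def] by measurable

lemma gain_edge: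
  assumes pq: "0 < snd p" "0 < snd q" "ivl q \<subseteq> {0..}" and r: "\<And>y. y \<in> ivl q \<Longrightarrow> \<rho> y = snd p / snd q"
  shows "(\<integral>\<^sup>+y. ennreal (gain y) * indicator (ivl q) y \<partial>lam) = ennreal ((sqrt (snd p) - sqrt (snd q))\<^sup>2)"
proof -
  have "(\<integral>\<^sup>+y. ennreal (gain y) * indicator (ivl q) y \<partial>lam) = (\<integral>\<^sup>+y. ennreal ((sqrt (snd p / snd q) - 1)\<^sup>2) * indicator (ivl q) y \<partial>lam)"
    by (intro nn_integral_cong) (auto simp: gain_def r split: split_indicator)
  also have "\<dots> = ennreal ((sqrt (snd p / snd q) - 1)\<^sup>2) * emeasure lam (ivl q)" by (rule nn_integral_cmult_indicator) auto
  also have "emeasure lam (ivl q) = ennreal (snd q)" using pq by (simp add: emeasure_lam Int_absorb2) (simp add: ivl_def)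
  also have "ennreal ((sqrt (snd p / snd q) - 1)\<^sup>2) * ennreal (snd q) = ennreal ((sqrt (snd p / snd q) - 1)\<^sup>2 * (sqrt (snd q))\<^sup>2)"
    using pq by (simp add: ennreal_mult)
  also have "(sqrt (snd p / snd q) - 1)\<^sup>2 * (sqrt (snd q))\<^sup>2 = ((sqrt (snd p / snd q) - 1) * sqrt (snd q))\<^sup>2" by (simp add: power_mult_distrib)
  also have "(sqrt (snd p / snd q) - 1) * sqrt (snd q) = sqrt (snd p) - sqrt (snd q)"
    using pq by (simp add: left_diff_distrib real_sqrt_mult[symmetric])
  finally show ?thesis .
qed

text \<open>No point is covered twice, so the targets of the edges are disjoint and the integral
  splits into one summand of \<open>cost\<close> per edge.\<close>

lemma gain_columns:
  assumes css: "\<forall>d\<in>set css. posc d" "\<And>x. CNT css x \<le> indicator {0..} x" and g: "GR css \<subseteq> G"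
  shows "(\<integral>\<^sup>+y. ennreal (gain y) * indicator {y. \<exists>x r. (x, y, r) \<in> GR css} y \<partial>lam) = ennreal (sum_list (map cost css))"
proof -
  define es where "es = concat (map edges css)"
  have mem: "\<exists>d\<in>set css. (p, q) \<in> set (edges d)" if "(p, q) \<in> set es" for p q using that by (auto simp: es_def)
  have ge: "(x, aff (p, q) x, snd p / snd q) \<in> G" if "(p, q) \<in> set es" "x \<in> ivl p" for p q x
  proof -
    obtain d where d: "d \<in> set css" "(p, q) \<in> set (edges d)" using mem[OF \<open>(p, q) \<in> set es\<close>] by blast
    then show ?thesis using edge_gr[OF d(2) _ that(2)] css(1) g by (auto simp: GR_def)
  qed
  have ps: "0 < snd p \<and> 0 < snd q" if "(p, q) \<in> set es" for p q
    using mem[OF that] css(1) edges_set by (fastforce simp: posc_def)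
  have ge': "(aff (q, p) y, y, snd p / snd q) \<in> G" if "(p, q) \<in> set es" "y \<in> ivl q" for p q y
    using ge[OF that(1)] aff_inv[of p q y] ps[OF that(1)] that(2) by metis
  have le: "(\<Sum>e\<leftarrow>es. indicator (ivl (snd e)) y) \<le> (indicator {0..} y :: real)" for y
  proof -
    have "(\<Sum>e\<leftarrow>es. indicator (ivl (snd e)) y) = (\<Sum>d\<leftarrow>css. \<Sum>e\<leftarrow>edges d. indicator (ivl (snd e)) y :: real)"
      unfolding es_def by (rule sum_list_map_concat)
    also have "\<dots> \<le> CNT css y" unfolding CNT_def by (rule sum_list_mono) (rule edges_cnt)
    finally show ?thesis using css(2)[of y] by linarith
  qed
  have mb: "indicator (ivl (snd e)) y \<le> (indicator {0..} y :: real)" if "e \<in> set es" for e y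
    using member_le_sum_map[of e es "\<lambda>e. indicator (ivl (snd e)) y"] that le[of y] by simp
  have sub: "ivl (snd e) \<subseteq> {0..}" if "e \<in> set es" for e
  proof
    fix y assume "y \<in> ivl (snd e)"
    then show "y \<in> {0..}" using mb[OF that, of y] by (cases "0 \<le> y") simp_all
  qed
  have un: "indicator {y. \<exists>x r. (x, y, r) \<in> GR css} y = (\<Sum>e\<leftarrow>es. indicator (ivl (snd e)) y :: ennreal)" for y
  proof -
    have 1: "(\<exists>x r. (x, y, r) \<in> GR css) \<longleftrightarrow> (\<exists>e\<in>set es. y \<in> ivl (snd e))"
    proof
      assume "\<exists>x r. (x, y, r) \<in> GR css"
      then obtain x r d where d: "d \<in> set css" "(x, y, r) \<in> gr d" by (auto simp: GR_def)
      obtain p q where "(p, q) \<in> set (edges d)" "y \<in> ivl q" using grE[OF d(2)] css(1) d(1) by metis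
      then show "\<exists>e\<in>set es. y \<in> ivl (snd e)" using d(1) by (force simp: es_def)
    next
      assume "\<exists>e\<in>set es. y \<in> ivl (snd e)"
      then obtain p q where pq: "(p, q) \<in> set es" "y \<in> ivl q" by auto
      obtain d where d: "d \<in> set css" "(p, q) \<in> set (edges d)" using mem[OF pq(1)] by blast
      have "(aff (q, p) y, y, snd p / snd q) \<in> gr d"
        using edge_gr[OF d(2)] css(1) d(1) aff_inv[of p q y] ps[OF pq(1)] pq(2) by metis
      then show "\<exists>x r. (x, y, r) \<in> GR css" using d(1) by (auto simp: GR_def)
    qed
    have 2: "(\<Sum>e\<leftarrow>es'. indicator (ivl (snd e)) y :: ennreal) = ennreal (\<Sum>e\<leftarrow>es'. indicator (ivl (snd e)) y)" for es' :: "(lev \<times> lev) list"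
    proof (induction es')
      case (Cons e es')
      have "0 \<le> (\<Sum>e\<leftarrow>es'. indicator (ivl (snd e)) y :: real)" by (intro sum_list_nonneg) auto
      then show ?case using Cons by (simp add: ennreal_plus ennreal_indicator)
    qed simp
    show ?thesis
    proof (cases "\<exists>e\<in>set es. y \<in> ivl (snd e)")
      case True
      then obtain e where e: "e \<in> set es" "y \<in> ivl (snd e)" by auto
      have "1 \<le> (\<Sum>e\<leftarrow>es. indicator (ivl (snd e)) y :: real)"
        using member_le_sum_map[of e es "\<lambda>e. indicator (ivl (snd e)) y"] e by simp
      moreover have "(\<Sum>e\<leftarrow>es. indicator (ivl (snd e)) y :: real) \<le> 1" by (rule order_trans[OF le]) (simp add: indicator_def)
      ultimately have "(\<Sum>e\<leftarrow>es. indicator (ivl (snd e)) y :: real) = 1" by linarith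
      then show ?thesis using True 1 2[of es] by simp
    next
      case False
      then have z: "\<forall>e\<in>set es. indicator (ivl (snd e)) y = (0::ennreal)" by auto
      have "(\<Sum>e\<leftarrow>es. indicator (ivl (snd e)) y) = (\<Sum>e\<leftarrow>es. 0::ennreal)"
        by (rule arg_cong[where f=sum_list], rule map_cong) (use z in auto)
      then show ?thesis using False 1 by simp
    qed
  qed
  have "(\<integral>\<^sup>+y. ennreal (gain y) * (\<Sum>e\<leftarrow>es'. indicator (ivl (snd e)) y) \<partial>lam) = ennreal (\<Sum>(p, q)\<leftarrow>es'. (sqrt (snd p) - sqrt (snd q))\<^sup>2)"
    if "set es' \<subseteq> set es" for es'
    using that
  proof (induction es')
    case (Cons e es')
    obtain p q where pq: "e = (p, q)" by (metis surj_pair)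
    have m: "(\<lambda>y. \<Sum>e\<leftarrow>es'. indicator (ivl (snd e)) y :: ennreal) \<in> borel_measurable borel" for es' :: "(lev \<times> lev) list"
      by (induction es') auto
    have "(\<integral>\<^sup>+y. ennreal (gain y) * (\<Sum>e\<leftarrow>e # es'. indicator (ivl (snd e)) y) \<partial>lam)
       = (\<integral>\<^sup>+y. ennreal (gain y) * indicator (ivl q) y + ennreal (gain y) * (\<Sum>e\<leftarrow>es'. indicator (ivl (snd e)) y) \<partial>lam)"
      by (simp add: pq distrib_left)
    also have "\<dots> = (\<integral>\<^sup>+y. ennreal (gain y) * indicator (ivl q) y \<partial>lam) + (\<integral>\<^sup>+y. ennreal (gain y) * (\<Sum>e\<leftarrow>es'. indicator (ivl (snd e)) y) \<partial>lam)"
      using m by (intro nn_integral_add) auto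
    also have "(\<integral>\<^sup>+y. ennreal (gain y) * indicator (ivl q) y \<partial>lam) = ennreal ((sqrt (snd p) - sqrt (snd q))\<^sup>2)"
      by (rule gain_edge) (use Cons.prems pq ps[of p q] sub[of e] ge'[of p q, THEN G_eq] in auto)
    also have "(\<integral>\<^sup>+y. ennreal (gain y) * (\<Sum>e\<leftarrow>es'. indicator (ivl (snd e)) y) \<partial>lam) = ennreal (\<Sum>(p, q)\<leftarrow>es'. (sqrt (snd p) - sqrt (snd q))\<^sup>2)"
      using Cons by simp
    also have "ennreal ((sqrt (snd p) - sqrt (snd q))\<^sup>2) + ennreal (\<Sum>(p, q)\<leftarrow>es'. (sqrt (snd p) - sqrt (snd q))\<^sup>2)
        = ennreal (\<Sum>(p, q)\<leftarrow>e # es'. (sqrt (snd p) - sqrt (snd q))\<^sup>2)"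
      unfolding pq by (simp, subst ennreal_plus) (auto intro!: sum_list_nonneg)
    finally show ?case .
  qed simp
  from this[of es] have "(\<integral>\<^sup>+y. ennreal (gain y) * indicator {y. \<exists>x r. (x, y, r) \<in> GR css} y \<partial>lam)
    = ennreal (\<Sum>(p, q)\<leftarrow>es. (sqrt (snd p) - sqrt (snd q))\<^sup>2)" unfolding un by simp
  also have "(\<Sum>(p, q)\<leftarrow>es. (sqrt (snd p) - sqrt (snd q))\<^sup>2) = sum_list (map cost css)"
    unfolding es_def sum_list_map_concat cost_def by simp
  finally show ?thesis .
qed

lemma ran_borel: assumes "\<forall>d\<in>set css. posc d" shows "{y. \<exists>x r. (x, y, r) \<in> GR css} \<in> sets borel"
proof -
  have "{y. \<exists>x r. (x, y, r) \<in> GR css} = (\<Union>d\<in>set css. \<Union>(p, q)\<in>set (edges d). ivl q)"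
  proof (intro equalityI subsetI)
    fix y assume "y \<in> {y. \<exists>x r. (x, y, r) \<in> GR css}"
    then obtain x r d where d: "d \<in> set css" "(x, y, r) \<in> gr d" by (auto simp: GR_def)
    obtain p q where "(p, q) \<in> set (edges d)" "y \<in> ivl q" using grE[OF d(2)] assms d(1) by metis
    then show "y \<in> (\<Union>d\<in>set css. \<Union>(p, q)\<in>set (edges d). ivl q)" using d(1) by fast
  next
    fix y assume "y \<in> (\<Union>d\<in>set css. \<Union>(p, q)\<in>set (edges d). ivl q)"
    then obtain d p q where d: "d \<in> set css" "(p, q) \<in> set (edges d)" "y \<in> ivl q" by auto
    have "0 < snd p" "0 < snd q" using edges_set[OF d(2)] assms d(1) by (auto simp: posc_def)
    then have "(aff (q, p) y, y, snd p / snd q) \<in> gr d"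
      using edge_gr[OF d(2)] assms d(1) aff_inv[of p q y] d(3) by metis
    then show "y \<in> {y. \<exists>x r. (x, y, r) \<in> GR css}" using d(1) by (auto simp: GR_def)
  qed
  moreover have "\<dots> \<in> sets borel" by (intro sets.finite_UN finite_set) (simp split: prod.split)
  ultimately show ?thesis by simp
qed

text \<open>The gain over the range of \<open>c n\<close> is \<open>cost (c n)\<close>, which
  exceeds the cost of \<open>css\<close> by at most \<open>\<delta>\<close>. These ranges increase
  to the conull set \<open>R\<close>.\<close>

lemma gain_bounds:
  assumes css: "\<forall>d\<in>set css. posc d" "\<And>x. CNT css x \<le> indicator {0..} x" "GR css \<subseteq> gr (c 0)"
    and cst: "\<And>n. cost (c n) \<le> sum_list (map cost css) + \<delta>" and d: "0 \<le> \<delta>"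
  shows "(\<integral>\<^sup>+y. ennreal (gain y) * indicator (- {y. \<exists>x r. (x, y, r) \<in> GR css}) y \<partial>lam) \<le> ennreal \<delta>"
    "(\<integral>\<^sup>+y. ennreal (gain y) \<partial>lam) < \<infinity>"
proof -
  define B where "B = {y. \<exists>x r. (x, y, r) \<in> GR css}"
  define Rn where "Rn n = {y. \<exists>x r. (x, y, r) \<in> gr (c n)}" for n
  have Bm[measurable]: "B \<in> sets borel" unfolding B_def by (rule ran_borel[OF css(1)])
  have Rm[measurable]: "Rn n \<in> sets borel" for n using ran_borel[of "[c n]"] pos by (simp add: Rn_def)
  have B1: "B \<subseteq> Rn n" for n using css(3) gr_mono[of 0 n] by (auto simp: B_def Rn_def)
  have IB: "(\<integral>\<^sup>+y. ennreal (gain y) * indicator B y \<partial>lam) = ennreal (sum_list (map cost css))"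
    unfolding B_def by (rule gain_columns[OF css(1,2)]) (use css(3) in \<open>auto simp: G_def\<close>)
  have c0: "0 \<le> cost d" for d by (auto simp: cost_def intro!: sum_list_nonneg)
  have IR: "(\<integral>\<^sup>+y. ennreal (gain y) * indicator (Rn n) y \<partial>lam) = ennreal (cost (c n))" for n
  proof -
    have "(\<integral>\<^sup>+y. ennreal (gain y) * indicator {y. \<exists>x r. (x, y, r) \<in> GR [c n]} y \<partial>lam) = ennreal (sum_list (map cost [c n]))"
      by (rule gain_columns) (use pos in \<open>auto simp: cn G_def split: split_indicator\<close>)
    then show ?thesis by (simp add: Rn_def)
  qed
  have cs0: "0 \<le> sum_list (map cost css)" using c0 by (intro sum_list_nonneg) auto
  have diff: "(\<integral>\<^sup>+y. ennreal (gain y) * indicator (Rn n - B) y \<partial>lam) \<le> ennreal \<delta>" for n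
  proof -
    have "ennreal (cost (c n)) = (\<integral>\<^sup>+y. ennreal (gain y) * indicator B y + ennreal (gain y) * indicator (Rn n - B) y \<partial>lam)"
      unfolding IR[symmetric] using B1[of n] by (intro nn_integral_cong) (auto split: split_indicator)
    also have "\<dots> = ennreal (sum_list (map cost css)) + (\<integral>\<^sup>+y. ennreal (gain y) * indicator (Rn n - B) y \<partial>lam)"
      unfolding IB[symmetric] by (intro nn_integral_add) auto
    finally have "ennreal (sum_list (map cost css)) + (\<integral>\<^sup>+y. ennreal (gain y) * indicator (Rn n - B) y \<partial>lam)
       \<le> ennreal (sum_list (map cost css)) + ennreal \<delta>"
      using cst[of n] cs0 d by (metis ennreal_leI ennreal_plus)
    then show ?thesis by (simp add: ennreal_add_left_cancel_le)
  qed
  have "(SUP n. \<integral>\<^sup>+y. ennreal (gain y) * indicator (Rn n - B) y \<partial>lam) = (\<integral>\<^sup>+y. (SUP n. ennreal (gain y) * indicator (Rn n - B) y) \<partial>lam)"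
  proof (rule nn_integral_monotone_convergence_SUP[symmetric])
    have "Rn n \<subseteq> Rn (Suc n)" for n using grS[of n] by (auto simp: Rn_def)
    then show "incseq (\<lambda>n y. ennreal (gain y) * indicator (Rn n - B) y)"
      by (intro incseq_SucI) (auto simp: le_fun_def split: split_indicator)
  qed auto
  moreover have "(\<integral>\<^sup>+y. ennreal (gain y) * indicator (- B) y \<partial>lam) \<le> (\<integral>\<^sup>+y. (SUP n. ennreal (gain y) * indicator (Rn n - B) y) \<partial>lam)"
  proof (rule nn_integral_mono_AE)
    have "AE y in lam. y \<in> R" using AE_not_in[of "- R" lam] conull_R by (auto simp: null_sets_def)
    then show "AE y in lam. ennreal (gain y) * indicator (- B) y \<le> (SUP n. ennreal (gain y) * indicator (Rn n - B) y)"
    proof eventually_elim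
      fix y assume "y \<in> R"
      then obtain n where "y \<in> Rn n" by (auto simp: R_def G_def Rn_def)
      then have "ennreal (gain y) * indicator (- B) y = ennreal (gain y) * indicator (Rn n - B) y" by (auto split: split_indicator)
      also have "\<dots> \<le> (SUP n. ennreal (gain y) * indicator (Rn n - B) y)" by (rule SUP_upper) simp
      finally show "ennreal (gain y) * indicator (- B) y \<le> (SUP n. ennreal (gain y) * indicator (Rn n - B) y)" .
    qed
  qed
  moreover have "(SUP n. \<integral>\<^sup>+y. ennreal (gain y) * indicator (Rn n - B) y \<partial>lam) \<le> ennreal \<delta>" by (rule SUP_least) (rule diff)
  ultimately have main: "(\<integral>\<^sup>+y. ennreal (gain y) * indicator (- B) y \<partial>lam) \<le> ennreal \<delta>" by simp
  then show "(\<integral>\<^sup>+y. ennreal (gain y) * indicator (- {y. \<exists>x r. (x, y, r) \<in> GR css}) y \<partial>lam) \<le> ennreal \<delta>" by (simp add: B_def)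
  have "(\<integral>\<^sup>+y. ennreal (gain y) \<partial>lam) = (\<integral>\<^sup>+y. ennreal (gain y) * indicator B y + ennreal (gain y) * indicator (- B) y \<partial>lam)"
    by (intro nn_integral_cong) (auto split: split_indicator)
  also have "\<dots> = ennreal (sum_list (map cost css)) + (\<integral>\<^sup>+y. ennreal (gain y) * indicator (- B) y \<partial>lam)"
    unfolding IB[symmetric] by (intro nn_integral_add) auto
  also have "\<dots> < \<infinity>" using main by (simp add: ennreal_add_less_top le_less_trans[OF main])
  finally show "(\<integral>\<^sup>+y. ennreal (gain y) \<partial>lam) < \<infinity>" .
qed

end

section \<open>From towers to nonsingular maps\<close>

context std_space begin

text \<open>\<open>nonsingular\<close> asks for a genuine bijection. The points whose forward
  iterates under \<open>f\<close> or \<open>g\<close> ever meet the bad set \<open>N\<close> form a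
  null set; on its complement \<open>X0\<close> the two maps are inverse bijections, and elsewhere
  the identity is used.\<close>

lemma nonsingular_of_AE_inverse:
  assumes f[measurable]: "f \<in> borel_measurable borel" and g[measurable]: "g \<in> borel_measurable borel"
    and gf: "AE x in M. g (f x) = x" and fg: "AE x in M. f (g x) = x"
    and nf: "\<And>A. A \<in> sets borel \<Longrightarrow> emeasure M A = 0 \<Longrightarrow> emeasure M (f -` A) = 0"
    and ng: "\<And>A. A \<in> sets borel \<Longrightarrow> emeasure M A = 0 \<Longrightarrow> emeasure M (g -` A) = 0"
  obtains T where "nonsingular M T" "AE x in M. T x = f x" "AE x in M. Tinv M T x = g x"
proof -
  define N where "N = {x. g (f x) \<noteq> x \<or> f (g x) \<noteq> x}"
  have Nm[measurable]: "N \<in> sets borel"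
  proof -
    have "(\<lambda>x. dist (g (f x)) x) \<in> borel_measurable borel" "(\<lambda>x. dist (f (g x)) x) \<in> borel_measurable borel"
      by measurable
    then have "{x \<in> space borel. dist (g (f x)) x = 0} \<in> sets borel" "{x \<in> space borel. dist (f (g x)) x = 0} \<in> sets borel"
      by measurable
    then have "- ({x. g (f x) = x} \<inter> {x. f (g x) = x}) \<in> sets borel" by auto
    moreover have "N = - ({x. g (f x) = x} \<inter> {x. f (g x) = x})" by (auto simp: N_def)
    ultimately show ?thesis by simp
  qed
  have "AE x in M. x \<notin> N" using gf fg by eventually_elim (simp add: N_def)
  then have N0: "emeasure M N = 0" by (subst (asm) AE_iff_measurable[of N]) (auto simp: sets_M)
  have pm[measurable]: "(f ^^ n) \<in> borel_measurable borel" "(g ^^ n) \<in> borel_measurable borel" for n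
    by (auto intro: measurable_compose_n)
  have fn: "emeasure M ((f ^^ n) -` A) = 0" if "A \<in> sets borel" "emeasure M A = 0" for n A
    using that
  proof (induction n arbitrary: A)
    case (Suc n)
    have e: "(f ^^ Suc n) -` A = (f ^^ n) -` (f -` A)" by auto
    moreover have "f -` A \<in> sets borel" by (rule measurable_sets_borel[OF f Suc.prems(1)])
    ultimately show ?case unfolding e using Suc.IH[of "f -` A"] nf[OF Suc.prems] by blast
  qed simp
  have gn: "emeasure M ((g ^^ n) -` A) = 0" if "A \<in> sets borel" "emeasure M A = 0" for n A
    using that
  proof (induction n arbitrary: A)
    case (Suc n)
    have e: "(g ^^ Suc n) -` A = (g ^^ n) -` (g -` A)" by auto
    moreover have "g -` A \<in> sets borel" by (rule measurable_sets_borel[OF g Suc.prems(1)])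
    ultimately show ?case unfolding e using Suc.IH[of "g -` A"] ng[OF Suc.prems] by blast
  qed simp
  define X0 where "X0 = {x. \<forall>n. (f ^^ n) x \<notin> N \<and> (g ^^ n) x \<notin> N}"
  have X0c: "- X0 = (\<Union>n. (f ^^ n) -` N \<union> (g ^^ n) -` N)" by (auto simp: X0_def)
  have vm: "(f ^^ n) -` N \<in> sets borel" "(g ^^ n) -` N \<in> sets borel" for n
    by (rule measurable_sets_borel[OF pm(1) Nm], rule measurable_sets_borel[OF pm(2) Nm])
  have X0m[measurable]: "X0 \<in> sets borel"
  proof -
    have "- X0 \<in> sets borel" unfolding X0c using vm by auto
    then show ?thesis using borel_comp by fastforce
  qed
  have "(f ^^ n) -` N \<union> (g ^^ n) -` N \<in> null_sets M" for n
    using fn[OF Nm N0, of n] gn[OF Nm N0, of n] vm by (intro null_sets.Un) (auto simp: null_sets_def sets_M)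
  then have "- X0 \<in> null_sets M" unfolding X0c by (intro null_sets_UN) auto
  then have AX: "AE x in M. x \<in> X0" using AE_not_in by force
  have inX: "g (f x) = x" "f (g x) = x" if "x \<in> X0" for x
  proof -
    have "(f ^^ 0) x \<notin> N" using that unfolding X0_def by blast
    then show "g (f x) = x" "f (g x) = x" by (auto simp: N_def)
  qed
  have X0f: "f x \<in> X0" if x: "x \<in> X0" for x
  proof -
    have "(f ^^ n) (f x) \<notin> N" for n
    proof -
      have "(f ^^ Suc n) x \<notin> N" using x unfolding X0_def by blast
      then show ?thesis by (simp add: funpow_swap1)
    qed
    moreover have "(g ^^ n) (f x) \<notin> N" for n
    proof (cases n)
      case 0
      have "(f ^^ 1) x \<notin> N" using x unfolding X0_def by blast
      then show ?thesis using 0 by simp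
    next
      case (Suc k)
      have "(g ^^ k) x \<notin> N" using x unfolding X0_def by blast
      moreover have "(g ^^ n) (f x) = (g ^^ k) x" using inX(1)[OF x] by (simp only: Suc funpow_Suc_right o_apply)
      ultimately show ?thesis by simp
    qed
    ultimately show ?thesis unfolding X0_def by blast
  qed
  have X0g: "g x \<in> X0" if x: "x \<in> X0" for x
  proof -
    have "(g ^^ n) (g x) \<notin> N" for n
    proof -
      have "(g ^^ Suc n) x \<notin> N" using x unfolding X0_def by blast
      then show ?thesis by (simp add: funpow_swap1)
    qed
    moreover have "(f ^^ n) (g x) \<notin> N" for n
    proof (cases n)
      case 0
      have "(g ^^ 1) x \<notin> N" using x unfolding X0_def by blast
      then show ?thesis using 0 by simp
    next
      case (Suc k)
      have "(f ^^ k) x \<notin> N" using x unfolding X0_def by blast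
      moreover have "(f ^^ n) (g x) = (f ^^ k) x" using inX(2)[OF x] by (simp only: Suc funpow_Suc_right o_apply)
      ultimately show ?thesis by simp
    qed
    ultimately show ?thesis unfolding X0_def by blast
  qed
  define T V where "T x = (if x \<in> X0 then f x else x)" and "V x = (if x \<in> X0 then g x else x)" for x
  have Tm[measurable]: "T \<in> borel_measurable borel" and Vm[measurable]: "V \<in> borel_measurable borel"
    unfolding T_def[abs_def] V_def[abs_def] by (auto intro!: measurable_If_set)
  have VT: "V (T x) = x" "T (V x) = x" for x using X0f X0g inX by (auto simp: T_def V_def)
  have AT: "AE x in M. T x = f x" "AE x in M. V x = g x" using AX by (eventually_elim, simp add: T_def V_def)+
  have Tn: "emeasure M (T -` A) = 0" if A[measurable]: "A \<in> sets borel" and "emeasure M A = 0" for A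
  proof -
    have "emeasure M (T -` A) = emeasure M (f -` A)"
      by (rule emeasure_eq_AE) (use AT(1) in \<open>auto simp: sets_M intro: measurable_sets_borel[OF Tm A] measurable_sets_borel[OF f A] elim!: eventually_mono\<close>)
    then show ?thesis using nf that by simp
  qed
  have Vn: "emeasure M (V -` A) = 0" if A[measurable]: "A \<in> sets borel" and "emeasure M A = 0" for A
  proof -
    have "emeasure M (V -` A) = emeasure M (g -` A)"
      by (rule emeasure_eq_AE) (use AT(2) in \<open>auto simp: sets_M intro: measurable_sets_borel[OF Vm A] measurable_sets_borel[OF g A] elim!: eventually_mono\<close>)
    then show ?thesis using ng that by simp
  qed
  have "emeasure M (T -` A) = 0 \<longleftrightarrow> emeasure M A = 0" if A: "A \<in> sets borel" for A
  proof
    assume "emeasure M (T -` A) = 0"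
    from Vn[OF measurable_sets_borel[OF Tm A] this] have "emeasure M (V -` (T -` A)) = 0" .
    moreover have "V -` (T -` A) = A" using VT by auto
    ultimately show "emeasure M A = 0" by simp
  qed (rule Tn[OF A])
  note ns = nonsingularI[OF Tm Vm VT this]
  show thesis
  proof (rule that[OF _ AT(1)])
    show "nonsingular M T" by (rule ns)
    have "Tinv M T = V" by (rule ns)
    then show "AE x in M. Tinv M T x = g x" using AT(2) by simp
  qed
qed

text \<open>\<open>\<tau>\<close> and \<open>\<sigma>\<close> are transported to \<open>M\<close> by
  \<open>G\<close> and its almost everywhere inverse \<open>\<Gamma>\<close>, then corrected to a
  bijection.\<close>

lemma tower_map:
  assumes tw: "towers c K W" and Gm[measurable]: "G \<in> borel_measurable borel" and \<Gamma>m[measurable]: "\<Gamma> \<in> borel_measurable borel"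
    and dG: "distr M borel G = density lborel (indicator {0..})" and \<Gamma>G: "AE x in M. \<Gamma> (G x) = x"
  obtains T where "nonsingular M T" "AE x in M. G x \<in> towers.D c \<and> G (T x) = towers.\<tau> c (G x)"
    "AE x in M. G x \<in> towers.R c \<and> G (Tinv M T x) = towers.\<sigma> c (G x)" "AE x in M. Tprime M T x = towers.\<rho> c (G x)"
proof -
  interpret tw: towers c K W by (rule tw)
  let ?lam = "density lborel (indicator {0..}) :: real measure"
  note [measurable] = tw.\<tau>_borel tw.\<sigma>_borel tw.\<rho>_borel tw.D_borel tw.R_borel
  have GA: "AE x in M. P (G x)" if "AE t in ?lam. P t" for P
  proof (rule AE_distrD[of G M borel])
    show "G \<in> borel_measurable M" using Gm by simp
    show "AE t in distr M borel G. P t" unfolding dG by (rule that)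
  qed
  have eG: "emeasure M (G -` A) = emeasure ?lam A" if "A \<in> sets borel" for A
    unfolding dG[symmetric] using that by (subst emeasure_distr) auto
  have nz: "AE t in ?lam. t \<notin> A" if "A \<in> sets borel" "emeasure ?lam A = 0" for A
    using that by (intro AE_not_in) (auto simp: null_sets_def)
  \<comment> \<open>\<open>G (\<Gamma> t) = t\<close> may fail on a null set; as
    \<open>\<tau>\<close> and \<open>\<sigma>\<close> pull null sets back to null sets, it holds
    almost everywhere at their values.\<close>
  define Z where "Z = {t. G (\<Gamma> t) \<noteq> t}"
  have Zm[measurable]: "Z \<in> sets borel"
  proof -
    have "{t \<in> space borel. G (\<Gamma> t) = t} \<in> sets borel" by (intro borel_measurable_eq) auto
    moreover have "Z = - {t \<in> space borel. G (\<Gamma> t) = t}" by (auto simp: Z_def)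
    ultimately show ?thesis by auto
  qed
  have Z0: "emeasure ?lam Z = 0"
  proof -
    have "AE x in M. x \<notin> G -` Z" using \<Gamma>G by eventually_elim (simp add: Z_def)
    then have "emeasure M (G -` Z) = 0"
      by (subst (asm) AE_iff_measurable[of "G -` Z"]) (auto simp: sets_M intro: measurable_sets_borel[OF Gm Zm])
    then show ?thesis by (simp add: eG)
  qed
  have G\<Gamma>: "AE x in M. G (\<Gamma> (tw.\<tau> (G x))) = tw.\<tau> (G x)" "AE x in M. G (\<Gamma> (tw.\<sigma> (G x))) = tw.\<sigma> (G x)"
  proof -
    have "AE t in ?lam. t \<notin> tw.\<tau> -` Z" "AE t in ?lam. t \<notin> tw.\<sigma> -` Z"
      by (rule nz[OF measurable_sets_borel[OF tw.\<tau>_borel Zm] tw.\<tau>_null[OF Zm Z0]],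
          rule nz[OF measurable_sets_borel[OF tw.\<sigma>_borel Zm] tw.\<sigma>_null[OF Zm Z0]])
    then have "AE x in M. G x \<notin> tw.\<tau> -` Z" "AE x in M. G x \<notin> tw.\<sigma> -` Z" by (auto dest: GA)
    then show "AE x in M. G (\<Gamma> (tw.\<tau> (G x))) = tw.\<tau> (G x)" "AE x in M. G (\<Gamma> (tw.\<sigma> (G x))) = tw.\<sigma> (G x)"
      by (auto simp: Z_def elim!: eventually_mono)
  qed
  have GD: "AE x in M. G x \<in> tw.D" "AE x in M. G x \<in> tw.R"
    using nz[OF _ tw.conull_D] nz[OF _ tw.conull_R] by (auto dest!: GA)
  define f g where "f x = \<Gamma> (tw.\<tau> (G x))" and "g x = \<Gamma> (tw.\<sigma> (G x))" for x
  have fm: "f \<in> borel_measurable borel" and gm: "g \<in> borel_measurable borel"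
    unfolding f_def[abs_def] g_def[abs_def] by measurable
  have "AE x in M. g (f x) = x" using G\<Gamma>(1) GD(1) \<Gamma>G
    by eventually_elim (simp add: f_def g_def tw.\<sigma>_\<tau>)
  moreover have "AE x in M. f (g x) = x" using G\<Gamma>(2) GD(2) \<Gamma>G
    by eventually_elim (simp add: f_def g_def tw.\<tau>_\<sigma>)
  moreover have n\<Gamma>: "emeasure ?lam (\<Gamma> -` A) = 0" if A: "A \<in> sets borel" "emeasure M A = 0" for A
  proof -
    have m: "\<Gamma> -` A \<in> sets borel" by (rule measurable_sets_borel[OF \<Gamma>m A(1)])
    have "emeasure ?lam (\<Gamma> -` A) = emeasure M (G -` (\<Gamma> -` A))" by (rule eG[OF m, symmetric])
    also have "\<dots> = emeasure M A"
      by (rule emeasure_eq_AE) (use \<Gamma>G A in \<open>auto simp: sets_M intro: measurable_sets_borel[OF Gm m] elim!: eventually_mono\<close>)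
    finally show ?thesis using A by simp
  qed
  have nf: "emeasure M (f -` A) = 0" if A: "A \<in> sets borel" "emeasure M A = 0" for A
  proof -
    have m: "\<Gamma> -` A \<in> sets borel" by (rule measurable_sets_borel[OF \<Gamma>m A(1)])
    have "f -` A = G -` (tw.\<tau> -` (\<Gamma> -` A))" by (auto simp: f_def)
    then show ?thesis using eG[OF measurable_sets_borel[OF tw.\<tau>_borel m]] tw.\<tau>_null[OF m n\<Gamma>[OF A]] by simp
  qed
  have ng: "emeasure M (g -` A) = 0" if A: "A \<in> sets borel" "emeasure M A = 0" for A
  proof -
    have m: "\<Gamma> -` A \<in> sets borel" by (rule measurable_sets_borel[OF \<Gamma>m A(1)])
    have "g -` A = G -` (tw.\<sigma> -` (\<Gamma> -` A))" by (auto simp: g_def)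
    then show ?thesis using eG[OF measurable_sets_borel[OF tw.\<sigma>_borel m]] tw.\<sigma>_null[OF m n\<Gamma>[OF A]] by simp
  qed
  obtain T where T: "nonsingular M T" "AE x in M. T x = f x" "AE x in M. Tinv M T x = g x"
    using nonsingular_of_AE_inverse[OF fm gm calculation(1,2) nf ng] by blast
  note Tm[measurable] = nonsingularD(2)[OF T(1)]
  show thesis
  proof (rule that[OF T(1)])
    show "AE x in M. G x \<in> tw.D \<and> G (T x) = tw.\<tau> (G x)" using T(2) G\<Gamma>(1) GD(1) by eventually_elim (simp add: f_def)
    show "AE x in M. G x \<in> tw.R \<and> G (Tinv M T x) = tw.\<sigma> (G x)" using T(3) G\<Gamma>(2) GD(2) by eventually_elim (simp add: g_def)
    show "AE x in M. Tprime M T x = tw.\<rho> (G x)"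
    proof (rule Tprime_unique)
      show "(\<lambda>x. tw.\<rho> (G x)) \<in> borel_measurable borel" by measurable
      show "0 \<le> tw.\<rho> (G x)" for x using tw.\<rho>_pos less_imp_le by blast
      show "density M (\<lambda>x. ennreal (tw.\<rho> (G x))) = distr M M T"
      proof (rule measure_eqI)
        fix A assume "A \<in> sets (density M (\<lambda>x. ennreal (tw.\<rho> (G x))))"
        then have A[measurable]: "A \<in> sets borel" by (simp add: sets_M)
        have m[measurable]: "\<Gamma> -` A \<in> sets borel" by (rule measurable_sets_borel[OF \<Gamma>m A])
        have "emeasure (distr M M T) A = emeasure M (T -` A)" by (subst emeasure_distr) (auto simp: sets_M)
        also have "\<dots> = emeasure M (G -` (tw.\<tau> -` (\<Gamma> -` A)))"
        proof (rule emeasure_eq_AE)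
          show "AE x in M. x \<in> T -` A \<longleftrightarrow> x \<in> G -` (tw.\<tau> -` (\<Gamma> -` A))" using T(2) by eventually_elim (simp add: f_def)
        qed (auto simp: sets_M intro: measurable_sets_borel[OF Tm A] measurable_sets_borel[OF Gm measurable_sets_borel[OF tw.\<tau>_borel m]])
        also have "\<dots> = emeasure ?lam (tw.\<tau> -` (\<Gamma> -` A))" by (rule eG[OF measurable_sets_borel[OF tw.\<tau>_borel m]])
        also have "\<dots> = emeasure (distr ?lam borel tw.\<tau>) (\<Gamma> -` A)" by (subst emeasure_distr) auto
        also have "\<dots> = (\<integral>\<^sup>+t. ennreal (tw.\<rho> t) * indicator (\<Gamma> -` A) t \<partial>?lam)"
          unfolding tw.distr_\<tau> by (rule emeasure_density) auto
        also have "\<dots> = (\<integral>\<^sup>+x. ennreal (tw.\<rho> (G x)) * indicator (\<Gamma> -` A) (G x) \<partial>M)"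
          unfolding dG[symmetric] by (rule nn_integral_distr) auto
        also have "\<dots> = (\<integral>\<^sup>+x. ennreal (tw.\<rho> (G x)) * indicator A x \<partial>M)"
          by (intro nn_integral_cong_AE) (use \<Gamma>G in \<open>auto elim!: eventually_mono split: split_indicator\<close>)
        also have "\<dots> = emeasure (density M (\<lambda>x. ennreal (tw.\<rho> (G x)))) A"
          by (rule emeasure_density[symmetric]) (auto simp: sets_M)
        finally show "emeasure (density M (\<lambda>x. ennreal (tw.\<rho> (G x)))) A = emeasure (distr M M T) A" by simp
      qed simp
    qed
  qed
qed

end

text \<open>Replacing \<open>s\<close> by \<open>a n * s\<close> shifts the averaged terms by one
  index, so only two of them survive. The error \<open>1 / L n\<close> passes unchanged to earlier
  stages, because the recursion averages and commutes with scaling. Late stages make invariance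
  under every positive integer exact; rationals and continuity then give a constant for each
  \<open>n\<close>, and the recursion equates these constants.\<close>

lemma averaging_constant:
  fixes g :: "nat \<Rightarrow> real \<Rightarrow> real" and a L :: "nat \<Rightarrow> nat"
  assumes g01: "\<And>n s. 0 < s \<Longrightarrow> 0 \<le> g n s \<and> g n s \<le> 1"
    and cont: "\<And>n s. 0 < s \<Longrightarrow> isCont (g n) s"
    and rec: "\<And>n s. 0 < s \<Longrightarrow> g n s = (\<Sum>l<L n. g (Suc n) (s / (real (L n) * real (a n ^ l)))) / real (L n)"
    and a: "\<And>n. a n = 2 + fst (prod_decode n)" and L: "\<And>n. L n = n + 2"
  shows "\<exists>k. \<forall>n s. 0 < s \<longrightarrow> g n s = k"
proof -
  have L0: "0 < real (L n)" for n by (simp add: L)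
  have a0: "0 < real (a n)" for n by (simp add: a)
  have step1: "\<bar>g n (real (a n) * s) - g n s\<bar> \<le> 1 / real (L n)" if s: "0 < s" for n s
  proof -
    define h where "h l = g (Suc n) (real (a n) * s / (real (L n) * real (a n ^ l)))" for l
    have hb: "0 \<le> h l \<and> h l \<le> 1" for l unfolding h_def using a0[of n] L0[of n] s by (intro g01) simp
    have 1: "g n (real (a n) * s) = (\<Sum>l<L n. h l) / real (L n)"
      using a0[of n] s by (subst rec) (auto simp: h_def)
    have 2: "g n s = (\<Sum>l<L n. h (Suc l)) / real (L n)"
      using a0[of n] s by (subst rec) (auto simp: h_def)
    have "g n (real (a n) * s) - g n s = (\<Sum>l<L n. h l - h (Suc l)) / real (L n)"
      unfolding 1 2 by (simp add: sum_subtractf diff_divide_distrib)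
    also have "\<dots> = (h 0 - h (L n)) / real (L n)" using sum_lessThan_telescope'[of h "L n"] by simp
    finally have "\<bar>g n (real (a n) * s) - g n s\<bar> = \<bar>h 0 - h (L n)\<bar> / real (L n)" by simp
    also have "\<dots> \<le> 1 / real (L n)" using hb[of 0] hb[of "L n"] L0[of n] by (intro divide_right_mono) auto
    finally show ?thesis .
  qed
  have step2: "\<bar>g m (b * s) - g m s\<bar> \<le> \<eta>" if b: "0 < b" and H: "\<And>s. 0 < s \<Longrightarrow> \<bar>g n (b * s) - g n s\<bar> \<le> \<eta>" and "m \<le> n" and s: "0 < s"
    for m n b \<eta> s
    using \<open>m \<le> n\<close> s
  proof (induction arbitrary: s rule: inc_induct)
    case base then show ?case by (rule H)
  next
    case (step i)
    have "g i (b * s) - g i s = (\<Sum>l<L i. g (Suc i) (b * (s / (real (L i) * real (a i ^ l)))) - g (Suc i) (s / (real (L i) * real (a i ^ l)))) / real (L i)"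
      using step.prems b by (simp add: rec[of "b * s" i] rec[of s i] sum_subtractf diff_divide_distrib)
    also have "\<bar>\<dots>\<bar> \<le> (\<Sum>l<L i. \<eta>) / real (L i)"
      unfolding abs_divide
    proof (intro frac_le)
      show "\<bar>\<Sum>l<L i. g (Suc i) (b * (s / (real (L i) * real (a i ^ l)))) - g (Suc i) (s / (real (L i) * real (a i ^ l)))\<bar> \<le> (\<Sum>l<L i. \<eta>)"
        using step.prems a0[of i] L0[of i] by (intro order_trans[OF sum_abs] sum_mono step.IH) simp
      have "0 \<le> \<eta>" using step.IH[of 1] by linarith
      then show "0 \<le> (\<Sum>l<L i. \<eta>)" by (simp add: sum_nonneg)
    qed (use L0[of i] in auto)
    also have "\<dots> = \<eta>" using L0[of i] by simp
    finally show ?case .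
  qed
  have step3: "g m (real b * s) = g m s" if b: "0 < b" and s: "0 < s" for m b s
  proof (cases "b = 1")
    case False
    then have b2: "2 \<le> b" using b by simp
    have "\<bar>g m (real b * s) - g m s\<bar> \<le> 1 / real (j + 1)" for j
    proof -
      \<comment> \<open>Decoding returns \<open>a n = b\<close>, and \<open>n\<close> is at least
        \<open>m\<close> and \<open>j\<close>, so the error is below
        \<open>1 / (j + 1)\<close>.\<close>
      define n where "n = prod_encode (b - 2, max m j)"
      have n: "max m j \<le> n" unfolding n_def by (rule le_prod_encode_2)
      have an: "a n = b" using b2 by (simp add: a n_def)
      have "\<bar>g m (real b * s) - g m s\<bar> \<le> 1 / real (L n)"
        by (rule step2[of "real b" n]) (use step1[of _ n] an n b s in auto)
      also have "\<dots> \<le> 1 / real (j + 1)" using n by (intro divide_left_mono) (auto simp: L)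
      finally show ?thesis .
    qed
    then have "\<bar>g m (real b * s) - g m s\<bar> \<le> 0"
      by (intro LIMSEQ_le_const[OF LIMSEQ_Suc[OF lim_1_over_n]]) (auto simp: add.commute)
    then show ?thesis by simp
  qed simp
  have step4: "g m t = g m 1" if t: "0 < t" for m t
  proof (rule ccontr)
    assume ne: "g m t \<noteq> g m 1"
    then have "0 < \<bar>g m t - g m 1\<bar>" by simp
    then obtain d where d: "0 < d" "\<And>x. dist x t < d \<Longrightarrow> dist (g m x) (g m t) < \<bar>g m t - g m 1\<bar>"
      using cont[OF t, of m] unfolding continuous_at_eps_delta by blast
    \<comment> \<open>A rational \<open>r = p / q\<close> close to \<open>t\<close>: since
      \<open>q * r = p * 1\<close>, integer invariance gives \<open>g m r = g m 1\<close>.\<close>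
    obtain r where r: "r \<in> \<rat>" "t < r" "r < t + d" using Rats_dense_in_real[of t "t + d"] d(1) by auto
    obtain p q :: nat where pq: "q \<noteq> 0" "\<bar>r\<bar> = real p / real q" using Rats_abs_nat_div_natE[OF r(1)] by metis
    have rp: "r = real p / real q" "0 < r" using pq r t by auto
    then have p0: "0 < p" using pq(1) by (cases p) auto
    have "g m r = g m (real q * r)" using step3[of q r m] pq(1) rp by simp
    also have "real q * r = real p * 1" using pq(1) rp by simp
    also have "g m (real p * 1) = g m 1" by (rule step3) (use p0 in auto)
    finally have "g m r = g m 1" .
    moreover have "dist r t < d" using r by (simp add: dist_real_def)
    ultimately show False using d(2)[of r] by (simp add: dist_real_def abs_minus_commute)
  qed
  have step5: "g n 1 = g (Suc n) 1" for n
  proof -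
    have "g n 1 = (\<Sum>l<L n. g (Suc n) 1) / real (L n)"
      unfolding rec[of 1 n, simplified] using a0[of n] L0[of n] by (intro arg_cong2[where f="(/)"] sum.cong step4) auto
    then show ?thesis using L0[of n] by simp
  qed
  have "g n 1 = g 0 1" for n by (induction n) (use step5 in auto)
  then show ?thesis using step4 by metis
qed

section \<open>Ergodicity of tower maps\<close>

lemma borel_measurable_sum_list_indicator:
  "\<forall>B\<in>set Bs. B \<in> sets N \<Longrightarrow> (\<lambda>x. \<Sum>B\<leftarrow>Bs. indicator B x :: ennreal) \<in> borel_measurable N"
  by (induction Bs) auto

lemma nn_integral_sum_list_indicator:
  "\<forall>B\<in>set Bs. B \<in> sets N \<Longrightarrow> (\<integral>\<^sup>+x. (\<Sum>B\<leftarrow>Bs. indicator B x) \<partial>N) = (\<Sum>B\<leftarrow>Bs. emeasure N B)"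
proof (induction Bs)
  case (Cons B Bs)
  have "(\<integral>\<^sup>+x. (\<Sum>B\<leftarrow>B # Bs. indicator B x) \<partial>N) = (\<integral>\<^sup>+x. indicator B x + (\<Sum>B\<leftarrow>Bs. indicator B x) \<partial>N)" by simp
  also have "\<dots> = (\<integral>\<^sup>+x. indicator B x \<partial>N) + (\<integral>\<^sup>+x. (\<Sum>B\<leftarrow>Bs. indicator B x) \<partial>N)"
    using Cons.prems by (intro nn_integral_add borel_measurable_sum_list_indicator) auto
  finally show ?case using Cons by simp
qed simp

lemma ennreal_sum_list: "(\<And>x. x \<in> set xs \<Longrightarrow> 0 \<le> f x) \<Longrightarrow> ennreal (\<Sum>x\<leftarrow>xs. f x) = (\<Sum>x\<leftarrow>xs. ennreal (f x))"
proof (induction xs)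
  case (Cons x xs)
  have "0 \<le> (\<Sum>x\<leftarrow>xs. f x)" using Cons.prems by (intro sum_list_nonneg) auto
  then show ?case using Cons by (simp add: ennreal_plus)
qed simp

lemma sum_list_filter_le: "(\<Sum>p\<leftarrow>filter P c. indicator (f p) x) \<le> (\<Sum>p\<leftarrow>c. indicator (f p) x :: real)"
  by (induction c) (auto simp: add_increasing)

lemma along_column:
  assumes "\<And>p q. (p, q) \<in> set (edges d) \<Longrightarrow> f p = f q" "p \<in> set d" shows "f p = f (hd d)"
  using assms
proof (induction d)
  case (Cons z d)
  show ?case
  proof (cases "p \<in> set d")
    case True
    then obtain w d' where d: "d = w # d'" by (cases d) auto
    have "f p = f (hd d)" by (rule Cons.IH[OF _ True]) (use Cons.prems(1) d in auto)
    moreover have "f z = f w" by (rule Cons.prems(1)) (simp add: d)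
    ultimately show ?thesis by (simp add: d)
  qed (use Cons.prems in simp)
qed simp

context std_space begin

lemma AE_nu: assumes "AE x in M. P x" shows "AE z in nu. P (fst z)"
proof -
  from assms obtain N where N: "{x. \<not> P x} \<subseteq> N" "N \<in> sets borel" "emeasure M N = 0"
    by (elim AE_E) (auto simp: sets_M)
  have m[measurable]: "N \<times> (UNIV :: real set) \<in> sets borel" by (rule boxes_measurable) (use N in auto)
  have "emeasure nu (N \<times> UNIV) = integral\<^sup>N nu (indicator (N \<times> UNIV))" by (simp add: sets_nu)
  also have "\<dots> = (\<integral>\<^sup>+x. \<integral>\<^sup>+y. ennreal (exp y) * indicator (N \<times> UNIV) (x, y) \<partial>lborel \<partial>M)" by (rule nn_integral_nu) auto
  also have "\<dots> = (\<integral>\<^sup>+x. 0 \<partial>M)"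
  proof (rule nn_integral_cong_AE)
    have "AE x in M. x \<notin> N" using N by (intro AE_not_in) (auto simp: null_sets_def sets_M)
    then show "AE x in M. (\<integral>\<^sup>+y. ennreal (exp y) * indicator (N \<times> UNIV) (x, y) \<partial>lborel) = 0"
      by eventually_elim simp
  qed
  finally have "emeasure nu (N \<times> UNIV) = 0" by simp
  then show ?thesis by (intro AE_I[of _ _ "N \<times> UNIV"]) (use N in \<open>auto simp: sets_nu\<close>)
qed

text \<open>The box above a level \<open>p\<close> up to height \<open>ln (s / snd p)\<close> has
  mass \<open>s\<close>, and the extension carries it, up to a null set, onto the corresponding box
  of the next level. The mass of an invariant \<open>E\<close> in it thus depends only on
  \<open>s\<close> and the column. The constant density obtained for levels passes to intervals and
  then to all Borel sets, which forces \<open>E\<close> or its complement to be null.\<close>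

lemma tower_ergodic:
  assumes tw: "towers c K W" and Gm[measurable]: "G \<in> borel_measurable borel" and \<Gamma>m[measurable]: "\<Gamma> \<in> borel_measurable borel"
    and dG: "distr M borel G = density lborel (indicator {0..})" and \<Gamma>G: "AE x in M. \<Gamma> (G x) = x"
    and T: "nonsingular M T" and T1: "AE x in M. G x \<in> towers.D c \<and> G (T x) = towers.\<tau> c (G x)"
    and T2: "AE x in M. Tprime M T x = towers.\<rho> c (G x)"
    and cut: "\<And>n s t. (s, t) \<in> set (fracs (2 + fst (prod_decode n)) (n + 2)) \<Longrightarrow> sublev s t (hd (c n)) \<in> set (c (Suc n))"
  shows "ergodic nu (maharam M T)"
  unfolding ergodic_def
proof (intro ballI impI)
  interpret tw: towers c K W by (rule tw)
  fix E assume "E \<in> sets nu" and inv: "maharam M T -` E \<inter> space nu = E"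
  then have E[measurable]: "E \<in> sets borel" by (simp add: sets_nu)
  note mT[measurable] = maharam_measurable(1)[OF T]
  let ?lam = "density lborel (indicator {0..}) :: real measure"
  have lam: "emeasure ?lam A = emeasure lborel (A \<inter> {0..})" if "A \<in> sets borel" for A by (rule tw.emeasure_lam[OF that])
  have eG: "emeasure M (G -` A) = emeasure ?lam A" if "A \<in> sets borel" for A
    unfolding dG[symmetric] using that by (subst emeasure_distr) auto
  define box where "box B b = (G -` B) \<times> {..b}" for B :: "real set" and b :: real
  have GB: "G -` B \<in> sets borel" if "B \<in> sets borel" for B by (rule measurable_sets_borel[OF Gm that])
  have boxm[measurable]: "box B b \<in> sets borel" if "B \<in> sets borel" for B b
    unfolding box_def using GB[OF that] by (intro boxes_measurable) auto
  have boxnu: "emeasure nu (box B b) = ennreal (exp b) * emeasure lborel (B \<inter> {0..})" if "B \<in> sets borel" for B b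
    unfolding box_def using that by (simp add: emeasure_nu_box GB eG lam)
  \<comment> \<open>The part of \<open>E\<close> below height \<open>b\<close>, pushed to the half
    line. Being a measure for fixed \<open>b\<close>, it adds up over the pieces of a level.\<close>
  define \<kappa> where "\<kappa> b = distr (density nu (indicator (E \<inter> UNIV \<times> {..b}))) borel (\<lambda>z. G (fst z))" for b
  have Gf[measurable]: "(\<lambda>z::'a \<times> real. G (fst z)) \<in> borel_measurable borel" unfolding borel_prod[symmetric] by measurable
  have Eb[measurable]: "E \<inter> UNIV \<times> {..b} \<in> sets borel" for b :: real by (intro sets.Int E boxes_measurable) auto
  have \<kappa>s: "sets (\<kappa> b) = sets borel" for b by (simp add: \<kappa>_def)
  have \<kappa>: "emeasure (\<kappa> b) B = emeasure nu (E \<inter> box B b)" if B[measurable]: "B \<in> sets borel" for B b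
  proof -
    have v: "(\<lambda>z::'a \<times> real. G (fst z)) -` B \<in> sets borel" by (rule measurable_sets_borel[OF Gf B])
    have "emeasure (\<kappa> b) B = emeasure (density nu (indicator (E \<inter> UNIV \<times> {..b}))) ((\<lambda>z. G (fst z)) -` B)"
      unfolding \<kappa>_def using v by (subst emeasure_distr) (auto simp: sets_nu)
    also have "\<dots> = (\<integral>\<^sup>+z. indicator (E \<inter> UNIV \<times> {..b}) z * indicator ((\<lambda>z. G (fst z)) -` B) z \<partial>nu)"
      using v by (intro emeasure_density) (auto simp: sets_nu)
    also have "\<dots> = (\<integral>\<^sup>+z. indicator (E \<inter> box B b) z \<partial>nu)"
      by (intro nn_integral_cong) (auto simp: box_def split: split_indicator)
    finally show ?thesis using boxm[OF B] by (simp add: sets_nu)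
  qed
  have \<kappa>le: "emeasure (\<kappa> b) B \<le> ennreal (exp b) * emeasure lborel (B \<inter> {0..})" if B: "B \<in> sets borel" for B b
    unfolding \<kappa>[OF B] boxnu[OF B, symmetric] using B by (intro emeasure_mono) (auto simp: sets_nu)
  have ivlK: "emeasure lborel (ivl p \<inter> {0..}) = ennreal (snd p)" "0 < snd p" if "p \<in> set (c n)" for p n
  proof -
    show p: "0 < snd p" using tw.pos that by (auto simp: posc_def)
    have "ivl p \<inter> {0..} = ivl p" using tw.lev_sub[OF that] by auto
    then show "emeasure lborel (ivl p \<inter> {0..}) = ennreal (snd p)" using p by (simp add: ivl_def)
  qed
  \<comment> \<open>The mass of \<open>E\<close> in the box of mass \<open>s\<close> above
    \<open>p\<close>.\<close>
  define e where "e p s = measure (\<kappa> (ln (s / snd p))) (ivl p)" for p s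
  have emk: "emeasure (\<kappa> b) (ivl p) = ennreal (measure (\<kappa> b) (ivl p))" if "p \<in> set (c n)" for p n b
  proof -
    have "emeasure (\<kappa> b) (ivl p) \<le> ennreal (exp b) * ennreal (snd p)" using \<kappa>le[of "ivl p" b] ivlK(1)[OF that] by simp
    also have "\<dots> < \<infinity>" by (simp add: ennreal_mult_less_top)
    finally show ?thesis by (intro emeasure_eq_ennreal_measure) auto
  qed
  have Einv: "z \<in> E \<longleftrightarrow> maharam M T z \<in> E" for z using inv by auto

  \<comment> \<open>Along the edge the extension lowers fibres by \<open>ln (snd q / snd p)\<close>,
    exactly the difference of the two heights, \<open>b - b'\<close>. Invariance of \<open>E\<close>
    and of \<open>nu\<close> does the rest.\<close>
  have edge: "e p s = e q s" if pq: "(p, q) \<in> set (edges (c n))" and s: "0 < s" for p q n s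
  proof -
    have pq': "(p, q) \<in> tw.EE" using pq by (auto simp: tw.EE_def)
    have ps: "0 < snd p" "0 < snd q" using tw.EE_pos[OF pq'] by auto
    define b b' where "b = ln (s / snd p)" and "b' = ln (s / snd q)"
    have bb: "b = b' + ln (snd q / snd p)" using ps s by (simp add: b_def b'_def ln_div)
    have AEx: "AE x in M. \<forall>y. (maharam M T (x, y) \<in> box (ivl q) b' \<longleftrightarrow> (x, y) \<in> box (ivl p) b)"
      using T1 AE_comp[OF T T2] Tprime_Tinv[OF T]
    proof eventually_elim
      fix x assume 1: "G x \<in> tw.D \<and> G (T x) = tw.\<tau> (G x)" and 2: "Tprime M T (T x) = tw.\<rho> (G (T x))"
        and 3: "Tprime M (Tinv M T) x = 1 / Tprime M T (T x)"
      have G1: "(G x, tw.\<tau> (G x), tw.\<rho> (tw.\<tau> (G x))) \<in> tw.G" using 1 tw.G_eq by (auto simp: tw.D_def)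
      have iff: "tw.\<tau> (G x) \<in> ivl q \<longleftrightarrow> G x \<in> ivl p"
      proof
        assume y: "tw.\<tau> (G x) \<in> ivl q"
        from tw.EE_G'[OF pq' y] G1 have "G x = tw.aff (q, p) (tw.\<tau> (G x))" using tw.G_inj by blast
        then show "G x \<in> ivl p" using tw.aff_inv[OF ps y] by simp
      next
        assume "G x \<in> ivl p"
        from tw.EE_G[OF pq' this] G1 have t: "tw.\<tau> (G x) = tw.aff (p, q) (G x)" using tw.G_fun by blast
        show "tw.\<tau> (G x) \<in> ivl q" unfolding t using tw.aff_inv[OF ps(2,1) \<open>G x \<in> ivl p\<close>] by simp
      qed
      show "\<forall>y. (maharam M T (x, y) \<in> box (ivl q) b' \<longleftrightarrow> (x, y) \<in> box (ivl p) b)"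
      proof (cases "G x \<in> ivl p")
        case True
        then have "tw.\<tau> (G x) \<in> ivl q" using iff by simp
        from tw.EE_G'[OF pq' this] have "tw.\<rho> (tw.\<tau> (G x)) = snd p / snd q" using tw.G_eq by blast
        then have "ln (Tprime M (Tinv M T) x) = ln (snd q / snd p)" using 1 2 3 by simp
        then show ?thesis using True iff 1 by (auto simp: maharam_eq box_def bb)
      next
        case False
        then show ?thesis using iff 1 by (auto simp: maharam_eq box_def)
      qed
    qed
    have "emeasure (\<kappa> b') (ivl q) = emeasure nu (E \<inter> box (ivl q) b')" by (rule \<kappa>) auto
    also have "\<dots> = emeasure (distr nu nu (maharam M T)) (E \<inter> box (ivl q) b')" by (simp add: distr_maharam[OF T])
    also have "\<dots> = emeasure nu (maharam M T -` (E \<inter> box (ivl q) b'))"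
      by (subst emeasure_distr) (auto simp: sets_nu)
    also have "\<dots> = emeasure nu (E \<inter> box (ivl p) b)"
    proof (rule emeasure_eq_AE)
      show "AE z in nu. z \<in> maharam M T -` (E \<inter> box (ivl q) b') \<longleftrightarrow> z \<in> E \<inter> box (ivl p) b"
        using AE_nu[OF AEx]
      proof eventually_elim
        fix z :: "'a \<times> real" assume "\<forall>y. (maharam M T (fst z, y) \<in> box (ivl q) b' \<longleftrightarrow> (fst z, y) \<in> box (ivl p) b)"
        then have "maharam M T z \<in> box (ivl q) b' \<longleftrightarrow> z \<in> box (ivl p) b" by (metis prod.collapse)
        then show "z \<in> maharam M T -` (E \<inter> box (ivl q) b') \<longleftrightarrow> z \<in> E \<inter> box (ivl p) b" using Einv[of z] by simp
      qed
      have "E \<inter> box (ivl q) b' \<in> sets borel" by (intro sets.Int) auto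
      from measurable_sets_borel[OF mT this] show "maharam M T -` (E \<inter> box (ivl q) b') \<in> sets nu" by (simp add: sets_nu)
    qed (auto simp: sets_nu)
    also have "\<dots> = emeasure (\<kappa> b) (ivl p)" by (rule \<kappa>[symmetric]) auto
    finally show ?thesis by (simp add: e_def b_def b'_def measure_def)
  qed
  have level: "e p s = e (hd (c n)) s" if "p \<in> set (c n)" "0 < s" for p n s
    by (rule along_column[of "c n" "\<lambda>p. e p s"]) (use edge that in auto)
  have hdm: "hd (c n) \<in> set (c n)" for n using tw.pos by (simp add: posc_def)

  define g where "g n s = e (hd (c n)) s / s" for n s
  have es: "e p s = measure nu (E \<inter> box (ivl p) (ln (s / snd p)))" for p s
    unfolding e_def measure_def by (simp add: \<kappa>)
  have ebox: "emeasure nu (box (ivl p) (ln (s / snd p))) = ennreal s" if "p \<in> set (c n)" "0 < s" for p n s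
    using that ivlK[OF that(1)] by (subst boxnu) (auto simp: ennreal_mult'[symmetric])
  have ele: "0 \<le> e p s" "e p s \<le> s" if "p \<in> set (c n)" "0 < s" for p n s
  proof -
    show "0 \<le> e p s" by (simp add: e_def)
    have "measure nu (E \<inter> box (ivl p) (ln (s / snd p))) \<le> measure nu (box (ivl p) (ln (s / snd p)))"
      using ebox[OF that] by (intro measure_mono_fmeasurable) (auto simp: sets_nu fmeasurable_def)
    also have "\<dots> = s" using ebox[OF that] that by (simp add: measure_def)
    finally show "e p s \<le> s" by (simp add: es)
  qed
  \<comment> \<open>Enlarging the box from mass \<open>s\<close> to \<open>s'\<close> adds mass
    \<open>s' - s\<close>, which bounds what \<open>E\<close> gains; this Lipschitz bound supplies
    continuity in \<open>s\<close>.\<close>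
  have elip: "e p s \<le> e p s' \<and> e p s' - e p s \<le> s' - s" if p: "p \<in> set (c n)" and s: "0 < s" "s \<le> s'" for p n s s'
  proof -
    let ?B = "box (ivl p) (ln (s / snd p))" and ?B' = "box (ivl p) (ln (s' / snd p))"
    have ln: "ln (s / snd p) \<le> ln (s' / snd p)" using ivlK(2)[OF p] s by (intro ln_mono divide_right_mono) auto
    have BB: "?B \<subseteq> ?B'" using ln by (auto simp: box_def)
    have s': "0 < s'" using s by simp
    have fm: "?B \<in> fmeasurable nu" "?B' \<in> fmeasurable nu"
      using ebox[OF p s(1)] ebox[OF p s'] by (auto simp: fmeasurable_def sets_nu)
    have fE: "E \<inter> ?B \<in> fmeasurable nu" "E \<inter> ?B' \<in> fmeasurable nu"
      using fmeasurable_Int_fmeasurable[OF fm(1), of E] fmeasurable_Int_fmeasurable[OF fm(2), of E] by (auto simp: sets_nu Int_commute)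
    have mB: "measure nu ?B = s" "measure nu ?B' = s'" using ebox[OF p s(1)] ebox[OF p s'] s by (auto simp: measure_def)
    have 1: "e p s \<le> e p s'" unfolding es using BB fE by (intro measure_mono_fmeasurable) auto
    have "e p s' - e p s = measure nu (E \<inter> ?B' - E \<inter> ?B)"
      unfolding es using fE BB by (subst measurable_measure_Diff) auto
    also have "\<dots> \<le> measure nu (?B' - ?B)"
    proof (rule measure_mono_fmeasurable)
      show "E \<inter> ?B' - E \<inter> ?B \<in> sets nu" by (rule sets.Diff[OF fmeasurableD[OF fE(2)] fmeasurableD[OF fE(1)]])
      show "?B' - ?B \<in> fmeasurable nu" by (rule fmeasurable_Diff[OF fm(2) fmeasurableD[OF fm(1)]])
    qed auto
    also have "\<dots> = s' - s" using fm BB mB by (subst measurable_measure_Diff) auto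
    finally show ?thesis using 1 by simp
  qed
  have gcont: "isCont (g n) s" if s: "0 < s" for n s
  proof -
    let ?f = "e (hd (c n))"
    have lip: "\<bar>?f x - ?f y\<bar> \<le> \<bar>x - y\<bar>" if "0 < x" "0 < y" for x y
      using elip[OF hdm[of n] that(1), of y] elip[OF hdm[of n] that(2), of x] by (cases "x \<le> y") auto
    have "isCont ?f s" unfolding continuous_at_eps_delta
    proof (intro allI impI)
      fix \<epsilon> :: real assume \<epsilon>: "0 < \<epsilon>"
      show "\<exists>d>0. \<forall>x'. dist x' s < d \<longrightarrow> dist (?f x') (?f s) < \<epsilon>"
      proof (rule exI[of _ "min s \<epsilon>"], intro conjI allI impI)
        fix x' assume d: "dist x' s < min s \<epsilon>"
        then have "0 < x'" by (auto simp: dist_real_def)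
        then show "dist (?f x') (?f s) < \<epsilon>" using lip[of x' s] s d by (auto simp: dist_real_def)
      qed (use s \<epsilon> in auto)
    qed
    then show ?thesis unfolding g_def[abs_def] using s by (intro continuous_intros) auto
  qed
  \<comment> \<open>Over a piece of relative length \<open>v - u\<close> the same height
    \<open>b\<close> gives a box of mass \<open>s * (v - u)\<close>. Part \<open>l\<close> has
    \<open>a ^ l\<close> pieces of relative length \<open>1 / (L * a ^ l)\<close>; after division by
    \<open>s\<close> the plain average over \<open>l\<close> is left.\<close>
  have grec: "g n s = (\<Sum>l<n + 2. g (Suc n) (s / (real (n + 2) * real ((2 + fst (prod_decode n)) ^ l)))) / real (n + 2)"
    if s: "0 < s" for n s
  proof -
    define a L where "a = 2 + fst (prod_decode n)" and "L = n + 2"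
    have aL: "0 < a" "0 < L" by (auto simp: a_def L_def)
    define h where "h = hd (c n)"
    have hp: "0 < snd h" and hc: "h \<in> set (c n)" using ivlK(2)[OF hdm] hdm by (auto simp: h_def)
    define b where "b = ln (s / snd h)"
    have ph: "posc [h]" using hp by (simp add: posc_def)
    have ind: "indicator (ivl h) x = (\<Sum>(u, v)\<leftarrow>fracs a L. indicator (ivl (sublev u v h)) x :: real)" for x
      using cut_all(2)[OF ph aL, of x] by (simp add: cnt_def CNT_def o_def split_beta')
    have ind': "indicator (ivl h) x = (\<Sum>B\<leftarrow>map (\<lambda>(u, v). ivl (sublev u v h)) (fracs a L). indicator B x :: ennreal)" for x
    proof -
      have "indicator (ivl h) x = ennreal (indicator (ivl h) x)" by (simp add: ennreal_indicator)
      also have "\<dots> = (\<Sum>(u, v)\<leftarrow>fracs a L. ennreal (indicator (ivl (sublev u v h)) x))"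
        unfolding ind by (subst ennreal_sum_list) (auto simp: split_beta')
      finally show ?thesis by (simp add: o_def split_beta' ennreal_indicator)
    qed
    have mem: "sublev u v h \<in> set (c (Suc n))" if "(u, v) \<in> set (fracs a L)" for u v
      using cut that by (simp add: h_def a_def L_def)
    have piece: "measure (\<kappa> b) (ivl (sublev u v h)) = e (hd (c (Suc n))) (s * (v - u))" if uv: "(u, v) \<in> set (fracs a L)" for u v
    proof -
      have d: "0 < v - u" using fracs_mem(2)[OF uv aL(1)] by simp
      have "ln (s * (v - u) / snd (sublev u v h)) = b" using d by (simp add: sublev_def b_def)
      then have "measure (\<kappa> b) (ivl (sublev u v h)) = e (sublev u v h) (s * (v - u))" by (simp add: e_def)
      also have "\<dots> = e (hd (c (Suc n))) (s * (v - u))" by (rule level[OF mem[OF uv]]) (use s d in simp)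
      finally show ?thesis .
    qed
    have "ennreal (e h s) = emeasure (\<kappa> b) (ivl h)" using emk[OF hc] by (simp add: e_def b_def)
    also have "\<dots> = (\<integral>\<^sup>+x. indicator (ivl h) x \<partial>\<kappa> b)" by (simp add: \<kappa>s)
    also have "\<dots> = (\<Sum>B\<leftarrow>map (\<lambda>(u, v). ivl (sublev u v h)) (fracs a L). emeasure (\<kappa> b) B)"
      unfolding ind' by (rule nn_integral_sum_list_indicator) (auto simp: \<kappa>s)
    also have "\<dots> = (\<Sum>z\<leftarrow>fracs a L. ennreal (e (hd (c (Suc n))) (s * (snd z - fst z))))"
      unfolding map_map o_def
    proof (intro arg_cong[where f=sum_list] map_cong refl)
      fix z assume z: "z \<in> set (fracs a L)"
      then show "emeasure (\<kappa> b) (case z of (u, v) \<Rightarrow> ivl (sublev u v h)) = ennreal (e (hd (c (Suc n))) (s * (snd z - fst z)))"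
        using emk[OF mem[of "fst z" "snd z"], of b] piece[of "fst z" "snd z"] by (simp add: split_beta')
    qed
    also have "\<dots> = ennreal (\<Sum>(u, v)\<leftarrow>fracs a L. e (hd (c (Suc n))) (s * (v - u)))"
      by (subst ennreal_sum_list) (auto simp: e_def split_beta')
    also have "(\<Sum>(u, v)\<leftarrow>fracs a L. e (hd (c (Suc n))) (s * (v - u))) = (\<Sum>l<L. real (a ^ l) * e (hd (c (Suc n))) (s * (1 / (real L * real (a ^ l)))))"
      by (rule fracs_sum_diff[OF aL])
    finally have "e h s = (\<Sum>l<L. real (a ^ l) * e (hd (c (Suc n))) (s * (1 / (real L * real (a ^ l)))))"
      by (subst (asm) ennreal_inj) (auto simp: e_def intro!: sum_nonneg)
    then have "g n s = (\<Sum>l<L. real (a ^ l) * e (hd (c (Suc n))) (s * (1 / (real L * real (a ^ l)))) / s)"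
      by (simp add: g_def h_def sum_divide_distrib)
    also have "\<dots> = (\<Sum>l<L. g (Suc n) (s / (real L * real (a ^ l))) / real L)"
      by (intro sum.cong refl) (use aL s in \<open>simp add: g_def\<close>)
    also have "\<dots> = (\<Sum>l<L. g (Suc n) (s / (real L * real (a ^ l)))) / real L" by (simp only: sum_divide_distrib)
    finally show ?thesis by (simp only: a_def L_def)
  qed
  have "\<exists>k. \<forall>n s. 0 < s \<longrightarrow> g n s = k"
  proof (rule averaging_constant)
    show "0 \<le> g n s \<and> g n s \<le> 1" if "0 < s" for n s using ele[OF hdm that] that by (simp add: g_def)
  qed (rule gcont, assumption, rule grec, assumption, rule refl, rule refl)
  then obtain k where k: "\<And>n s. 0 < s \<Longrightarrow> g n s = k" by blast
  have k0: "0 \<le> k" using k[of 1 0] ele(1)[OF hdm, of 1 0] by (simp add: g_def)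
  have lev: "measure (\<kappa> b) (ivl p) = k * exp b * snd p" if p: "p \<in> set (c n)" for p n b
  proof -
    define s where "s = exp b * snd p"
    have s: "0 < s" "ln (s / snd p) = b" using ivlK(2)[OF p] by (auto simp: s_def)
    have "measure (\<kappa> b) (ivl p) = e p s" by (simp add: e_def s)
    also have "\<dots> = e (hd (c n)) s" by (rule level[OF p s(1)])
    also have "\<dots> = k * s" using k[OF s(1), of n] s(1) by (simp add: g_def field_simps)
    finally show ?thesis by (simp add: s_def)
  qed

  \<comment> \<open>The levels of stage \<open>n\<close> inside \<open>{0..<z}\<close> miss only
    points within \<open>\<bar>W\<bar> / 2 ^ n\<close> of \<open>z\<close>. On the missed set,
    \<open>\<kappa> b\<close> is at most \<open>exp b\<close> times length.\<close>
  have initial: "emeasure (\<kappa> b) {0..<z} = ennreal (k * exp b * z)" if z: "0 \<le> z" for z b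
  proof -
    have fin: "emeasure (\<kappa> b) B \<noteq> \<infinity>" if "B \<in> sets borel" "B \<subseteq> {0..<z}" for B
    proof -
      have "emeasure (\<kappa> b) B \<le> ennreal (exp b) * emeasure lborel (B \<inter> {0..})" by (rule \<kappa>le[OF that(1)])
      also have "\<dots> \<le> ennreal (exp b) * emeasure lborel {0..<z}"
        using that by (intro mult_left_mono emeasure_mono) auto
      also have "\<dots> < \<infinity>" using z by (simp add: ennreal_mult_less_top)
      finally show ?thesis by simp
    qed
    have approx: "\<bar>measure (\<kappa> b) {0..<z} - k * exp b * z\<bar> \<le> (exp b + k * exp b) * (\<bar>W\<bar> / 2 ^ n)" if n: "z \<le> real n" for n
    proof -
      define \<epsilon> where "\<epsilon> = \<bar>W\<bar> / 2 ^ n"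
      define ps where "ps = filter (\<lambda>p. fst p + snd p \<le> z) (c n)"
      define U where "U = (\<Union>p\<in>set ps. ivl p)"
      have psc: "p \<in> set (c n)" "fst p + snd p \<le> z" if "p \<in> set ps" for p using that by (auto simp: ps_def)
      have zK: "z \<le> K n" using tw.K_ge[of n] n by simp
      have Um[measurable]: "U \<in> sets borel" unfolding U_def by (intro sets.finite_UN) auto
      have Us: "U \<subseteq> {0..<z}"
      proof
        fix x assume "x \<in> U"
        then obtain p where p: "p \<in> set ps" "x \<in> ivl p" by (auto simp: U_def)
        then show "x \<in> {0..<z}" using psc[OF p(1)] tw.lev_sub[OF psc(1)[OF p(1)]] by (auto simp: ivl_def)
      qed
      have Ur: "{0..<z} - U \<subseteq> {max 0 (z - \<epsilon>)..<z}"
      proof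
        fix x assume x: "x \<in> {0..<z} - U"
        have "\<exists>p\<in>set (c n). x \<in> ivl p"
        proof (rule ccontr)
          assume "\<not> ?thesis"
          then have "\<forall>p\<in>set (c n). indicator (ivl p) x = (0::real)" by auto
          then have "cnt (c n) x = (\<Sum>p\<leftarrow>c n. 0)" unfolding cnt_def by (intro arg_cong[where f=sum_list] map_cong) auto
          then show False using x zK by (simp add: tw.cn)
        qed
        then obtain p where p: "p \<in> set (c n)" "x \<in> ivl p" by blast
        have "\<not> fst p + snd p \<le> z" using x p by (cases p) (auto simp: U_def ps_def)
        moreover have "snd p \<le> \<epsilon>" using tw.wid[OF p(1)] unfolding \<epsilon>_def by (rule order_trans) (simp add: divide_right_mono)
        ultimately show "x \<in> {max 0 (z - \<epsilon>)..<z}" using p(2) x by (auto simp: ivl_def)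
      qed
      have e0: "0 \<le> \<epsilon>" by (simp add: \<epsilon>_def)
      have indU: "indicator U x = (\<Sum>B\<leftarrow>map ivl ps. indicator B x :: ennreal)" for x
      proof (cases "x \<in> U")
        case True
        then obtain p where p: "p \<in> set ps" "x \<in> ivl p" by (auto simp: U_def)
        have "(\<Sum>p\<leftarrow>ps. indicator (ivl p) x :: real) \<le> cnt (c n) x"
          unfolding cnt_def ps_def by (rule sum_list_filter_le)
        then have "(\<Sum>p\<leftarrow>ps. indicator (ivl p) x :: real) \<le> 1" using tw.cn_le[of n x] by linarith
        moreover have "1 \<le> (\<Sum>p\<leftarrow>ps. indicator (ivl p) x :: real)"
          using member_le_sum_map[OF p(1), of "\<lambda>p. indicator (ivl p) x"] p(2) by simp
        ultimately have "(\<Sum>p\<leftarrow>ps. indicator (ivl p) x :: real) = 1" by linarith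
        then have "(\<Sum>p\<leftarrow>ps. ennreal (indicator (ivl p) x)) = 1" by (subst ennreal_sum_list[symmetric]) auto
        then show ?thesis using True by (simp add: o_def ennreal_indicator)
      next
        case False
        then have z: "\<forall>p\<in>set ps. indicator (ivl p) x = (0::ennreal)" by (auto simp: U_def)
        have "(\<Sum>p\<leftarrow>ps. indicator (ivl p) x) = (\<Sum>p\<leftarrow>ps. 0::ennreal)" by (intro arg_cong[where f=sum_list] map_cong) (use z in auto)
        then show ?thesis using False by (simp add: o_def)
      qed
      have mU: "emeasure N U = (\<Sum>B\<leftarrow>map ivl ps. emeasure N B)" if "sets N = sets borel" for N
      proof -
        have "emeasure N U = (\<integral>\<^sup>+x. indicator U x \<partial>N)" using that by simp
        also have "\<dots> = (\<Sum>B\<leftarrow>map ivl ps. emeasure N B)" unfolding indU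
          by (rule nn_integral_sum_list_indicator) (auto simp: that)
        finally show ?thesis .
      qed
      define w where "w = (\<Sum>p\<leftarrow>ps. snd p)"
      have w0: "0 \<le> w" unfolding w_def by (intro sum_list_nonneg) (use psc ivlK(2) in \<open>force intro: less_imp_le\<close>)
      have lU: "emeasure lborel U = ennreal w"
      proof -
        have "emeasure lborel U = (\<Sum>p\<leftarrow>ps. emeasure lborel (ivl p))" by (subst mU) (auto simp: o_def)
        also have "\<dots> = (\<Sum>p\<leftarrow>ps. ennreal (snd p))"
        proof (intro arg_cong[where f=sum_list] map_cong refl)
          fix p assume "p \<in> set ps"
          then have "0 < snd p" using psc(1) ivlK(2) by blast
          then show "emeasure lborel (ivl p) = ennreal (snd p)" by (simp add: ivl_def)
        qed
        also have "\<dots> = ennreal w" unfolding w_def by (rule ennreal_sum_list[symmetric]) (use psc ivlK(2) in \<open>force intro: less_imp_le\<close>)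
        finally show ?thesis .
      qed
      have kU: "emeasure (\<kappa> b) U = ennreal (k * exp b * w)"
      proof -
        have "emeasure (\<kappa> b) U = (\<Sum>p\<leftarrow>ps. emeasure (\<kappa> b) (ivl p))" by (subst mU) (auto simp: o_def \<kappa>s)
        also have "\<dots> = (\<Sum>p\<leftarrow>ps. ennreal (k * exp b * snd p))"
        proof (intro arg_cong[where f=sum_list] map_cong refl)
          fix p assume "p \<in> set ps"
          then have "p \<in> set (c n)" using psc by simp
          then show "emeasure (\<kappa> b) (ivl p) = ennreal (k * exp b * snd p)" using emk lev by simp
        qed
        also have "\<dots> = ennreal (\<Sum>p\<leftarrow>ps. k * exp b * snd p)"
          by (rule ennreal_sum_list[symmetric]) (use psc ivlK(2) k0 in \<open>force intro: less_imp_le\<close>)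
        also have "(\<Sum>p\<leftarrow>ps. k * exp b * snd p) = k * exp b * w" by (simp add: w_def sum_list_const_mult)
        finally show ?thesis .
      qed
      have rest: "emeasure lborel ({0..<z} - U) \<le> ennreal \<epsilon>"
      proof -
        have "emeasure lborel ({0..<z} - U) \<le> emeasure lborel {max 0 (z - \<epsilon>)..<z}" using Ur by (intro emeasure_mono) auto
        also have "\<dots> \<le> ennreal \<epsilon>" using z e0 by (cases "max 0 (z - \<epsilon>) \<le> z") (auto simp: max_def intro!: ennreal_leI)
        finally show ?thesis .
      qed
      have split: "emeasure N {0..<z} = emeasure N U + emeasure N ({0..<z} - U)" if "sets N = sets borel" for N
        using Us that by (subst plus_emeasure) (auto simp: Un_absorb1 intro!: arg_cong[where f="emeasure N"])
      have "ennreal z = ennreal w + emeasure lborel ({0..<z} - U)" using split[of lborel] z lU by simp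
      then obtain r where r: "emeasure lborel ({0..<z} - U) = ennreal r" "0 \<le> r"
        using rest by (cases "emeasure lborel ({0..<z} - U)") (auto simp: top_unique)
      have rz: "z = w + r" "r \<le> \<epsilon>"
        using \<open>ennreal z = _\<close> r w0 z rest e0 by (auto simp: ennreal_plus[symmetric] simp del: ennreal_plus)
      define t where "t = measure (\<kappa> b) ({0..<z} - U)"
      have t: "emeasure (\<kappa> b) ({0..<z} - U) = ennreal t" "0 \<le> t"
        unfolding t_def using fin[of "{0..<z} - U"] by (auto intro!: emeasure_eq_ennreal_measure)
      have "ennreal t \<le> ennreal (exp b) * ennreal r"
        using \<kappa>le[of "{0..<z} - U" b] t r by (simp add: Int_absorb2 subset_iff)
      then have tr: "t \<le> exp b * r" using r by (simp add: ennreal_mult'[symmetric])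
      have "emeasure (\<kappa> b) {0..<z} = ennreal (k * exp b * w + t)"
        using split[OF \<kappa>s] kU t k0 w0 by (simp add: ennreal_plus)
      then have m: "measure (\<kappa> b) {0..<z} = k * exp b * w + t" using k0 w0 t by (intro measure_eq_emeasure_eq_ennreal) auto
      have "\<bar>measure (\<kappa> b) {0..<z} - k * exp b * z\<bar> = \<bar>t - k * exp b * r\<bar>" unfolding m by (subst rz(1)) (simp add: algebra_simps)
      also have "\<dots> \<le> t + k * exp b * r" using t(2) k0 r(2) by (simp add: abs_le_iff)
      also have "\<dots> \<le> exp b * r + k * exp b * r" using tr by simp
      also have "\<dots> = (exp b + k * exp b) * r" by (simp add: algebra_simps)
      also have "\<dots> \<le> (exp b + k * exp b) * \<epsilon>" using rz(2) k0 by (intro mult_left_mono) auto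
      finally show ?thesis by (simp add: \<epsilon>_def)
    qed
    obtain n0 :: nat where n0: "z \<le> real n0" using real_arch_simple by blast
    have "(\<lambda>n. (exp b + k * exp b) * (\<bar>W\<bar> / 2 ^ n)) \<longlonglongrightarrow> (exp b + k * exp b) * 0"
      by (intro tendsto_mult tendsto_const LIMSEQ_divide_realpow_zero) auto
    then have "\<bar>measure (\<kappa> b) {0..<z} - k * exp b * z\<bar> \<le> (exp b + k * exp b) * 0"
    proof (rule LIMSEQ_le_const)
      show "\<exists>N. \<forall>n\<ge>N. \<bar>measure (\<kappa> b) {0..<z} - k * exp b * z\<bar> \<le> (exp b + k * exp b) * (\<bar>W\<bar> / 2 ^ n)"
        using approx n0 by (intro exI[of _ n0]) (auto intro: order_trans)
    qed
    then have "measure (\<kappa> b) {0..<z} = k * exp b * z" by simp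
    moreover have "emeasure (\<kappa> b) {0..<z} = ennreal (measure (\<kappa> b) {0..<z})" using fin[of "{0..<z}"] by (intro emeasure_eq_ennreal_measure) auto
    ultimately show ?thesis by simp
  qed
  have initial': "emeasure (\<kappa> b) {..z} = ennreal (k * exp b * z)" for z b
  proof (cases "0 \<le> z")
    case True
    have ze: "emeasure (\<kappa> b) {z} = 0" "emeasure (\<kappa> b) {..<0} = 0"
    proof -
      have "{z} \<inter> {0..} = {z}" "{..<0} \<inter> {0..} = ({} :: real set)" using True by auto
      then show "emeasure (\<kappa> b) {z} = 0" "emeasure (\<kappa> b) {..<0} = 0" using \<kappa>le[of "{z}" b] \<kappa>le[of "{..<0}" b] by auto
    qed
    have "emeasure (\<kappa> b) {..z} = emeasure (\<kappa> b) {0..<z}"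
    proof (rule emeasure_eq_AE)
      have "{z} \<in> null_sets (\<kappa> b)" "{..<0} \<in> null_sets (\<kappa> b)" using ze by (auto simp: null_sets_def \<kappa>s)
      from this[THEN AE_not_in] show "AE x in \<kappa> b. x \<in> {..z} \<longleftrightarrow> x \<in> {0..<z}" by eventually_elim auto
    qed (auto simp: \<kappa>s)
    then show ?thesis using initial[OF True] by simp
  next
    case False
    have "{..z} \<inter> {0..} = {}" using False by auto
    then have "emeasure (\<kappa> b) {..z} = 0" using \<kappa>le[of "{..z}" b] by simp
    moreover have "k * exp b * z \<le> 0" using False k0 by (simp add: mult_nonneg_nonpos)
    ultimately show ?thesis by (simp add: ennreal_neg)
  qed

  \<comment> \<open>In the plane the lower left quadrants form a generator stable under
    intersection, and their preimages are boxes, where the density is already known.\<close>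
  define \<Psi> where "\<Psi> z = (G (fst z), snd z)" for z :: "'a \<times> real"
  have \<Psi>m[measurable]: "\<Psi> \<in> borel_measurable borel" unfolding \<Psi>_def[abs_def] borel_prod[symmetric] by measurable
  have eq: "distr (density nu (indicator E)) borel \<Psi> = distr (density nu (\<lambda>_. ennreal k)) borel \<Psi>"
  proof (rule measure_eqI_generator_eq[where E="range (\<lambda>a::real \<times> real. {..a})" and \<Omega>=UNIV and A="\<lambda>i. {..(real i, real i)}"])
    have L: "emeasure (distr (density nu (indicator E)) borel \<Psi>) {..(z, b)} = ennreal (k * exp b * z)" for z b
    proof -
      have v: "\<Psi> -` {..(z, b)} = box {..z} b" by (auto simp: \<Psi>_def box_def)
      have "emeasure (distr (density nu (indicator E)) borel \<Psi>) {..(z, b)} = emeasure (density nu (indicator E)) (box {..z} b)"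
        unfolding v[symmetric] by (subst emeasure_distr) auto
      also have "\<dots> = (\<integral>\<^sup>+z'. indicator E z' * indicator (box {..z} b) z' \<partial>nu)" by (rule emeasure_density) (auto simp: sets_nu)
      also have "\<dots> = (\<integral>\<^sup>+z'. indicator (E \<inter> box {..z} b) z' \<partial>nu)" by (intro nn_integral_cong) (auto split: split_indicator)
      also have "\<dots> = emeasure (\<kappa> b) {..z}" by (simp add: \<kappa> sets_nu)
      finally show ?thesis by (simp add: initial')
    qed
    have Rr: "emeasure (distr (density nu (\<lambda>_. ennreal k)) borel \<Psi>) {..(z, b)} = ennreal (k * exp b * z)" for z b
    proof -
      have v: "\<Psi> -` {..(z, b)} = box {..z} b" by (auto simp: \<Psi>_def box_def)
      have "emeasure (distr (density nu (\<lambda>_. ennreal k)) borel \<Psi>) {..(z, b)} = emeasure (density nu (\<lambda>_. ennreal k)) (box {..z} b)"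
        unfolding v[symmetric] by (subst emeasure_distr) auto
      also have "\<dots> = ennreal k * emeasure nu (box {..z} b)" by (subst emeasure_density_const) (auto simp: sets_nu)
      also have "\<dots> = ennreal k * (ennreal (exp b) * emeasure lborel ({..z} \<inter> {0..}))" by (subst boxnu) auto
      also have "{..z} \<inter> {0..} = {0..z}" by auto
      also have "emeasure lborel {0..z} = ennreal z" by (cases "0 \<le> z") (auto simp: ennreal_neg)
      also have "ennreal k * (ennreal (exp b) * ennreal z) = ennreal (k * exp b * z)"
        using k0 by (cases "0 \<le> z") (auto simp: ennreal_mult ennreal_neg mult_nonneg_nonpos mult.assoc)
      finally show ?thesis .
    qed
    show "emeasure (distr (density nu (indicator E)) borel \<Psi>) X = emeasure (distr (density nu (\<lambda>_. ennreal k)) borel \<Psi>) X"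
      if "X \<in> range (\<lambda>a. {..a})" for X
      using that L Rr by (auto simp del: atMost_iff)
    show "Int_stable (range (\<lambda>a::real \<times> real. {..a}))"
    proof (rule Int_stableI)
      fix X Y assume "X \<in> range (\<lambda>a::real \<times> real. {..a})" "Y \<in> range (\<lambda>a::real \<times> real. {..a})"
      then obtain p q where "X = {..p}" "Y = {..q}" by auto
      then have "X \<inter> Y = {..(min (fst p) (fst q), min (snd p) (snd q))}" by (auto simp: less_eq_prod_def)
      then show "X \<inter> Y \<in> range (\<lambda>a::real \<times> real. {..a})" by auto
    qed
    show "(\<Union>i. {..(real i, real i)}) = UNIV"
    proof (intro equalityI subsetI)
      fix p :: "real \<times> real"
      obtain n where "max (fst p) (snd p) \<le> real n" using real_arch_simple by blast
      then show "p \<in> (\<Union>i. {..(real i, real i)})" by (auto simp: less_eq_prod_def)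
    qed simp
    show "emeasure (distr (density nu (indicator E)) borel \<Psi>) {..(real i, real i)} \<noteq> \<infinity>" for i by (simp add: L)
    show "sets (distr (density nu (indicator E)) borel \<Psi>) = sigma_sets UNIV (range (\<lambda>a::real \<times> real. {..a}))"
      "sets (distr (density nu (\<lambda>_. ennreal k)) borel \<Psi>) = sigma_sets UNIV (range (\<lambda>a::real \<times> real. {..a}))"
      by (simp_all add: borel_eq_atMost)
  qed auto
  have key: "emeasure nu (E \<inter> D) = ennreal k * emeasure nu D" if D[measurable]: "D \<in> sets borel" for D
  proof -
    \<comment> \<open>\<open>\<Gamma>\<close> represents an arbitrary Borel set, up to a null set,
      as a preimage under \<open>\<Psi>\<close>.\<close>
    define D' where "D' = {p. (\<Gamma> (fst p), snd p) \<in> D}"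
    have mm: "(\<lambda>p::real \<times> real. (\<Gamma> (fst p), snd p)) \<in> borel_measurable borel"
      unfolding borel_prod[symmetric] by measurable
    have D'm[measurable]: "D' \<in> sets borel" unfolding D'_def using measurable_sets_borel[OF mm D] by (simp add: vimage_def)
    have v: "\<Psi> -` D' \<in> sets borel" by (rule measurable_sets_borel[OF \<Psi>m D'm])
    have AD: "AE z in nu. z \<in> \<Psi> -` D' \<longleftrightarrow> z \<in> D"
      using AE_nu[OF \<Gamma>G] by eventually_elim (simp add: \<Psi>_def D'_def)
    have "emeasure nu (E \<inter> D) = emeasure nu (E \<inter> \<Psi> -` D')"
      by (rule emeasure_eq_AE) (use AD v in \<open>auto simp: sets_nu elim!: eventually_mono\<close>)
    also have "\<dots> = (\<integral>\<^sup>+z. indicator (E \<inter> \<Psi> -` D') z \<partial>nu)" using v by (simp add: sets_nu)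
    also have "\<dots> = (\<integral>\<^sup>+z. indicator E z * indicator (\<Psi> -` D') z \<partial>nu)" by (intro nn_integral_cong) (auto split: split_indicator)
    also have "\<dots> = emeasure (density nu (indicator E)) (\<Psi> -` D')" using v by (intro emeasure_density[symmetric]) (auto simp: sets_nu)
    also have "\<dots> = emeasure (distr (density nu (indicator E)) borel \<Psi>) D'" by (subst emeasure_distr) auto
    also have "\<dots> = emeasure (density nu (\<lambda>_. ennreal k)) (\<Psi> -` D')" unfolding eq by (subst emeasure_distr) auto
    also have "\<dots> = ennreal k * emeasure nu (\<Psi> -` D')" using v by (subst emeasure_density_const) (auto simp: sets_nu)
    also have "emeasure nu (\<Psi> -` D') = emeasure nu D"
      by (rule emeasure_eq_AE) (use AD v in \<open>auto simp: sets_nu elim!: eventually_mono\<close>)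
    finally show ?thesis .
  qed
  show "emeasure nu E = 0 \<or> emeasure nu (space nu - E) = 0"
  proof (cases "k = 0")
    case True
    then show ?thesis using key[of E] by simp
  next
    case False
    have "E \<inter> (- E) = {}" by auto
    then have "ennreal k * emeasure nu (- E) = 0" using key[of "- E"] by simp
    then show ?thesis using False k0 by (simp add: Compl_eq_Diff_UNIV)
  qed
qed

end

section \<open>Density\<close>

context std_space begin

text \<open>\<open>p\<close> labels the source pieces P_i and \<open>q\<close> the target pieces
  R_i, with 0 for the rest. Pairs of labels become consecutive intervals of the half line, on which
  \<open>initial_columns\<close> maps most of P_i to R_i; \<open>tower_sequence\<close> completes
  the columns. As \<open>Y\<close> is the range of the initial columns, the deviation outside
  \<open>Y\<close> is paid by linking alone.\<close>

lemma ergodic_model: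
  fixes p q :: "'a \<Rightarrow> nat"
  assumes na: "non_atomic M" and inf: "emeasure M UNIV = \<infinity>" and m: "1 \<le> m"
    and pm: "\<And>i. {x. p x = i} \<in> sets borel" and qm: "\<And>i. {x. q x = i} \<in> sets borel"
    and pq: "\<And>x. p x \<le> m" "\<And>x. q x \<le> m"
    and P: "\<And>i. i \<in> {1..m} \<Longrightarrow> 0 < emeasure M {x. p x = i} \<and> emeasure M {x. p x = i} < \<infinity>"
    and Q: "\<And>i. i \<in> {1..m} \<Longrightarrow> 0 < emeasure M {x. q x = i} \<and> emeasure M {x. q x = i} < \<infinity>"
    and d: "0 < (\<delta>::real)"
  obtains T Y where "nonsingular M T" "ergodic nu (maharam M T)" "Y \<in> sets borel"
    "AE x in M. x \<in> Y \<longrightarrow> q x \<in> {1..m} \<and> p (Tinv M T x) = q x \<and>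
        Tprime M T x = measure M {z. p z = q x} / measure M {z. q z = q x}"
    "emeasure M ({x. 1 \<le> q x} - Y) \<le> ennreal \<delta>"
    "(\<integral>\<^sup>+x. ennreal ((sqrtTprime M T x - 1)\<^sup>2) * indicator (- Y) x \<partial>M) \<le> ennreal \<delta>"
    "(\<integral>\<^sup>+x. ennreal ((sqrtTprime M T x - 1)\<^sup>2) \<partial>M) < \<infinity>"
proof -
  \<comment> \<open>\<open>\<kappa>\<close> numbers the pairs \<open>(p, q)\<close> so that \<open>(0, 0)\<close>, the only class of infinite measure, comes last\<close>
  define n where "n = m * (m + 2)"
  define pk qk where "pk k = (n - k) div (m + 1)" and "qk k = (n - k) mod (m + 1)" for k
  define \<kappa> where "\<kappa> x = n - (p x * (m + 1) + q x)" for x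
  have code: "p x * (m + 1) + q x \<le> n" for x
  proof -
    have "p x * (m + 1) \<le> m * (m + 1)" using pq by (intro mult_right_mono) auto
    then show ?thesis using pq(2)[of x] by (simp add: n_def algebra_simps)
  qed
  have dec: "pk (\<kappa> x) = p x" "qk (\<kappa> x) = q x" for x
  proof -
    have e: "n - \<kappa> x = p x * (m + 1) + q x" using code[of x] by (simp add: \<kappa>_def)
    have l: "q x < m + 1" using pq(2)[of x] by simp
    show "pk (\<kappa> x) = p x" unfolding pk_def e using l by (subst div_mult_self3) auto
    show "qk (\<kappa> x) = q x" unfolding qk_def e using l by (subst mod_mult_self3) simp
  qed
  have \<kappa>n: "\<kappa> x < n \<longleftrightarrow> 1 \<le> p x \<or> 1 \<le> q x" for x
  proof -
    have "0 < n" using m by (simp add: n_def)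
    then have "\<kappa> x < n \<longleftrightarrow> 0 < p x * (m + 1) + q x" using code[of x] unfolding \<kappa>_def by arith
    then show ?thesis by auto
  qed
  have \<kappa>m: "{x. \<kappa> x = i} \<in> sets borel" for i
  proof -
    have "{x. \<kappa> x = i} = (\<Union>a\<in>{..m}. \<Union>b\<in>{b. b \<le> m \<and> n - (a * (m + 1) + b) = i}. {x. p x = a} \<inter> {x. q x = b})"
      using pq by (auto simp: \<kappa>_def)
    moreover have "\<dots> \<in> sets borel" using pm qm by (intro sets.finite_UN sets.Int) auto
    ultimately show ?thesis by simp
  qed
  have sub: "{x. \<kappa> x = k} \<subseteq> {x. p x = pk k} \<inter> {x. q x = qk k}" for k using dec by auto
  have pkm: "pk k \<le> m \<and> qk k \<le> m" for k
  proof -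
    have "pk k \<le> n div (m + 1)" unfolding pk_def by (intro div_le_mono) simp
    also have "\<dots> < m + 1" by (subst div_less_iff_less_mult) (auto simp: n_def algebra_simps)
    finally have "pk k \<le> m" by simp
    moreover have "qk k < m + 1" unfolding qk_def by (rule mod_less_divisor) simp
    ultimately show ?thesis by simp
  qed
  \<comment> \<open>The index \<open>n\<close> codes the pair \<open>(0, 0)\<close>, so every class
    below \<open>n\<close> lies in some P_i or R_i and has finite measure.\<close>
  have pk0: "1 \<le> pk k \<or> 1 \<le> qk k" if "k < n" for k
  proof (rule ccontr)
    assume "\<not> ?thesis"
    then have "pk k = 0" "qk k = 0" by auto
    then have "n - k = 0" unfolding pk_def qk_def using div_mult_mod_eq[of "n - k" "m + 1"] by simp
    then show False using that by simp
  qed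
  have fin: "emeasure M {x. \<kappa> x = k} < \<infinity>" if k: "k < n" for k
  proof (cases "1 \<le> pk k")
    case True
    have "emeasure M {x. \<kappa> x = k} \<le> emeasure M {x. p x = pk k}" using sub[of k] pm by (intro emeasure_mono) (auto simp: sets_M)
    also have "\<dots> < \<infinity>" using P[of "pk k"] True pkm by auto
    finally show ?thesis .
  next
    case False
    then have 1: "1 \<le> qk k" using pk0[OF k] by simp
    have "emeasure M {x. \<kappa> x = k} \<le> emeasure M {x. q x = qk k}" using sub[of k] qm by (intro emeasure_mono) (auto simp: sets_M)
    also have "\<dots> < \<infinity>" using Q[of "qk k"] 1 pkm by auto
    finally show ?thesis .
  qed
  define w where "w k = measure M {x. \<kappa> x = k}" for k
  have \<kappa>le: "\<kappa> x \<le> n" for x by (simp add: \<kappa>_def)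
  obtain G \<Gamma> where G[measurable]: "G \<in> borel_measurable borel" and \<Gamma>: "\<Gamma> \<in> borel_measurable borel"
    and dG: "distr M borel G = density lborel (indicator {0..})" and \<Gamma>G: "AE x in M. \<Gamma> (G x) = x"
    and at: "\<And>k. k \<le> n \<Longrightarrow> AE x in M. \<kappa> x < k \<longleftrightarrow> G x < (\<Sum>j<k. w j)"
  proof (rule iso_exists[OF na inf \<kappa>m fin \<kappa>le, folded w_def])
    fix G :: "'a \<Rightarrow> real" and \<Gamma> :: "real \<Rightarrow> 'a"
    assume a: "G \<in> borel_measurable borel" "\<Gamma> \<in> borel_measurable borel"
      "distr M borel G = density lborel (indicator {0..})" "AE x in M. \<Gamma> (G x) = x"
      "\<And>k. k \<le> n \<Longrightarrow> AE x in M. \<kappa> x < k \<longleftrightarrow> G x < (\<Sum>j<k. w j)"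
    show thesis by (rule that[OF a])
  qed
  define atom where "atom k = ((\<Sum>j<k. w j), w k)" for k
  have w0: "0 \<le> w k" for k by (simp add: w_def)
  have "AE x in M. \<forall>k\<in>{..n}. \<kappa> x < k \<longleftrightarrow> G x < (\<Sum>j<k. w j)"
    by (rule AE_finite_allI) (use at in auto)
  then have atom: "AE x in M. \<forall>k<n. \<kappa> x = k \<longleftrightarrow> G x \<in> ivl (atom k)"
  proof eventually_elim
    fix x assume a: "\<forall>k\<in>{..n}. \<kappa> x < k \<longleftrightarrow> G x < (\<Sum>j<k. w j)"
    show "\<forall>k<n. \<kappa> x = k \<longleftrightarrow> G x \<in> ivl (atom k)"
    proof (intro allI impI)
      fix k assume "k < n"
      then have "\<kappa> x < k \<longleftrightarrow> G x < (\<Sum>j<k. w j)" "\<kappa> x < Suc k \<longleftrightarrow> G x < (\<Sum>j<k. w j) + w k"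
        using a[rule_format, of k] a[rule_format, of "Suc k"] by auto
      then show "\<kappa> x = k \<longleftrightarrow> G x \<in> ivl (atom k)" by (auto simp: ivl_def atom_def)
    qed
  qed
  have sumM: "(\<Sum>k | k < n \<and> f k = i. w k) = measure M {x. f (\<kappa> x) = i}"
    if "\<And>x. f (\<kappa> x) = i \<Longrightarrow> \<kappa> x < n" for f :: "nat \<Rightarrow> nat" and i
  proof -
    have "{x. f (\<kappa> x) = i} = (\<Union>k\<in>{k. k < n \<and> f k = i}. {x. \<kappa> x = k})" using that by auto
    moreover have "measure M \<dots> = (\<Sum>k | k < n \<and> f k = i. w k)" unfolding w_def
      by (rule measure_finite_Union) (use fin \<kappa>m in \<open>auto simp: disjoint_family_on_def sets_M less_top[symmetric]\<close>)
    ultimately show ?thesis by simp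
  qed
  have PW: "(\<Sum>k | k < n \<and> pk k = i. w k) = measure M {x. p x = i}" if "i \<in> {1..m}" for i
    using sumM[of pk i] that by (simp add: dec \<kappa>n)
  have QW: "(\<Sum>k | k < n \<and> qk k = i. w k) = measure M {x. q x = i}" if "i \<in> {1..m}" for i
    using sumM[of qk i] that by (simp add: dec \<kappa>n)
  have mpos: "0 < measure M {x. p x = i}" "0 < measure M {x. q x = i}" if "i \<in> {1..m}" for i
    using P[OF that] Q[OF that] by (auto simp: measure_def enn2real_positive_iff)
  define K0 where "K0 = (\<Sum>k<n. w k)"
  \<comment> \<open>The first strips of all atoms have total length \<open>K0 / N\<close>; they
    cover, up to a null set, what \<open>Y\<close> misses of the R_i.\<close>
  obtain N :: nat where N: "K0 / \<delta> < real N" using reals_Archimedean2 by blast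
  have K00: "0 \<le> K0" by (simp add: K0_def w0 sum_nonneg)
  have Np: "0 < N" using N d K00 by (cases N) (auto simp: divide_less_0_iff)
  have KN: "K0 / real N \<le> \<delta>" using N Np d by (simp add: field_simps)
  obtain css where css: "\<forall>c\<in>set css. posc c" "\<And>x. CNT css x = indicator {0..<K0} x"
    and GRc: "\<And>x y r. (x, y, r) \<in> GR css \<Longrightarrow> \<exists>i\<in>{1..m}. (\<exists>k<n. pk k = i \<and> x \<in> ivl (atom k)) \<and>
        (\<exists>k<n. qk k = i \<and> y \<in> ivl (atom k)) \<and> r = measure M {x. p x = i} / measure M {x. q x = i}"
    and cov: "\<And>k y. k < n \<Longrightarrow> qk k \<in> {1..m} \<Longrightarrow> y \<in> ivl (atom k) \<Longrightarrow>
        y \<in> ivl (sublev 0 (1 / real N) (atom k)) \<or> (\<exists>x r. (x, y, r) \<in> GR css)"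
  proof -
    have "\<exists>css. (\<forall>c\<in>set css. posc c) \<and> (\<forall>x. CNT css x = indicator {0..<\<Sum>k<n. w k} x) \<and>
      (\<forall>(x, y, r)\<in>GR css. \<exists>i\<in>{1..m}. (\<exists>k<n. pk k = i \<and> x \<in> ivl (atom k)) \<and> (\<exists>k<n. qk k = i \<and> y \<in> ivl (atom k)) \<and>
        r = (\<Sum>k | k < n \<and> pk k = i. w k) / (\<Sum>k | k < n \<and> qk k = i. w k)) \<and>
      (\<forall>k<n. qk k \<in> {1..m} \<longrightarrow> (\<forall>y\<in>ivl (atom k). y \<in> ivl (sublev 0 (1 / real N) (atom k)) \<or> (\<exists>x r. (x, y, r) \<in> GR css)))"
      unfolding atom_def by (rule initial_columns) (use w0 pkm Np PW QW mpos in auto)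
    then obtain css where 1: "\<forall>c\<in>set css. posc c" "\<forall>x. CNT css x = indicator {0..<K0} x"
      and 2: "\<forall>(x, y, r)\<in>GR css. \<exists>i\<in>{1..m}. (\<exists>k<n. pk k = i \<and> x \<in> ivl (atom k)) \<and> (\<exists>k<n. qk k = i \<and> y \<in> ivl (atom k)) \<and>
        r = (\<Sum>k | k < n \<and> pk k = i. w k) / (\<Sum>k | k < n \<and> qk k = i. w k)"
      and 3: "\<forall>k<n. qk k \<in> {1..m} \<longrightarrow> (\<forall>y\<in>ivl (atom k). y \<in> ivl (sublev 0 (1 / real N) (atom k)) \<or> (\<exists>x r. (x, y, r) \<in> GR css))"
      unfolding K0_def by blast
    show thesis
    proof (rule that[of css])
      fix x y r assume "(x, y, r) \<in> GR css"
      from bspec[OF 2 this] obtain i where i: "i \<in> {1..m}" "\<exists>k<n. pk k = i \<and> x \<in> ivl (atom k)" "\<exists>k<n. qk k = i \<and> y \<in> ivl (atom k)"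
        "r = (\<Sum>k | k < n \<and> pk k = i. w k) / (\<Sum>k | k < n \<and> qk k = i. w k)"
        unfolding split_conv by (elim bexE conjE) (rule that)
      have "r = measure M {x. p x = i} / measure M {x. q x = i}" unfolding i(4) PW[OF i(1)] QW[OF i(1)] ..
      with i(2,3) show "\<exists>i\<in>{1..m}. (\<exists>k<n. pk k = i \<and> x \<in> ivl (atom k)) \<and>
        (\<exists>k<n. qk k = i \<and> y \<in> ivl (atom k)) \<and> r = measure M {x. p x = i} / measure M {x. q x = i}"
        by (intro bexI[OF _ i(1)] conjI)
    qed (rule 1(1), rule 1(2)[rule_format], rule 3[rule_format], assumption+)
  qed
  have K0p: "0 < K0"
  proof -
    have 1: "1 \<in> {1..m}" using m by simp
    have "0 < (\<Sum>k | k < n \<and> pk k = 1. w k)" using PW[OF 1] mpos(1)[OF 1] by simp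
    also have "\<dots> \<le> K0" unfolding K0_def by (rule sum_mono2) (use w0 in auto)
    finally show ?thesis .
  qed
  have ne: "css \<noteq> []"
  proof
    assume "css = []"
    then have "CNT css 0 = 0" by (simp add: CNT_def)
    then show False using css(2)[of 0] K0p by simp
  qed
  obtain c K W where tseq: "\<And>n. posc (c n)" "\<And>n x. cnt (c n) x = indicator {0..<K n} x" "\<And>n. K n + 1 \<le> K (Suc n)" "0 \<le> K 0"
    "\<And>n. gr (c n) \<subseteq> gr (c (Suc n))" "\<And>n p. p \<in> set (c n) \<Longrightarrow> snd p \<le> W / 2 ^ n"
    "\<And>n. ivl (hd (c (Suc n))) \<subseteq> ivl (hd (c n))" "\<And>n. ivl (last (c (Suc n))) \<subseteq> ivl (last (c n))"
    and cut: "\<And>n s t. (s, t) \<in> set (fracs (2 + fst (prod_decode n)) (n + 2)) \<Longrightarrow> sublev s t (hd (c n)) \<in> set (c (Suc n))"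
    and gr0: "GR css \<subseteq> gr (c 0)" and cst: "\<And>n. cost (c n) \<le> sum_list (map cost css) + \<delta>"
    by (rule tower_sequence[OF ne css K00 d, of "\<lambda>n. 2 + fst (prod_decode n)" "\<lambda>n. n + 2"]) auto
  have tow: "towers c K W" by unfold_locales (fact tseq)+
  interpret tw: towers c K W by (rule tow)
  obtain T where T: "nonsingular M T" and T1: "AE x in M. G x \<in> tw.D \<and> G (T x) = tw.\<tau> (G x)"
    and T2: "AE x in M. G x \<in> tw.R \<and> G (Tinv M T x) = tw.\<sigma> (G x)" and T3: "AE x in M. Tprime M T x = tw.\<rho> (G x)"
    by (rule tower_map[OF tow G \<Gamma> dG \<Gamma>G])
  define B where "B = {y. \<exists>x r. (x, y, r) \<in> GR css}"
  have Bm[measurable]: "B \<in> sets borel" unfolding B_def by (rule tw.ran_borel[OF css(1)])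
  define Y where "Y = G -` B"
  have Ym[measurable]: "Y \<in> sets borel" unfolding Y_def by (rule measurable_sets_borel[OF G Bm])
  have le0: "CNT css x \<le> indicator {0..} x" for x by (simp add: css(2) split: split_indicator)
  note gb = tw.gain_bounds[OF css(1) le0 gr0 cst less_imp_le[OF d]]
  have push: "(\<integral>\<^sup>+x. ennreal ((sqrtTprime M T x - 1)\<^sup>2) * indicator (G -` A) x \<partial>M) = (\<integral>\<^sup>+y. ennreal (tw.gain y) * indicator A y \<partial>tw.lam)"
    if A[measurable]: "A \<in> sets borel" for A
  proof -
    have "(\<integral>\<^sup>+x. ennreal ((sqrtTprime M T x - 1)\<^sup>2) * indicator (G -` A) x \<partial>M) = (\<integral>\<^sup>+x. ennreal (tw.gain (G x)) * indicator A (G x) \<partial>M)"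
      by (rule nn_integral_cong_AE) (use T3 in \<open>auto elim!: eventually_mono simp: sqrtTprime_def tw.gain_def split: split_indicator\<close>)
    also have "\<dots> = (\<integral>\<^sup>+y. ennreal (tw.gain y) * indicator A y \<partial>distr M borel G)"
      by (subst nn_integral_distr) auto
    finally show ?thesis by (simp add: dG)
  qed
  show thesis
  proof (rule that[OF T _ Ym])
    show "ergodic nu (maharam M T)" by (rule tower_ergodic[OF tow G \<Gamma> dG \<Gamma>G T T1 T3 cut])
    show "AE x in M. x \<in> Y \<longrightarrow> q x \<in> {1..m} \<and> p (Tinv M T x) = q x \<and>
        Tprime M T x = measure M {z. p z = q x} / measure M {z. q z = q x}"
      using T2 T3 atom AE_comp[OF nonsingular_Tinv(1)[OF T] atom]
    proof eventually_elim
      fix x assume 1: "G x \<in> tw.R \<and> G (Tinv M T x) = tw.\<sigma> (G x)" and 2: "Tprime M T x = tw.\<rho> (G x)"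
        and 3: "\<forall>k<n. \<kappa> x = k \<longleftrightarrow> G x \<in> ivl (atom k)"
        and 4: "\<forall>k<n. \<kappa> (Tinv M T x) = k \<longleftrightarrow> G (Tinv M T x) \<in> ivl (atom k)"
      show "x \<in> Y \<longrightarrow> q x \<in> {1..m} \<and> p (Tinv M T x) = q x \<and>
          Tprime M T x = measure M {z. p z = q x} / measure M {z. q z = q x}"
      proof
        assume "x \<in> Y"
        then obtain y r where g: "(y, G x, r) \<in> GR css" by (auto simp: Y_def B_def)
        then have "(y, G x, r) \<in> tw.G" using gr0 by (auto simp: tw.G_def)
        then have yr: "tw.\<sigma> (G x) = y" "tw.\<rho> (G x) = r" using tw.G_eq by auto
        from GRc[OF g] obtain i k k' where i: "i \<in> {1..m}" and k: "k < n" "pk k = i" "y \<in> ivl (atom k)"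
          and k': "k' < n" "qk k' = i" "G x \<in> ivl (atom k')" and r: "r = measure M {x. p x = i} / measure M {x. q x = i}" by blast
        have "\<kappa> x = k'" using 3 k' by blast
        then have qi: "q x = i" using dec(2)[of x] k' by simp
        have "\<kappa> (Tinv M T x) = k" using 4 k 1 yr by simp
        then have "p (Tinv M T x) = i" using dec(1)[of "Tinv M T x"] k by simp
        then show "q x \<in> {1..m} \<and> p (Tinv M T x) = q x \<and>
          Tprime M T x = measure M {z. p z = q x} / measure M {z. q z = q x}" using qi i r yr 2 by simp
      qed
    qed
    have sm: "ivl (sublev 0 (1 / real N) (atom k)) \<in> sets borel" for k by (simp add: ivl_def)
    have vm: "G -` ivl (sublev 0 (1 / real N) (atom k)) \<in> sets borel" for k by (rule measurable_sets_borel[OF G sm])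
    have "emeasure M ({x. 1 \<le> q x} - Y) \<le> emeasure M (\<Union>k<n. G -` ivl (sublev 0 (1 / real N) (atom k)))"
    proof (rule emeasure_mono_AE)
      show "AE x in M. x \<in> {x. 1 \<le> q x} - Y \<longrightarrow> x \<in> (\<Union>k<n. G -` ivl (sublev 0 (1 / real N) (atom k)))"
        using atom
      proof eventually_elim
        fix x assume a: "\<forall>k<n. \<kappa> x = k \<longleftrightarrow> G x \<in> ivl (atom k)"
        show "x \<in> {x. 1 \<le> q x} - Y \<longrightarrow> x \<in> (\<Union>k<n. G -` ivl (sublev 0 (1 / real N) (atom k)))"
        proof
          assume x: "x \<in> {x. 1 \<le> q x} - Y"
          then have k: "\<kappa> x < n" using \<kappa>n by auto
          have "qk (\<kappa> x) \<in> {1..m}" using x pq by (simp add: dec)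
          from cov[OF k this, of "G x"] a k x show "x \<in> (\<Union>k<n. G -` ivl (sublev 0 (1 / real N) (atom k)))"
            by (auto simp: Y_def B_def)
        qed
      qed
    qed (use vm in \<open>auto simp: sets_M\<close>)
    also have "\<dots> \<le> (\<Sum>k<n. emeasure M (G -` ivl (sublev 0 (1 / real N) (atom k))))"
      using vm by (intro emeasure_subadditive_finite) (auto simp: sets_M)
    also have "\<dots> \<le> (\<Sum>k<n. ennreal (w k / real N))"
    proof (rule sum_mono)
      fix k
      have "emeasure M (G -` ivl (sublev 0 (1 / real N) (atom k))) = emeasure (distr M borel G) (ivl (sublev 0 (1 / real N) (atom k)))"
        using sm[of k] by (subst emeasure_distr) auto
      also have "\<dots> = emeasure lborel (ivl (sublev 0 (1 / real N) (atom k)) \<inter> {0..})" unfolding dG by (rule tw.emeasure_lam[OF sm])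
      also have "\<dots> \<le> emeasure lborel (ivl (sublev 0 (1 / real N) (atom k)))" using sm by (intro emeasure_mono) auto
      also have "\<dots> = ennreal (w k / real N)" using w0[of k] by (simp add: ivl_def sublev_def atom_def)
      finally show "emeasure M (G -` ivl (sublev 0 (1 / real N) (atom k))) \<le> ennreal (w k / real N)" .
    qed
    also have "\<dots> = ennreal (K0 / real N)" using w0 by (simp add: K0_def sum_divide_distrib)
    also have "\<dots> \<le> ennreal \<delta>" using KN by (rule ennreal_leI)
    finally show "emeasure M ({x. 1 \<le> q x} - Y) \<le> ennreal \<delta>" .
    have "- Y = G -` (- B)" by (auto simp: Y_def)
    then show "(\<integral>\<^sup>+x. ennreal ((sqrtTprime M T x - 1)\<^sup>2) * indicator (- Y) x \<partial>M) \<le> ennreal \<delta>"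
      using push[of "- B"] gb(1) Bm by (simp add: B_def)
    show "(\<integral>\<^sup>+x. ennreal ((sqrtTprime M T x - 1)\<^sup>2) \<partial>M) < \<infinity>" using push[of UNIV] gb(2) by simp
  qed
qed

end

section \<open>Reduction of neighbourhoods to indicators, and finite labellings\<close>

lemma norm2_scale: "norm2 M (\<lambda>x. c * f x) = \<bar>c\<bar> * norm2 M f"
  by (simp add: norm2_def power_mult_distrib real_sqrt_mult)

lemma norm2_sum:
  assumes "finite I" "\<And>i. i \<in> I \<Longrightarrow> L2 M (f i)"
  shows "L2 M (\<lambda>x. \<Sum>i\<in>I. f i x) \<and> norm2 M (\<lambda>x. \<Sum>i\<in>I. f i x) \<le> (\<Sum>i\<in>I. norm2 M (f i))"
  using assms
proof (induction I rule: finite_induct)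
  case empty
  show ?case by (simp add: L2_def norm2_def)
next
  case (insert i I)
  then have IH: "L2 M (\<lambda>x. \<Sum>i\<in>I. f i x)" "norm2 M (\<lambda>x. \<Sum>i\<in>I. f i x) \<le> (\<Sum>i\<in>I. norm2 M (f i))" by auto
  have i: "L2 M (f i)" using insert by simp
  show ?case using L2_add[OF i IH(1)] norm2_triangle[OF i IH(1)] IH(2) insert.hyps by simp
qed

lemma emeasure_vanish:
  fixes N :: "'b measure"
  assumes "\<And>n. Z n \<in> sets N" "incseq Z" "(\<Union>n. Z n) = space N" "emeasure N (space N) < \<infinity>" "0 < e"
  shows "\<forall>\<^sub>F n in sequentially. emeasure N (space N - Z n) < e"
proof -
  have "(\<lambda>n. emeasure N (space N - Z n)) \<longlonglongrightarrow> emeasure N (\<Inter>n. space N - Z n)"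
  proof (rule Lim_emeasure_decseq)
    show "emeasure N (space N - Z i) \<noteq> \<infinity>" for i
      using emeasure_space[of N "space N - Z i"] assms(4) by (auto simp: top_unique)
  qed (use assms in \<open>auto simp: decseq_def incseq_def\<close>)
  moreover have "(\<Inter>n. space N - Z n) = {}" using assms(3) by blast
  ultimately have "(\<lambda>n. emeasure N (space N - Z n)) \<longlonglongrightarrow> 0" by (simp only: emeasure_empty)
  then show ?thesis using assms(5) by (rule order_tendstoD(2))
qed

context std_space begin

text \<open>Labels attained only on null sets are discarded, so the classes \<open>1\<close> to
  \<open>m\<close> have positive measure; 0 collects the discarded points and the complement of
  \<open>Z\<close>. Positivity of \<open>Z\<close> gives \<open>1 \<le> m\<close>.\<close>

lemma finite_labels:
  fixes \<l> :: "'a \<Rightarrow> 'b"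
  assumes Z: "Z \<in> sets borel" "0 < emeasure M Z" and fin: "finite (\<l> ` Z)" and lm: "\<And>l. {x\<in>Z. \<l> x = l} \<in> sets borel"
  obtains m q where "1 \<le> m" "\<And>i. {x. q x = i} \<in> sets borel" "\<And>x. q x \<le> (m::nat)"
    "\<And>i. i \<in> {1..m} \<Longrightarrow> 0 < emeasure M {x. q x = i}" "{x. 1 \<le> q x} \<subseteq> Z" "emeasure M (Z - {x. 1 \<le> q x}) = 0"
    "\<And>x y. q x = q y \<Longrightarrow> 1 \<le> q x \<Longrightarrow> \<l> x = \<l> y"
proof -
  define \<Lambda> where "\<Lambda> = {l\<in>\<l> ` Z. 0 < emeasure M {x\<in>Z. \<l> x = l}}"
  define m where "m = card \<Lambda>"
  have "finite \<Lambda>" using fin by (simp add: \<Lambda>_def)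
  then obtain h where h: "bij_betw h {1..m} \<Lambda>" using ex_bij_betw_nat_finite_1 unfolding m_def by blast
  define q where "q x = (if x \<in> Z \<and> \<l> x \<in> \<Lambda> then inv_into {1..m} h (\<l> x) else 0)" for x
  have qi: "q x = i \<longleftrightarrow> x \<in> Z \<and> \<l> x = h i" if i: "i \<in> {1..m}" for x i
  proof
    assume "q x = i"
    then have "x \<in> Z" "\<l> x \<in> \<Lambda>" "inv_into {1..m} h (\<l> x) = i" using i by (auto simp: q_def split: if_splits)
    moreover have "h (inv_into {1..m} h (\<l> x)) = \<l> x" using h \<open>\<l> x \<in> \<Lambda>\<close> by (meson bij_betw_inv_into_right)
    ultimately show "x \<in> Z \<and> \<l> x = h i" by simp
  next
    assume x: "x \<in> Z \<and> \<l> x = h i"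
    then have "\<l> x \<in> \<Lambda>" using h i by (auto simp: bij_betw_def)
    then show "q x = i" using x h i by (simp add: q_def bij_betw_inv_into_left)
  qed
  have q1: "1 \<le> q x \<longleftrightarrow> x \<in> Z \<and> \<l> x \<in> \<Lambda>" and qm: "q x \<le> m" for x
  proof -
    have "inv_into {1..m} h (\<l> x) \<in> {1..m}" if "\<l> x \<in> \<Lambda>" using h that by (metis bij_betw_def inv_into_into)
    then show "1 \<le> q x \<longleftrightarrow> x \<in> Z \<and> \<l> x \<in> \<Lambda>" "q x \<le> m" by (auto simp: q_def)
  qed
  have pos: "{x. q x = i} \<in> sets borel" "0 < emeasure M {x. q x = i}" if i: "i \<in> {1..m}" for i
  proof -
    have e: "{x. q x = i} = {x\<in>Z. \<l> x = h i}" using qi[OF i] by auto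
    have "h i \<in> \<Lambda>" using h i by (auto simp: bij_betw_def)
    then show "{x. q x = i} \<in> sets borel" "0 < emeasure M {x. q x = i}" unfolding e using lm by (auto simp: \<Lambda>_def)
  qed
  have null: "emeasure M (Z - {x. 1 \<le> q x}) = 0"
  proof -
    have "Z - {x. 1 \<le> q x} = (\<Union>l\<in>\<l> ` Z - \<Lambda>. {x\<in>Z. \<l> x = l})" using q1 by fastforce
    moreover have "\<dots> \<in> null_sets M"
      by (rule null_sets_UN') (use fin lm in \<open>auto simp: \<Lambda>_def null_sets_def sets_M countable_finite\<close>)
    ultimately show ?thesis by auto
  qed
  show thesis
  proof (rule that[of m q])
    show "1 \<le> m"
    proof (rule ccontr)
      assume "\<not> 1 \<le> m"
      then have "{x. 1 \<le> q x} = {}" using qm by (auto dest: order_trans)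
      then have "Z - {x. 1 \<le> q x} = Z" by blast
      then show False using null Z by simp
    qed
    show "{x. q x = i} \<in> sets borel" for i
    proof -
      consider "i \<in> {1..m}" | "i = 0" | "m < i" by fastforce
      then show ?thesis
      proof cases
        case 2
        have "{x. q x = 0} = - (\<Union>i\<in>{1..m}. {x. q x = i})" using qm by (auto simp: not_less_eq_eq)
        moreover have "(\<Union>i\<in>{1..m}. {x. q x = i}) \<in> sets borel" using pos(1) by (intro sets.finite_UN) auto
        ultimately show ?thesis using 2 borel_comp by metis
      next
        case 3
        then have "{x. q x = i} = {}" using qm by (auto simp: not_le[symmetric])
        then show ?thesis by simp
      qed (rule pos(1))
    qed
    show "\<l> x = \<l> y" if "q x = q y" "1 \<le> q x" for x y
    proof -
      have i: "q x \<in> {1..m}" using that qm by simp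
      from qi[OF i, of x] qi[OF i, of y] that show ?thesis by simp
    qed
  qed (use pos(2) null q1 qm in auto)
qed

text \<open>The quotient of the two measures is the average of \<open>Tprime M S\<close> over
  \<open>B\<close>, so its square root stays within the bounds for
  \<open>sqrtTprime\<close>.\<close>

lemma emeasure_vimage_bounds:
  assumes S: "nonsingular M S" and B: "B \<in> sets borel" "emeasure M B < \<infinity>" "0 < emeasure M B"
    and ab: "0 \<le> a" "\<And>x. x \<in> B \<Longrightarrow> a \<le> sqrtTprime M S x \<and> sqrtTprime M S x \<le> b"
  shows "emeasure M (S -` B) < \<infinity>" "a \<le> sqrt (measure M (S -` B) / measure M B)" "sqrt (measure M (S -` B) / measure M B) \<le> b"
proof -
  note [measurable] = B(1) nonsingularD(2)[OF S]
  have SB: "S -` B \<in> sets borel" by (rule measurable_sets_borel[OF nonsingularD(2)[OF S] B(1)])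
  have b0: "0 \<le> b"
  proof -
    obtain x where "x \<in> B" using B(3) by fastforce
    then show ?thesis using ab by force
  qed
  have "emeasure M (S -` B) = (\<integral>\<^sup>+x. indicator (S -` B) x \<partial>M)" using SB by (simp add: sets_M)
  also have "\<dots> = (\<integral>\<^sup>+x. indicator B (S x) \<partial>M)" by (intro nn_integral_cong) (simp split: split_indicator)
  also have "\<dots> = (\<integral>\<^sup>+x. ennreal (Tprime M S x) * indicator B x \<partial>M)" by (rule nn_integral_T[OF S]) simp
  finally have e: "emeasure M (S -` B) = (\<integral>\<^sup>+x. ennreal (Tprime M S x) * indicator B x \<partial>M)" .
  have sq: "a\<^sup>2 \<le> Tprime M S x \<and> Tprime M S x \<le> b\<^sup>2" if "x \<in> B" for x
    using ab(2)[OF that] ab(1) power_mono[of a "sqrtTprime M S x" 2] power_mono[of "sqrtTprime M S x" b 2]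
    by (auto simp: sqrtTprime_def)
  have c: "(\<integral>\<^sup>+x. ennreal r * indicator B x \<partial>M) = ennreal r * emeasure M B" for r
    using B(1) by (intro nn_integral_cmult_indicator) (simp add: sets_M)
  have lo: "ennreal (a\<^sup>2) * emeasure M B \<le> emeasure M (S -` B)"
    unfolding e c[symmetric] by (intro nn_integral_mono) (auto split: split_indicator intro!: ennreal_leI dest: sq)
  have up: "emeasure M (S -` B) \<le> ennreal (b\<^sup>2) * emeasure M B"
    unfolding e c[symmetric] by (intro nn_integral_mono) (auto split: split_indicator intro!: ennreal_leI dest: sq)
  have "ennreal (b\<^sup>2) * emeasure M B < \<infinity>" using B(2) by (simp add: ennreal_mult_less_top)
  with up show f: "emeasure M (S -` B) < \<infinity>" by (rule le_less_trans)
  have mB: "emeasure M B = ennreal (measure M B)" "emeasure M (S -` B) = ennreal (measure M (S -` B))"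
    using B(2) f by (auto intro!: emeasure_eq_ennreal_measure)
  have p: "0 < measure M B" using B(2,3) by (auto simp: measure_def enn2real_positive_iff)
  have "a\<^sup>2 * measure M B \<le> measure M (S -` B)" using lo unfolding mB by (simp add: ennreal_mult'[symmetric])
  then have "a\<^sup>2 \<le> measure M (S -` B) / measure M B" using p by (simp add: field_simps)
  then show "a \<le> sqrt (measure M (S -` B) / measure M B)" by (rule real_le_rsqrt)
  have "measure M (S -` B) \<le> b\<^sup>2 * measure M B" using up unfolding mB by (simp add: ennreal_mult'[symmetric])
  then have "measure M (S -` B) / measure M B \<le> b\<^sup>2" using p by (simp add: field_simps)
  then show "sqrt (measure M (S -` B) / measure M B) \<le> b" using b0 by (intro real_le_lsqrt) auto
qed

lemma L2_simple_approx:
  assumes f: "L2 M f" and e: "0 < e"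
  obtains h where "h \<in> borel_measurable borel" "finite (range h)" "\<And>y. y \<noteq> 0 \<Longrightarrow> emeasure M (h -` {y}) < \<infinity>" "L2 M h"
    "norm2 M (\<lambda>x. f x - h x) < e"
proof -
  have fm[measurable]: "f \<in> borel_measurable borel" and fi: "integrable M (\<lambda>x. (f x)\<^sup>2)" using f by (auto simp: L2_def)
  obtain F where F: "\<And>i. simple_function M (F i)" "\<And>x. (\<lambda>i. F i x) \<longlonglongrightarrow> f x" "\<And>i x. \<bar>F i x\<bar> \<le> 2 * \<bar>f x\<bar>"
    using borel_measurable_implies_sequence_metric[of f M 0] by (auto simp: dist_real_def)
  have Fm[measurable]: "F i \<in> borel_measurable borel" for i using borel_measurable_simple_function[OF F(1)] by simp
  have L: "L2 M (F i)" for i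
  proof -
    have "integrable M (\<lambda>x. (F i x)\<^sup>2)"
    proof (rule Bochner_Integration.integrable_bound[of _ "\<lambda>x. 4 * (f x)\<^sup>2"])
      show "AE x in M. norm ((F i x)\<^sup>2) \<le> norm (4 * (f x)\<^sup>2)"
        using power_mono[OF F(3)[of i], of _ 2] by (auto simp: power_mult_distrib)
    qed (use fi in auto)
    then show ?thesis by (simp add: L2_def)
  qed
  have "(\<lambda>i. \<integral>x. (f x - F i x)\<^sup>2 \<partial>M) \<longlonglongrightarrow> (\<integral>x. 0 \<partial>M)"
  proof (rule integral_dominated_convergence[where w="\<lambda>x. 9 * (f x)\<^sup>2"])
    show "AE x in M. (\<lambda>i. (f x - F i x)\<^sup>2) \<longlonglongrightarrow> 0"
    proof (rule AE_I2)
      fix x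
      have "(\<lambda>i. (f x - F i x)\<^sup>2) \<longlonglongrightarrow> (f x - f x)\<^sup>2" by (intro tendsto_intros F(2))
      then show "(\<lambda>i. (f x - F i x)\<^sup>2) \<longlonglongrightarrow> 0" by simp
    qed
    show "AE x in M. norm ((f x - F i x)\<^sup>2) \<le> 9 * (f x)\<^sup>2" for i
    proof (rule AE_I2)
      fix x
      have "\<bar>f x - F i x\<bar> \<le> 3 * \<bar>f x\<bar>" using F(3)[of i x] by linarith
      from power_mono[OF this, of 2] show "norm ((f x - F i x)\<^sup>2) \<le> 9 * (f x)\<^sup>2" by (simp add: power_mult_distrib)
    qed
  qed (use fi in auto)
  then have "\<forall>\<^sub>F i in sequentially. (\<integral>x. (f x - F i x)\<^sup>2 \<partial>M) < e\<^sup>2" using e by (intro order_tendstoD) auto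
  then obtain i where i: "(\<integral>x. (f x - F i x)\<^sup>2 \<partial>M) < e\<^sup>2" by (auto simp: eventually_sequentially)
  show thesis
  proof (rule that[OF Fm[of i] _ _ L[of i]])
    show "finite (range (F i))" using simple_functionD(1)[OF F(1)[of i]] by simp
    show "emeasure M (F i -` {y}) < \<infinity>" if y: "y \<noteq> 0" for y
    proof -
      have m: "F i -` {y} \<in> sets borel" by (rule measurable_sets_borel[OF Fm]) simp
      have "ennreal (y\<^sup>2) * emeasure M (F i -` {y}) = (\<integral>\<^sup>+x. ennreal (y\<^sup>2) * indicator (F i -` {y}) x \<partial>M)"
        using m by (intro nn_integral_cmult_indicator[symmetric]) (simp add: sets_M)
      also have "\<dots> \<le> (\<integral>\<^sup>+x. ennreal ((F i x)\<^sup>2) \<partial>M)" by (intro nn_integral_mono) (auto split: split_indicator)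
      also have "\<dots> < \<infinity>" using L[of i] by (subst nn_integral_eq_integral) (auto simp: L2_def)
      finally show ?thesis using y by (auto simp: ennreal_mult_less_top ennreal_mult_eq_top_iff less_top[symmetric])
    qed
    show "norm2 M (\<lambda>x. f x - F i x) < e" unfolding norm2_def using i e by (auto intro: real_less_lsqrt)
  qed
qed

text \<open>Replacing \<open>f\<close> by a simple function costs less than \<open>e / 4\<close>
  twice, uniformly in \<open>T\<close> since the operators are isometries. The simple function is a
  finite combination of indicators, and \<open>r\<close> limits its contribution to another
  \<open>e / 4\<close>.\<close>

lemma indicators_determine_UT:
  assumes S: "nonsingular M S" and f: "L2 M f" and e: "0 < (e::real)"
  shows "\<exists>\<A> r. finite \<A> \<and> (\<forall>A\<in>\<A>. A \<in> sets borel \<and> emeasure M A < \<infinity>) \<and> 0 < r \<and>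
    (\<forall>T. nonsingular M T \<longrightarrow> (\<forall>A\<in>\<A>. norm2 M (\<lambda>x. UT M T (indicator A) x - UT M S (indicator A) x) < r) \<longrightarrow>
      norm2 M (\<lambda>x. UT M T f x - UT M S f x) < e)"
proof -
  from e have "0 < e / 4" by simp
  from L2_simple_approx[OF f this] obtain h where h[measurable]: "h \<in> borel_measurable borel" and hf: "finite (range h)"
    and hy: "\<And>y. y \<noteq> 0 \<Longrightarrow> emeasure M (h -` {y}) < \<infinity>" and hL: "L2 M h" and fh: "norm2 M (\<lambda>x. f x - h x) < e / 4" by metis
  define V where "V = range h - {0}"
  define r where "r = e / 4 / (1 + (\<Sum>y\<in>V. \<bar>y\<bar>))"
  have Vf: "finite V" using hf by (simp add: V_def)
  have sp: "0 \<le> (\<Sum>y\<in>V. \<bar>y\<bar>)" by (simp add: sum_nonneg)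
  then have "0 < 1 + (\<Sum>y\<in>V. \<bar>y\<bar>)" by linarith
  then have r0: "0 < r" unfolding r_def using e by (intro divide_pos_pos) auto
  have sr: "(\<Sum>y\<in>V. \<bar>y\<bar>) * r \<le> e / 4"
  proof -
    have "(\<Sum>y\<in>V. \<bar>y\<bar>) * r \<le> (1 + (\<Sum>y\<in>V. \<bar>y\<bar>)) * r" using r0 by (intro mult_right_mono) auto
    also have "\<dots> = e / 4"
    proof -
      have "c * (e / 4 / c) = e / 4" if "0 < c" for c using that by simp
      then show ?thesis unfolding r_def using \<open>0 < 1 + (\<Sum>y\<in>V. \<bar>y\<bar>)\<close> by blast
    qed
    finally show ?thesis .
  qed
  have hm: "h -` {y} \<in> sets borel" for y by (rule measurable_sets_borel[OF h]) simp
  have hs: "h x = (\<Sum>y\<in>V. y * indicator (h -` {y}) x)" for x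
  proof -
    have "(\<Sum>y\<in>V. y * indicator (h -` {y}) x) = (\<Sum>y\<in>V. if y = h x then y else 0)"
      by (intro sum.cong) (auto split: split_indicator)
    also have "\<dots> = h x" using Vf by (subst sum.delta) (auto simp: V_def)
    finally show ?thesis by simp
  qed
  have key: "norm2 M (\<lambda>x. UT M T f x - UT M S f x) < e" if T: "nonsingular M T"
    and a: "\<forall>A\<in>(\<lambda>y. h -` {y}) ` V. norm2 M (\<lambda>x. UT M T (indicator A) x - UT M S (indicator A) x) < r" for T
  proof -
    have UTh: "UT M T' h x = (\<Sum>y\<in>V. y * UT M T' (indicator (h -` {y})) x)" for T' x
      unfolding UT_def by (subst hs) (simp add: sum_distrib_left mult.left_commute)
    have Li: "L2 M (\<lambda>x. y * (UT M T (indicator (h -` {y})) x - UT M S (indicator (h -` {y})) x))" if "y \<in> V" for y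
      using that hm hy by (intro L2_scale L2_diff L2_UT T S L2_indicator) (auto simp: V_def)
    have "norm2 M (\<lambda>x. UT M T h x - UT M S h x) = norm2 M (\<lambda>x. \<Sum>y\<in>V. y * (UT M T (indicator (h -` {y})) x - UT M S (indicator (h -` {y})) x))"
      by (simp add: UTh sum_subtractf right_diff_distrib)
    also have "\<dots> \<le> (\<Sum>y\<in>V. norm2 M (\<lambda>x. y * (UT M T (indicator (h -` {y})) x - UT M S (indicator (h -` {y})) x)))"
      by (rule norm2_sum[THEN conjunct2]) (use Vf Li in auto)
    also have "\<dots> \<le> (\<Sum>y\<in>V. \<bar>y\<bar> * r)"
      unfolding norm2_scale using a by (intro sum_mono mult_left_mono) (auto intro: less_imp_le)
    also have "\<dots> \<le> e / 4" using sr by (simp add: sum_distrib_right)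
    finally have 1: "norm2 M (\<lambda>x. UT M T h x - UT M S h x) \<le> e / 4" .
    have d: "norm2 M (\<lambda>x. UT M T' f x - UT M T' h x) < e / 4" if "nonsingular M T'" for T'
      using norm2_UT[OF that L2_diff[OF f hL]] fh by (simp add: UT_diff)
    note L = L2_UT[OF T f] L2_UT[OF S f] L2_UT[OF T hL] L2_UT[OF S hL]
    have "norm2 M (\<lambda>x. UT M T f x - UT M S f x) \<le> norm2 M (\<lambda>x. UT M T f x - UT M T h x) + norm2 M (\<lambda>x. UT M T h x - UT M S f x)"
      by (rule norm2_triangle3[OF L(1,3,2)])
    also have "norm2 M (\<lambda>x. UT M T h x - UT M S f x) \<le> norm2 M (\<lambda>x. UT M T h x - UT M S h x) + norm2 M (\<lambda>x. UT M S h x - UT M S f x)"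
      by (rule norm2_triangle3[OF L(3,4,2)])
    finally show ?thesis using 1 d[OF T] d[OF S] norm2_minus_commute[of M "UT M S h" "UT M S f"] e by linarith
  qed
  show ?thesis
    by (intro exI[of _ "(\<lambda>y. h -` {y}) ` V"] exI[of _ r]) (use Vf r0 hm hy key in \<open>auto simp: V_def\<close>)
qed

text \<open>Cauchy-Schwarz reduces the weak condition for \<open>(f, g)\<close> to the norm of
  \<open>UT M T f - UT M S f\<close>, hence to indicators; \<open>1 + norm2 M g\<close> avoids a
  zero denominator.\<close>

lemma indicators_determine_nhd:
  assumes S: "nonsingular M S" and "finite F" and "\<forall>(f, g)\<in>F. L2 M f \<and> L2 M g" and e: "0 < (e::real)"
  shows "\<exists>\<A> r. finite \<A> \<and> (\<forall>A\<in>\<A>. A \<in> sets borel \<and> emeasure M A < \<infinity>) \<and> 0 < r \<and>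
    (\<forall>T. nonsingular M T \<longrightarrow> (\<forall>A\<in>\<A>. norm2 M (\<lambda>x. UT M T (indicator A) x - UT M S (indicator A) x) < r) \<longrightarrow>
      (\<forall>(f, g)\<in>F. \<bar>inner2 M (UT M T f) g - inner2 M (UT M S f) g\<bar> < e))"
  using assms(2,3)
proof (induction F rule: finite_induct)
  case empty
  show ?case by (intro exI[of _ "{}"] exI[of _ 1]) simp
next
  case (insert z F)
  obtain f g where z: "z = (f, g)" by fastforce
  have f: "L2 M f" and g: "L2 M g" using insert.prems z by auto
  from insert obtain \<A> r where A: "finite \<A>" "\<forall>A\<in>\<A>. A \<in> sets borel \<and> emeasure M A < \<infinity>" "0 < r"
    "\<And>T. nonsingular M T \<Longrightarrow> (\<forall>A\<in>\<A>. norm2 M (\<lambda>x. UT M T (indicator A) x - UT M S (indicator A) x) < r) \<Longrightarrow>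
      (\<forall>(f, g)\<in>F. \<bar>inner2 M (UT M T f) g - inner2 M (UT M S f) g\<bar> < e)" by auto
  have "0 < e / (1 + norm2 M g)" using e by (intro divide_pos_pos) (auto intro: add_pos_nonneg)
  from indicators_determine_UT[OF S f this] obtain \<B> r' where B: "finite \<B>" "\<forall>A\<in>\<B>. A \<in> sets borel \<and> emeasure M A < \<infinity>" "0 < r'"
    "\<And>T. nonsingular M T \<Longrightarrow> (\<forall>A\<in>\<B>. norm2 M (\<lambda>x. UT M T (indicator A) x - UT M S (indicator A) x) < r') \<Longrightarrow>
      norm2 M (\<lambda>x. UT M T f x - UT M S f x) < e / (1 + norm2 M g)" by auto
  have key: "\<bar>inner2 M (UT M T f) g - inner2 M (UT M S f) g\<bar> < e" if T: "nonsingular M T"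
    and n: "norm2 M (\<lambda>x. UT M T f x - UT M S f x) < e / (1 + norm2 M g)" for T
  proof -
    let ?d = "\<lambda>x. UT M T f x - UT M S f x"
    have L: "L2 M (UT M T f)" "L2 M (UT M S f)" "L2 M ?d" using L2_UT[OF T f] L2_UT[OF S f] L2_diff by auto
    have "inner2 M (UT M T f) g - inner2 M (UT M S f) g = (\<integral>x. ?d x * g x \<partial>M)"
      unfolding inner2_def left_diff_distrib
      by (rule Bochner_Integration.integral_diff[symmetric]) (intro L2_integrable_mult L g)+
    then have "\<bar>inner2 M (UT M T f) g - inner2 M (UT M S f) g\<bar> \<le> (\<integral>x. \<bar>?d x * g x\<bar> \<partial>M)"
      using integral_abs_bound[of M "\<lambda>x. ?d x * g x"] by simp
    also have "\<dots> \<le> norm2 M ?d * norm2 M g" by (rule L2_Cauchy_Schwarz[OF L(3) g])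
    also have "\<dots> \<le> norm2 M ?d * (1 + norm2 M g)" by (intro mult_left_mono) auto
    also have "\<dots> < e" using n norm2_nonneg[of M g] by (subst (asm) pos_less_divide_eq) (auto intro: add_pos_nonneg)
    finally show ?thesis .
  qed
  show ?case
  proof (intro exI[of _ "\<A> \<union> \<B>"] exI[of _ "min r r'"] conjI allI impI)
    fix T assume T: "nonsingular M T"
      and a: "\<forall>A\<in>\<A> \<union> \<B>. norm2 M (\<lambda>x. UT M T (indicator A) x - UT M S (indicator A) x) < min r r'"
    show "\<forall>(f, g)\<in>insert z F. \<bar>inner2 M (UT M T f) g - inner2 M (UT M S f) g\<bar> < e"
      using A(4)[OF T] key[OF T B(4)[OF T]] a z by auto
  qed (use A B in auto)
qed


text \<open>On a set \<open>Z n\<close> of finite measure with \<open>sqrt S'\<close> bounded, the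
  pieces R_i are so fine that \<open>sqrt S'\<close> varies by at most \<open>1 / N\<close> and that
  the preimage of R_i under \<open>S\<close> lies inside or outside each test set. On
  \<open>Y\<close> the model \<open>T\<close> then has nearly the right derivative and preimages in
  the right test sets; \<open>Z n - Y\<close> and the tails are small.\<close>

lemma Erg_near_indicators:
  assumes na: "non_atomic M" and inf: "emeasure M UNIV = \<infinity>" and S: "S \<in> Aut2 M"
    and \<A>: "finite \<A>" "\<And>A. A \<in> \<A> \<Longrightarrow> A \<in> sets borel" "\<And>A. A \<in> \<A> \<Longrightarrow> emeasure M A < \<infinity>" and e: "0 < (e::real)"
  obtains T where "T \<in> Erg_III1_2 M" "norm2 M (\<lambda>x. sqrtTprime M T x - sqrtTprime M S x) < e"
    "\<And>A. A \<in> \<A> \<Longrightarrow> norm2 M (\<lambda>x. UT M T (indicator A) x - UT M S (indicator A) x) < e"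
proof -
  have nS: "nonsingular M S" and LS: "L2 M (\<lambda>x. sqrtTprime M S x - 1)" using S by (auto simp: Aut2_def)
  define s where "s = sqrtTprime M S"
  have sm[measurable]: "s \<in> borel_measurable borel" and s0: "0 \<le> s x" for x by (auto simp: s_def sqrtTprime_def)
  note Sm = nonsingularD(2)[OF nS] and Vm = nonsingularD(3)[OF nS]
  obtain X :: "nat \<Rightarrow> 'a set" where X: "incseq X" "\<And>n. X n \<in> sets borel" "\<And>n. emeasure M (X n) < \<infinity>" "(\<Union>n. X n) = UNIV"
    by (rule exhaustion) blast
  define Z where "Z n = X n \<inter> {x. s x \<le> real n}" for n
  have Zm: "Z n \<in> sets borel" for n
  proof -
    have "{x \<in> space borel. s x \<le> real n} \<in> sets borel" by measurable
    then show ?thesis using X(2)[of n] by (simp add: Z_def)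
  qed
  have Zi: "incseq Z" unfolding incseq_def
  proof (intro allI impI subsetI)
    fix m n x assume mn: "m \<le> n" and "x \<in> Z m"
    then have "x \<in> X m" "s x \<le> real m" by (auto simp: Z_def)
    moreover have "X m \<subseteq> X n" using X(1) mn by (simp add: incseq_def)
    moreover have "real m \<le> real n" using mn by simp
    ultimately show "x \<in> Z n" by (auto simp: Z_def)
  qed
  have ZU: "(\<Union>n. Z n) = UNIV"
  proof (intro equalityI subsetI)
    fix x :: 'a
    obtain a where a: "x \<in> X a" using X(4) by blast
    obtain b :: nat where b: "s x \<le> real b" using real_arch_simple by blast
    have "x \<in> X (max a b)" using X(1) a by (meson incseqD max.cobounded1 subsetD)
    moreover have "s x \<le> real (max a b)" using b by simp
    ultimately show "x \<in> (\<Union>n. Z n)" by (auto simp: Z_def)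
  qed simp
  \<comment> \<open>The bound for both tails: \<open>sqrt S' - 1\<close> outside \<open>Z n\<close>,
    and the test sets outside the preimage of \<open>Z n\<close>.\<close>
  define \<eta> where "\<eta> = e\<^sup>2 / 8"
  have \<eta>: "0 < ennreal \<eta>" "0 < \<eta>" using e by (auto simp: \<eta>_def)
  have e2: "0 < e\<^sup>2" using e by simp
  have 1: "\<forall>\<^sub>F n in sequentially. (\<integral>\<^sup>+x. ennreal ((s x - 1)\<^sup>2) * indicator (- Z n) x \<partial>M) < ennreal \<eta>"
  proof -
    let ?N = "density M (\<lambda>x. ennreal ((s x - 1)\<^sup>2))"
    have sp: "space ?N = UNIV" by simp
    have em: "emeasure ?N A = (\<integral>\<^sup>+x. ennreal ((s x - 1)\<^sup>2) * indicator A x \<partial>M)" if "A \<in> sets borel" for A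
      using that by (intro emeasure_density) (auto simp: sets_M)
    have "emeasure ?N (space ?N) = (\<integral>\<^sup>+x. ennreal ((s x - 1)\<^sup>2) \<partial>M)" unfolding sp by (subst em) auto
    also have "\<dots> < \<infinity>" using LS by (subst nn_integral_eq_integral) (auto simp: L2_def s_def)
    finally have "\<forall>\<^sub>F n in sequentially. emeasure ?N (space ?N - Z n) < ennreal \<eta>"
      using Zm Zi ZU \<eta> by (intro emeasure_vanish) (auto simp: sets_M)
    then show ?thesis by eventually_elim (use Zm em in \<open>simp add: Compl_eq_Diff_UNIV\<close>)
  qed
  have SZ: "S -` Z n \<in> sets borel" for n by (rule measurable_sets_borel[OF Sm Zm])
  have 2: "\<forall>\<^sub>F n in sequentially. \<forall>A\<in>\<A>. emeasure M (A - S -` Z n) < ennreal \<eta>"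
  proof (rule eventually_ball_finite[OF \<A>(1)], intro ballI)
    fix A assume A: "A \<in> \<A>"
    note Am = \<A>(2)[OF A]
    let ?N = "density M (indicator A)"
    have sp: "space ?N = UNIV" by simp
    have em: "emeasure ?N B = emeasure M (A \<inter> B)" if B: "B \<in> sets borel" for B
    proof -
      have "emeasure ?N B = (\<integral>\<^sup>+x. indicator A x * indicator B x \<partial>M)"
        using B Am by (intro emeasure_density) (auto simp: sets_M)
      also have "\<dots> = (\<integral>\<^sup>+x. indicator (A \<inter> B) x \<partial>M)" by (intro nn_integral_cong) (auto split: split_indicator)
      finally show ?thesis using B Am by (simp add: sets_M)
    qed
    have U: "(\<Union>n. S -` Z n) = UNIV" using ZU by blast
    have I: "incseq (\<lambda>n. S -` Z n)" using Zi by (auto simp: incseq_def)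
    have "emeasure ?N (space ?N) = emeasure M A" unfolding sp by (subst em) auto
    then have "\<forall>\<^sub>F n in sequentially. emeasure ?N (space ?N - S -` Z n) < ennreal \<eta>"
      using SZ U I \<eta> \<A>(3)[OF A] by (intro emeasure_vanish) (auto simp: sets_M)
    moreover have "emeasure ?N (space ?N - S -` Z n) = emeasure M (A - S -` Z n)" for n
    proof -
      have "A \<inter> (UNIV - S -` Z n) = A - S -` Z n" by blast
      moreover have "UNIV - S -` Z n \<in> sets borel" using SZ[of n] by (intro sets.Diff) auto
      ultimately show ?thesis unfolding sp by (simp only: em)
    qed
    ultimately show "\<forall>\<^sub>F n in sequentially. emeasure M (A - S -` Z n) < ennreal \<eta>" by simp
  qed
  have 3: "\<forall>\<^sub>F n in sequentially. 0 < emeasure M (Z n)"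
  proof (rule order_tendstoD(1))
    have "(\<lambda>n. emeasure M (Z n)) \<longlonglongrightarrow> emeasure M (\<Union>n. Z n)"
      by (rule Lim_emeasure_incseq) (use Zm Zi in \<open>auto simp: sets_M\<close>)
    then show "(\<lambda>n. emeasure M (Z n)) \<longlonglongrightarrow> \<infinity>" unfolding ZU inf .
  qed simp
  from eventually_conj[OF 1 eventually_conj[OF 2 eventually_conj[OF 3 eventually_ge_at_top[of 1]]]]
  obtain n where n1: "(\<integral>\<^sup>+x. ennreal ((s x - 1)\<^sup>2) * indicator (- Z n) x \<partial>M) < ennreal \<eta>"
    and n2: "\<And>A. A \<in> \<A> \<Longrightarrow> emeasure M (A - S -` Z n) < ennreal \<eta>" and n3: "0 < emeasure M (Z n)" and n4: "1 \<le> n"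
    by (auto simp: eventually_sequentially)
  have Zf: "emeasure M (Z n) < \<infinity>"
    using emeasure_mono[of "Z n" "X n" M] X(2)[of n] X(3)[of n] by (auto simp: Z_def sets_M intro: le_less_trans)
  define z where "z = measure M (Z n)"
  have z: "emeasure M (Z n) = ennreal z" "0 \<le> z" using Zf by (auto simp: z_def intro: emeasure_eq_ennreal_measure)
  \<comment> \<open>Makes \<open>z / N\<close> and \<open>n * z / N\<close> at most
    \<open>e\<^sup>2 / 16\<close>; these are the errors from the mesh \<open>1 / N\<close> on
    \<open>Z n\<close>.\<close>
  obtain N :: nat where "16 * (real n * z + z) / e\<^sup>2 < real N" using reals_Archimedean2 by blast
  then have N: "16 * (real n * z + z) < e\<^sup>2 * real N" using e2 by (simp add: pos_divide_less_eq mult.commute)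
  have Np: "1 \<le> real N"
  proof -
    have "0 \<le> 16 * (real n * z + z)" using z by simp
    then have "0 < e\<^sup>2 * real N" using N by linarith
    then show ?thesis using e2 by (auto simp: zero_less_mult_iff)
  qed
  have Nz: "(real n * z + z) / real N \<le> e\<^sup>2 / 16" using N Np by (simp add: pos_divide_le_eq mult.commute)
  \<comment> \<open>Chosen after \<open>n\<close>: on \<open>Z n - Y\<close>, of measure at most
    \<open>\<delta>\<close>, only the bound \<open>n\<close> for \<open>sqrt S'\<close> is
    available, which costs a factor of order n^2.\<close>
  define \<delta> where "\<delta> = e\<^sup>2 / (16 * (1 + (real n)\<^sup>2))"
  have \<delta>: "0 < \<delta>" "2 * \<delta> + 2 * (real n)\<^sup>2 * \<delta> = e\<^sup>2 / 8"
  proof -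
    have p: "0 < 1 + (real n)\<^sup>2" by (intro add_pos_nonneg) auto
    then show "0 < \<delta>" using e2 by (simp add: \<delta>_def)
    have "2 * \<delta> + 2 * (real n)\<^sup>2 * \<delta> = (1 + (real n)\<^sup>2) * (2 * \<delta>)" by (simp add: algebra_simps)
    also have "\<dots> = e\<^sup>2 / 8"
    proof -
      have "c * (2 * (e\<^sup>2 / (16 * c))) = e\<^sup>2 / 8" if "0 < c" for c :: real using that by simp
      then show ?thesis unfolding \<delta>_def using p by blast
    qed
    finally show "2 * \<delta> + 2 * (real n)\<^sup>2 * \<delta> = e\<^sup>2 / 8" .
  qed

  \<comment> \<open>The first component fixes \<open>sqrt S'\<close> up to \<open>1 / N\<close>, the
    second fixes which test sets contain the preimage of \<open>x\<close>.\<close>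
  define \<l> where "\<l> x = (nat \<lfloor>real N * s x\<rfloor>, {A\<in>\<A>. Tinv M S x \<in> A})" for x
  have lfin: "finite (\<l> ` Z n)"
  proof (rule finite_subset)
    show "\<l> ` Z n \<subseteq> {..N * n} \<times> Pow \<A>"
    proof
      fix l assume "l \<in> \<l> ` Z n"
      then obtain x where x: "x \<in> Z n" "l = \<l> x" by blast
      have "real N * s x \<le> real N * real n" using x by (intro mult_left_mono) (auto simp: Z_def)
      then have "\<lfloor>real N * s x\<rfloor> \<le> int (N * n)" by (simp add: floor_le_iff)
      then have "nat \<lfloor>real N * s x\<rfloor> \<le> N * n" by (simp only: nat_le_iff)
      then show "l \<in> {..N * n} \<times> Pow \<A>" using x by (auto simp: \<l>_def)
    qed
  qed (use \<A> in auto)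
  have lm: "{x\<in>Z n. \<l> x = l} \<in> sets borel" for l
  proof -
    obtain k F where l: "l = (k, F)" by fastforce
    have 1: "{x\<in>space borel. nat \<lfloor>real N * s x\<rfloor> = k} \<in> sets borel" by measurable
    have VA: "Tinv M S -` A \<in> sets borel" if "A \<in> \<A>" for A by (rule measurable_sets_borel[OF Vm \<A>(2)[OF that]])
    have 2: "{x. {A\<in>\<A>. Tinv M S x \<in> A} = F} \<in> sets borel"
    proof (cases "F \<subseteq> \<A>")
      case True
      have "{x \<in> space borel. \<forall>A\<in>\<A>. Tinv M S x \<in> A \<longleftrightarrow> A \<in> F} \<in> sets borel"
      proof (rule sets.sets_Collect_finite_All[OF _ \<A>(1)])
        fix A assume A: "A \<in> \<A>"
        have e: "{x \<in> space borel. Tinv M S x \<in> A \<longleftrightarrow> A \<in> F} = (if A \<in> F then Tinv M S -` A else - (Tinv M S -` A))" by auto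
        show "{x \<in> space borel. Tinv M S x \<in> A \<longleftrightarrow> A \<in> F} \<in> sets borel" unfolding e
          using VA[OF A] borel_comp[OF VA[OF A]] by simp
      qed
      moreover have "{x. {A\<in>\<A>. Tinv M S x \<in> A} = F} = {x \<in> space borel. \<forall>A\<in>\<A>. Tinv M S x \<in> A \<longleftrightarrow> A \<in> F}"
        using True by auto
      ultimately show ?thesis by simp
    next
      case False
      then have "{x. {A\<in>\<A>. Tinv M S x \<in> A} = F} = {}" by auto
      then show ?thesis by simp
    qed
    have "{x\<in>Z n. \<l> x = l} = Z n \<inter> {x\<in>space borel. nat \<lfloor>real N * s x\<rfloor> = k} \<inter> {x. {A\<in>\<A>. Tinv M S x \<in> A} = F}"
      by (auto simp: \<l>_def l)
    moreover have "\<dots> \<in> sets borel" by (rule sets.Int[OF sets.Int[OF Zm 1] 2])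
    ultimately show ?thesis by simp
  qed
  obtain m q where m: "1 \<le> m" and qm: "\<And>i. {x. q x = i} \<in> sets borel" "\<And>x. q x \<le> (m::nat)"
    and q0: "\<And>i. i \<in> {1..m} \<Longrightarrow> 0 < emeasure M {x. q x = i}" and qZ: "{x. 1 \<le> q x} \<subseteq> Z n" "emeasure M (Z n - {x. 1 \<le> q x}) = 0"
    and ql: "\<And>x y. q x = q y \<Longrightarrow> 1 \<le> q x \<Longrightarrow> \<l> x = \<l> y"
    by (rule finite_labels[OF Zm n3 lfin lm]) blast
  \<comment> \<open>The class \<open>p = i\<close> is the preimage under \<open>S\<close> of the
    class \<open>q = i\<close>.\<close>
  define p where "p x = q (S x)" for x
  have pv: "{x. p x = i} = S -` {x. q x = i}" for i by (auto simp: p_def)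
  have qfin: "emeasure M {x. q x = i} < \<infinity>" if "i \<in> {1..m}" for i
  proof -
    have "{x. q x = i} \<subseteq> Z n" using qZ that by auto
    then show ?thesis using emeasure_mono[of "{x. q x = i}" "Z n" M] Zm Zf by (auto simp: sets_M intro: le_less_trans)
  qed
  \<comment> \<open>On a class \<open>sqrt S'\<close> stays in one interval of length
    \<open>1 / N\<close>, and so does the root of the measure ratio, which is the mean of
    \<open>S'\<close> over the class.\<close>
  have close: "\<bar>sqrt (measure M {y. p y = q x} / measure M {y. q y = q x}) - s x\<bar> \<le> 1 / real N"
    and pfin: "emeasure M {y. p y = q x} < \<infinity>" if x: "1 \<le> q x" for x
  proof -
    define k where "k = nat \<lfloor>real N * s x\<rfloor>"
    have i: "q x \<in> {1..m}" using x qm by simp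
    have b: "real k / real N \<le> s y \<and> s y \<le> (real k + 1) / real N" if "q y = q x" for y
    proof -
      have "nat \<lfloor>real N * s y\<rfloor> = k" using ql[of y x] that x by (simp add: \<l>_def k_def)
      moreover have "0 \<le> real N * s y" using s0 by simp
      ultimately have "real k \<le> real N * s y" "real N * s y \<le> real k + 1" by linarith+
      then show ?thesis using Np by (simp add: pos_divide_le_eq pos_le_divide_eq mult.commute)
    qed
    have "real k / real N \<le> sqrtTprime M S y \<and> sqrtTprime M S y \<le> (real k + 1) / real N" if "y \<in> {y. q y = q x}" for y
      using b that by (simp add: s_def)
    note eb = emeasure_vimage_bounds[OF nS qm(1) qfin[OF i] q0[OF i] _ this, unfolded pv[symmetric]]
    show "emeasure M {y. p y = q x} < \<infinity>" by (rule eb(1)) simp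
    have "real k / real N \<le> sqrt (measure M {y. p y = q x} / measure M {y. q y = q x})"
      "sqrt (measure M {y. p y = q x} / measure M {y. q y = q x}) \<le> (real k + 1) / real N" using eb(2,3) by simp_all
    then show "\<bar>sqrt (measure M {y. p y = q x} / measure M {y. q y = q x}) - s x\<bar> \<le> 1 / real N"
      using b[of x] unfolding add_divide_distrib by linarith
  qed
  have pm: "{x. p x = i} \<in> sets borel" for i unfolding pv by (rule measurable_sets_borel[OF Sm qm(1)])
  have P: "0 < emeasure M {x. p x = i} \<and> emeasure M {x. p x = i} < \<infinity>" if i: "i \<in> {1..m}" for i
  proof
    show "0 < emeasure M {x. p x = i}" unfolding pv
      using nonsingularD(6)[OF nS qm(1)] q0[OF i] by (metis zero_less_iff_neq_zero)
    obtain x where "q x = i" using q0[OF i] by fastforce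
    then show "emeasure M {x. p x = i} < \<infinity>" using pfin[of x] i by auto
  qed
  have pq: "p x \<le> m" "q x \<le> m" for x using qm by (auto simp: p_def)
  have Q: "0 < emeasure M {x. q x = i} \<and> emeasure M {x. q x = i} < \<infinity>" if "i \<in> {1..m}" for i using q0 qfin that by blast
  obtain T Y where T: "nonsingular M T" and erg: "ergodic nu (maharam M T)" and Ym: "Y \<in> sets borel"
    and TY: "AE x in M. x \<in> Y \<longrightarrow> q x \<in> {1..m} \<and> p (Tinv M T x) = q x \<and>
        Tprime M T x = measure M {z. p z = q x} / measure M {z. q z = q x}"
    and qY: "emeasure M ({x. 1 \<le> q x} - Y) \<le> ennreal \<delta>"
    and T1: "(\<integral>\<^sup>+x. ennreal ((sqrtTprime M T x - 1)\<^sup>2) * indicator (- Y) x \<partial>M) \<le> ennreal \<delta>"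
    and T2: "(\<integral>\<^sup>+x. ennreal ((sqrtTprime M T x - 1)\<^sup>2) \<partial>M) < \<infinity>"
    by (rule ergodic_model[OF na inf m pm qm(1) pq P Q \<delta>(1)])
  define t where "t = sqrtTprime M T"
  have tm[measurable]: "t \<in> borel_measurable borel" and t0: "0 \<le> t x" for x by (auto simp: t_def sqrtTprime_def)
  have LT: "L2 M (\<lambda>x. sqrtTprime M T x - 1)" unfolding L2_def
    using T2 by (auto intro!: integrableI_bounded)
  have TA: "T \<in> Aut2 M" using T LT by (simp add: Aut2_def)
  have ZYm: "Z n - Y \<in> sets borel" using Zm Ym by (rule sets.Diff)
  have q1m: "{x. 1 \<le> q x} \<in> sets borel"
  proof -
    have "{x. 1 \<le> q x} = - {x. q x = 0}" by auto
    then show ?thesis using qm(1)[of 0] by auto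
  qed
  have ZY: "emeasure M (Z n - Y) \<le> ennreal \<delta>"
  proof -
    have "emeasure M (Z n - Y) \<le> emeasure M (({x. 1 \<le> q x} - Y) \<union> (Z n - {x. 1 \<le> q x}))"
      using q1m Ym Zm[of n] by (intro emeasure_mono) (auto simp: sets_M)
    also have "\<dots> \<le> emeasure M ({x. 1 \<le> q x} - Y) + emeasure M (Z n - {x. 1 \<le> q x})"
      using q1m Ym Zm[of n] by (intro emeasure_subadditive) (auto simp: sets_M)
    finally show ?thesis using qY qZ(2) by simp
  qed
  have TY': "AE x in M. x \<in> Y \<longrightarrow> x \<in> Z n \<and> \<bar>t x - s x\<bar> \<le> 1 / real N \<and>
      (\<forall>A\<in>\<A>. Tinv M S x \<in> A \<longleftrightarrow> Tinv M T x \<in> A)"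
    using TY
  proof eventually_elim
    fix x assume a: "x \<in> Y \<longrightarrow> q x \<in> {1..m} \<and> p (Tinv M T x) = q x \<and>
        Tprime M T x = measure M {z. p z = q x} / measure M {z. q z = q x}"
    show "x \<in> Y \<longrightarrow> x \<in> Z n \<and> \<bar>t x - s x\<bar> \<le> 1 / real N \<and> (\<forall>A\<in>\<A>. Tinv M S x \<in> A \<longleftrightarrow> Tinv M T x \<in> A)"
    proof
      assume "x \<in> Y"
      then have 1: "1 \<le> q x" "p (Tinv M T x) = q x" "t x = sqrt (measure M {z. p z = q x} / measure M {z. q z = q x})"
        using a by (auto simp: t_def sqrtTprime_def)
      \<comment> \<open>So \<open>x\<close> and \<open>S (Tinv M T x)\<close> have equal labels, and
        their preimages under \<open>S\<close>, which are \<open>Tinv M S x\<close> and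
        \<open>Tinv M T x\<close>, lie in the same test sets.\<close>
      have "q x = q (S (Tinv M T x))" using 1(2) by (simp add: p_def)
      from ql[OF this 1(1)] have "{A\<in>\<A>. Tinv M S x \<in> A} = {A\<in>\<A>. Tinv M S (S (Tinv M T x)) \<in> A}" by (simp add: \<l>_def)
      then have "\<forall>A\<in>\<A>. Tinv M S x \<in> A \<longleftrightarrow> Tinv M T x \<in> A" unfolding nonsingularD(4)[OF nS] by blast
      then show "x \<in> Z n \<and> \<bar>t x - s x\<bar> \<le> 1 / real N \<and> (\<forall>A\<in>\<A>. Tinv M S x \<in> A \<longleftrightarrow> Tinv M T x \<in> A)"
        using qZ(1) 1 close[OF 1(1)] by auto
    qed
  qed
  have sZ: "s x \<le> real n" if "x \<in> Z n" for x using that by (simp add: Z_def)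
  have zN: "z / real N \<le> e\<^sup>2 / 16" "real n * z / real N \<le> e\<^sup>2 / 16"
  proof -
    have "0 \<le> z / real N" "0 \<le> real n * z / real N" using z(2) by simp_all
    then show "z / real N \<le> e\<^sup>2 / 16" "real n * z / real N \<le> e\<^sup>2 / 16"
      using Nz unfolding add_divide_distrib by linarith+
  qed

  \<comment> \<open>On \<open>Y\<close> the roots differ by at most \<open>1 / N\<close>; elsewhere
    both are compared with 1, where \<open>s - 1\<close> is bounded by \<open>n\<close> on
    \<open>Z n - Y\<close> and small in L2 outside \<open>Z n\<close>. The squared norm is at most
    7/16 of \<open>e\<^sup>2\<close>.\<close>
  have C1: "norm2 M (\<lambda>x. t x - s x) < e"
  proof -
    have L: "L2 M (\<lambda>x. t x - s x)"
      using L2_diff[OF LT LS] by (simp add: t_def s_def)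
    let ?f = "\<lambda>x. ennreal (1 / real N) * indicator (Z n) x + (ennreal 2 * (ennreal ((t x - 1)\<^sup>2) * indicator (- Y) x) +
       (ennreal 2 * (ennreal ((s x - 1)\<^sup>2) * indicator (- Z n) x) + ennreal (2 * (real n)\<^sup>2) * indicator (Z n - Y) x))"
    have "ennreal (\<integral>x. (t x - s x)\<^sup>2 \<partial>M) = (\<integral>\<^sup>+x. ennreal ((t x - s x)\<^sup>2) \<partial>M)"
      using L by (intro nn_integral_eq_integral[symmetric]) (auto simp: L2_def)
    also have "\<dots> \<le> (\<integral>\<^sup>+x. ?f x \<partial>M)"
    proof (rule nn_integral_mono_AE)
      show "AE x in M. ennreal ((t x - s x)\<^sup>2) \<le> ?f x" using TY'
      proof eventually_elim
        fix x assume a: "x \<in> Y \<longrightarrow> x \<in> Z n \<and> \<bar>t x - s x\<bar> \<le> 1 / real N \<and> (\<forall>A\<in>\<A>. Tinv M S x \<in> A \<longleftrightarrow> Tinv M T x \<in> A)"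
        have tri: "(t x - s x)\<^sup>2 \<le> 2 * (t x - 1)\<^sup>2 + 2 * (s x - 1)\<^sup>2"
          using zero_le_power2[of "t x + s x - 2"] by (simp add: power2_eq_square algebra_simps)
        consider "x \<in> Y" | "x \<notin> Y" "x \<in> Z n" | "x \<notin> Y" "x \<notin> Z n" by blast
        then show "ennreal ((t x - s x)\<^sup>2) \<le> ?f x"
        proof cases
          case 1
          have "(t x - s x)\<^sup>2 = \<bar>t x - s x\<bar> * \<bar>t x - s x\<bar>" by (simp add: power2_eq_square)
          also have "\<dots> \<le> 1 / real N * 1"
          proof (rule mult_mono)
            have "1 / real N \<le> 1" using Np by simp
            then show "\<bar>t x - s x\<bar> \<le> 1" using a 1 by linarith
          qed (use a 1 in auto)
          finally show ?thesis using a 1 by (auto intro: ennreal_leI)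
        next
          case 2
          have "\<bar>s x - 1\<bar> \<le> real n" using sZ[OF 2(2)] s0[of x] n4 by linarith
          then have "(s x - 1)\<^sup>2 \<le> (real n)\<^sup>2" by (metis abs_ge_zero power2_abs power_mono)
          then have "(t x - s x)\<^sup>2 \<le> 2 * (t x - 1)\<^sup>2 + 2 * (real n)\<^sup>2" using tri by linarith
          then have "ennreal ((t x - s x)\<^sup>2) \<le> ennreal (2 * (t x - 1)\<^sup>2 + 2 * (real n)\<^sup>2)" by (rule ennreal_leI)
          also have "\<dots> = ennreal 2 * ennreal ((t x - 1)\<^sup>2) + ennreal (2 * (real n)\<^sup>2)"
            by (subst ennreal_plus) (auto simp: ennreal_mult simp del: ennreal_numeral)
          also have "\<dots> \<le> ?f x" using 2 by (simp add: add_increasing)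
          finally show ?thesis .
        next
          case 3
          have "ennreal ((t x - s x)\<^sup>2) \<le> ennreal (2 * (t x - 1)\<^sup>2 + 2 * (s x - 1)\<^sup>2)" using tri by (rule ennreal_leI)
          also have "\<dots> = ennreal 2 * ennreal ((t x - 1)\<^sup>2) + ennreal 2 * ennreal ((s x - 1)\<^sup>2)"
            by (subst ennreal_plus) (auto simp: ennreal_mult simp del: ennreal_numeral)
          also have "\<dots> = ?f x" using 3 by simp
          finally show ?thesis by simp
        qed
      qed
    qed
    also have "\<dots> = ennreal (1 / real N) * emeasure M (Z n) + (ennreal 2 * (\<integral>\<^sup>+x. ennreal ((t x - 1)\<^sup>2) * indicator (- Y) x \<partial>M) +
       (ennreal 2 * (\<integral>\<^sup>+x. ennreal ((s x - 1)\<^sup>2) * indicator (- Z n) x \<partial>M) + ennreal (2 * (real n)\<^sup>2) * emeasure M (Z n - Y)))"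
    proof -
      note [measurable] = Ym Zm[of n] ZYm
      show ?thesis by (simp add: nn_integral_add nn_integral_cmult sets_M del: ennreal_numeral)
    qed
    also have "\<dots> \<le> ennreal (1 / real N) * ennreal z + (ennreal 2 * ennreal \<delta> + (ennreal 2 * ennreal \<eta> + ennreal (2 * (real n)\<^sup>2) * ennreal \<delta>))"
      using T1 n1 ZY unfolding z(1) t_def by (intro add_mono mult_left_mono) (auto intro: less_imp_le)
    also have "\<dots> = ennreal (z / real N + (2 * \<delta> + (2 * \<eta> + 2 * (real n)\<^sup>2 * \<delta>)))"
      using z(2) \<delta>(1) \<eta>(2) Np by (simp add: ennreal_mult'[symmetric] ennreal_plus[symmetric] del: ennreal_plus ennreal_numeral)
    finally have "(\<integral>x. (t x - s x)\<^sup>2 \<partial>M) \<le> z / real N + (2 * \<delta> + (2 * \<eta> + 2 * (real n)\<^sup>2 * \<delta>))"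
      using z(2) \<delta>(1) \<eta>(2) Np by (subst (asm) ennreal_le_iff) (auto intro!: add_nonneg_nonneg)
    also have "\<dots> < e\<^sup>2" using zN \<delta>(2) e2 unfolding \<eta>_def by linarith
    finally show ?thesis unfolding norm2_def using e by (auto intro: real_less_lsqrt)
  qed

  have C2: "norm2 M (\<lambda>x. UT M T (indicator A) x - UT M S (indicator A) x) < e" if A: "A \<in> \<A>" for A
  proof -
    note Am = \<A>(2)[OF A] and Af = \<A>(3)[OF A]
    let ?u = "UT M T (indicator A)" and ?v = "UT M S (indicator A)"
    \<comment> \<open>\<open>U_S\<close> of \<open>indicator A'\<close> is \<open>U_S\<close> of
      \<open>indicator A\<close> restricted to \<open>Z n\<close>, and at most \<open>\<eta>\<close>
      of the measure of \<open>A\<close> is lost.\<close>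
    define A' where "A' = A \<inter> S -` Z n"
    have A'm: "A' \<in> sets borel" using Am SZ by (simp add: A'_def)
    have A'f: "emeasure M A' < \<infinity>"
      using emeasure_mono[of A' A M] Am Af by (auto simp: A'_def sets_M intro: le_less_trans)
    note LA = L2_indicator[OF Am Af] and LA' = L2_indicator[OF A'm A'f]
    have Lu: "L2 M ?u" and Lv: "L2 M ?v" using L2_UT[OF T LA(1)] L2_UT[OF nS LA(1)] .
    have sq: "(\<integral>x. (UT M R (indicator B) x)\<^sup>2 \<partial>M) = measure M B"
      if "nonsingular M R" "B \<in> sets borel" "emeasure M B < \<infinity>" for R B
      using norm2_UT[OF that(1) L2_indicator(1)[OF that(2,3)]] L2_indicator(2)[OF that(2,3)]
      by (simp add: norm2_power2[symmetric])
    have iA': "integrable M (\<lambda>x. (UT M S (indicator A') x)\<^sup>2)" using L2_UT[OF nS LA'(1)] by (simp add: L2_def)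
    have ind: "integrable M (indicator (Z n - Y) :: 'a \<Rightarrow> real)" "integrable M (indicator (Z n) :: 'a \<Rightarrow> real)"
      using ZYm le_less_trans[OF ZY ennreal_less_top] Zm Zf by (auto simp: sets_M)
    \<comment> \<open>Both images have squared norm \<open>measure M A\<close>, so a lower bound for
      their inner product suffices. On \<open>Y\<close> the two indicators agree and the derivative
      roots differ by at most \<open>1 / N\<close>; on \<open>Z n - Y\<close> the loss is at most
      n^2; outside \<open>Z n\<close> the left side is 0. The squared distance comes to at most half
      of \<open>e\<^sup>2\<close>.\<close>
    have "(\<integral>x. (UT M S (indicator A') x)\<^sup>2 - ((real n)\<^sup>2 * indicator (Z n - Y) x + real n / real N * indicator (Z n) x) \<partial>M) \<le> (\<integral>x. ?u x * ?v x \<partial>M)"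
    proof (rule integral_mono_AE)
      show "AE x in M. (UT M S (indicator A') x)\<^sup>2 - ((real n)\<^sup>2 * indicator (Z n - Y) x + real n / real N * indicator (Z n) x) \<le> ?u x * ?v x"
        using TY'
      proof eventually_elim
        fix x assume a: "x \<in> Y \<longrightarrow> x \<in> Z n \<and> \<bar>t x - s x\<bar> \<le> 1 / real N \<and> (\<forall>A\<in>\<A>. Tinv M S x \<in> A \<longleftrightarrow> Tinv M T x \<in> A)"
        have u: "?u x = t x * indicator A (Tinv M T x)" and v: "?v x = s x * indicator A (Tinv M S x)"
          by (auto simp: UT_def t_def s_def)
        have uv0: "0 \<le> ?u x * ?v x" unfolding u v using s0 t0 by simp
        have w: "(UT M S (indicator A') x)\<^sup>2 = (s x)\<^sup>2 * indicator A (Tinv M S x) * indicator (Z n) x"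
          using nonsingularD(5)[OF nS, of x] by (auto simp: UT_def s_def A'_def split: split_indicator)
        have sle: "(s x)\<^sup>2 \<le> (real n)\<^sup>2" "s x / real N \<le> real n / real N" if "x \<in> Z n"
          using sZ[OF that] s0[of x] by (auto intro: power_mono divide_right_mono)
        have nN: "0 \<le> real n / real N" by simp
        consider "x \<notin> Z n" | "x \<in> Z n" "x \<notin> Y" | "x \<in> Y" "x \<in> Z n" "Tinv M S x \<notin> A" | "x \<in> Y" "x \<in> Z n" "Tinv M S x \<in> A" by blast
        then show "(UT M S (indicator A') x)\<^sup>2 - ((real n)\<^sup>2 * indicator (Z n - Y) x + real n / real N * indicator (Z n) x) \<le> ?u x * ?v x"
        proof cases
          case 1 then show ?thesis using uv0 by (simp add: w)
        next
          case 2
          have "(s x)\<^sup>2 * indicator A (Tinv M S x) \<le> (real n)\<^sup>2" using sle(1)[OF 2(1)] by (auto split: split_indicator)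
          then have "(s x)\<^sup>2 * indicator A (Tinv M S x) - ((real n)\<^sup>2 + real n / real N) \<le> ?u x * ?v x"
            using uv0 nN by linarith
          then show ?thesis using 2 by (simp add: w)
        next
          case 3
          have "- (real n / real N) \<le> ?u x * ?v x" using uv0 nN by linarith
          then show ?thesis using 3 by (simp add: w)
        next
          case 4
          then have "Tinv M T x \<in> A" and d: "\<bar>t x - s x\<bar> \<le> 1 / real N" using a A by auto
          then have "?u x * ?v x = t x * s x" using 4 by (simp add: u v)
          moreover have "(s x - 1 / real N) * s x \<le> t x * s x" using d s0[of x] by (intro mult_right_mono) auto
          moreover have "(s x - 1 / real N) * s x = (s x)\<^sup>2 - s x / real N" by (simp add: power2_eq_square algebra_simps)
          ultimately show ?thesis using sle(2)[OF 4(2)] 4 by (simp add: w)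
        qed
      qed
    qed (use iA' ind L2_integrable_mult[OF Lu Lv] in \<open>auto intro!: Bochner_Integration.integrable_diff Bochner_Integration.integrable_add\<close>)
    also have "(\<integral>x. (UT M S (indicator A') x)\<^sup>2 - ((real n)\<^sup>2 * indicator (Z n - Y) x + real n / real N * indicator (Z n) x) \<partial>M)
      = measure M A' - ((real n)\<^sup>2 * measure M (Z n - Y) + real n / real N * z)"
      using iA' ind sq[OF nS A'm A'f] by (simp add: z_def)
    finally have low: "measure M A' - ((real n)\<^sup>2 * measure M (Z n - Y) + real n / real N * z) \<le> (\<integral>x. ?u x * ?v x \<partial>M)" .
    have mZY: "measure M (Z n - Y) \<le> \<delta>" using ZY \<delta>(1) by (simp add: measure_def enn2real_leI)
    have mA: "measure M A - measure M A' \<le> \<eta>"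
    proof -
      have "measure M A - measure M A' = measure M (A - A')"
        by (rule measurable_measure_Diff[symmetric]) (use Am Af A'm in \<open>auto simp: A'_def fmeasurable_def sets_M\<close>)
      also have "A - A' = A - S -` Z n" by (auto simp: A'_def)
      also have "measure M (A - S -` Z n) \<le> \<eta>" using n2[OF A] \<eta>(2) by (simp add: measure_def enn2real_leI less_imp_le)
      finally show ?thesis .
    qed
    have "(\<integral>x. (?u x - ?v x)\<^sup>2 \<partial>M) = (\<integral>x. (?u x)\<^sup>2 + (?v x)\<^sup>2 - 2 * (?u x * ?v x) \<partial>M)"
      by (intro Bochner_Integration.integral_cong) (auto simp: power2_eq_square algebra_simps)
    also have "\<dots> = (\<integral>x. (?u x)\<^sup>2 \<partial>M) + (\<integral>x. (?v x)\<^sup>2 \<partial>M) - 2 * (\<integral>x. ?u x * ?v x \<partial>M)"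
      using Lu Lv L2_integrable_mult[OF Lu Lv] by (simp add: L2_def)
    also have "\<dots> \<le> 2 * \<eta> + 2 * (real n)\<^sup>2 * \<delta> + 2 * (real n * z / real N)"
    proof -
      have "(real n)\<^sup>2 * measure M (Z n - Y) \<le> (real n)\<^sup>2 * \<delta>" using mZY by (intro mult_left_mono) auto
      moreover have "real n / real N * z = real n * z / real N" by simp
      ultimately show ?thesis using low mA unfolding sq[OF T Am Af] sq[OF nS Am Af] by linarith
    qed
    also have "\<dots> < e\<^sup>2" using zN \<delta> e2 unfolding \<eta>_def by linarith
    finally show ?thesis unfolding norm2_def using e by (auto intro: real_less_lsqrt)
  qed

  show thesis
  proof (rule that[of T])
    show "T \<in> Erg_III1_2 M"
      using TA erg maharam_ergodic_imp_ergodic[OF T erg] by (simp add: Erg_III1_2_def ergodic_III1_def)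
  qed (use C1 C2 in \<open>auto simp: t_def s_def\<close>)
qed

theorem closure_Erg:
  assumes na: "non_atomic M" and inf: "emeasure M UNIV = \<infinity>"
  shows "(d2_topology M) closure_of (Erg_III1_2 M) = Aut2 M"
proof (intro equalityI subsetI)
  fix S assume S: "S \<in> Aut2 M"
  then have nS: "nonsingular M S" by (simp add: Aut2_def)
  show "S \<in> (d2_topology M) closure_of (Erg_III1_2 M)"
    unfolding in_closure_of
  proof (intro conjI allI impI)
    fix W assume "S \<in> W \<and> openin (d2_topology M) W"
    then have "S \<in> W" "d2_open M W" by auto
    then obtain F e where F: "finite F" "\<forall>(f,g)\<in>F. L2 M f \<and> L2 M g" and e: "0 < e"
      and sub: "{T\<in>Aut2 M. (\<forall>(f,g)\<in>F. \<bar>inner2 M (UT M T f) g - inner2 M (UT M S f) g\<bar> < e) \<and>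
                    norm2 M (\<lambda>x. sqrtTprime M T x - sqrtTprime M S x) < e} \<subseteq> W"
      unfolding d2_open_def by blast
    from indicators_determine_nhd[OF nS F e] obtain \<A> r where A: "finite \<A>" "\<forall>A\<in>\<A>. A \<in> sets borel \<and> emeasure M A < \<infinity>" "0 < r"
      and d: "\<And>T. nonsingular M T \<Longrightarrow> (\<forall>A\<in>\<A>. norm2 M (\<lambda>x. UT M T (indicator A) x - UT M S (indicator A) x) < r) \<Longrightarrow>
        (\<forall>(f, g)\<in>F. \<bar>inner2 M (UT M T f) g - inner2 M (UT M S f) g\<bar> < e)" by blast
    have "0 < min r e" using A(3) e by simp
    from Erg_near_indicators[OF na inf S A(1) _ _ this] A(2)
    obtain T where T: "T \<in> Erg_III1_2 M" "norm2 M (\<lambda>x. sqrtTprime M T x - sqrtTprime M S x) < min r e"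
      "\<And>A. A \<in> \<A> \<Longrightarrow> norm2 M (\<lambda>x. UT M T (indicator A) x - UT M S (indicator A) x) < min r e" by blast
    have TA: "T \<in> Aut2 M" "nonsingular M T" using T(1) by (auto simp: Erg_III1_2_def Aut2_def)
    have "T \<in> W" using sub TA(1) T(2) d[OF TA(2)] T(3) by auto
    then show "\<exists>y. y \<in> Erg_III1_2 M \<and> y \<in> W" using T(1) by blast
  qed (use S in simp)
qed (use closure_of_subset_topspace[of "d2_topology M" "Erg_III1_2 M"] in auto)

end

theorem theorem5p3:
  fixes M :: "('a::polish_space) measure"
  assumes "sets M = sets borel"
    and "sigma_finite_measure M"
    and "non_atomic M"
    and "emeasure M (space M) = \<infinity>"
  shows "gdelta_in (d2_topology M) (Erg_III1_2 M) \<and>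
         (d2_topology M) closure_of (Erg_III1_2 M) = topspace (d2_topology M)"
proof -
  interpret std_space M using assms(1,2) by (simp add: std_space_def std_space_axioms_def)
  show ?thesis using gdelta_Erg closure_Erg[OF assms(3)] assms(4) by simp
qed

end
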